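(* Fix $a,c,d,e,f,g\in\mathbb{C}$, let $h=2+3a-b-c-d-e-f-g$, and define $\vec x=\vec x(a,c,d,e,f,g)=(A,B,C,D,E,F,G)^T$ with $A=2+2a-c-d-e-f-g$, $B=1+a-e-f$, $C=1+a-e-g$, $D=1+a-f-g$, $E=2+2a-d-e-f-g$, $F=2+2a-c-e-f-g$, $G=2+a-e-f-g$ (so $\vec x\in V$). Then for every $\tau\in G\backslash H$, $$\gamma_2(M_\tau)(a,c,d,e,f,g)=\begin{cases} L_{\gamma_1(\tau)}(\vec x) & \text{if } \tau\in\mathscr{O}_1\cup\mathscr{O}_2,\\ J_{\gamma_1(\tau)}(\vec x) & \text{if }\tau\in\mathscr{O}_3.\end{cases}$$
   Context: $M$-side. Let $W=\{(a,\dots,h)^T\in\mathbb{C}^8:2+3a=b+c+d+e+f+g+h\}$. $H\subset GL(8,\mathbb{C})$ is generated by the coordinate transpositions $(23),(34),(45),(56),(67),(78)$ and the matrices $X$ (rows $(\tfrac12,\tfrac12,-\tfrac12,-\tfrac12,-\tfrac12,\tfrac12,\tfrac12,\tfrac12)$, $e_2$, $(-\tfrac12,\tfrac12,\tfrac12,-\tfrac12,-\tfrac12,\tfrac12,\tfrac12,\tfrac12)$, $(-\tfrac12,\tfrac12,-\tfrac12,\tfrac12,-\tfrac12,\tfrac12,\tfrac12,\tfrac12)$, $(-\tfrac12,\tfrac12,-\tfrac12,-\tfrac12,\tfrac12,\tfrac12,\tfrac12,\tfrac12)$, $e_6,e_7,e_8$) and $Y$ (rows $(-1,2,0,\dots,0)$,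 $(-1,1,1,0,\dots,0)$, $(0,1,0,\dots,0)$, $-e_1+e_2+e_r$ for $r=4,\dots,8$); $G=\langle(34),(45),(56),(67),(78),X\rangle$. With $x_0=b,x_1=h,x_2=g,x_3=f,x_4=e,x_5=d,x_6=c,x_7=a$, the coset $G\alpha$ is determined by the second entry of $\alpha\vec w$; $v(i,j)$ has second entry $x_i+x_j-x_7$ and $-v(i,j)$ has $1+x_7-x_i-x_j$ ($0\le i<j\le 7$). $\mathscr{O}_1=\{v(0,j),-v(1,j):2\le j\le7\}$, $\mathscr{O}_2=\{v(1,j),-v(0,j):2\le j\le7\}$, $\mathscr{O}_3=\{\pm v(0,1)\}\cup\{\pm v(i,j):2\le i<j\le7\}$. $M(a;b;c,d,e,f,g,h)=\frac{V(a;b,\dots,h)-V(2b-a;b,b-a+c,\dots,b-a+h)}{\sin\pi(b-a)\prod_{y\in\{b,\dots,h\}}\Gamma(y)\prod_{y\in\{c,\dots,h\}}\Gamma(b-a+y)}$, $V(a;b,\dots,h)=\frac\pi2\frac{\Gamma(1+a)\prod_{y\in\{b,\dots,h\}}\Gamma(y)}{\prod_{y\in\{b,\dots,h\}}\Gamma(1+a-y)}{}_9F_8\left[{a,1+a/2,b,\dots,h\atop a/2,1+a-b,\dots,1+a-h};1\right]$; $M$ is invariant under $G$ and $M_\tau(\vec w)=M(\alpha\vec w)$ for $\alpha\in\tau$. Write $\alpha\vec w=(a_\alpha,\dots,h_\alpha)$. Definition of $\gamma_2$. For $\tau\in\mathscr{O}_1\cup\mathscr{O}_2$ choose $\alpha\in\tau$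 with $a_\alpha,c_\alpha,d_\alpha,e_\alpha,f_\alpha,g_\alpha$ independent of $b$ and $\operatorname{Im}(b_\alpha)\to\pm\infty$ as $\operatorname{Im}(b)\to+\infty$ (such $\alpha$ exist); then, by the limit $\lim_{\operatorname{Im}b\to\pm\infty}\frac{\Gamma(1+a-h)\prod_{y\in\{c,..,g\}}\Gamma(b-a+y)}{\Gamma(b-a)}M(a;b;c,\dots,h)=\frac\pi2L(e,f,g,1+a-c-d;e+f+g-a;1+a-c,1+a-d)$ applied to $\alpha\vec w$, one sets $\gamma_2(M_\tau)=L(e_\alpha,f_\alpha,g_\alpha,1+a_\alpha-c_\alpha-d_\alpha;\,e_\alpha+f_\alpha+g_\alpha-a_\alpha;\,1+a_\alpha-c_\alpha,1+a_\alpha-d_\alpha)$. For $\tau\in\mathscr{O}_3$ choose $\alpha\in\tau$ with $a_\alpha,\dots,f_\alpha$ independent of $b$ and $\operatorname{Im}(g_\alpha)\to+\infty$; by the limit $\lim_{\operatorname{Im}g\to\pm\infty}\Gamma(1-b)\Gamma(1+a-g)\Gamma(1+a-h)\Gamma(b-a+g)\Gamma(b-a+h)M(a;b;c,\dots,h)=\frac\pi2J(b;c,d,1+a-e-f;b+c+d-a,1+a-e,1+a-f)$ applied to $\alpha\vec w$, set $\gamma_2(M_\tau)=J(b_\alpha;\,c_\alpha,d_\alpha,1+a_\alpha-e_\alpha-f_\alpha;\,b_\alpha+c_\alpha+d_\alpha-a_\alpha,1+a_\alpha-e_\alpha,1+a_\alpha-f_\alpha)$. These are functions of $a,c,d,e,f,g$.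 $J/L$-side. $J$ and $L$ are, for $E+F+G-A-B-C-D=1$: $J(A;B,C,D;E,F,G)=\frac{{}_4F_3[A,B,C,D;E,F,G;1]}{\sin\pi A\,\Gamma(A)\Gamma(1+A-E)\Gamma(1+A-F)\Gamma(1+A-G)\Gamma(E)\Gamma(F)\Gamma(G)}+\frac{{}_4F_3[A,1+A-E,1+A-F,1+A-G;1+A-B,1+A-C,1+A-D;1]}{\sin\pi A\,\Gamma(A)\Gamma(B)\Gamma(C)\Gamma(D)\Gamma(1+A-B)\Gamma(1+A-C)\Gamma(1+A-D)}$, $L(A,B,C,D;E;F,G)=\frac{{}_4F_3[A,B,C,D;E,F,G;1]}{\sin\pi E\prod_{Y\in\{A,B,C,D\}}\Gamma(1-E+Y)\Gamma(E)\Gamma(F)\Gamma(G)}-\frac{{}_4F_3[1+A-E,1+B-E,1+C-E,1+D-E;2-E,1+F-E,1+G-E;1]}{\sin\pi E\,\Gamma(A)\Gamma(B)\Gamma(C)\Gamma(D)\Gamma(2-E)\Gamma(1+F-E)\Gamma(1+G-E)}$. Let $V=\{(A,\dots,G)^T:E+F+G-A-B-C-D=1\}$, $X_1$ the $7\times7$ matrix with rows $e_1,-e_3+e_5,-e_2+e_5,e_4,e_5,-e_2-e_3+e_5+e_6,-e_2-e_3+e_5+e_7$, $H_1=\langle(12),(23),(34),(56),(67),X_1\rangle$, $G_J=\langle(23),(34),(56),(67),X_1\rangle$, $G_L=\langle(12),(23),(34),(67),(57)X_1(57)\rangle$. $J_\sigma(\vec x)=J(\alpha\vec x)$ for $\alpha\in\sigma\in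 G_J\backslash H_1$ and $L_\sigma(\vec x)=L(\beta\vec x)$ for $\beta\in\sigma\in G_L\backslash H_1$ (well defined). $J$-coset labels: the first coordinate of $\alpha\vec x$ determines $G_J\alpha$; with $(A_0,..,A_3)=(A,B,C,D)$, $(E_0,..,E_3)=(1,E,F,G)$, first coordinate $1+A_r-E_q$ gets the sign string $b_rb_q$ ($b_0={+}{+}{+},b_1={+}{-}{-},b_2={-}{+}{-},b_3={-}{-}{+}$), and $E_q-A_r$ gets the negated string. $L$-coset labels: $L_6(\vec x)=L(A,B,C,D;G;F,E)$, $L_5=L(A,B,C,D;F;E,G)$, $L_4=L(A,B,C,D;E;F,G)$, $L_3=L(A,1+A-E,1+A-F,1+A-G;1+A-D;1+A-B,1+A-C)$, $L_2=L(A,1+A-E,1+A-F,1+A-G;1+A-C;1+A-B,1+A-D)$, $L_1=L(A,1+A-E,1+A-F,1+A-G;1+A-B;1+A-C,1+A-D)$, and $L_{\overline k}(\vec x)=L_k(1-A,1-B,1-C,1-D,2-E,2-F,2-G)$ for $1\le k\le 6$. $\gamma_1$: $\gamma_1(v(0,j))=\gamma_1(v(1,j))=j-1$, $\gamma_1(-v(1,j))=\gamma_1(-v(0,j))=\overline{j-1}$ ($2\le j\le7$); $\gamma_1(\pm v(0,1))$ is the all-$\pm$ string; for $2\le i<j\le7$, $\gamma_1(v(i,j))$ has plus signs in positions $i-1,j-1$ and minus signs elsewhere, $\gamma_1(-v(i,j))$ is its negation. *)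

theory Defs
  imports "HOL-Analysis.Analysis"
begin

(* 1-based coordinates; in the numeral type 8, the literal 8 equals 0 *)
definition n8 :: "8 \<Rightarrow> nat" where
  "n8 i = (if i = 1 then 1 else if i = 2 then 2 else if i = 3 then 3 else if i = 4 then 4
           else if i = 5 then 5 else if i = 6 then 6 else if i = 7 then 7 else 8)"

definition n7 :: "7 \<Rightarrow> nat" where
  "n7 i = (if i = 1 then 1 else if i = 2 then 2 else if i = 3 then 3 else if i = 4 then 4
           else if i = 5 then 5 else if i = 6 then 6 else 7)"

definition mk8 :: "(nat \<Rightarrow> nat \<Rightarrow> complex) \<Rightarrow> complex^8^8" where
  "mk8 f = (\<chi> i j. f (n8 i) (n8 j))"

definition mk7 :: "(nat \<Rightarrow> nat \<Rightarrow> complex) \<Rightarrow> complex^7^7" where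
  "mk7 f = (\<chi> i j. f (n7 i) (n7 j))"

definition vec8 :: "(nat \<Rightarrow> complex) \<Rightarrow> complex^8" where
  "vec8 f = (\<chi> i. f (n8 i))"

definition vec7 :: "(nat \<Rightarrow> complex) \<Rightarrow> complex^7" where
  "vec7 f = (\<chi> i. f (n7 i))"

definition tr :: "nat \<Rightarrow> nat \<Rightarrow> nat \<Rightarrow> nat" where
  "tr p q k = (if k = p then q else if k = q then p else k)"

definition swap8 :: "nat \<Rightarrow> nat \<Rightarrow> complex^8^8" where
  "swap8 p q = mk8 (\<lambda>i j. if j = tr p q i then 1 else 0)"

definition swap7 :: "nat \<Rightarrow> nat \<Rightarrow> complex^7^7" where
  "swap7 p q = mk7 (\<lambda>i j. if j = tr p q i then 1 else 0)"

inductive_set gen_group :: "('a::field^'n^'n) set \<Rightarrow> ('a^'n^'n) set" for S where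
  gen_one: "mat 1 \<in> gen_group S"
| gen_mul: "s \<in> S \<Longrightarrow> g \<in> gen_group S \<Longrightarrow> s ** g \<in> gen_group S"
| gen_inv: "s \<in> S \<Longrightarrow> g \<in> gen_group S \<Longrightarrow> matrix_inv s ** g \<in> gen_group S"

definition right_cosets :: "('a::semiring_1^'n^'n) set \<Rightarrow> ('a^'n^'n) set \<Rightarrow> ('a^'n^'n) set set" where
  "right_cosets K L = {(\<lambda>k. k ** \<alpha>) ` K | \<alpha>. \<alpha> \<in> L}"

definition Xmat :: "complex^8^8" where
  "Xmat = mk8 (\<lambda>i j. [[1/2, 1/2, -1/2, -1/2, -1/2, 1/2, 1/2, 1/2],
                      [0, 1, 0, 0, 0, 0, 0, 0],
                      [-1/2, 1/2, 1/2, -1/2, -1/2, 1/2, 1/2, 1/2],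
                      [-1/2, 1/2, -1/2, 1/2, -1/2, 1/2, 1/2, 1/2],
                      [-1/2, 1/2, -1/2, -1/2, 1/2, 1/2, 1/2, 1/2],
                      [0, 0, 0, 0, 0, 1, 0, 0],
                      [0, 0, 0, 0, 0, 0, 1, 0],
                      [0, 0, 0, 0, 0, 0, 0, 1]] ! (i - 1) ! (j - 1))"

definition Ymat :: "complex^8^8" where
  "Ymat = mk8 (\<lambda>i j. if i = 1 then (if j = 1 then -1 else if j = 2 then 2 else 0)
                    else if i = 2 then (if j = 1 then -1 else if j = 2 then 1 else if j = 3 then 1 else 0)
                    else if i = 3 then (if j = 2 then 1 else 0)
                    else (if j = 1 then -1 else if j = 2 then 1 else if j = i then 1 else 0))"

definition Hgrp :: "(complex^8^8) set" where
  "Hgrp = gen_group {swap8 2 3, swap8 3 4, swap8 4 5, swap8 5 6, swap8 6 7, swap8 7 8, Xmat, Ymat}"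

definition Ggrp :: "(complex^8^8) set" where
  "Ggrp = gen_group {swap8 3 4, swap8 4 5, swap8 5 6, swap8 6 7, swap8 7 8, Xmat}"

definition Mcosets :: "(complex^8^8) set set" where
  "Mcosets = right_cosets Ggrp Hgrp"

definition hW :: "complex \<Rightarrow> complex \<Rightarrow> complex \<Rightarrow> complex \<Rightarrow> complex \<Rightarrow> complex \<Rightarrow> complex \<Rightarrow> complex" where
  "hW a b c d e f g = 2 + 3*a - b - c - d - e - f - g"

definition wvec :: "complex \<Rightarrow> complex \<Rightarrow> complex \<Rightarrow> complex \<Rightarrow> complex \<Rightarrow> complex \<Rightarrow> complex \<Rightarrow> complex^8" where
  "wvec a b c d e f g = vec8 (\<lambda>k. [a, b, c, d, e, f, g, hW a b c d e f g] ! (k - 1))"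

definition comp :: "nat \<Rightarrow> complex^8^8 \<Rightarrow> complex \<Rightarrow> complex \<Rightarrow> complex \<Rightarrow> complex \<Rightarrow> complex \<Rightarrow> complex \<Rightarrow> complex \<Rightarrow> complex" where
  "comp k \<alpha> a b c d e f g = (\<alpha> *v wvec a b c d e f g) $ (of_nat k)"

definition xM :: "nat \<Rightarrow> complex \<Rightarrow> complex \<Rightarrow> complex \<Rightarrow> complex \<Rightarrow> complex \<Rightarrow> complex \<Rightarrow> complex \<Rightarrow> complex" where
  "xM k a b c d e f g = [b, hW a b c d e f g, g, f, e, d, c, a] ! k"

(* the coset \<tau> has label v(i,j) (s = True) resp. -v(i,j) (s = False) *)
definition haslab :: "(complex^8^8) set \<Rightarrow> bool \<Rightarrow> nat \<Rightarrow> nat \<Rightarrow> bool" where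
  "haslab \<tau> s i j \<longleftrightarrow> (\<forall>\<alpha>\<in>\<tau>. \<forall>a b c d e f g. comp 2 \<alpha> a b c d e f g =
      (if s then xM i a b c d e f g + xM j a b c d e f g - xM 7 a b c d e f g
       else 1 + xM 7 a b c d e f g - xM i a b c d e f g - xM j a b c d e f g))"

definition O1 :: "(complex^8^8) set set" where
  "O1 = {\<tau>. \<exists>j\<in>{2..7}. haslab \<tau> True 0 j \<or> haslab \<tau> False 1 j}"

definition O2 :: "(complex^8^8) set set" where
  "O2 = {\<tau>. \<exists>j\<in>{2..7}. haslab \<tau> True 1 j \<or> haslab \<tau> False 0 j}"

definition O3 :: "(complex^8^8) set set" where
  "O3 = {\<tau>. (\<exists>s. haslab \<tau> s 0 1) \<or> (\<exists>s i j. 2 \<le> i \<and> i < j \<and> j \<le> 7 \<and> haslab \<tau> s i j)}"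

(* regularized Saalschuetzian 4F3 at 1: 4F3[a1..a4; b1,b2,b3; 1] / (Gamma b1 Gamma b2 Gamma b3),
   written with the reciprocal Gamma function *)
definition F43r :: "complex \<Rightarrow> complex \<Rightarrow> complex \<Rightarrow> complex \<Rightarrow> complex \<Rightarrow> complex \<Rightarrow> complex \<Rightarrow> complex" where
  "F43r a1 a2 a3 a4 b1 b2 b3 = (\<Sum>n. pochhammer a1 n * pochhammer a2 n * pochhammer a3 n * pochhammer a4 n
       * rGamma (b1 + of_nat n) * rGamma (b2 + of_nat n) * rGamma (b3 + of_nat n) / fact n)"

definition Jfun :: "complex \<Rightarrow> complex \<Rightarrow> complex \<Rightarrow> complex \<Rightarrow> complex \<Rightarrow> complex \<Rightarrow> complex \<Rightarrow> complex" where
  "Jfun A B C D E F G =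
     (F43r A B C D E F G * rGamma A * rGamma (1+A-E) * rGamma (1+A-F) * rGamma (1+A-G)
      + F43r A (1+A-E) (1+A-F) (1+A-G) (1+A-B) (1+A-C) (1+A-D) * rGamma A * rGamma B * rGamma C * rGamma D)
     / sin (of_real pi * A)"

definition Lfun :: "complex \<Rightarrow> complex \<Rightarrow> complex \<Rightarrow> complex \<Rightarrow> complex \<Rightarrow> complex \<Rightarrow> complex \<Rightarrow> complex" where
  "Lfun A B C D E F G =
     (F43r A B C D E F G * rGamma (1-E+A) * rGamma (1-E+B) * rGamma (1-E+C) * rGamma (1-E+D)
      - F43r (1+A-E) (1+B-E) (1+C-E) (1+D-E) (2-E) (1+F-E) (1+G-E) * rGamma A * rGamma B * rGamma C * rGamma D)
     / sin (of_real pi * E)"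

definition Jv :: "complex^7 \<Rightarrow> complex" where
  "Jv v = Jfun (v$1) (v$2) (v$3) (v$4) (v$5) (v$6) (v$7)"
definition Lv :: "complex^7 \<Rightarrow> complex" where
  "Lv v = Lfun (v$1) (v$2) (v$3) (v$4) (v$5) (v$6) (v$7)"

definition Jreg :: "complex^7 \<Rightarrow> bool" where "Jreg v \<longleftrightarrow> sin (of_real pi * v$1) \<noteq> 0"
definition Lreg :: "complex^7 \<Rightarrow> bool" where "Lreg v \<longleftrightarrow> sin (of_real pi * v$5) \<noteq> 0"

definition V7 :: "(complex^7) set" where
  "V7 = {v. v$5 + v$6 + v$7 - v$1 - v$2 - v$3 - v$4 = 1}"

definition X1mat :: "complex^7^7" where
  "X1mat = mk7 (\<lambda>i j. [[1,0,0,0,0,0,0],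
                       [0,0,-1,0,1,0,0],
                       [0,-1,0,0,1,0,0],
                       [0,0,0,1,0,0,0],
                       [0,0,0,0,1,0,0],
                       [0,-1,-1,0,1,1,0],
                       [0,-1,-1,0,1,0,1]] ! (i - 1) ! (j - 1))"

definition H1grp :: "(complex^7^7) set" where
  "H1grp = gen_group {swap7 1 2, swap7 2 3, swap7 3 4, swap7 5 6, swap7 6 7, X1mat}"

(* sign strings b_0 = +++, b_1 = +--, b_2 = -+-, b_3 = --+  (True = +) *)
definition bstr :: "nat \<Rightarrow> bool list" where
  "bstr r = [[True,True,True],[True,False,False],[False,True,False],[False,False,True]] ! r"

definition Aco :: "nat \<Rightarrow> complex^7 \<Rightarrow> complex" where
  "Aco r v = [v$1, v$2, v$3, v$4] ! r"
definition Eco :: "nat \<Rightarrow> complex^7 \<Rightarrow> complex" where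
  "Eco q v = [1, v$5, v$6, v$7] ! q"

(* \<beta> \<in> H_1 lies in the G_J-coset labelled by the sign string s *)
definition jlab :: "complex^7^7 \<Rightarrow> bool list \<Rightarrow> bool" where
  "jlab \<beta> s \<longleftrightarrow> (\<exists>r<4. \<exists>q<4.
      (s = bstr r @ bstr q \<and> (\<forall>v\<in>V7. (\<beta> *v v)$1 = 1 + Aco r v - Eco q v))
    \<or> (s = map Not (bstr r @ bstr q) \<and> (\<forall>v\<in>V7. (\<beta> *v v)$1 = Eco q v - Aco r v)))"

(* J_s(x) = J(\<beta> x) for \<beta> in the coset labelled s *)
definition Jlab_args :: "bool list \<Rightarrow> complex^7 \<Rightarrow> complex^7" where
  "Jlab_args s v = (SOME \<beta>. \<beta> \<in> H1grp \<and> jlab \<beta> s) *v v"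

(* L-labels: (False,k) is L_k, (True,k) is L_{bar k}, 1 \<le> k \<le> 6; arguments in slot order
   (A,B,C,D;E;F,G) of L *)
definition Lk_args :: "nat \<Rightarrow> complex^7 \<Rightarrow> complex^7" where
  "Lk_args k v = (let A = v$1; B = v$2; C = v$3; D = v$4; E = v$5; F = v$6; G = v$7 in
     vec7 (\<lambda>m. (if k = 6 then [A,B,C,D,G,F,E]
               else if k = 5 then [A,B,C,D,F,E,G]
               else if k = 4 then [A,B,C,D,E,F,G]
               else if k = 3 then [A,1+A-E,1+A-F,1+A-G,1+A-D,1+A-B,1+A-C]
               else if k = 2 then [A,1+A-E,1+A-F,1+A-G,1+A-C,1+A-B,1+A-D]
               else [A,1+A-E,1+A-F,1+A-G,1+A-B,1+A-C,1+A-D]) ! (m - 1)))"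

definition Lbar_pt :: "complex^7 \<Rightarrow> complex^7" where
  "Lbar_pt v = vec7 (\<lambda>m. [1 - v$1, 1 - v$2, 1 - v$3, 1 - v$4, 2 - v$5, 2 - v$6, 2 - v$7] ! (m - 1))"

datatype label = LL bool nat | JL "bool list"

definition Llab_args :: "bool \<Rightarrow> nat \<Rightarrow> complex^7 \<Rightarrow> complex^7" where
  "Llab_args bar k v = (if bar then Lk_args k (Lbar_pt v) else Lk_args k v)"

definition gamma1 :: "(complex^8^8) set \<Rightarrow> label" where
  "gamma1 \<tau> = (THE l.
      (\<exists>j\<in>{2..7}. (haslab \<tau> True 0 j \<or> haslab \<tau> True 1 j) \<and> l = LL False (j - 1))
    \<or> (\<exists>j\<in>{2..7}. (haslab \<tau> False 1 j \<or> haslab \<tau> False 0 j) \<and> l = LL True (j - 1))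
    \<or> (\<exists>s. haslab \<tau> s 0 1 \<and> l = JL (replicate 6 s))
    \<or> (\<exists>s i j. 2 \<le> i \<and> i < j \<and> j \<le> 7 \<and> haslab \<tau> s i j \<and>
          l = JL (map (\<lambda>k. if k = i - 1 \<or> k = j - 1 then s else \<not> s) [1..<7])))"

(* the right-hand side arguments: L_{gamma1 tau}(x) = Lv(lab_args ...), J_{gamma1 tau}(x) = Jv(lab_args ...) *)
fun lab_args :: "label \<Rightarrow> complex^7 \<Rightarrow> complex^7" where
  "lab_args (LL bar k) v = Llab_args bar k v"
| "lab_args (JL s) v = Jlab_args s v"

definition indep_b :: "nat \<Rightarrow> complex^8^8 \<Rightarrow> bool" where
  "indep_b k \<alpha> \<longleftrightarrow> (\<forall>a b b' c d e f g. comp k \<alpha> a b c d e f g = comp k \<alpha> a b' c d e f g)"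

definition Im_to_pm_inf :: "nat \<Rightarrow> complex^8^8 \<Rightarrow> bool" where
  "Im_to_pm_inf k \<alpha> \<longleftrightarrow> (\<forall>a c d e f g.
      filterlim (\<lambda>b. Im (comp k \<alpha> a b c d e f g)) at_top (filtercomap Im at_top)
    \<or> filterlim (\<lambda>b. Im (comp k \<alpha> a b c d e f g)) at_bot (filtercomap Im at_top))"

definition Im_to_inf :: "nat \<Rightarrow> complex^8^8 \<Rightarrow> bool" where
  "Im_to_inf k \<alpha> \<longleftrightarrow> (\<forall>a c d e f g.
      filterlim (\<lambda>b. Im (comp k \<alpha> a b c d e f g)) at_top (filtercomap Im at_top))"

definition good12 :: "complex^8^8 \<Rightarrow> bool" where
  "good12 \<alpha> \<longleftrightarrow> indep_b 1 \<alpha> \<and> indep_b 3 \<alpha> \<and> indep_b 4 \<alpha> \<and> indep_b 5 \<alpha> \<and> indep_b 6 \<alpha> \<and> indep_b 7 \<alpha>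
      \<and> Im_to_pm_inf 2 \<alpha>"

definition good3 :: "complex^8^8 \<Rightarrow> bool" where
  "good3 \<alpha> \<longleftrightarrow> indep_b 1 \<alpha> \<and> indep_b 2 \<alpha> \<and> indep_b 3 \<alpha> \<and> indep_b 4 \<alpha> \<and> indep_b 5 \<alpha> \<and> indep_b 6 \<alpha>
      \<and> Im_to_inf 7 \<alpha>"

(* arguments of the L (resp. J) giving gamma_2(M_tau)(a,c,d,e,f,g); the entries used
   do not depend on b, so b is set to 0 *)
definition gamma2_args :: "(complex^8^8) set \<Rightarrow> complex \<Rightarrow> complex \<Rightarrow> complex \<Rightarrow> complex \<Rightarrow> complex \<Rightarrow> complex \<Rightarrow> complex^7" where
  "gamma2_args \<tau> a c d e f g =
    (if \<tau> \<in> O1 \<union> O2 then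
       (let \<alpha> = (SOME \<alpha>. \<alpha> \<in> \<tau> \<and> good12 \<alpha>);
            a' = comp 1 \<alpha> a 0 c d e f g; c' = comp 3 \<alpha> a 0 c d e f g; d' = comp 4 \<alpha> a 0 c d e f g;
            e' = comp 5 \<alpha> a 0 c d e f g; f' = comp 6 \<alpha> a 0 c d e f g; g' = comp 7 \<alpha> a 0 c d e f g
        in vec7 (\<lambda>m. [e', f', g', 1 + a' - c' - d', e' + f' + g' - a', 1 + a' - c', 1 + a' - d'] ! (m - 1)))
     else
       (let \<alpha> = (SOME \<alpha>. \<alpha> \<in> \<tau> \<and> good3 \<alpha>);
            a' = comp 1 \<alpha> a 0 c d e f g; b' = comp 2 \<alpha> a 0 c d e f g; c' = comp 3 \<alpha> a 0 c d e f g;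
            d' = comp 4 \<alpha> a 0 c d e f g; e' = comp 5 \<alpha> a 0 c d e f g; f' = comp 6 \<alpha> a 0 c d e f g
        in vec7 (\<lambda>m. [b', c', d', 1 + a' - e' - f', b' + c' + d' - a', 1 + a' - e', 1 + a' - f'] ! (m - 1))))"

definition gamma2 :: "(complex^8^8) set \<Rightarrow> complex \<Rightarrow> complex \<Rightarrow> complex \<Rightarrow> complex \<Rightarrow> complex \<Rightarrow> complex \<Rightarrow> complex" where
  "gamma2 \<tau> a c d e f g = (if \<tau> \<in> O1 \<union> O2 then Lv (gamma2_args \<tau> a c d e f g) else Jv (gamma2_args \<tau> a c d e f g))"

definition xvec :: "complex \<Rightarrow> complex \<Rightarrow> complex \<Rightarrow> complex \<Rightarrow> complex \<Rightarrow> complex \<Rightarrow> complex^7" where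
  "xvec a c d e f g = vec7 (\<lambda>m. [2 + 2*a - c - d - e - f - g, 1 + a - e - f, 1 + a - e - g, 1 + a - f - g,
                               2 + 2*a - d - e - f - g, 2 + 2*a - c - e - f - g, 2 + a - e - f - g] ! (m - 1))"

end

theory Submission
  imports Defs "HOL-Complex_Analysis.Complex_Analysis" "HOL-Real_Asymp.Real_Asymp" "HOL-Combinatorics.Permutations"
begin

text \<open>
  In the coordinates \<open>y\<close> of \<open>V\<close> with \<open>A = 1/2 + (y1 + \<dots> + y6)/2\<close>, \<open>A - B = y2 + y3\<close>, \<open>A - C = y1 + y3\<close>,
  \<open>A - D = y1 + y2\<close>, \<open>E - 1 = y5 + y6\<close>, \<open>F - 1 = y4 + y6\<close>, \<open>G - 1 = y4 + y5\<close>, the function \<open>J\<close> is symmetric in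
  \<open>y1, \<dots>, y6\<close>, and \<open>L\<close> is a function of \<open>y4\<close> and of the other five coordinates that is invariant under
  permutations and even sign changes of these five. The group \<open>H1\<close> acts by signed permutations of the \<open>y\<close>. Give \<open>W\<close>
  the coordinates \<open>delta, z1, \<dots>, z6\<close> with \<open>v(0,j) = 1/2 + delta + z\<close> and \<open>v(1,j) = 1/2 - delta + z\<close>, \<open>z = z_(j-1)\<close>; then
  only \<open>delta\<close> depends on \<open>b\<close>, so the elements of \<open>H\<close> admitted in the definition of \<open>gamma2\<close> (after one transposition for
  \<open>O3\<close>) act by signed permutations of the \<open>z\<close>. The vector \<open>x\<close> of the theorem is the one with \<open>y = z\<close>,
  and the arguments of \<open>gamma2\<close> and those attached to the label then have the same coordinates up to such symmetries.

  The symmetry of \<open>L\<close> reduces to one two-term relation, which holds because both sides expand, by Gauss's theorem and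
  the nonterminating Saalschuetz theorem, into the same double sum of Beta functions. The symmetry of \<open>J\<close> follows from
  this and a four-term relation, which is the interchange of summation in a double sum of partial fractions. Both
  relations are proved for real parameters in a small box and continued analytically.
\<close>

section \<open>Gauss's summation theorem\<close>

text \<open>Both sides of the theorem hide choices: \<open>gamma2_args\<close> and
  \<open>Jlab_args\<close> use arbitrary elements picked by \<open>SOME\<close>. Computing with one
  convenient matrix per coset is therefore not enough; every admissible element has to be
  controlled. This is done through data that \<open>H\<close> visibly permutes, the 56 values
  \<open>x_i + x_j - x_7\<close> and their complements to 1, together with one invariant quadratic
  form. A choice also says nothing unless an admissible element exists; this is settled by a
  computation with roots.

  On the analytic side, exchanging summations needs positive terms or a majorant, hence restricted
  real parameters, while the relations are wanted everywhere. Dividing each series by the Gamma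
  functions of its lower parameters and clearing the sines leaves functions that are entire on every
  complex line in the Saalschuetzian hyperplane, so a real box suffices. The sine below
  \<open>L\<close> changes along with its numerator, so the symmetry of \<open>L\<close> is kept
  cross multiplied until the final quotient.\<close>

lemma Gamma_real_Suc: "x > 0 \<Longrightarrow> Gamma (x + 1) = x * Gamma (x::real)"
  by (rule Gamma_plus1) (auto elim!: nonpos_Ints_cases)

text \<open>Euler's limit formula in disguise: \<open>Gamma_series x n\<close> is
  \<open>fact n * n powr x / pochhammer x (n+1)\<close> and tends to \<open>Gamma x\<close>, while
  \<open>Gamma (x + n)\<close> is \<open>Gamma x * pochhammer x n\<close>. What remains between them
  is the factor \<open>(x + n) / n\<close>, which tends to 1.\<close>

lemma Gamma_real_asymp:
  assumes x: "x > (0::real)"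
  shows "(\<lambda>n. Gamma (x + real n)) \<sim>[sequentially] (\<lambda>n. fact n * real n powr (x - 1))"
proof -
  have *: "Gamma x \<noteq> 0" using x by (metis Gamma_real_pos less_irrefl)
  have G: "(\<lambda>n. pochhammer x (n+1) / Gamma_series x n * Gamma x / pochhammer x (n+1)) \<longlonglongrightarrow> 1"
  proof -
    have "(\<lambda>n. Gamma x / Gamma_series x n) \<longlonglongrightarrow> Gamma x / Gamma x"
      by (intro tendsto_intros Gamma_series_LIMSEQ) (use * in auto)
    moreover have "pochhammer x (n+1) \<noteq> 0" for n
      using x by (metis pochhammer_pos less_irrefl)
    ultimately show ?thesis using * by (simp add: field_simps)
  qed
  have "(\<lambda>n. Gamma (x + real n) / (fact n * real n powr (x - 1)) * ((x + real n) / real n)) \<longlonglongrightarrow> 1"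
  proof (rule Lim_transform_eventually[OF G])
    show "\<forall>\<^sub>F n in sequentially. pochhammer x (n+1) / Gamma_series x n * Gamma x / pochhammer x (n+1) =
        Gamma (x + real n) / (fact n * real n powr (x - 1)) * ((x + real n) / real n)"
      using eventually_gt_at_top[of 0]
    proof eventually_elim
      case (elim n)
      have p: "pochhammer x n > 0" "pochhammer x (n+1) > 0" using x by (auto intro: pochhammer_pos)
      have g: "Gamma (x + real n) = Gamma x * pochhammer x n"
        using x * by (subst pochhammer_Gamma) (auto elim!: nonpos_Ints_cases)
      have e: "exp (x * ln (real n)) = real n * real n powr (x - 1)"
        using elim by (simp add: powr_diff powr_def exp_diff algebra_simps)
      have "pochhammer x (n+1) = (x + real n) * pochhammer x n" by (simp add: pochhammer_rec')
      hence G': "Gamma_series x n = fact n * (real n * real n powr (x - 1)) / ((x + real n) * pochhammer x n)"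
        by (simp add: Gamma_series_def e)
      show ?case using p elim x unfolding g G'
        by (simp del: pochhammer_Suc add: divide_simps)
    qed
  qed
  moreover have "(\<lambda>n. (x + real n) / real n) \<longlonglongrightarrow> 1" by real_asymp
  ultimately have "(\<lambda>n. Gamma (x + real n) / (fact n * real n powr (x - 1)) * ((x + real n) / real n) / ((x + real n) / real n)) \<longlonglongrightarrow> 1/1"
    by (intro tendsto_divide) auto
  moreover have "\<forall>\<^sub>F n in sequentially. Gamma (x + real n) / (fact n * real n powr (x - 1)) * ((x + real n) / real n) / ((x + real n) / real n)
     = Gamma (x + real n) / (fact n * real n powr (x - 1))"
    using eventually_gt_at_top[of 0]
    by eventually_elim (use x in auto)
  ultimately have "(\<lambda>n. Gamma (x + real n) / (fact n * real n powr (x - 1))) \<longlonglongrightarrow> 1"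
    by (simp add: Lim_transform_eventually)
  thus ?thesis by (rule asymp_equivI')
qed

lemma Gamma_ratio_asymp:
  assumes "x > 0" "y > (0::real)"
  shows "(\<lambda>n. Gamma (x + real n) / Gamma (y + real n)) \<sim>[sequentially] (\<lambda>n. real n powr (x - y))"
proof -
  have "(\<lambda>n. Gamma (x + real n) / Gamma (y + real n)) \<sim>[sequentially]
      (\<lambda>n. (fact n * real n powr (x - 1)) / (fact n * real n powr (y - 1)))"
    by (intro asymp_equiv_intros Gamma_real_asymp assms)
  also have "(\<lambda>n. (fact n * real n powr (x - 1)) / (fact n * real n powr (y - 1))) = (\<lambda>n. real n powr (x - y))"
    by (simp add: powr_diff [symmetric] fun_eq_iff)
  finally show ?thesis .
qed

lemma summable_asymp_powr:
  fixes f :: "nat \<Rightarrow> real"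
  assumes "f \<sim>[sequentially] (\<lambda>n. real n powr e)" "e < -1"
  shows "summable f"
proof -
  have "f \<in> O(\<lambda>n. real n powr e)" using assms(1) by (rule asymp_equiv_imp_bigo)
  moreover have "summable (\<lambda>n. norm (real n powr e))"
    using assms(2) by (simp add: summable_real_powr_iff)
  ultimately show ?thesis by (rule summable_comparison_test_bigo[rotated])
qed

lemma tendsto_asymp_powr:
  fixes f :: "nat \<Rightarrow> real"
  assumes "f \<sim>[sequentially] (\<lambda>n. real n powr e)"
  shows "e = 0 \<Longrightarrow> f \<longlonglongrightarrow> 1" "e < 0 \<Longrightarrow> f \<longlonglongrightarrow> 0"
proof -
  have *: "((\<lambda>n. real n powr e) \<longlonglongrightarrow> l) \<Longrightarrow> f \<longlonglongrightarrow> l" for l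
    using tendsto_asymp_equiv_cong[OF assms] by blast
  show "f \<longlonglongrightarrow> 1" if "e = 0"
  proof (rule *)
    have "\<forall>\<^sub>F n in sequentially. 1 = real n powr e"
      using eventually_gt_at_top[of "0::nat"] by eventually_elim (simp add: that)
    thus "(\<lambda>n. real n powr e) \<longlonglongrightarrow> 1" by (rule Lim_transform_eventually[OF tendsto_const])
  qed
  show "f \<longlonglongrightarrow> 0" if "e < 0" by (rule *) (use that in real_asymp)
qed

text \<open>Tonelli for iterated series. The detour through unordered sums over the product set
  makes the two orders of summation symmetric, and gives summability of the columns as a
  conclusion.\<close>

lemma nonneg_suminf_swap:
  fixes f :: "nat \<Rightarrow> nat \<Rightarrow> real"
  assumes nn: "\<And>m n. f m n \<ge> 0" and s1: "\<And>m. summable (f m)" and s2: "summable (\<lambda>m. suminf (f m))"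
  shows "summable (\<lambda>m. f m n)" "(\<lambda>n. \<Sum>m. f m n) sums (\<Sum>m. \<Sum>n. f m n)"
proof -
  have a: "(f m has_sum suminf (f m)) UNIV" for m
    by (rule sums_nonneg_imp_has_sum) (use nn s1 in \<open>auto simp: summable_sums\<close>)
  have b: "((\<lambda>m. suminf (f m)) has_sum (\<Sum>m. suminf (f m))) UNIV"
    by (rule sums_nonneg_imp_has_sum) (use nn s1 s2 in \<open>auto simp: summable_sums suminf_nonneg\<close>)
  have "(\<lambda>(m,n). f m n) summable_on (UNIV \<times> UNIV)"
    by (rule summable_on_SigmaI[where g = "\<lambda>m. suminf (f m)"]) (use a b nn in \<open>auto simp: summable_on_def\<close>)
  then obtain S where S: "((\<lambda>(m,n). f m n) has_sum S) (UNIV \<times> UNIV)" by (auto simp: summable_on_def)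
  have "((\<lambda>m. suminf (f m)) has_sum S) UNIV"
    by (rule has_sum_SigmaD[OF S]) (use a in auto)
  hence SS: "S = (\<Sum>m. suminf (f m))" using b has_sum_unique by blast
  have S': "((\<lambda>(n,m). f m n) has_sum S) (UNIV \<times> UNIV)"
    using S has_sum_swap[where f = "\<lambda>(m,n). f m n" and S = S and A = UNIV and B = UNIV] by (simp only: prod.case)
  have so: "(\<lambda>m. f m n) summable_on UNIV" for n
    using S' summable_on_SigmaD1[of "\<lambda>n m. f m n" UNIV "\<lambda>_. UNIV"] by (auto simp: summable_on_def)
  have hs: "((\<lambda>m. f m n) has_sum (\<Sum>m. f m n)) UNIV" and su: "summable (\<lambda>m. f m n)" for n
  proof -
    from so obtain l where l: "((\<lambda>m. f m n) has_sum l) UNIV" by (auto simp: summable_on_def)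
    from has_sum_imp_sums[OF this] l show "((\<lambda>m. f m n) has_sum (\<Sum>m. f m n)) UNIV" "summable (\<lambda>m. f m n)"
      by (auto simp: sums_iff)
  qed
  show "summable (\<lambda>m. f m n)" by (rule su)
  show "(\<lambda>n. \<Sum>m. f m n) sums (\<Sum>m. \<Sum>n. f m n)"
    unfolding SS[symmetric] by (rule has_sum_imp_sums, rule has_sum_SigmaD[OF S']) (use hs in auto)
qed

lemma Gamma_real_nonzero: "x > 0 \<Longrightarrow> Gamma (x::real) \<noteq> 0"
  by (metis Gamma_real_pos less_irrefl)

lemma Gamma_real_add_nat: "x > 0 \<Longrightarrow> Gamma (x + real k) = Gamma x * pochhammer x k"
  using Gamma_real_nonzero[of x] by (subst pochhammer_Gamma) (auto elim!: nonpos_Ints_cases)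

lemma Gauss_term_asymp:
  assumes "p > 0" "q > 0" "c > (0::real)"
  shows "(\<lambda>n. Gamma (p + real n) * Gamma (q + real n) / (Gamma (1 + real n) * Gamma (c + real n)))
    \<sim>[sequentially] (\<lambda>n. real n powr (p + q - 1 - c))"
proof -
  have "(\<lambda>n. Gamma (p + real n) / Gamma (1 + real n) * (Gamma (q + real n) / Gamma (c + real n))) \<sim>[sequentially]
     (\<lambda>n. real n powr (p - 1) * real n powr (q - c))"
    by (intro asymp_equiv_intros Gamma_ratio_asymp assms) auto
  thus ?thesis by (simp add: powr_add[symmetric] algebra_simps)
qed

text \<open>The common end of the proofs of both summation theorems: the cross multiplied recurrence
  says that \<open>f / g\<close> has period 1, and a sequence that is constant with limit 1 is
  1.\<close>

lemma shift_periodic_eq: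
  fixes f g :: "real \<Rightarrow> real"
  assumes g: "\<And>x. x \<ge> c \<Longrightarrow> g x > 0"
    and rec: "\<And>x. x \<ge> c \<Longrightarrow> f (x + 1) * g x = f x * g (x + 1)"
    and lim: "(\<lambda>n. f (c + real n) / g (c + real n)) \<longlonglongrightarrow> 1"
  shows "f c = g c"
proof -
  have "f (c + real n) / g (c + real n) = f c / g c" for n
  proof (induction n)
    case (Suc n)
    have "f (c + real n + 1) / g (c + real n + 1) = f (c + real n) / g (c + real n)"
      using rec[of "c + real n"] g[of "c + real n"] g[of "c + real n + 1"] by (simp add: field_simps)
    thus ?case using Suc by (simp add: algebra_simps)
  qed simp
  hence "(\<lambda>n. f (c + real n) / g (c + real n)) \<longlonglongrightarrow> f c / g c" by simp
  hence "f c / g c = 1" using lim LIMSEQ_unique by blast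
  thus ?thesis using g[of c] by (simp add: field_simps)
qed

text \<open>The sum is viewed as a function of \<open>c\<close> alone. A contiguous relation
  supplies the recurrence for \<open>shift_periodic_eq\<close>, and as \<open>c\<close> tends to
  infinity only the term \<open>n = 0\<close> survives.\<close>

theorem Gauss_sum:
  assumes p: "p > 0" and q: "q > 0" and c: "c > p + (q::real)"
  shows "(\<lambda>n. Gamma (p + real n) * Gamma (q + real n) / (Gamma (1 + real n) * Gamma (c + real n))) sums
      (Gamma p * Gamma q * Gamma (c - p - q) / (Gamma (c - p) * Gamma (c - q)))"
proof -
  define t where "t = (\<lambda>c n. Gamma (p + real n) * Gamma (q + real n) / (Gamma (1 + real n) * Gamma (c + real n)))"
  define S where "S = (\<lambda>c. suminf (t c))"
  define R where "R = (\<lambda>c. Gamma p * Gamma q * Gamma (c - p - q) / (Gamma (c - p) * Gamma (c - q)))"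
  have sm: "summable (t x)" if "x \<ge> c" for x
    unfolding t_def using that assms by (intro summable_asymp_powr[OF Gauss_term_asymp]) auto
  have tpos: "t x n > 0" if "x \<ge> c" for x n
    unfolding t_def using that assms by (auto intro!: divide_pos_pos mult_pos_pos)
  have rec: "S (x + 1) * R x = S x * R (x + 1)" if x: "x \<ge> c" for x
  proof -
    \<comment> \<open>The telescoping certificate of the contiguous relation: its differences
      combine \<open>t (x + 1)\<close> and \<open>t x\<close> with coefficients free of
      \<open>n\<close>, and it is 0 at the start and in the limit.\<close>
    define Q where "Q = (\<lambda>n. real n * t x n)"
    have tx: "t (x + 1) n = t x n / (x + real n)" for n
      using Gamma_real_Suc[of "x + real n"] x assms unfolding t_def
      by (simp add: algebra_simps add_ac)
    have Qs: "Q (Suc n) - Q n = (x - p) * (x - q) * t (x + 1) n - (x - p - q) * t x n" for n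
    proof -
      have "t x (Suc n) = t x n * ((p + real n) * (q + real n)) / ((1 + real n) * (x + real n))"
        using Gamma_real_Suc[of "x + real n"] Gamma_real_Suc[of "p + real n"] Gamma_real_Suc[of "q + real n"]
          Gamma_real_Suc[of "1 + real n"] x assms unfolding t_def
        by (simp add: algebra_simps add_ac)
      moreover have "(1 + real n) * (T / ((1 + real n) * d)) = T / d" for T d
        using of_nat_0_le_iff[of n] by (subst times_divide_eq_right, subst mult_divide_mult_cancel_left) linarith+
      ultimately have "Q (Suc n) = t x n * ((p + real n) * (q + real n)) / (x + real n)"
        unfolding Q_def by simp
      moreover have "x + real n \<noteq> 0" using x assms by linarith
      ultimately show ?thesis unfolding Q_def tx by (simp add: divide_simps) (simp add: algebra_simps)
    qed
    have "Q \<sim>[sequentially] (\<lambda>n. real n * real n powr (p + q - 1 - x))"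
      unfolding Q_def t_def using x assms by (intro asymp_equiv_intros Gauss_term_asymp) auto
    also have "(\<lambda>n. real n * real n powr (p + q - 1 - x)) \<sim>[sequentially] (\<lambda>n. real n powr (p + q - x))"
      by (rule asymp_equiv_refl_ev, use eventually_gt_at_top[of "0::nat"] in eventually_elim) (auto simp: powr_diff powr_add)
    finally have "Q \<longlonglongrightarrow> 0" by (rule tendsto_asymp_powr) (use x assms in auto)
    hence "(\<lambda>n. Q (Suc n) - Q n) sums (0 - Q 0)" by (rule telescope_sums)
    hence "(\<lambda>n. (x - p) * (x - q) * t (x + 1) n - (x - p - q) * t x n) sums 0"
      unfolding Qs by (simp add: Q_def)
    moreover have "(\<lambda>n. (x - p) * (x - q) * t (x + 1) n - (x - p - q) * t x n) sums ((x - p) * (x - q) * S (x + 1) - (x - p - q) * S x)"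
      unfolding S_def by (intro sums_diff sums_mult summable_sums sm) (use x in auto)
    ultimately have "(x - p) * (x - q) * S (x + 1) = (x - p - q) * S x"
      using sums_unique2 by fastforce
    moreover have "(x - p) * (x - q) * R (x + 1) = (x - p - q) * R x"
    proof -
      have "Gamma (x + 1 - p - q) = (x - p - q) * Gamma (x - p - q)" "Gamma (x + 1 - p) = (x - p) * Gamma (x - p)"
         "Gamma (x + 1 - q) = (x - q) * Gamma (x - q)"
        using x assms Gamma_real_Suc[of "x - p - q"] Gamma_real_Suc[of "x - p"] Gamma_real_Suc[of "x - q"]
        by (simp_all add: algebra_simps)
      thus ?thesis unfolding R_def using x assms by simp
    qed
    ultimately have "(x - p) * (x - q) * (S (x + 1) * R x) = (x - p) * (x - q) * (S x * R (x + 1))" by algebra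
    thus ?thesis using x assms by simp
  qed
  have Rpos: "R x > 0" if "x \<ge> c" for x
    unfolding R_def using that assms by (auto intro!: divide_pos_pos mult_pos_pos)
  have lim1: "(\<lambda>n. Gamma (c + real n) * S (c + real n)) \<longlonglongrightarrow> Gamma p * Gamma q"
  proof -
    \<comment> \<open>The factor \<open>Gamma (c + n)\<close> turns term \<open>k\<close> into a
      constant over \<open>pochhammer (c + n) k\<close>. This does not increase with
      \<open>n\<close>, so the values at \<open>n = 0\<close> form the majorant for Tannery's
      theorem.\<close>
    define a where "a = (\<lambda>k n. Gamma (c + real n) * t (c + real n) k)"
    have a_eq: "a k n = Gamma (p + real k) * Gamma (q + real k) / Gamma (1 + real k) / pochhammer (c + real n) k" for k n
      unfolding a_def t_def using assms Gamma_real_nonzero[of "c + real n"]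
      by (simp add: Gamma_real_add_nat[of "c + real n" k])
    have "(\<lambda>n. suminf (\<lambda>k. a k n)) \<longlonglongrightarrow> suminf (\<lambda>k. if k = 0 then Gamma p * Gamma q else 0)"
    proof (rule conjunct2[OF conjunct2[OF tannerys_theorem]])
      show "(\<lambda>n. a k n) \<longlonglongrightarrow> (if k = 0 then Gamma p * Gamma q else 0)" for k
      proof (cases k)
        case (Suc j)
        have "filterlim (\<lambda>n. pochhammer (c + real n) k) at_top sequentially"
        proof (rule filterlim_at_top_mono)
          show "filterlim (\<lambda>n. real n) at_top sequentially" by real_asymp
          show "\<forall>\<^sub>F n in sequentially. real n \<le> pochhammer (c + real n) k"
            using eventually_gt_at_top[of 1]
          proof eventually_elim
            case (elim n)
            have "real n * 1 \<le> (c + real n) * pochhammer (c + real n + 1) j"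
            proof (intro mult_mono)
              show "1 \<le> pochhammer (c + real n + 1) j"
                unfolding pochhammer_prod using assms elim by (intro prod_ge_1) auto
            qed (use assms elim in auto)
            thus ?case by (simp add: Suc pochhammer_rec)
          qed
        qed
        hence "(\<lambda>n. Gamma (p + real k) * Gamma (q + real k) / Gamma (1 + real k) / pochhammer (c + real n) k) \<longlonglongrightarrow> 0"
          by (intro real_tendsto_divide_at_top[OF tendsto_const])
        thus ?thesis by (simp add: a_eq Suc)
      qed (simp add: a_eq)
      show "summable (\<lambda>k. a k 0)"
        unfolding a_def using sm[of c] by (auto intro!: summable_mult)
      show "\<forall>\<^sub>F x in at_top \<times>\<^sub>F sequentially. (case x of (k, n) \<Rightarrow> norm (a k n) \<le> a k 0)"
      proof (rule always_eventually, safe)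
        fix k n
        have "pochhammer c k \<le> pochhammer (c + real n) k"
          unfolding pochhammer_prod using assms by (intro prod_mono) auto
        moreover have "pochhammer c k > 0" using assms by (intro pochhammer_pos) auto
        ultimately show "norm (a k n) \<le> a k 0"
          unfolding a_eq using assms by (auto intro!: divide_left_mono mult_pos_pos simp: abs_mult)
      qed
    qed auto
    also have "suminf (\<lambda>k::nat. if k = 0 then Gamma p * Gamma q else 0) = Gamma p * Gamma q"
      using sums_If_finite_set[of "{0::nat}" "\<lambda>_. Gamma p * Gamma q"] by (simp add: sums_iff)
    finally show ?thesis unfolding S_def a_def using sm by (simp add: suminf_mult)
  qed
  have lim2: "(\<lambda>n. Gamma (c + real n) * R (c + real n)) \<longlonglongrightarrow> Gamma p * Gamma q * 1"
  proof -
    have "(\<lambda>n. (Gamma (c + real n) / Gamma (c - p + real n)) * (Gamma (c - p - q + real n) / Gamma (c - q + real n))) \<sim>[sequentially]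
      (\<lambda>n. real n powr (c - (c - p)) * real n powr (c - p - q - (c - q)))"
      using assms by (intro asymp_equiv_intros Gamma_ratio_asymp) auto
    hence "(\<lambda>n. (Gamma (c + real n) / Gamma (c - p + real n)) * (Gamma (c - p - q + real n) / Gamma (c - q + real n))) \<longlonglongrightarrow> 1"
      by (intro tendsto_asymp_powr(1)[where e = 0]) (auto simp: powr_add[symmetric])
    from tendsto_mult_left[OF this, of "Gamma p * Gamma q"] show ?thesis
      unfolding R_def by (simp add: algebra_simps add_ac)
  qed
  have "(\<lambda>n. (Gamma (c + real n) * S (c + real n)) / (Gamma (c + real n) * R (c + real n))) \<longlonglongrightarrow> (Gamma p * Gamma q) / (Gamma p * Gamma q * 1)"
    using assms Gamma_real_nonzero[of p] Gamma_real_nonzero[of q] by (intro tendsto_divide lim1 lim2) auto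
  moreover have "Gamma (c + real n) \<noteq> 0" for n using assms Gamma_real_nonzero[of "c + real n"] by simp
  ultimately have lim: "(\<lambda>n. S (c + real n) / R (c + real n)) \<longlonglongrightarrow> 1" using assms Gamma_real_nonzero[of p] Gamma_real_nonzero[of q] by simp
  have "S c = R c" by (rule shift_periodic_eq[of c R S, OF Rpos rec lim])
  thus ?thesis using sm[of c] by (simp add: sums_iff S_def R_def t_def)
qed


section \<open>The nonterminating Saalschuetz theorem\<close>

text \<open>The summand of a Saalschuetzian 3F2 at a real index \<open>s\<close>: its last lower
  parameter is forced by the condition that lower minus upper parameters sum to 1. With a real
  index, the companion series is the same summand sampled at \<open>1 - E + n\<close>.\<close>

definition Saalschuetz_term :: "real \<Rightarrow> real \<Rightarrow> real \<Rightarrow> real \<Rightarrow> real \<Rightarrow> real" where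
  "Saalschuetz_term A C D E s = Gamma (A + s) * Gamma (C + s) * Gamma (D + s) /
     (Gamma (1 + s) * Gamma (E + s) * Gamma (1 + C + D - E + A + s))"

lemma Saalschuetz_term_asymp:
  assumes "A > 0" "C > 0" "D > 0" "E > 0" "E < 1" "x \<ge> 0"
  shows "(\<lambda>n. Saalschuetz_term A C D E (x + real n)) \<sim>[sequentially] (\<lambda>n. real n powr -2)"
proof -
  have "(\<lambda>n. Gamma ((A + x) + real n) / Gamma ((1 + x) + real n) * (Gamma ((C + x) + real n) / Gamma ((E + x) + real n))
      * (Gamma ((D + x) + real n) / Gamma ((1 + C + D - E + A + x) + real n))) \<sim>[sequentially]
     (\<lambda>n. real n powr ((A + x) - (1 + x)) * real n powr ((C + x) - (E + x)) * real n powr ((D + x) - (1 + C + D - E + A + x)))"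
    by (intro asymp_equiv_intros Gamma_ratio_asymp) (use assms in auto)
  thus ?thesis by (simp add: powr_add[symmetric] Saalschuetz_term_def add.assoc)
qed

lemma Saalschuetz_term_summable:
  assumes "A > 0" "C > 0" "D > 0" "E > 0" "E < 1" "x \<ge> 0"
  shows "summable (\<lambda>n. Saalschuetz_term A C D E (x + real n))"
  by (rule summable_asymp_powr[OF Saalschuetz_term_asymp]) (use assms in auto)

text \<open>The WZ certificate for the recurrence in \<open>A\<close>. Its right-hand side telescopes to 1 both along \<open>s = n\<close> and along
  \<open>s = 1 - E + n\<close>, so the inhomogeneous terms cancel in the difference of the two series.\<close>

lemma Saalschuetz_term_WZ:
  assumes "A > 0" "C > 0" "D > 0" "E > 0" "E < 1" "s \<ge> 0"
  shows "(A+1+C-E) * (A+1+D-E) * Saalschuetz_term (A+1) C D E s - A * (A+1-E) * Saalschuetz_term A C D E s =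
     (s + 1) * (s + E) * Saalschuetz_term A C D E (s + 1) - s * (s + E - 1) * Saalschuetz_term A C D E s"
proof -
  define g where "g = 1 + C + D - E"
  have g: "g > 0" using assms by (simp add: g_def)
  define T where "T = Saalschuetz_term A C D E s"
  have 1: "Saalschuetz_term (A+1) C D E s = T * (A + s) / (g + A + s)"
    using assms g Gamma_real_Suc[of "A + s"] Gamma_real_Suc[of "g + A + s"]
    unfolding Saalschuetz_term_def T_def g_def by (simp add: add_ac) (simp add: algebra_simps)
  have "Saalschuetz_term A C D E (s + 1) = T * ((A + s) * (C + s) * (D + s)) / ((1 + s) * (E + s) * (g + A + s))"
    using assms g Gamma_real_Suc[of "A + s"] Gamma_real_Suc[of "C + s"] Gamma_real_Suc[of "D + s"]
      Gamma_real_Suc[of "1 + s"] Gamma_real_Suc[of "E + s"] Gamma_real_Suc[of "g + A + s"]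
    unfolding Saalschuetz_term_def T_def g_def by (simp add: add_ac) (simp add: algebra_simps)
  hence 2: "(s + 1) * (s + E) * Saalschuetz_term A C D E (s + 1) = T * ((A + s) * (C + s) * (D + s)) / (g + A + s)"
    using assms by (simp add: add.commute)
  have E: "E = 1 + C + D - g" by (simp add: g_def)
  have "g + A + s \<noteq> 0" using g assms by linarith
  thus ?thesis unfolding 1 2 T_def[symmetric] unfolding E
    by (simp add: divide_simps) (simp add: algebra_simps)
qed

lemma Gamma_reflection_real:
  assumes "0 < x" "x < (1::real)"
  shows "Gamma x * Gamma (1 - x) = pi / sin (pi * x)"
proof -
  have "complex_of_real (Gamma x * Gamma (1 - x)) = Gamma (complex_of_real x) * Gamma (1 - complex_of_real x)"
    by (simp add: Gamma_complex_of_real[symmetric])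
  also have "\<dots> = complex_of_real pi / sin (complex_of_real (pi * x))"
    by (simp add: Gamma_reflection_complex)
  also have "\<dots> = complex_of_real (pi / sin (pi * x))" by (simp only: sin_of_real of_real_divide)
  finally have "complex_of_real (Gamma x * Gamma (1 - x)) = complex_of_real (pi / sin (pi * x))" .
  thus ?thesis using of_real_eq_iff by blast
qed

lemma sin_pi_pos: "0 < x \<Longrightarrow> x < 1 \<Longrightarrow> sin (pi * x) > 0"
  using mult_strict_left_mono[of x 1 pi] by (intro sin_gt_zero) auto

lemma sin_sin_diff:
  "sin (e - c) * sin (e - d) - sin c * sin d = sin e * sin (e - c - (d::'a::{real_normed_field,banach}))"
proof -
  have "cos (d - c) = cos (c - d)" using cos_minus[of "c - d"] by simp
  moreover have "e - c - (e - d) = d - c" "e - c + (e - d) = e + (e - c - d)" "e - (e - c - d) = c + d" by auto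
  ultimately show ?thesis by (simp add: sin_times_sin field_simps)
qed

text \<open>The limiting case \<open>A \<rightarrow> \<infinity>\<close> of the theorem below. The
  inequalities put the arguments of the reciprocal Gammas into the unit interval, where reflection
  replaces each by a Gamma times a sine; both terms then have the same Gamma factors and
  \<open>sin_sin_diff\<close> remains.\<close>

lemma Saalschuetz_const:
  assumes CDE: "C > 0" "D > 0" "C + D < E" "E < (1::real)"
  shows "Gamma C * Gamma D * Gamma (E - C - D) / (Gamma (E - C) * Gamma (E - D)) -
       Gamma (1+C-E) * Gamma (1+D-E) * Gamma (E - C - D) / (Gamma (1-C) * Gamma (1-D)) =
     Gamma C * Gamma D * Gamma (1+C-E) * Gamma (1+D-E) * sin (pi * E) / (pi * Gamma (1+C+D-E))"
proof -
  have inv: "1 / Gamma x = Gamma (1 - x) * sin (pi * x) / pi" if "0 < x" "x < 1" for x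
  proof -
    have "Gamma x \<noteq> 0" using that Gamma_real_nonzero by blast
    thus ?thesis using Gamma_reflection_real[OF that] sin_pi_pos[OF that] by (simp add: field_simps)
  qed
  have a: "1 / Gamma (E - C) = Gamma (1+C-E) * sin (pi * (E - C)) / pi"
     "1 / Gamma (E - D) = Gamma (1+D-E) * sin (pi * (E - D)) / pi"
     "1 / Gamma (1 - C) = Gamma C * sin (pi * C) / pi" "1 / Gamma (1 - D) = Gamma D * sin (pi * D) / pi"
    "1 / Gamma (1+C+D-E) = Gamma (E - C - D) * sin (pi * (E - C - D)) / pi"
    using inv[of "E - C"] inv[of "E - D"] inv[of "1 - C"] inv[of "1 - D"] inv[of "1+C+D-E"] assms sin_pi_minus[of "pi * C"]  sin_pi_minus[of "pi * D"] sin_pi_minus[of "pi * (E - C - D)"]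
    by (simp_all add: algebra_simps)
  have "Gamma C * Gamma D * Gamma (E - C - D) / (Gamma (E - C) * Gamma (E - D)) -
       Gamma (1+C-E) * Gamma (1+D-E) * Gamma (E - C - D) / (Gamma (1-C) * Gamma (1-D)) =
     Gamma C * Gamma D * Gamma (E - C - D) * (1 / Gamma (E - C)) * (1 / Gamma (E - D)) -
       Gamma (1+C-E) * Gamma (1+D-E) * Gamma (E - C - D) * (1 / Gamma (1-C)) * (1 / Gamma (1-D))" by simp
  also have "\<dots> = Gamma C * Gamma D * Gamma (1+C-E) * Gamma (1+D-E) * Gamma (E - C - D) / pi^2 *
      (sin (pi * E - pi * C) * sin (pi * E - pi * D) - sin (pi * C) * sin (pi * D))"
    unfolding a by (simp add: field_simps power2_eq_square)
  also have "\<dots> = Gamma C * Gamma D * Gamma (1+C-E) * Gamma (1+D-E) * sin (pi * E) / pi * (1 / Gamma (1+C+D-E))"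
    unfolding a sin_sin_diff by (simp add: field_simps power2_eq_square)
  finally show ?thesis by simp
qed

text \<open>The limit as \<open>A \<rightarrow> \<infinity>\<close> (Tannery), where Gauss's theorem evaluates the series, fixes the periodic factor left open by the
  recurrence.\<close>

lemma Saalschuetz_limit:
  assumes A: "A > 0" and CDE: "C > 0" "D > 0" "C + D < E" "E < 1" and y: "y \<ge> 0"
  shows "(\<lambda>m. Gamma (A + real m + (1+C+D-E)) / Gamma (A + real m) * (\<Sum>n. Saalschuetz_term (A + real m) C D E (y + real n)))
     \<longlonglongrightarrow> (\<Sum>n. Gamma (C + (y + real n)) * Gamma (D + (y + real n)) / (Gamma (1 + (y + real n)) * Gamma (E + (y + real n))))"
proof -
  define g where "g = 1 + C + D - E"
  have g: "g > 0" using assms by (simp add: g_def)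
  define r where "r = (\<lambda>n. Gamma (C + (y + real n)) * Gamma (D + (y + real n)) / (Gamma (1 + (y + real n)) * Gamma (E + (y + real n))))"
  define a where "a = (\<lambda>n m. Gamma (A + real m + g) / Gamma (A + real m) * Saalschuetz_term (A + real m) C D E (y + real n))"
  \<comment> \<open>The normalised term is the limiting term times a quotient of two Betas with the
    same second argument, which is at most 1 by monotonicity; so \<open>r\<close> is its own
    majorant.\<close>
  have a_eq: "a n m = r n * (Beta (A + real m + (y + real n)) g / Beta (A + real m) g)" for n m
    unfolding a_def r_def Saalschuetz_term_def Beta_def g_def[symmetric]
    using A g y Gamma_real_nonzero[of g] by (simp add: add_ac mult_ac)
  have "(\<lambda>m. suminf (\<lambda>n. a n m)) \<longlonglongrightarrow> suminf r"
  proof (rule conjunct2[OF conjunct2[OF tannerys_theorem]])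
    show "(\<lambda>m. a n m) \<longlonglongrightarrow> r n" for n
    proof -
      have "(\<lambda>m. Gamma ((A + g) + real m) / Gamma (A + real m) * (Gamma ((A + (y + real n)) + real m) / Gamma ((A + g + (y + real n)) + real m))) \<sim>[sequentially]
        (\<lambda>m. real m powr ((A + g) - A) * real m powr ((A + (y + real n)) - (A + g + (y + real n))))"
        using assms g by (intro asymp_equiv_intros Gamma_ratio_asymp) auto
      hence "(\<lambda>m. Gamma ((A + g) + real m) / Gamma (A + real m) * (Gamma ((A + (y + real n)) + real m) / Gamma ((A + g + (y + real n)) + real m))) \<longlonglongrightarrow> 1"
        by (intro tendsto_asymp_powr(1)[where e = 0]) (auto simp: powr_add[symmetric])
      from tendsto_mult_left[OF this, of "r n"] show ?thesis
        unfolding a_def r_def Saalschuetz_term_def g_def[symmetric] by (simp add: add_ac mult_ac)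
    qed
    have "r \<sim>[sequentially] (\<lambda>n. real n powr ((C + y) - (1 + y)) * real n powr ((D + y) - (E + y)))"
    proof -
      have "(\<lambda>n. Gamma ((C + y) + real n) / Gamma ((1 + y) + real n) * (Gamma ((D + y) + real n) / Gamma ((E + y) + real n))) \<sim>[sequentially]
          (\<lambda>n. real n powr ((C + y) - (1 + y)) * real n powr ((D + y) - (E + y)))"
        using assms by (intro asymp_equiv_intros Gamma_ratio_asymp) auto
      thus ?thesis unfolding r_def by (simp add: add_ac)
    qed
    thus "summable r"
      by (intro summable_asymp_powr[where e = "C + D - 1 - E"]) (use assms in \<open>auto simp: powr_add[symmetric] algebra_simps\<close>)
    show "\<forall>\<^sub>F x in at_top \<times>\<^sub>F sequentially. (case x of (n, m) \<Rightarrow> norm (a n m) \<le> r n)"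
    proof (rule always_eventually, safe)
      fix n m
      have r0: "r n \<ge> 0" unfolding r_def using assms by auto
      have "Beta (A + real m + (y + real n)) g \<le> Beta (A + real m) g"
        using A g y by (intro Beta_real_mono) auto
      moreover have "Beta (A + real m + (y + real n)) g > 0" "Beta (A + real m) g > 0"
        unfolding Beta_def using A g y by auto
      ultimately have "Beta (A + real m + (y + real n)) g / Beta (A + real m) g \<le> 1"
         "Beta (A + real m + (y + real n)) g / Beta (A + real m) g \<ge> 0" by auto
      thus "norm (a n m) \<le> r n"
        unfolding a_eq real_norm_def abs_mult using r0 by (metis abs_of_nonneg mult_left_le)
    qed
  qed auto
  moreover have "suminf (\<lambda>n. a n m) = Gamma (A + real m + g) / Gamma (A + real m) * (\<Sum>n. Saalschuetz_term (A + real m) C D E (y + real n))" for m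
    unfolding a_def by (rule suminf_mult, rule Saalschuetz_term_summable) (use assms in auto)
  ultimately show ?thesis by (simp add: r_def g_def)
qed

theorem nonterminating_Saalschuetz:
  assumes A: "A > 0" and CDE: "C > 0" "D > 0" "C + D < E" "E < 1"
  shows "(\<Sum>n. Saalschuetz_term A C D E (real n)) - (\<Sum>n. Saalschuetz_term A C D E (1 - E + real n)) =
    Gamma C * Gamma D * Gamma (1+C-E) * Gamma (1+D-E) * sin (pi * E) / (pi * Gamma (1+C+D-E)) *
      (Gamma A * Gamma (A+1-E) / (Gamma (A+1+C-E) * Gamma (A+1+D-E)))"
proof -
  define g where "g = 1 + C + D - E"
  have g: "g > 0" using assms by (simp add: g_def)
  define S where "S = (\<lambda>A. (\<Sum>n. Saalschuetz_term A C D E (0 + real n)) - (\<Sum>n. Saalschuetz_term A C D E (1 - E + real n)))"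
  define k where "k = Gamma C * Gamma D * Gamma (1+C-E) * Gamma (1+D-E) * sin (pi * E) / (pi * Gamma g)"
  define R where "R = (\<lambda>A. k * (Gamma A * Gamma (A+1-E) / (Gamma (A+1+C-E) * Gamma (A+1+D-E))))"
  have "pi * E < pi * 1" using CDE by (intro mult_strict_left_mono) auto
  hence sE: "sin (pi * E) > 0" using CDE by (intro sin_gt_zero) auto
  have k: "k > 0" unfolding k_def using sE g CDE by (intro divide_pos_pos mult_pos_pos) auto
  have rec: "S (x + 1) * R x = S x * R (x + 1)" if x: "x \<ge> A" for x
  proof -
    have x0: "x > 0" using x A by simp
    \<comment> \<open>The condition on \<open>y\<close> selects exactly the two starting points 0
      and \<open>1 - E\<close>, where the boundary term \<open>Q 0\<close> vanishes.\<close>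
    have tele: "(x+1+C-E) * (x+1+D-E) * (\<Sum>n. Saalschuetz_term (x+1) C D E (y + real n)) - x * (x+1-E) * (\<Sum>n. Saalschuetz_term x C D E (y + real n)) = 1"
      if y: "y \<ge> 0" "y * (y + E - 1) = 0" for y
    proof -
      define Q where "Q = (\<lambda>n. (y + real n) * (y + real n + E - 1) * Saalschuetz_term x C D E (y + real n))"
      have "Q \<sim>[sequentially] (\<lambda>n. (y + real n) * (y + real n + E - 1) * real n powr -2)"
        unfolding Q_def by (intro asymp_equiv_intros Saalschuetz_term_asymp) (use CDE x0 y in auto)
      moreover have "(\<lambda>n. (y + real n) * (y + real n + E - 1) * real n powr -2) \<longlonglongrightarrow> 1" by real_asymp
      ultimately have Q: "Q \<longlonglongrightarrow> 1" using tendsto_asymp_equiv_cong by blast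
      have "(\<lambda>n. Q (Suc n) - Q n) sums (1 - Q 0)" by (rule telescope_sums[OF Q])
      moreover have "Q (Suc n) - Q n = (x+1+C-E) * (x+1+D-E) * Saalschuetz_term (x+1) C D E (y + real n) - x * (x+1-E) * Saalschuetz_term x C D E (y + real n)" for n
        using Saalschuetz_term_WZ[of x C D E "y + real n"] x0 CDE y unfolding Q_def by (simp add: add_ac)
      moreover have "Q 0 = 0" using y unfolding Q_def by simp
      ultimately have "(\<lambda>n. (x+1+C-E) * (x+1+D-E) * Saalschuetz_term (x+1) C D E (y + real n) - x * (x+1-E) * Saalschuetz_term x C D E (y + real n)) sums 1" by simp
      moreover have "(\<lambda>n. (x+1+C-E) * (x+1+D-E) * Saalschuetz_term (x+1) C D E (y + real n) - x * (x+1-E) * Saalschuetz_term x C D E (y + real n)) sums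
         ((x+1+C-E) * (x+1+D-E) * (\<Sum>n. Saalschuetz_term (x+1) C D E (y + real n)) - x * (x+1-E) * (\<Sum>n. Saalschuetz_term x C D E (y + real n)))"
        by (intro sums_diff sums_mult summable_sums Saalschuetz_term_summable) (use x0 CDE y in auto)
      ultimately show ?thesis by (rule sums_unique2[symmetric])
    qed
    have "(x+1+C-E) * (x+1+D-E) * S (x+1) - x * (x+1-E) * S x = 0"
      using tele[of 0] tele[of "1-E"] CDE unfolding S_def by (simp add: algebra_simps)
    moreover have "(x+1+C-E) * (x+1+D-E) * R (x+1) = x * (x+1-E) * R x"
    proof -
      have "Gamma (x+1) = x * Gamma x" "Gamma (x+1+1-E) = (x+1-E) * Gamma (x+1-E)"
        "Gamma (x+1+1+C-E) = (x+1+C-E) * Gamma (x+1+C-E)" "Gamma (x+1+1+D-E) = (x+1+D-E) * Gamma (x+1+D-E)"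
        using x0 CDE Gamma_real_Suc[of x] Gamma_real_Suc[of "x+1-E"] Gamma_real_Suc[of "x+1+C-E"] Gamma_real_Suc[of "x+1+D-E"]
        by (simp_all add: algebra_simps)
      thus ?thesis unfolding R_def using x0 CDE by simp
    qed
    ultimately have "(x+1+C-E) * (x+1+D-E) * (S (x + 1) * R x) = (x+1+C-E) * (x+1+D-E) * (S x * R (x + 1))" by algebra
    thus ?thesis using x0 CDE by simp
  qed
  have Rpos: "R x > 0" if "x \<ge> A" for x
    unfolding R_def using that assms k by (auto intro!: divide_pos_pos mult_pos_pos)
  have lim: "(\<lambda>m. S (A + real m) / R (A + real m)) \<longlonglongrightarrow> 1"
  proof -
    have "(\<lambda>m. Gamma (A + real m + g) / Gamma (A + real m) * (\<Sum>n. Saalschuetz_term (A + real m) C D E (0 + real n)) -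
             Gamma (A + real m + g) / Gamma (A + real m) * (\<Sum>n. Saalschuetz_term (A + real m) C D E (1 - E + real n)))
        \<longlonglongrightarrow> (\<Sum>n. Gamma (C + (0 + real n)) * Gamma (D + (0 + real n)) / (Gamma (1 + (0 + real n)) * Gamma (E + (0 + real n))))
          - (\<Sum>n. Gamma (C + (1 - E + real n)) * Gamma (D + (1 - E + real n)) / (Gamma (1 + (1 - E + real n)) * Gamma (E + (1 - E + real n))))"
      unfolding g_def by (intro tendsto_diff Saalschuetz_limit) (use assms in auto)
    also have "(\<Sum>n. Gamma (C + (0 + real n)) * Gamma (D + (0 + real n)) / (Gamma (1 + (0 + real n)) * Gamma (E + (0 + real n)))) =
        Gamma C * Gamma D * Gamma (E - C - D) / (Gamma (E - C) * Gamma (E - D))"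
      using Gauss_sum[of C D E] CDE by (simp add: sums_iff)
    also have "(\<Sum>n. Gamma (C + (1 - E + real n)) * Gamma (D + (1 - E + real n)) / (Gamma (1 + (1 - E + real n)) * Gamma (E + (1 - E + real n)))) =
        Gamma (1+C-E) * Gamma (1+D-E) * Gamma (E - C - D) / (Gamma (1-C) * Gamma (1-D))"
      using Gauss_sum[of "1+C-E" "1+D-E" "2-E"] CDE by (simp add: sums_iff algebra_simps)
    also have "Gamma C * Gamma D * Gamma (E - C - D) / (Gamma (E - C) * Gamma (E - D)) -
       Gamma (1+C-E) * Gamma (1+D-E) * Gamma (E - C - D) / (Gamma (1-C) * Gamma (1-D)) = k"
      unfolding k_def g_def by (rule Saalschuetz_const) (use CDE in auto)
    finally have l1: "(\<lambda>m. Gamma (A + real m + g) / Gamma (A + real m) * S (A + real m)) \<longlonglongrightarrow> k"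
      by (simp add: S_def algebra_simps)
    have "(\<lambda>m. Gamma ((A + g) + real m) / Gamma ((A + 1 + C - E) + real m) * (Gamma ((A + 1 - E) + real m) / Gamma ((A + 1 + D - E) + real m))) \<sim>[sequentially]
       (\<lambda>m. real m powr ((A + g) - (A + 1 + C - E)) * real m powr ((A + 1 - E) - (A + 1 + D - E)))"
      using assms g by (intro asymp_equiv_intros Gamma_ratio_asymp) auto
    hence "(\<lambda>m. Gamma ((A + g) + real m) / Gamma ((A + 1 + C - E) + real m) * (Gamma ((A + 1 - E) + real m) / Gamma ((A + 1 + D - E) + real m))) \<longlonglongrightarrow> 1"
      by (intro tendsto_asymp_powr(1)[where e = 0]) (auto simp: powr_add[symmetric] g_def)
    from tendsto_mult_left[OF this, of k]
    have "(\<lambda>m. k * (Gamma ((A + g) + real m) / Gamma ((A + 1 + C - E) + real m) * (Gamma ((A + 1 - E) + real m) / Gamma ((A + 1 + D - E) + real m)))) \<longlonglongrightarrow> k"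
      by simp
    also have "(\<lambda>m. k * (Gamma ((A + g) + real m) / Gamma ((A + 1 + C - E) + real m) * (Gamma ((A + 1 - E) + real m) / Gamma ((A + 1 + D - E) + real m))))
      = (\<lambda>m. Gamma (A + real m + g) / Gamma (A + real m) * R (A + real m))"
    proof
      fix m
      have nz: "Gamma (A + real m) \<noteq> 0" using A by (intro Gamma_real_nonzero) auto
      have eqs: "(A + g) + real m = A + real m + g" "(A + 1 + C - E) + real m = A + real m + 1 + C - E"
        "(A + 1 - E) + real m = A + real m + 1 - E" "(A + 1 + D - E) + real m = A + real m + 1 + D - E" by auto
      show "k * (Gamma ((A + g) + real m) / Gamma ((A + 1 + C - E) + real m) * (Gamma ((A + 1 - E) + real m) / Gamma ((A + 1 + D - E) + real m)))
      = Gamma (A + real m + g) / Gamma (A + real m) * R (A + real m)" unfolding R_def eqs using nz by (simp add: mult_ac)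
    qed
    finally have l2: "(\<lambda>m. Gamma (A + real m + g) / Gamma (A + real m) * R (A + real m)) \<longlonglongrightarrow> k" .
    have "(\<lambda>m. (Gamma (A + real m + g) / Gamma (A + real m) * S (A + real m)) / (Gamma (A + real m + g) / Gamma (A + real m) * R (A + real m))) \<longlonglongrightarrow> k / k"
      using k by (intro tendsto_divide l1 l2) auto
    moreover have "Gamma (A + real m) \<noteq> 0" "Gamma (A + real m + g) \<noteq> 0" for m
      using A g by (auto intro!: Gamma_real_nonzero simp del: Gamma_real_pos)
    ultimately show ?thesis using k by simp
  qed
  have "S A = R A" by (rule shift_periodic_eq[of A R S, OF Rpos rec lim])
  thus ?thesis by (simp add: S_def R_def k_def g_def)
qed

section \<open>The two-term relation\<close>

text \<open>The part of \<open>Saalschuetz_term\<close> that is free of \<open>A\<close>. With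
  \<open>g = 1 + C + D - E\<close> the other part is \<open>Beta (A + s) g / Gamma g\<close>, and
  replacing \<open>g\<close> by \<open>g + k\<close> is what the expansions below need.\<close>

definition Gamma_quot2 :: "real \<Rightarrow> real \<Rightarrow> real \<Rightarrow> real \<Rightarrow> real" where
  "Gamma_quot2 C D E s = Gamma (C + s) * Gamma (D + s) / (Gamma (1 + s) * Gamma (E + s))"

lemma Gamma_quot2_nonneg: "C > 0 \<Longrightarrow> D > 0 \<Longrightarrow> E > 0 \<Longrightarrow> s \<ge> 0 \<Longrightarrow> Gamma_quot2 C D E s \<ge> 0"
  by (auto simp: Gamma_quot2_def)

lemma Beta_real_nonneg: "x > 0 \<Longrightarrow> y > 0 \<Longrightarrow> Beta x y \<ge> (0::real)"
  by (auto simp: Beta_def)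

lemma Beta_real_rec: "x > 0 \<Longrightarrow> y > 0 \<Longrightarrow> Beta x (y + 1) = Beta x y - Beta (x + 1) (y::real)"
proof -
  assume "x > 0" "y > 0"
  hence "x \<notin> \<int>\<^sub>\<le>\<^sub>0" "y \<notin> \<int>\<^sub>\<le>\<^sub>0" by (auto elim!: nonpos_Ints_cases)
  thus ?thesis using Beta_plus1_plus1[of x y] by simp
qed

lemma Beta_pair_summable:
  assumes "A > 0" "C > 0" "D > 0" "E > 0" "E < 1" "y \<ge> 0"
  shows "summable (\<lambda>n. Gamma_quot2 C D E (y + real n) * Beta (A + (y + real n)) (1 + C + D - E + real k))"
proof (rule summable_comparison_test')
  show "summable (\<lambda>n. Gamma (1 + C + D - E) * Saalschuetz_term A C D E (y + real n))"
    by (intro summable_mult Saalschuetz_term_summable) (use assms in auto)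
  fix n
  have "Gamma (1 + C + D - E) * Saalschuetz_term A C D E (y + real n) = Gamma_quot2 C D E (y + real n) * Beta (A + (y + real n)) (1 + C + D - E)"
    by (simp add: Saalschuetz_term_def Gamma_quot2_def Beta_def add_ac mult_ac)
  moreover have "Beta (A + (y + real n)) (1 + C + D - E + real k) \<le> Beta (A + (y + real n)) (1 + C + D - E)"
    by (rule Beta_real_mono) (use assms in auto)
  ultimately show "norm (Gamma_quot2 C D E (y + real n) * Beta (A + (y + real n)) (1 + C + D - E + real k))
      \<le> Gamma (1 + C + D - E) * Saalschuetz_term A C D E (y + real n)"
    using assms Gamma_quot2_nonneg[of C D E "y + real n"] Beta_real_nonneg[of "A + (y + real n)" "1 + C + D - E + real k"]
    by (simp add: abs_mult mult_left_mono)
qed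

lemma Beta_Gauss_sums:
  assumes "A > 0" "C > 0" "D > 0" "g + A > C + D" "g > 0"
  shows "(\<lambda>m. Gamma_quot2 C D g (real m) * Beta A (g + real m)) sums
    (Gamma A * (Gamma C * Gamma D * Gamma (g + A - C - D) / (Gamma (g + A - C) * Gamma (g + A - D))))"
proof -
  have "(\<lambda>m. Gamma A * (Gamma (C + real m) * Gamma (D + real m) / (Gamma (1 + real m) * Gamma (g + A + real m)))) sums
    (Gamma A * (Gamma C * Gamma D * Gamma (g + A - C - D) / (Gamma (g + A - C) * Gamma (g + A - D))))"
    by (intro sums_mult Gauss_sum) (use assms in auto)
  also have "(\<lambda>m. Gamma A * (Gamma (C + real m) * Gamma (D + real m) / (Gamma (1 + real m) * Gamma (g + A + real m)))) =
     (\<lambda>m. Gamma_quot2 C D g (real m) * Beta A (g + real m))"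
  proof
    fix m
    have "Gamma (g + real m) \<noteq> 0" using assms by (intro Gamma_real_nonzero) auto
    thus "Gamma A * (Gamma (C + real m) * Gamma (D + real m) / (Gamma (1 + real m) * Gamma (g + A + real m))) =
      Gamma_quot2 C D g (real m) * Beta A (g + real m)"
      by (simp add: Gamma_quot2_def Beta_def add_ac mult_ac)
  qed
  finally show ?thesis .
qed

lemma Beta_Gauss_summable:
  assumes "A > 0" "C > 0" "D > 0" "g + A > C + D" "g > 0"
  shows "summable (\<lambda>m. Gamma_quot2 C D g (real m) * Beta A (g + real k + real m))"
proof (rule summable_comparison_test')
  show "summable (\<lambda>m. Gamma_quot2 C D g (real m) * Beta A (g + real m))"
    using Beta_Gauss_sums[OF assms] by (simp add: sums_iff)
  fix m
  have "Beta A (g + real k + real m) \<le> Beta A (g + real m)"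
    by (rule Beta_real_mono) (use assms in auto)
  thus "norm (Gamma_quot2 C D g (real m) * Beta A (g + real k + real m)) \<le> Gamma_quot2 C D g (real m) * Beta A (g + real m)"
    using assms Gamma_quot2_nonneg[of C D g "real m"] Beta_real_nonneg[of A "g + real k + real m"]
    by (simp add: abs_mult mult_left_mono)
qed

text \<open>At \<open>k = 0\<close> the left side is the nonterminating Saalschuetz theorem and the
  right side is evaluated by Gauss. Both sides are linear in the Beta factor, and
  \<open>Beta x (y + 1) = Beta x y - Beta (x + 1) y\<close> reduces \<open>k + 1\<close> to
  \<open>k\<close> at \<open>A\<close> and at \<open>A + 1\<close>; hence the induction with
  \<open>A\<close> arbitrary.\<close>

lemma Beta_pair_sum:
  assumes A: "A > 0" and CDE: "C > 0" "D > 0" "C + D < E" "E < 1"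
  defines "g \<equiv> 1 + C + D - E"
  shows "(\<Sum>n. Gamma_quot2 C D E (0 + real n) * Beta (A + (0 + real n)) (g + real k)) -
         (\<Sum>n. Gamma_quot2 C D E (1 - E + real n) * Beta (A + (1 - E + real n)) (g + real k)) =
      Gamma (1+C-E) * Gamma (1+D-E) * sin (pi * E) / pi * (\<Sum>m. Gamma_quot2 C D g (real m) * Beta A (g + real k + real m))"
  using A
proof (induction k arbitrary: A)
  case (0 A)
  have g: "g > 0" "g + A > C + D" using CDE 0 by (auto simp: g_def)
  have nz: "Gamma g \<noteq> 0" using g by (intro Gamma_real_nonzero)
  have eq: "Gamma_quot2 C D E s * Beta (A + s) (g + real 0) = Gamma g * Saalschuetz_term A C D E s" for s
    by (simp add: Saalschuetz_term_def Gamma_quot2_def Beta_def g_def add_ac mult_ac)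
  have "(\<Sum>n. Gamma_quot2 C D E (0 + real n) * Beta (A + (0 + real n)) (g + real 0)) -
         (\<Sum>n. Gamma_quot2 C D E (1 - E + real n) * Beta (A + (1 - E + real n)) (g + real 0)) =
     Gamma g * ((\<Sum>n. Saalschuetz_term A C D E (0 + real n)) - (\<Sum>n. Saalschuetz_term A C D E (1 - E + real n)))"
    unfolding eq using suminf_mult[OF Saalschuetz_term_summable[of A C D E 0]] suminf_mult[OF Saalschuetz_term_summable[of A C D E "1 - E"]] 0 CDE
    by (simp add: right_diff_distrib)
  also have "\<dots> = Gamma (1+C-E) * Gamma (1+D-E) * sin (pi * E) / pi * (Gamma A * (Gamma C * Gamma D * Gamma (g + A - C - D) / (Gamma (g + A - C) * Gamma (g + A - D))))"
    using nonterminating_Saalschuetz[OF 0 CDE] nz by (simp add: g_def[symmetric]) (simp add: g_def add_ac mult_ac algebra_simps)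
  also have "Gamma A * (Gamma C * Gamma D * Gamma (g + A - C - D) / (Gamma (g + A - C) * Gamma (g + A - D))) = (\<Sum>m. Gamma_quot2 C D g (real m) * Beta A (g + real 0 + real m))"
    using Beta_Gauss_sums[of A C D g] 0 CDE g by (simp add: sums_iff)
  finally show ?case .
next
  case (Suc k A)
  have g: "g > 0" "g + A > C + D" using CDE Suc.prems by (auto simp: g_def)
  have split1: "(\<Sum>n. Gamma_quot2 C D E (y + real n) * Beta (A + (y + real n)) (g + real (Suc k))) =
     (\<Sum>n. Gamma_quot2 C D E (y + real n) * Beta (A + (y + real n)) (g + real k)) - (\<Sum>n. Gamma_quot2 C D E (y + real n) * Beta ((A + 1) + (y + real n)) (g + real k))"
    if "y \<ge> 0" for y
  proof -
    have "Gamma_quot2 C D E (y + real n) * Beta (A + (y + real n)) (g + real (Suc k)) =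
        Gamma_quot2 C D E (y + real n) * Beta (A + (y + real n)) (g + real k) - Gamma_quot2 C D E (y + real n) * Beta ((A + 1) + (y + real n)) (g + real k)" for n
    proof -
      have "Beta (A + (y + real n)) (g + real (Suc k)) = Beta (A + (y + real n)) (g + real k) - Beta ((A + 1) + (y + real n)) (g + real k)"
        using Beta_real_rec[of "A + (y + real n)" "g + real k"] Suc.prems that g by (simp add: add_ac)
      thus ?thesis by (simp only: right_diff_distrib)
    qed
    thus ?thesis
      using Suc.prems CDE that unfolding g_def by (subst suminf_diff) (auto intro!: Beta_pair_summable)
  qed
  have split2: "(\<Sum>m. Gamma_quot2 C D g (real m) * Beta A (g + real (Suc k) + real m)) =
     (\<Sum>m. Gamma_quot2 C D g (real m) * Beta A (g + real k + real m)) - (\<Sum>m. Gamma_quot2 C D g (real m) * Beta (A + 1) (g + real k + real m))"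
  proof -
    have "Gamma_quot2 C D g (real m) * Beta A (g + real (Suc k) + real m) =
        Gamma_quot2 C D g (real m) * Beta A (g + real k + real m) - Gamma_quot2 C D g (real m) * Beta (A + 1) (g + real k + real m)" for m
    proof -
      have "Beta A (g + real (Suc k) + real m) = Beta A (g + real k + real m) - Beta (A + 1) (g + real k + real m)"
        using Beta_real_rec[of A "g + real k + real m"] Suc.prems g by (simp add: add_ac)
      thus ?thesis by (simp only: right_diff_distrib)
    qed
    thus ?thesis
      using Suc.prems CDE g by (subst suminf_diff) (auto intro!: Beta_Gauss_summable)
  qed
  show ?case
    using Suc.IH[of A] Suc.IH[of "A + 1"] Suc.prems CDE split1[of 0] split1[of "1 - E"] split2
    by (simp add: right_diff_distrib)
qed

definition Gamma_quot4 :: "real \<Rightarrow> real \<Rightarrow> real \<Rightarrow> real \<Rightarrow> real \<Rightarrow> real \<Rightarrow> real \<Rightarrow> real \<Rightarrow> real" where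
  "Gamma_quot4 A B C D E F G s = Gamma (A + s) * Gamma (B + s) * Gamma (C + s) * Gamma (D + s) /
     (Gamma (1 + s) * Gamma (E + s) * Gamma (F + s) * Gamma (G + s))"

lemma Gamma_quot4_summable:
  assumes "A > 0" "B > 0" "C > 0" "D > 0" "E > 0" "F > 0" "G > 0" "E + F + G - A - B - C - D = 1" "x \<ge> 0"
  shows "summable (\<lambda>n. Gamma_quot4 A B C D E F G (x + real n))"
proof -
  have "(\<lambda>n. Gamma ((A + x) + real n) / Gamma ((1 + x) + real n) * (Gamma ((B + x) + real n) / Gamma ((E + x) + real n))
      * (Gamma ((C + x) + real n) / Gamma ((F + x) + real n)) * (Gamma ((D + x) + real n) / Gamma ((G + x) + real n))) \<sim>[sequentially]
     (\<lambda>n. real n powr ((A + x) - (1 + x)) * real n powr ((B + x) - (E + x)) * real n powr ((C + x) - (F + x)) * real n powr ((D + x) - (G + x)))"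
    by (intro asymp_equiv_intros Gamma_ratio_asymp) (use assms in auto)
  also have "(\<lambda>n. real n powr ((A + x) - (1 + x)) * real n powr ((B + x) - (E + x)) * real n powr ((C + x) - (F + x)) * real n powr ((D + x) - (G + x)))
    = (\<lambda>n. real n powr ((A + x) - (1 + x) + ((B + x) - (E + x)) + ((C + x) - (F + x)) + ((D + x) - (G + x))))"
    by (simp only: powr_add)
  also have "(A + x) - (1 + x) + ((B + x) - (E + x)) + ((C + x) - (F + x)) + ((D + x) - (G + x)) = -2" using assms(8) by linarith
  finally have "(\<lambda>n. Gamma_quot4 A B C D E F G (x + real n)) \<sim>[sequentially] (\<lambda>n. real n powr -2)"
    by (simp add: Gamma_quot4_def add.assoc)
  thus ?thesis by (rule summable_asymp_powr) simp
qed

definition Beta_double_sum :: "real \<Rightarrow> real \<Rightarrow> real \<Rightarrow> real \<Rightarrow> real \<Rightarrow> real \<Rightarrow> real" where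
  "Beta_double_sum A g C D p q = (\<Sum>k. \<Sum>m. Gamma_quot2 p q g (real k) * (Gamma_quot2 C D g (real m) * Beta A (g + real k + real m)))"

text \<open>The Saalschuetzian condition reads \<open>g + A = F + G - B\<close>, so Gauss's theorem
  read backwards expands the factors with \<open>A\<close>, \<open>B\<close>, \<open>F\<close>,
  \<open>G\<close> into a series of \<open>Beta (A + s) (g + k)\<close>. Positivity permits
  exchanging the sums, and for each \<open>k\<close> the difference of the two inner series is
  \<open>Beta_pair_sum\<close>.\<close>

lemma Gamma_quot4_pair_eq_Beta_double_sum:
  assumes A: "A > 0" and CDE: "C > 0" "D > 0" "C + D < E" "E < 1" and B: "B > 0"
    and FG: "F > B" "G > B" and S: "E + F + G - A - B - C - D = 1"
  defines "g \<equiv> 1 + C + D - E" and "p \<equiv> F - B" and "q \<equiv> G - B"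
  shows "Gamma p * Gamma q * ((\<Sum>n. Gamma_quot4 A B C D E F G (0 + real n)) - (\<Sum>n. Gamma_quot4 A B C D E F G (1 - E + real n))) =
     Gamma (1+C-E) * Gamma (1+D-E) * sin (pi * E) / pi * Beta_double_sum A g C D p q"
    and "\<And>k. summable (\<lambda>m. Gamma_quot2 p q g (real k) * (Gamma_quot2 C D g (real m) * Beta A (g + real k + real m)))"
    and "summable (\<lambda>k. \<Sum>m. Gamma_quot2 p q g (real k) * (Gamma_quot2 C D g (real m) * Beta A (g + real k + real m)))"
proof -
  have pq: "p > 0" "q > 0" using FG by (auto simp: p_def q_def)
  have g: "g > 0" using CDE by (auto simp: g_def)
  have gA: "g + A = F + G - B" using S by (simp add: g_def)
  have pqnz: "Gamma p \<noteq> 0" "Gamma q \<noteq> 0" using pq Gamma_real_nonzero by auto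
  have ksum: "(\<lambda>k. Gamma_quot2 p q g (real k) * Beta (A + s) (g + real k)) sums
      (Gamma p * Gamma q * (Gamma (A + s) * Gamma (B + s) / (Gamma (F + s) * Gamma (G + s))))" if "s \<ge> 0" for s
  proof -
    have "(\<lambda>k. Gamma_quot2 p q g (real k) * Beta (A + s) (g + real k)) sums
      (Gamma (A + s) * (Gamma p * Gamma q * Gamma (g + (A + s) - p - q) / (Gamma (g + (A + s) - p) * Gamma (g + (A + s) - q))))"
      by (rule Beta_Gauss_sums) (use A g pq that gA B in \<open>auto simp: p_def q_def\<close>)
    moreover have "g + (A + s) - p - q = B + s" "g + (A + s) - p = G + s" "g + (A + s) - q = F + s"
      using gA by (auto simp: p_def q_def)
    ultimately have "(\<lambda>k. Gamma_quot2 p q g (real k) * Beta (A + s) (g + real k)) sums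
      (Gamma (A + s) * (Gamma p * Gamma q * Gamma (B + s) / (Gamma (G + s) * Gamma (F + s))))" by (simp only:)
    thus ?thesis by (simp add: mult_ac)
  qed
  define f where "f = (\<lambda>y n k. Gamma_quot2 C D E (y + real n) * (Gamma_quot2 p q g (real k) * Beta (A + (y + real n)) (g + real k)))"
  have Gamma_quot4_f: "f y n sums (Gamma p * Gamma q * Gamma_quot4 A B C D E F G (y + real n))" if "y \<ge> 0" for y n
    using sums_mult[OF ksum[of "y + real n"], of "Gamma_quot2 C D E (y + real n)"] that unfolding f_def
    by (simp add: Gamma_quot4_def Gamma_quot2_def mult_ac)
  have E: "E > 0" using CDE by linarith
  have main: "(\<lambda>k. Gamma_quot2 p q g (real k) * (\<Sum>n. Gamma_quot2 C D E (y + real n) * Beta (A + (y + real n)) (g + real k))) sums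
     (Gamma p * Gamma q * (\<Sum>n. Gamma_quot4 A B C D E F G (y + real n)))" if y: "y \<ge> 0" for y
  proof -
    have Ths: "summable (\<lambda>n. Gamma_quot4 A B C D E F G (y + real n))"
      by (rule Gamma_quot4_summable) (use assms E y in auto)
    have su: "suminf (f y n) = Gamma p * Gamma q * Gamma_quot4 A B C D E F G (y + real n)" for n
      using Gamma_quot4_f[OF y] by (simp add: sums_iff)
    have "(\<lambda>k. \<Sum>n. f y n k) sums (\<Sum>n. \<Sum>k. f y n k)"
    proof (rule nonneg_suminf_swap)
      show "0 \<le> f y m n" for m n unfolding f_def
        by (intro mult_nonneg_nonneg Gamma_quot2_nonneg Beta_real_nonneg) (use A CDE pq g y E in auto)
      show "summable (f y m)" for m using Gamma_quot4_f[OF y] by (simp add: sums_iff)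
      show "summable (\<lambda>m. suminf (f y m))" unfolding su by (intro summable_mult Ths)
    qed
    moreover have "(\<Sum>n. f y n k) = Gamma_quot2 p q g (real k) * (\<Sum>n. Gamma_quot2 C D E (y + real n) * Beta (A + (y + real n)) (g + real k))" for k
    proof -
      have "(\<Sum>n. f y n k) = (\<Sum>n. Gamma_quot2 p q g (real k) * (Gamma_quot2 C D E (y + real n) * Beta (A + (y + real n)) (g + real k)))"
        by (simp add: f_def mult_ac)
      also have "\<dots> = Gamma_quot2 p q g (real k) * (\<Sum>n. Gamma_quot2 C D E (y + real n) * Beta (A + (y + real n)) (g + real k))"
        unfolding g_def by (intro suminf_mult Beta_pair_summable) (use A CDE y E in auto)
      finally show ?thesis .
    qed
    moreover have "(\<Sum>n. \<Sum>k. f y n k) = Gamma p * Gamma q * (\<Sum>n. Gamma_quot4 A B C D E F G (y + real n))"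
      unfolding su using Ths by (rule suminf_mult)
    ultimately show ?thesis by simp
  qed
  define K where "K = Gamma (1+C-E) * Gamma (1+D-E) * sin (pi * E) / pi"
  have K: "K > 0" unfolding K_def using CDE E sin_pi_pos[of E] by (auto intro!: mult_pos_pos divide_pos_pos)
  have ms: "summable (\<lambda>m. Gamma_quot2 C D g (real m) * Beta A (g + real k + real m))" for k
    by (rule Beta_Gauss_summable) (use A CDE g in \<open>auto simp: g_def\<close>)
  show s1: "summable (\<lambda>m. Gamma_quot2 p q g (real k) * (Gamma_quot2 C D g (real m) * Beta A (g + real k + real m)))" for k
    by (intro summable_mult ms)
  have diff: "Gamma_quot2 p q g (real k) * (\<Sum>n. Gamma_quot2 C D E (0 + real n) * Beta (A + (0 + real n)) (g + real k)) -
      Gamma_quot2 p q g (real k) * (\<Sum>n. Gamma_quot2 C D E (1 - E + real n) * Beta (A + (1 - E + real n)) (g + real k)) =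
      K * (\<Sum>m. Gamma_quot2 p q g (real k) * (Gamma_quot2 C D g (real m) * Beta A (g + real k + real m)))" for k
  proof -
    have "(\<Sum>m. Gamma_quot2 p q g (real k) * (Gamma_quot2 C D g (real m) * Beta A (g + real k + real m))) = Gamma_quot2 p q g (real k) * (\<Sum>m. Gamma_quot2 C D g (real m) * Beta A (g + real k + real m))"
      by (intro suminf_mult ms)
    thus ?thesis
    using Beta_pair_sum[OF A CDE, of k] unfolding g_def[symmetric] K_def[symmetric]
    by (simp add: right_diff_distrib[symmetric])
  qed
  have *: "(\<lambda>k. K * (\<Sum>m. Gamma_quot2 p q g (real k) * (Gamma_quot2 C D g (real m) * Beta A (g + real k + real m)))) sums
     (Gamma p * Gamma q * (\<Sum>n. Gamma_quot4 A B C D E F G (0 + real n)) - Gamma p * Gamma q * (\<Sum>n. Gamma_quot4 A B C D E F G (1 - E + real n)))"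
    unfolding diff[symmetric] by (intro sums_diff main) (use CDE in auto)
  show s2: "summable (\<lambda>k. \<Sum>m. Gamma_quot2 p q g (real k) * (Gamma_quot2 C D g (real m) * Beta A (g + real k + real m)))"
    using summable_mult_D[OF sums_summable[OF *]] K by simp
  show "Gamma p * Gamma q * ((\<Sum>n. Gamma_quot4 A B C D E F G (0 + real n)) - (\<Sum>n. Gamma_quot4 A B C D E F G (1 - E + real n))) =
     Gamma (1+C-E) * Gamma (1+D-E) * sin (pi * E) / pi * Beta_double_sum A g C D p q"
    using * suminf_mult[OF s2, of K] unfolding Beta_double_sum_def K_def[symmetric] by (simp add: sums_iff right_diff_distrib)
qed

text \<open>\<open>Beta_double_sum A g C D p q\<close> is symmetric under exchange of \<open>(C, D)\<close> and \<open>(p, q)\<close>.\<close>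

lemma Gamma_quot4_swap:
  assumes A: "A > 0" and CDE: "C > 0" "D > 0" "C + D < E" "E < 1" and B: "A < B" "B < A + 1"
    and FG: "F > B" "G > B" and S: "E + F + G - A - B - C - D = 1"
  shows "Gamma (F - B) * Gamma (G - B) * Gamma (F - A) * Gamma (G - A) * sin (pi * (1 + A - B)) *
     ((\<Sum>n. Gamma_quot4 A B C D E F G (0 + real n)) - (\<Sum>n. Gamma_quot4 A B C D E F G (1 - E + real n))) =
    Gamma C * Gamma D * Gamma (1+C-E) * Gamma (1+D-E) * sin (pi * E) *
     ((\<Sum>n. Gamma_quot4 A (1+A-E) (F-B) (G-B) (1+A-B) (1+A+C-E) (1+A+D-E) (0 + real n)) -
      (\<Sum>n. Gamma_quot4 A (1+A-E) (F-B) (G-B) (1+A-B) (1+A+C-E) (1+A+D-E) (1 - (1+A-B) + real n)))"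
proof -
  define g where "g = 1 + C + D - E"
  have E: "E > 0" using CDE by linarith
  have g: "g > 0" using CDE by (auto simp: g_def)
  \<comment> \<open>The second pair of series has the same \<open>g\<close> with exchanged roles:
    its \<open>(C, D)\<close> are \<open>(F - B, G - B)\<close> and its \<open>(p, q)\<close> are
    \<open>(C, D)\<close>.\<close>
  have eqs: "1 + (F - B) + (G - B) - (1 + A - B) = g" "1+A+C-E - (1+A-E) = C" "1+A+D-E - (1+A-E) = D"
    "1 + (F - B) - (1 + A - B) = F - A" "1 + (G - B) - (1 + A - B) = G - A" using S by (auto simp: g_def)
  have DSs: "Beta_double_sum A g C D (F-B) (G-B) = Beta_double_sum A g (F-B) (G-B) C D"
  proof -
    have "(\<lambda>m. \<Sum>k. Gamma_quot2 (F-B) (G-B) g (real k) * (Gamma_quot2 C D g (real m) * Beta A (g + real k + real m))) sums Beta_double_sum A g C D (F-B) (G-B)"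
      unfolding Beta_double_sum_def
    proof (rule nonneg_suminf_swap)
      show "0 \<le> Gamma_quot2 (F-B) (G-B) g (real m) * (Gamma_quot2 C D g (real n) * Beta A (g + real m + real n))" for m n
        by (intro mult_nonneg_nonneg Gamma_quot2_nonneg Beta_real_nonneg) (use A CDE FG g in auto)
    qed (use Gamma_quot4_pair_eq_Beta_double_sum(2,3)[of A C D E B F G] assms in \<open>simp_all add: g_def\<close>)
    hence "Beta_double_sum A g C D (F-B) (G-B) = (\<Sum>m. \<Sum>k. Gamma_quot2 (F-B) (G-B) g (real k) * (Gamma_quot2 C D g (real m) * Beta A (g + real k + real m)))"
      by (simp add: sums_iff)
    also have "\<dots> = Beta_double_sum A g (F-B) (G-B) C D" unfolding Beta_double_sum_def by (simp add: mult_ac add_ac)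
    finally show ?thesis .
  qed
  have 1: "Gamma (F-B) * Gamma (G-B) * ((\<Sum>n. Gamma_quot4 A B C D E F G (0 + real n)) - (\<Sum>n. Gamma_quot4 A B C D E F G (1 - E + real n))) =
     Gamma (1+C-E) * Gamma (1+D-E) * sin (pi * E) / pi * Beta_double_sum A g C D (F-B) (G-B)"
    using Gamma_quot4_pair_eq_Beta_double_sum(1)[of A C D E B F G] assms by (simp add: g_def)
  have 2: "Gamma C * Gamma D * ((\<Sum>n. Gamma_quot4 A (1+A-E) (F-B) (G-B) (1+A-B) (1+A+C-E) (1+A+D-E) (0 + real n)) -
      (\<Sum>n. Gamma_quot4 A (1+A-E) (F-B) (G-B) (1+A-B) (1+A+C-E) (1+A+D-E) (1 - (1+A-B) + real n))) =
     Gamma (F-A) * Gamma (G-A) * sin (pi * (1+A-B)) / pi * Beta_double_sum A g (F-B) (G-B) C D"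
    using Gamma_quot4_pair_eq_Beta_double_sum(1)[of A "F-B" "G-B" "1+A-B" "1+A-E" "1+A+C-E" "1+A+D-E"] unfolding eqs
    by (rule meta_mp) (use assms E in auto)
  have alg: "a * b * c * d * s' * P = u * v * w * x * s * Q"
    if "a * b * P = w * x * s / pi * T" "u * v * Q = c * d * s' / pi * T" for a b c d s s' P Q u v w x T :: real
  proof -
    have "a * b * c * d * s' * P = c * d * s' * (a * b * P)" by (simp only: mult_ac)
    also have "\<dots> = w * x * s * (u * v * Q)" unfolding that by simp
    finally show ?thesis by (simp only: mult_ac)
  qed
  show ?thesis by (rule alg[OF 1 2[folded DSs]])
qed

section \<open>The four-term relation\<close>

lemma rGamma_real_eq: "rGamma (x::real) = 1 / Gamma x"
  by (simp add: rGamma_inverse_Gamma divide_inverse)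

lemma pochhammer_real_Gamma: "x > 0 \<Longrightarrow> pochhammer x n = Gamma (x + real n) / Gamma (x::real)"
  using Gamma_real_add_nat[of x n] Gamma_real_nonzero[of x] by simp

section \<open>Gauss's theorem with one negative parameter, and Euler's transformation\<close>

lemma Gauss_sum_poch:
  assumes "p > 0" "q > 0" "c > p + (q::real)"
  shows "(\<lambda>n. pochhammer p n * pochhammer q n * rGamma (c + real n) / fact n) sums
     (Gamma (c - p - q) * rGamma (c - p) * rGamma (c - q))"
proof -
  have nz: "Gamma p \<noteq> 0" "Gamma q \<noteq> 0" using assms Gamma_real_nonzero by auto
  have "(\<lambda>n. 1 / (Gamma p * Gamma q) * (Gamma (p + real n) * Gamma (q + real n) / (Gamma (1 + real n) * Gamma (c + real n)))) sums
      (1 / (Gamma p * Gamma q) * (Gamma p * Gamma q * Gamma (c - p - q) / (Gamma (c - p) * Gamma (c - q))))"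
    by (intro sums_mult Gauss_sum assms)
  moreover have "1 / (Gamma p * Gamma q) * (Gamma (p + real n) * Gamma (q + real n) / (Gamma (1 + real n) * Gamma (c + real n)))
    = pochhammer p n * pochhammer q n * rGamma (c + real n) / fact n" for n
    using assms Gamma_fact[where ?'a = real, of n] by (simp add: pochhammer_real_Gamma rGamma_real_eq mult_ac)
  ultimately show ?thesis using nz by (simp add: rGamma_real_eq)
qed

text \<open>In the four-term relation the parameter \<open>1 + A - G\<close> lies between -1 and 0,
  so the terms are not all positive. A contiguous relation writes the series as a difference of
  multiples of two series with positive parameters, \<open>u\<close> and the shift \<open>v'\<close>
  of \<open>v\<close>, which also gives absolute convergence.\<close>

lemma Gauss_sum_ext:
  assumes p: "p > 0" and q: "q > -1" and c: "c > p + (q::real)" and c': "c > 0" "c > p" "c > q"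
  shows "(\<lambda>n. pochhammer p n * pochhammer q n * rGamma (c + real n) / fact n) sums
     (Gamma (c - p - q) * rGamma (c - p) * rGamma (c - q))" (is "?f sums _")
    and "summable (\<lambda>n. \<bar>pochhammer p n * pochhammer q n * rGamma (c + real n) / fact n\<bar>)"
proof -
  define u where "u = (\<lambda>n. pochhammer p n * pochhammer (q+1) n * rGamma (c + 1 + real n) / fact n)"
  define v where "v = (\<lambda>n. pochhammer (p+1) n * pochhammer (q+1) n * rGamma (c + 2 + real n) / fact n)"
  define v' where "v' = (\<lambda>n. case n of 0 \<Rightarrow> 0 | Suc m \<Rightarrow> v m)"
  have us: "u sums (Gamma (c - p - q) * rGamma (c + 1 - p) * rGamma (c - q))"
    unfolding u_def using Gauss_sum_poch[of p "q+1" "c+1"] assms by (simp add: algebra_simps)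
  have vs: "v sums (Gamma (c - p - q) * rGamma (c + 1 - p) * rGamma (c + 1 - q))"
    unfolding v_def using Gauss_sum_poch[of "p+1" "q+1" "c+2"] assms by (simp add: algebra_simps)
  have v's: "v' sums (Gamma (c - p - q) * rGamma (c + 1 - p) * rGamma (c + 1 - q))"
    using sums_Suc[of v'] vs by (simp add: v'_def)
  have f_eq: "?f n = c * u n - (c - q) * p * v' n" for n
  proof (cases n)
    case 0
    show ?thesis using rGamma_plus1[of c] by (simp add: 0 u_def v'_def)
  next
    case (Suc m)
    have r: "rGamma (c + real n) = (c + real n) * rGamma (c + 2 + real m)"
      using rGamma_plus1[of "c + real n"] by (simp add: Suc algebra_simps)
    have r2: "rGamma (c + 1 + real n) = rGamma (c + 2 + real m)" by (simp add: Suc algebra_simps)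
    have q1: "pochhammer q n = q * pochhammer (q+1) m" "pochhammer (q+1) n = pochhammer (q+1) m * (q + 1 + real m)" "pochhammer p n = p * pochhammer (p+1) m"
      by (simp add: Suc pochhammer_rec, simp only: Suc pochhammer_Suc, simp add: Suc pochhammer_rec)
    have v'n: "v' n = real n * (pochhammer (p+1) m * pochhammer (q+1) m * rGamma (c + 2 + real m)) / fact n"
      by (simp add: v'_def v_def Suc)
    define X where "X = pochhammer (p+1) m * pochhammer (q+1) m * rGamma (c + 2 + real m) / fact n"
    have "u n = p * (q + 1 + real m) * X" "v' n = real n * X" "?f n = p * q * (c + real n) * X"
      unfolding u_def v'n r r2 q1 X_def by (simp_all add: mult_ac)
    thus ?thesis by (simp add: Suc algebra_simps)
  qed
  have val: "c * (Gamma (c - p - q) * rGamma (c + 1 - p) * rGamma (c - q)) - (c - q) * p * (Gamma (c - p - q) * rGamma (c + 1 - p) * rGamma (c + 1 - q)) =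
     Gamma (c - p - q) * rGamma (c - p) * rGamma (c - q)"
  proof -
    have r: "rGamma (c - p) = (c - p) * rGamma (c + 1 - p)" "rGamma (c - q) = (c - q) * rGamma (c + 1 - q)"
      using rGamma_plus1[of "c - p"] rGamma_plus1[of "c - q"] by (simp_all add: algebra_simps)
    show ?thesis unfolding r by (simp add: algebra_simps)
  qed
  show "?f sums (Gamma (c - p - q) * rGamma (c - p) * rGamma (c - q))"
    unfolding f_eq val[symmetric] by (intro sums_diff sums_mult us v's)
  have pos: "u n \<ge> 0" "v' n \<ge> 0" for n
    using assms by (auto simp: u_def v'_def v_def rGamma_real_eq split: nat.splits intro!: divide_nonneg_nonneg mult_nonneg_nonneg pochhammer_nonneg)
  show "summable (\<lambda>n. \<bar>?f n\<bar>)"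
  proof (rule summable_comparison_test')
    show "summable (\<lambda>n. c * u n + (c - q) * p * v' n)"
      using us v's by (intro summable_add summable_mult) (auto simp: sums_iff)
    show "norm \<bar>?f n\<bar> \<le> c * u n + (c - q) * p * v' n" for n
    proof -
      have "c * u n \<ge> 0" "(c - q) * p * v' n \<ge> 0" using pos[of n] p c' by auto
      thus ?thesis unfolding f_eq real_norm_def by linarith
    qed
  qed
qed

text \<open>The coefficient of \<open>x^N\<close> in Euler's transformation: the series with
  parameters \<open>e - b\<close>, \<open>e - c\<close>, \<open>e\<close> is the one with
  \<open>b\<close>, \<open>c\<close>, \<open>e\<close> times the binomial series of exponent
  \<open>-(e - b - c)\<close>.\<close>

lemma Pfaff_Saalschuetz:
  fixes b c e :: real
  assumes e: "e > 0"
  shows "(\<Sum>n\<le>N. pochhammer b n * pochhammer c n / (fact n * pochhammer e n) * (pochhammer (e-b-c) (N-n) / fact (N-n)))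
     = pochhammer (e-b) N * pochhammer (e-c) N / (fact N * pochhammer e N)"
proof (induction N)
  case (Suc N)
  define w where "w = e - b - c"
  define a where "a = (\<lambda>n. pochhammer b n * pochhammer c n / (fact n * pochhammer e n))"
  define d where "d = (\<lambda>k. pochhammer w k / fact k)"
  have pe: "pochhammer e n > 0" for n using e by (rule pochhammer_pos)
  have a_rec: "a (Suc n) * ((1 + real n) * (e + real n)) = a n * ((b + real n) * (c + real n))" for n
    using pe[of n] e unfolding a_def by (simp add: pochhammer_Suc divide_simps)
  have d_rec: "d (Suc k) * (1 + real k) = d k * (w + real k)" for k
    unfolding d_def by (simp add: pochhammer_Suc divide_simps)
  \<comment> \<open>The certificate for the recurrence in \<open>N\<close>; the sum of its
    differences leaves the term \<open>n = N + 1\<close>, which completes the sum on the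
    left.\<close>
  define g where "g = (\<lambda>n. real n * (e + real n - 1) * a n * d (Suc N - n))"
  have step: "(1 + real N) * (e + real N) * (a n * d (Suc N - n)) - (e - b + real N) * (e - c + real N) * (a n * d (N - n)) = g n - g (Suc n)"
    if "n \<le> N" for n
  proof -
    obtain k where k: "N = n + k" using \<open>n \<le> N\<close> le_Suc_ex by blast
    have [simp]: "Suc N - n = Suc k" "N - n = k" using k by auto
    define D where "D = d (Suc k)"
    have dk: "d k * (w + real k) = D * (1 + real k)" using d_rec[of k] by (simp add: D_def)
    have gS: "g (Suc n) = a n * ((b + real n) * (c + real n)) * d k"
      unfolding g_def a_rec[symmetric] by (simp add: algebra_simps)
    have "(1 + real k) * ((1 + real N) * (e + real N) * (a n * D) - (e - b + real N) * (e - c + real N) * (a n * d k)) =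
       (1 + real k) * (real n * (e + real n - 1) * a n * D - a n * ((b + real n) * (c + real n)) * d k)"
      (is "?l = ?r")
    proof -
      have "?l - ?r = a n * (1 + real k) * ((e + 2 * real n + real k) * (D * (1 + real k) - d k * (w + real k)))"
        unfolding k w_def by (simp add: algebra_simps)
      thus ?thesis using dk by simp
    qed
    hence "(1 + real N) * (e + real N) * (a n * D) - (e - b + real N) * (e - c + real N) * (a n * d k) =
       real n * (e + real n - 1) * a n * D - a n * ((b + real n) * (c + real n)) * d k"
      by (subst (asm) mult_cancel_left) (use of_nat_0_le_iff[of k] in linarith)
    moreover have "g n = real n * (e + real n - 1) * a n * D" by (simp add: g_def D_def)
    ultimately show ?thesis unfolding gS by (simp add: D_def)
  qed
  have "(1 + real N) * (e + real N) * (\<Sum>n\<le>N. a n * d (Suc N - n)) - (e - b + real N) * (e - c + real N) * (\<Sum>n\<le>N. a n * d (N - n)) = (\<Sum>n\<le>N. g n - g (Suc n))"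
    unfolding sum_distrib_left sum_subtractf[symmetric] by (intro sum.cong step) auto
  also have "\<dots> = g 0 - g (Suc N)" by (rule sum_telescope)
  also have "\<dots> = - ((1 + real N) * (e + real N) * a (Suc N))" by (simp add: g_def d_def)
  finally have "(1 + real N) * (e + real N) * (\<Sum>n\<le>Suc N. a n * d (Suc N - n)) = (e - b + real N) * (e - c + real N) * (\<Sum>n\<le>N. a n * d (N - n))"
    by (simp add: algebra_simps d_def)
  also have "(\<Sum>n\<le>N. a n * d (N - n)) = pochhammer (e-b) N * pochhammer (e-c) N / (fact N * pochhammer e N)"
    using Suc.IH by (simp add: a_def d_def w_def)
  finally have "(\<Sum>n\<le>Suc N. a n * d (Suc N - n)) = pochhammer (e-b) (Suc N) * pochhammer (e-c) (Suc N) / (fact (Suc N) * pochhammer e (Suc N))"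
    using pe[of N] e by (simp add: pochhammer_Suc divide_simps mult_ac add_ac del: sum.atMost_Suc)
  thus ?case by (simp add: a_def d_def w_def)
qed simp

text \<open>Reduction to the nonnegative case: adding the product bound \<open>a n * b m\<close>
  makes the terms nonnegative, and the contribution of the product factorises and is subtracted
  again.\<close>

lemma dominated_suminf_swap:
  fixes f :: "nat \<Rightarrow> nat \<Rightarrow> real"
  assumes bd: "\<And>n m. \<bar>f n m\<bar> \<le> a n * b m" and a: "summable a" and b: "summable b"
    and nn: "\<And>n. a n \<ge> 0" "\<And>m. b m \<ge> 0"
  shows "(\<lambda>m. \<Sum>n. f n m) sums (\<Sum>n. \<Sum>m. f n m)" "summable (\<lambda>n. \<Sum>m. f n m)"
proof -
  define g where "g = (\<lambda>n m. f n m + a n * b m)"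
  have g0: "g n m \<ge> 0" and g1: "g n m \<le> 2 * a n * b m" for n m
    using bd[of n m] unfolding g_def by linarith+
  have hs: "summable (\<lambda>m. a n * b m)" for n by (intro summable_mult b)
  have fs: "summable (f n)" for n
    by (rule summable_comparison_test'[OF hs[of n]]) (use bd in auto)
  have gs: "summable (g n)" for n unfolding g_def by (intro summable_add fs hs)
  have gsum: "suminf (g n) = suminf (f n) + a n * suminf b" for n
    unfolding g_def using suminf_add[OF fs hs] suminf_mult[OF b] by simp
  have gs2: "summable (\<lambda>n. suminf (g n))"
  proof (rule summable_comparison_test')
    show "summable (\<lambda>n. 2 * suminf b * a n)" by (intro summable_mult a)
    show "norm (suminf (g n)) \<le> 2 * suminf b * a n" for n
    proof -
      have "suminf (g n) \<le> (\<Sum>m. 2 * a n * b m)" by (intro suminf_le gs g1 summable_mult b)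
      also have "\<dots> = 2 * a n * suminf b" by (intro suminf_mult b)
      finally show ?thesis using suminf_nonneg[OF gs g0] by (simp add: mult_ac)
    qed
  qed
  have as: "summable (\<lambda>n. a n * suminf b)" by (intro summable_mult2 a)
  show fs2: "summable (\<lambda>n. \<Sum>m. f n m)"
    using summable_diff[OF gs2 as] by (simp add: gsum)
  have 1: "(\<lambda>m. \<Sum>n. g n m) sums (\<Sum>n. \<Sum>m. g n m)" "\<And>m. summable (\<lambda>n. g n m)"
    using nonneg_suminf_swap[of g, OF g0 gs gs2] by auto
  have 2: "(\<lambda>m. (\<Sum>n. a n * b m)) sums (suminf a * suminf b)"
    using suminf_mult2[OF a] sums_mult[OF summable_sums[OF b], of "suminf a"] by simp
  have 3: "(\<Sum>n. \<Sum>m. g n m) = (\<Sum>n. \<Sum>m. f n m) + suminf a * suminf b"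
    unfolding gsum using suminf_add[OF fs2 as] suminf_mult2[OF a] by simp
  have 4: "(\<Sum>n. f n m) = (\<Sum>n. g n m) - (\<Sum>n. a n * b m)" for m
    using suminf_diff[OF 1(2)[of m] summable_mult2[OF a]] by (simp add: g_def)
  show "(\<lambda>m. \<Sum>n. f n m) sums (\<Sum>n. \<Sum>m. f n m)"
    using sums_diff[OF 1(1) 2] unfolding 4 3 by simp
qed


section \<open>Partial fractions of Gamma quotients\<close>

lemma Beta_partial_fractions:
  assumes "x > 0" "0 < w" "w < (1::real)"
  shows "(\<lambda>j. pochhammer w j / fact j / (x + real j)) sums Beta x (1 - w)"
proof -
  have "(\<lambda>j. Gamma x * (pochhammer w j * pochhammer x j * rGamma (x + 1 + real j) / fact j)) sums
     (Gamma x * (Gamma (x + 1 - w - x) * rGamma (x + 1 - w) * rGamma (x + 1 - x)))"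
    by (intro sums_mult Gauss_sum_poch) (use assms in auto)
  moreover have "Gamma x * (pochhammer w j * pochhammer x j * rGamma (x + 1 + real j) / fact j) = pochhammer w j / fact j / (x + real j)" for j
  proof -
    have "Gamma x * pochhammer x j = Gamma (x + real j)" using assms by (simp add: Gamma_real_add_nat)
    moreover have "Gamma (x + real j) * rGamma (x + 1 + real j) = 1 / (x + real j)"
      using Gamma_real_Suc[of "x + real j"] Gamma_real_nonzero[of "x + real j"] assms by (simp add: rGamma_real_eq add_ac)
    moreover have "Gamma x * (pochhammer w j * pochhammer x j * rGamma (x + 1 + real j) / fact j) = pochhammer w j / fact j * ((Gamma x * pochhammer x j) * rGamma (x + 1 + real j))"
      by simp
    ultimately show ?thesis by simp
  qed
  ultimately show ?thesis by (simp add: Beta_def rGamma_real_eq algebra_simps)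
qed

text \<open>Euler's transformation integrated against a power, without integrals: each Beta is
  expanded into simple fractions, and the terms with the same pole \<open>-(X + N)\<close> are
  collected by \<open>Pfaff_Saalschuetz\<close>.\<close>

lemma Euler_partial_fractions:
  fixes b c e X :: real
  assumes b: "b > 0" and c: "c > 0" and w: "0 < e - b - c" "e - b - c < 1" and X: "X > 0"
    and S: "(\<lambda>n. pochhammer b n * pochhammer c n / (fact n * pochhammer e n) * Beta (X + real n) (1 - (e - b - c))) sums S"
  shows "(\<lambda>N. pochhammer (e-b) N * pochhammer (e-c) N / (fact N * pochhammer e N) / (X + real N)) sums S"
proof -
  define w where "w = e - b - c"
  have e: "e > 0" using b c w by linarith
  define a where "a = (\<lambda>n. pochhammer b n * pochhammer c n / (fact n * pochhammer e n))"
  have a0: "a n \<ge> 0" for n unfolding a_def using b c e by (auto intro!: divide_nonneg_nonneg mult_nonneg_nonneg pochhammer_nonneg)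
  define f where "f = (\<lambda>n N. if n \<le> N then a n * (pochhammer w (N - n) / fact (N - n) / (X + real N)) else 0)"
  have fs: "f n sums (a n * Beta (X + real n) (1 - w))" for n
  proof -
    have "(\<lambda>j. a n * (pochhammer w j / fact j / (X + real n + real j))) sums (a n * Beta (X + real n) (1 - w))"
      by (intro sums_mult Beta_partial_fractions) (use X w in \<open>auto simp: w_def\<close>)
    hence "(\<lambda>j. f n (j + n)) sums (a n * Beta (X + real n) (1 - w))" by (simp add: f_def add_ac)
    thus ?thesis by (subst (asm) sums_zero_iff_shift) (auto simp: f_def)
  qed
  have "(\<lambda>N. \<Sum>n. f n N) sums (\<Sum>n. \<Sum>N. f n N)"
  proof (rule nonneg_suminf_swap)
    show "0 \<le> f m n" for m n
      unfolding f_def using a0[of m] w X by (auto intro!: mult_nonneg_nonneg divide_nonneg_nonneg pochhammer_nonneg simp: w_def)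
    show "summable (f m)" for m using fs by (simp add: sums_iff)
    show "summable (\<lambda>m. suminf (f m))" using fs S by (simp add: sums_iff a_def w_def)
  qed
  moreover have "(\<Sum>n. \<Sum>N. f n N) = S" using fs S by (simp add: sums_iff a_def w_def)
  moreover have "(\<Sum>n. f n N) = pochhammer (e-b) N * pochhammer (e-c) N / (fact N * pochhammer e N) / (X + real N)" for N
  proof -
    have "(\<Sum>n. f n N) = (\<Sum>n\<le>N. f n N)" by (rule suminf_finite) (auto simp: f_def)
    also have "\<dots> = (\<Sum>n\<le>N. a n * (pochhammer w (N - n) / fact (N - n))) / (X + real N)"
      unfolding sum_divide_distrib by (rule sum.cong) (auto simp: f_def)
    also have "(\<Sum>n\<le>N. a n * (pochhammer w (N - n) / fact (N - n))) = pochhammer (e-b) N * pochhammer (e-c) N / (fact N * pochhammer e N)"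
      using Pfaff_Saalschuetz[OF e, of b c N] by (simp add: a_def w_def)
    finally show ?thesis .
  qed
  ultimately show ?thesis by simp
qed

text \<open>The summand of a regularized 2F1 at 1. Up to a constant factor these are the residues of
  the Gamma quotients expanded next.\<close>

definition Gauss_coeff :: "real \<Rightarrow> real \<Rightarrow> real \<Rightarrow> nat \<Rightarrow> real" where
  "Gauss_coeff B C E n = pochhammer B n * pochhammer C n * rGamma (E + real n) / fact n"

text \<open>This is \<open>Beta_pair_sum\<close> at \<open>k = 0\<close> for the parameters
  \<open>E - B\<close> and \<open>E - C\<close>: Gauss evaluates its right side to the Gamma
  quotient, and \<open>Euler_partial_fractions\<close> turns both Beta series on its left side into
  partial fractions.\<close>

lemma Gamma_ratio_partial_fractions:
  assumes BCE: "B < E" "C < E" "E < 1" "B + C > E" and x: "x > (0::real)"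
  shows "summable (\<lambda>n. Gauss_coeff B C E n / (x + real n))" (is ?t1)
    "summable (\<lambda>n. Gauss_coeff (1+B-E) (1+C-E) (2-E) n / (x + 1 - E + real n))" (is ?t2)
    "Gamma x * Gamma (x + 1 - E) * rGamma (x + 1 - B) * rGamma (x + 1 - C) * sin (pi * E) / pi =
      rGamma (1-B) * rGamma (1-C) * (\<Sum>n. Gauss_coeff B C E n / (x + real n)) -
      rGamma (E-B) * rGamma (E-C) * (\<Sum>n. Gauss_coeff (1+B-E) (1+C-E) (2-E) n / (x + 1 - E + real n))" (is ?t3)
proof -
  define b where "b = E - B"
  define c where "c = E - C"
  have b: "b > 0" and c: "c > 0" and bc: "b + c < E" using BCE by (auto simp: b_def c_def)
  have E: "E > 0" using b c bc by linarith
  define g where "g = 1 + b + c - E"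
  have g: "g > 0" "g < 1" using b c bc E BCE by (auto simp: g_def)
  \<comment> \<open>Covers both series at once: \<open>y = 0\<close> with parameters
    \<open>b\<close>, \<open>c\<close>, \<open>E\<close>, and \<open>y = 1 - E\<close> with
    parameters \<open>1 - B\<close>, \<open>1 - C\<close>, \<open>2 - E\<close>.\<close>
  have part: "summable (\<lambda>n. Gauss_coeff (e - b') (e - c') e n / (X + real n)) \<and>
     (\<Sum>n. Gamma_quot2 b c E (y + real n) * Beta (x + (y + real n)) g) = Gamma b' * Gamma c' * (\<Sum>n. Gauss_coeff (e - b') (e - c') e n / (X + real n))"
    if y: "y \<ge> 0" and eqs: "b' > 0" "c' > 0" "e > 0" "e - b' - c' = 1 - g" "X = x + y"
      and rreq: "\<And>n. Gamma_quot2 b c E (y + real n) = Gamma_quot2 b' c' e (real n)" for y b' c' e X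
  proof -
    have nz: "Gamma b' \<noteq> 0" "Gamma c' \<noteq> 0" "Gamma e \<noteq> 0" using eqs Gamma_real_nonzero by auto
    have sm: "summable (\<lambda>n. Gamma_quot2 b c E (y + real n) * Beta (x + (y + real n)) g)"
      unfolding g_def using Beta_pair_summable[of x b c E y 0] x b c E BCE y by simp
    have Gamma_quot2_eq: "Gamma_quot2 b' c' e (real n) = Gamma b' * Gamma c' / Gamma e * (pochhammer b' n * pochhammer c' n / (fact n * pochhammer e n))" for n
      using eqs nz Gamma_fact[where ?'a = real, of n] by (simp add: Gamma_quot2_def pochhammer_real_Gamma)
    have "(\<lambda>n. Gamma e / (Gamma b' * Gamma c') * (Gamma_quot2 b c E (y + real n) * Beta (x + (y + real n)) g)) sums
       (Gamma e / (Gamma b' * Gamma c') * (\<Sum>n. Gamma_quot2 b c E (y + real n) * Beta (x + (y + real n)) g))"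
      by (intro sums_mult summable_sums sm)
    also have "(\<lambda>n. Gamma e / (Gamma b' * Gamma c') * (Gamma_quot2 b c E (y + real n) * Beta (x + (y + real n)) g)) =
        (\<lambda>n. pochhammer b' n * pochhammer c' n / (fact n * pochhammer e n) * Beta (X + real n) (1 - (e - b' - c')))"
      unfolding rreq Gamma_quot2_eq eqs(4,5) using nz by (simp add: fun_eq_iff add_ac)
    finally have "(\<lambda>N. pochhammer (e-b') N * pochhammer (e-c') N / (fact N * pochhammer e N) / (X + real N)) sums
       (Gamma e / (Gamma b' * Gamma c') * (\<Sum>n. Gamma_quot2 b c E (y + real n) * Beta (x + (y + real n)) g))"
      by (rule Euler_partial_fractions[rotated 5]) (use eqs g x y in auto)
    from sums_mult[OF this, of "rGamma e"]
    have "(\<lambda>N. rGamma e * (pochhammer (e-b') N * pochhammer (e-c') N / (fact N * pochhammer e N) / (X + real N))) sums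
       (1 / (Gamma b' * Gamma c') * (\<Sum>n. Gamma_quot2 b c E (y + real n) * Beta (x + (y + real n)) g))"
      using nz by (simp add: rGamma_real_eq)
    also have "(\<lambda>N. rGamma e * (pochhammer (e-b') N * pochhammer (e-c') N / (fact N * pochhammer e N) / (X + real N))) =
       (\<lambda>n. Gauss_coeff (e - b') (e - c') e n / (X + real n))"
      unfolding Gauss_coeff_def using eqs nz by (simp add: fun_eq_iff rGamma_real_eq Gamma_real_add_nat)
    finally show ?thesis using nz by (auto simp: sums_iff)
  qed
  have p0: "summable (\<lambda>n. Gauss_coeff B C E n / (x + real n)) \<and>
     (\<Sum>n. Gamma_quot2 b c E (0 + real n) * Beta (x + (0 + real n)) g) = Gamma b * Gamma c * (\<Sum>n. Gauss_coeff B C E n / (x + real n))"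
    using part[of 0 b c E x] b c E by (simp add: g_def b_def c_def)
  have p1: "summable (\<lambda>n. Gauss_coeff (1+B-E) (1+C-E) (2-E) n / (x + 1 - E + real n)) \<and>
     (\<Sum>n. Gamma_quot2 b c E (1 - E + real n) * Beta (x + (1 - E + real n)) g) =
       Gamma (1-B) * Gamma (1-C) * (\<Sum>n. Gauss_coeff (1+B-E) (1+C-E) (2-E) n / (x + 1 - E + real n))"
  proof -
    have "Gamma_quot2 b c E (1 - E + real n) = Gamma_quot2 (1-B) (1-C) (2-E) (real n)" for n
      by (simp add: Gamma_quot2_def b_def c_def add_ac mult_ac algebra_simps)
    thus ?thesis using part[of "1 - E" "1-B" "1-C" "2-E" "x + 1 - E"] BCE by (simp add: g_def b_def c_def algebra_simps)
  qed
  show ?t1 ?t2 using p0 p1 by auto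
  have nz: "Gamma b \<noteq> 0" "Gamma c \<noteq> 0" "Gamma (1-B) \<noteq> 0" "Gamma (1-C) \<noteq> 0" "Gamma g \<noteq> 0"
    using b c BCE g Gamma_real_nonzero by auto
  have "Gamma b * Gamma c * (\<Sum>n. Gauss_coeff B C E n / (x + real n)) -
      Gamma (1-B) * Gamma (1-C) * (\<Sum>n. Gauss_coeff (1+B-E) (1+C-E) (2-E) n / (x + 1 - E + real n)) =
     Gamma (1+b-E) * Gamma (1+c-E) * sin (pi * E) / pi * (\<Sum>m. Gamma_quot2 b c g (real m) * Beta x (g + real 0 + real m))"
    using Beta_pair_sum[OF x b c bc BCE(3), of 0] p0 p1 unfolding g_def[symmetric] by simp
  also have "(\<Sum>m. Gamma_quot2 b c g (real m) * Beta x (g + real 0 + real m)) =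
      Gamma x * (Gamma b * Gamma c * Gamma (g + x - b - c) / (Gamma (g + x - b) * Gamma (g + x - c)))"
  proof -
    have "g + x > b + c" using BCE x by (simp add: g_def)
    thus ?thesis using Beta_Gauss_sums[of x b c g] x b c g by (simp add: sums_iff)
  qed
  also have "Gamma (1+b-E) * Gamma (1+c-E) * sin (pi * E) / pi * (Gamma x * (Gamma b * Gamma c * Gamma (g + x - b - c) / (Gamma (g + x - b) * Gamma (g + x - c)))) =
     Gamma b * Gamma c * Gamma (1-B) * Gamma (1-C) * (Gamma x * Gamma (x + 1 - E) * rGamma (x + 1 - B) * rGamma (x + 1 - C) * sin (pi * E) / pi)"
    by (simp add: b_def c_def g_def rGamma_real_eq algebra_simps)
  finally have fin: "Gamma b * Gamma c * (\<Sum>n. Gauss_coeff B C E n / (x + real n)) -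
      Gamma (1-B) * Gamma (1-C) * (\<Sum>n. Gauss_coeff (1+B-E) (1+C-E) (2-E) n / (x + 1 - E + real n)) =
     Gamma b * Gamma c * Gamma (1-B) * Gamma (1-C) * (Gamma x * Gamma (x + 1 - E) * rGamma (x + 1 - B) * rGamma (x + 1 - C) * sin (pi * E) / pi)" .
  have alg: "P = rGamma b3 * rGamma b4 * S - rGamma b1 * rGamma b2 * T"
    if "Gamma b1 * Gamma b2 * S - Gamma b3 * Gamma b4 * T = Gamma b1 * Gamma b2 * Gamma b3 * Gamma b4 * P"
      "Gamma b1 \<noteq> 0" "Gamma b2 \<noteq> 0" "Gamma b3 \<noteq> 0" "Gamma b4 \<noteq> 0" for b1 b2 b3 b4 P S T :: real
    using that by (simp add: rGamma_real_eq field_simps)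
  show ?t3 using alg[OF fin] nz by (simp add: b_def c_def)
qed


text \<open>The expansion with \<open>C\<close> one unit lower. The previous lemma at
  \<open>C + 1\<close> is divided by \<open>x - C\<close>, and each fraction is split into a
  multiple of \<open>1 / (x - C)\<close> and one of the old denominator.\<close>

lemma Gamma_ratio_partial_fractions2:
  assumes BCE: "B < E" "C < E - 1" "E < 1" "B + C > E - 1" and x: "x > (0::real)" and BC': "B + C < E" "B > 0" "-1 < C"
  shows "summable (\<lambda>n. \<bar>Gauss_coeff B C E n\<bar>)" "summable (\<lambda>n. \<bar>Gauss_coeff (1+B-E) (1+C-E) (2-E) n\<bar>)"
    "Gamma x * Gamma (x + 1 - E) * rGamma (x + 1 - B) * rGamma (x + 1 - C) * sin (pi * E) / pi =
      rGamma (1-B) * rGamma (1-C) * (\<Sum>n. Gauss_coeff B C E n / (x + real n)) -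
      rGamma (E-B) * rGamma (E-C) * (\<Sum>n. Gauss_coeff (1+B-E) (1+C-E) (2-E) n / (x + 1 - E + real n))" (is ?t3)
proof -
  have E: "E > 0" using BCE BC' by linarith
  have G0: "Gauss_coeff B C E sums (Gamma (E - B - C) * rGamma (E - B) * rGamma (E - C))" "summable (\<lambda>n. \<bar>Gauss_coeff B C E n\<bar>)"
    unfolding Gauss_coeff_def using assms E by (intro Gauss_sum_ext; simp)+
  have G1: "Gauss_coeff (1+B-E) (1+C-E) (2-E) sums (Gamma (E - B - C) * rGamma (1 - B) * rGamma (1 - C))"
    "summable (\<lambda>n. \<bar>Gauss_coeff (1+B-E) (1+C-E) (2-E) n\<bar>)"
  proof -
    have eqs: "2 - E - (1+B-E) - (1+C-E) = E - B - C" "2 - E - (1+B-E) = 1 - B" "2 - E - (1+C-E) = 1 - C" by auto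
    show "Gauss_coeff (1+B-E) (1+C-E) (2-E) sums (Gamma (E - B - C) * rGamma (1 - B) * rGamma (1 - C))"
      unfolding Gauss_coeff_def eqs[symmetric] by (rule Gauss_sum_ext(1)) (use assms E in auto)
    show "summable (\<lambda>n. \<bar>Gauss_coeff (1+B-E) (1+C-E) (2-E) n\<bar>)"
      unfolding Gauss_coeff_def by (rule Gauss_sum_ext(2)) (use assms E in auto)
  qed
  show "summable (\<lambda>n. \<bar>Gauss_coeff B C E n\<bar>)" "summable (\<lambda>n. \<bar>Gauss_coeff (1+B-E) (1+C-E) (2-E) n\<bar>)" by fact+
  have Cx: "x - C > 0" "C \<noteq> 0" "1 + C - E \<noteq> 0" using x BCE BC' by auto
  note PF = Gamma_ratio_partial_fractions[of B E "C+1" x]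
  have decomp: "c * (Gauss_coeff B' (c+1) e n / (X + real n)) / (x - C) = Gauss_coeff B' c e n * (1 / (x - C)) - Gauss_coeff B' c e n / (X + real n)"
    if "c \<noteq> 0" "X + real n > 0" "X = x - C + c" for c B' e X n
  proof -
    have pc: "c * pochhammer (c+1) n = pochhammer c n * (c + real n)"
      using pochhammer_rec[of c n] pochhammer_Suc[of c n] by simp
    have "c * (Gauss_coeff B' (c+1) e n / (X + real n)) / (x - C) = pochhammer B' n * (c * pochhammer (c+1) n) * rGamma (e + real n) / fact n / (X + real n) / (x - C)"
      by (simp add: Gauss_coeff_def)
    also have "\<dots> = Gauss_coeff B' c e n * ((c + real n) / ((X + real n) * (x - C)))"
      unfolding pc by (simp add: Gauss_coeff_def mult_ac)
    also have "(c + real n) / ((X + real n) * (x - C)) = 1 / (x - C) - 1 / (X + real n)"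
      using that Cx by (simp add: divide_simps)
    finally show ?thesis by (simp add: right_diff_distrib)
  qed
  have S0: "(-C) * (\<Sum>n. Gauss_coeff B (C+1) E n / (x + real n)) / (x - C) = (\<Sum>n. Gauss_coeff B C E n / (x + real n)) - (\<Sum>n. Gauss_coeff B C E n) / (x - C)"
    and S1: "(E - C - 1) * (\<Sum>n. Gauss_coeff (1+B-E) (1+(C+1)-E) (2-E) n / (x + 1 - E + real n)) / (x - C) =
       (\<Sum>n. Gauss_coeff (1+B-E) (1+C-E) (2-E) n / (x + 1 - E + real n)) - (\<Sum>n. Gauss_coeff (1+B-E) (1+C-E) (2-E) n) / (x - C)"
  proof -
    have gen: "(-c) * (\<Sum>n. Gauss_coeff B' (c+1) e n / (X + real n)) / (x - C) = (\<Sum>n. Gauss_coeff B' c e n / (X + real n)) - (\<Sum>n. Gauss_coeff B' c e n) / (x - C)"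
      if c: "c \<noteq> 0" "X > 0" "X = x - C + c" and sm: "summable (\<lambda>n. Gauss_coeff B' (c+1) e n / (X + real n))" "summable (Gauss_coeff B' c e)" for c B' e X
    proof -
      have sm2: "summable (\<lambda>n. Gauss_coeff B' c e n / (X + real n))"
      proof -
        have "Gauss_coeff B' c e n / (X + real n) = Gauss_coeff B' c e n * (1 / (x - C)) - c * (Gauss_coeff B' (c+1) e n / (X + real n)) / (x - C)" for n
          using decomp[of c X n B' e] c by simp
        moreover have "summable (\<lambda>n. Gauss_coeff B' c e n * (1 / (x - C)) - c * (Gauss_coeff B' (c+1) e n / (X + real n)) / (x - C))"
          by (intro summable_diff summable_mult2 summable_divide summable_mult sm)
        ultimately show ?thesis by simp
      qed
      have "c * (\<Sum>n. Gauss_coeff B' (c+1) e n / (X + real n)) / (x - C) = (\<Sum>n. c * (Gauss_coeff B' (c+1) e n / (X + real n)) / (x - C))"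
        using suminf_mult[OF sm(1), of c] suminf_divide[OF summable_mult[OF sm(1), of c], of "x - C"] by simp
      also have "\<dots> = (\<Sum>n. Gauss_coeff B' c e n * (1 / (x - C)) - Gauss_coeff B' c e n / (X + real n))"
        using decomp c by (intro suminf_cong) (auto intro!: decomp)
      also have "\<dots> = (\<Sum>n. Gauss_coeff B' c e n * (1 / (x - C))) - (\<Sum>n. Gauss_coeff B' c e n / (X + real n))"
        by (rule suminf_diff[symmetric]) (intro summable_mult2 sm sm2)+
      also have "(\<Sum>n. Gauss_coeff B' c e n * (1 / (x - C))) = (\<Sum>n. Gauss_coeff B' c e n) * (1 / (x - C))"
        by (rule suminf_mult2[symmetric, OF sm(2)])
      finally show ?thesis by simp
    qed
    show "(-C) * (\<Sum>n. Gauss_coeff B (C+1) E n / (x + real n)) / (x - C) = (\<Sum>n. Gauss_coeff B C E n / (x + real n)) - (\<Sum>n. Gauss_coeff B C E n) / (x - C)"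
      using gen[of C x B E] Cx x PF(1) G0(1) BCE by (simp add: sums_iff)
    have e: "1 + (C + 1) - E = (1 + C - E) + 1" "x + 1 - E = x - C + (1 + C - E)" by auto
    have "(-(1 + C - E)) * (\<Sum>n. Gauss_coeff (1+B-E) ((1+C-E) + 1) (2-E) n / (x + 1 - E + real n)) / (x - C) =
       (\<Sum>n. Gauss_coeff (1+B-E) (1+C-E) (2-E) n / (x + 1 - E + real n)) - (\<Sum>n. Gauss_coeff (1+B-E) (1+C-E) (2-E) n) / (x - C)"
    proof (rule gen)
      have "C + 1 < E" "B + (C + 1) > E" using BCE by auto
      from PF(2)[OF BCE(1) this(1) BCE(3) this(2) x]
      show "summable (\<lambda>n. Gauss_coeff (1+B-E) ((1+C-E) + 1) (2-E) n / (x + 1 - E + real n))" unfolding e(1) .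
      show "summable (Gauss_coeff (1+B-E) (1+C-E) (2-E))" using G1(1) by (simp add: sums_iff)
    qed (use Cx x BCE in auto)
    moreover have "-(1 + C - E) = E - C - 1" by simp
    ultimately show "(E - C - 1) * (\<Sum>n. Gauss_coeff (1+B-E) (1+(C+1)-E) (2-E) n / (x + 1 - E + real n)) / (x - C) =
       (\<Sum>n. Gauss_coeff (1+B-E) (1+C-E) (2-E) n / (x + 1 - E + real n)) - (\<Sum>n. Gauss_coeff (1+B-E) (1+C-E) (2-E) n) / (x - C)"
      unfolding e(1) by (simp only:)
  qed
  define s0 where "s0 = (\<Sum>n. Gauss_coeff B (C+1) E n / (x + real n))"
  define s1 where "s1 = (\<Sum>n. Gauss_coeff (1+B-E) (1+(C+1)-E) (2-E) n / (x + 1 - E + real n))"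
  have r: "rGamma (x + 1 - (C + 1)) = (x - C) * rGamma (x + 1 - C)" "rGamma (1 - (C + 1)) = (-C) * rGamma (1 - C)"
    "rGamma (E - (C + 1)) = (E - C - 1) * rGamma (E - C)"
    using rGamma_plus1[of "x - C"] rGamma_plus1[of "-C"] rGamma_plus1[of "E - C - 1"] by (simp_all add: algebra_simps)
  have "Gamma x * Gamma (x + 1 - E) * rGamma (x + 1 - B) * ((x - C) * rGamma (x + 1 - C)) * sin (pi * E) / pi =
      rGamma (1-B) * ((-C) * rGamma (1 - C)) * s0 - rGamma (E-B) * ((E - C - 1) * rGamma (E - C)) * s1"
    using PF(3) BCE x unfolding r s0_def s1_def by simp
  hence "Gamma x * Gamma (x + 1 - E) * rGamma (x + 1 - B) * rGamma (x + 1 - C) * sin (pi * E) / pi =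
      rGamma (1-B) * rGamma (1 - C) * ((-C) * s0 / (x - C)) - rGamma (E-B) * rGamma (E - C) * ((E - C - 1) * s1 / (x - C))"
  proof -
    have alg: "g1 * g2 * g3 * g4 * s / pi = a * b * (u * t0 / d) - c * e * (v * t1 / d)"
      if "g1 * g2 * g3 * (d * g4) * s / pi = a * (u * b) * t0 - c * (v * e) * t1" "d \<noteq> 0"
      for g1 g2 g3 g4 s a b c d e u v t0 t1 :: real
    proof -
      have "g1 * g2 * g3 * g4 * s / pi = (g1 * g2 * g3 * (d * g4) * s / pi) / d" using that(2) by simp
      also have "\<dots> = a * b * (u * t0 / d) - c * e * (v * t1 / d)" unfolding that(1) by (simp add: diff_divide_distrib mult_ac)
      finally show ?thesis .
    qed
    assume *: "Gamma x * Gamma (x + 1 - E) * rGamma (x + 1 - B) * ((x - C) * rGamma (x + 1 - C)) * sin (pi * E) / pi =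
      rGamma (1-B) * ((-C) * rGamma (1 - C)) * s0 - rGamma (E-B) * ((E - C - 1) * rGamma (E - C)) * s1"
    show ?thesis by (rule alg[OF *]) (use Cx in auto)
  qed
  \<comment> \<open>The pole at \<open>x = C\<close> disappears: by Gauss both coefficient sums are
    \<open>Gamma (E-B-C)\<close> times two reciprocal Gammas, and with their prefactors they become
    equal.\<close>
  also have "\<dots> = rGamma (1-B) * rGamma (1-C) * (\<Sum>n. Gauss_coeff B C E n / (x + real n)) -
      rGamma (E-B) * rGamma (E-C) * (\<Sum>n. Gauss_coeff (1+B-E) (1+C-E) (2-E) n / (x + 1 - E + real n))"
    unfolding s0_def s1_def S0 S1 using G0(1) G1(1) by (simp add: sums_iff right_diff_distrib)
  finally show ?t3 .
qed


lemma Gauss_coeff_nonneg: "B > 0 \<Longrightarrow> C > 0 \<Longrightarrow> E > 0 \<Longrightarrow> Gauss_coeff B C E n \<ge> 0"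
  by (auto simp: Gauss_coeff_def rGamma_real_eq intro!: divide_nonneg_nonneg mult_nonneg_nonneg pochhammer_nonneg)

text \<open>The bound \<open>q n / (x + n) * \<bar>p m\<bar>\<close> is a product, so
  \<open>dominated_suminf_swap\<close> applies. It lets the denominator help the convergence in
  \<open>n\<close>, while absolute summability is asked of \<open>p\<close> alone.\<close>

lemma kernel_swap:
  fixes q p :: "nat \<Rightarrow> real"
  assumes q: "\<And>n. q n \<ge> 0" "summable (\<lambda>n. q n / (x + real n))" and p: "summable (\<lambda>m. \<bar>p m\<bar>)" and x: "x > 0"
  shows "(\<Sum>n. q n * (\<Sum>m. p m / (x + real n + real m))) = (\<Sum>m. p m * (\<Sum>n. q n / (x + real m + real n)))"
    and "summable (\<lambda>n. q n * (\<Sum>m. p m / (x + real n + real m)))"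
    and "summable (\<lambda>m. p m * (\<Sum>n. q n / (x + real m + real n)))"
proof -
  define f where "f = (\<lambda>n m. q n * p m / (x + real n + real m))"
  have bd: "\<bar>f n m\<bar> \<le> q n / (x + real n) * \<bar>p m\<bar>" for n m
  proof -
    have "\<bar>f n m\<bar> = q n * \<bar>p m\<bar> / (x + real n + real m)"
      using x q by (simp add: f_def abs_mult)
    also have "\<dots> \<le> q n * \<bar>p m\<bar> / (x + real n)"
      using x q by (intro divide_left_mono mult_nonneg_nonneg mult_pos_pos) auto
    finally show ?thesis by simp
  qed
  have "q n / (x + real n) \<ge> 0" for n using q x by (intro divide_nonneg_nonneg) auto
  note sw = dominated_suminf_swap[OF bd q(2) p this abs_ge_zero]
  have ps: "summable (\<lambda>m. p m / (x + real n + real m))" for n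
  proof (rule summable_comparison_test')
    show "summable (\<lambda>m. \<bar>p m\<bar> / x)" by (intro summable_divide p)
    show "norm (p m / (x + real n + real m)) \<le> \<bar>p m\<bar> / x" for m
      using x by (auto intro!: divide_left_mono)
  qed
  have qs: "summable (\<lambda>n. q n / (x + real m + real n))" for m
  proof (rule summable_comparison_test'[OF q(2)])
    show "norm (q n / (x + real m + real n)) \<le> q n / (x + real n)" for n
      using x q(1)[of n] by (auto intro!: divide_left_mono)
  qed
  have 1: "(\<Sum>m. f n m) = q n * (\<Sum>m. p m / (x + real n + real m))" for n
    using suminf_mult[OF ps, of "q n" n] by (simp add: f_def)
  have 2: "(\<Sum>n. f n m) = p m * (\<Sum>n. q n / (x + real m + real n))" for m
    using suminf_mult[OF qs, of "p m" m] by (simp add: f_def mult_ac add_ac)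
  show "(\<Sum>n. q n * (\<Sum>m. p m / (x + real n + real m))) = (\<Sum>m. p m * (\<Sum>n. q n / (x + real m + real n)))"
    "summable (\<lambda>n. q n * (\<Sum>m. p m / (x + real n + real m)))"
    "summable (\<lambda>m. p m * (\<Sum>n. q n / (x + real m + real n)))"
    using sw unfolding 1 2 by (auto simp: sums_iff)
qed

text \<open>Each of \<open>P1\<close>, \<open>P2\<close> is a combination of two partial fraction series, with poles at \<open>- n\<close>, \<open>E - 1 - n\<close> and \<open>- A - m\<close>, \<open>- D - m\<close> respectively. Both
  sides of the last identity are the resulting double sum over \<open>n\<close> and \<open>m\<close>, summed in the two possible orders.\<close>

lemma four_term_real:
  fixes A B C D E F G :: real
  assumes pos: "A > 0" "A < D" "D < A + 1" and BCE: "B < E" "C < E" "E < 1" "B + C > E" "B > 0" "C > 0"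
    and FG: "F > D" "G > D + 1" "F < A + 1" "G < A + 2" and S: "E + F + G - A - B - C - D = 1"
  defines "P1 \<equiv> \<lambda>t. Gamma t * Gamma (t + 1 - E) * rGamma (t + 1 - B) * rGamma (t + 1 - C)"
    and "P2 \<equiv> \<lambda>s. Gamma (A + s) * Gamma (D + s) * rGamma (F + s) * rGamma (G + s)"
    and "q0 \<equiv> Gauss_coeff B C E" and "q1 \<equiv> Gauss_coeff (1+B-E) (1+C-E) (2-E)"
    and "p0 \<equiv> Gauss_coeff (1+A-F) (1+A-G) (1+A-D)" and "p1 \<equiv> Gauss_coeff (1+D-F) (1+D-G) (1+D-A)"
  shows "summable (\<lambda>n. q0 n * P2 (real n))" "summable (\<lambda>n. q1 n * P2 (1 - E + real n))"
    "summable (\<lambda>m. p0 m * P1 (A + real m))" "summable (\<lambda>m. p1 m * P1 (D + real m))"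
    "sin (pi * (D - A)) * (rGamma (1-B) * rGamma (1-C) * (\<Sum>n. q0 n * P2 (real n)) - rGamma (E-B) * rGamma (E-C) * (\<Sum>n. q1 n * P2 (1 - E + real n))) =
     sin (pi * E) * (rGamma (F-A) * rGamma (G-A) * (\<Sum>m. p0 m * P1 (A + real m)) - rGamma (F-D) * rGamma (G-D) * (\<Sum>m. p1 m * P1 (D + real m)))"
proof -
  have E: "E > 0" using BCE by linarith
  have E2: "1 + A - D > 0" "1 + A - D < 1" using pos by auto
  define W0 W1 V0 V1 where "W0 = rGamma (1-B) * rGamma (1-C)" and "W1 = rGamma (E-B) * rGamma (E-C)"
    and "V0 = rGamma (F-A) * rGamma (G-A)" and "V1 = rGamma (F-D) * rGamma (G-D)"
  have q0: "q0 n \<ge> 0" and q1: "q1 n \<ge> 0" for n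
    unfolding q0_def q1_def by (rule Gauss_coeff_nonneg; use BCE E in simp)+
  have PF1: "P1 t * sin (pi * E) / pi = W0 * (\<Sum>n. q0 n / (t + real n)) - W1 * (\<Sum>n. q1 n / (t + 1 - E + real n))"
     "summable (\<lambda>n. q0 n / (t + real n))" "summable (\<lambda>n. q1 n / (t + 1 - E + real n))" if "t > 0" for t
    unfolding P1_def q0_def q1_def W0_def W1_def using Gamma_ratio_partial_fractions[OF BCE(1-4) that] by auto
  have ps: "summable (\<lambda>m. \<bar>p0 m\<bar>)" "summable (\<lambda>m. \<bar>p1 m\<bar>)"
    and PF2: "\<And>s. s \<ge> 0 \<Longrightarrow> P2 s * sin (pi * (D - A)) / pi = V0 * (\<Sum>m. p0 m / (A + s + real m)) - V1 * (\<Sum>m. p1 m / (D + s + real m))"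
  proof -
    have sn: "sin (pi * (1 + A - D)) = sin (pi * (D - A))"
      using sin_pi_minus[of "pi * (D - A)"] by (simp add: algebra_simps)
    have eqs: "1 + (1 + A - F) - (1 + A - D) = 1 + D - F" "1 + (1 + A - G) - (1 + A - D) = 1 + D - G" "2 - (1 + A - D) = 1 + D - A"
      "1 - (1 + A - F) = F - A" "1 - (1 + A - G) = G - A" "1 + A - D - (1 + A - F) = F - D" "1 + A - D - (1 + A - G) = G - D" by auto
    have eqx: "x + 1 - (1 + A - F) = F + (x - A)" "x + 1 - (1 + A - G) = G + (x - A)" "x + 1 - (1 + A - D) = D + (x - A)" for x by auto
    \<comment> \<open>\<open>P2 s\<close> is a Gamma quotient of the same shape at
      \<open>x = A + s\<close>, with \<open>1+A-F\<close>, \<open>1+A-G\<close>,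
      \<open>1+A-D\<close> in the places of \<open>B\<close>, \<open>C\<close>, \<open>E\<close>.
      Since \<open>G > D + 1\<close>, the shifted version of the expansion is the one that
      applies.\<close>
    note PF = Gamma_ratio_partial_fractions2[of "1+A-F" "1+A-D" "1+A-G", unfolded eqs eqx sn]
    have cond: "1+A-F < 1+A-D" "1+A-G < 1+A-D-1" "1+A-D < 1" "1+A-F + (1+A-G) > 1+A-D-1" "1+A-F + (1+A-G) < 1+A-D" "1+A-F > 0" "-1 < 1+A-G"
      using pos BCE FG S by auto
    show "summable (\<lambda>m. \<bar>p0 m\<bar>)" "summable (\<lambda>m. \<bar>p1 m\<bar>)"
      unfolding p0_def p1_def using PF(1,2)[OF cond(1-4) zero_less_one cond(5-7)] by auto
    fix s :: real assume "s \<ge> 0"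
    hence "A + s > 0" using pos by simp
    from PF(3)[OF cond(1-4) this cond(5-7)]
    show "P2 s * sin (pi * (D - A)) / pi = V0 * (\<Sum>m. p0 m / (A + s + real m)) - V1 * (\<Sum>m. p1 m / (D + s + real m))"
      unfolding P2_def V0_def V1_def p0_def p1_def by (simp add: add_ac)
  qed
  \<comment> \<open>The four double sums pair each coefficient sequence of \<open>P1\<close> with
    each of \<open>P2\<close>. Every side of the relation is a combination of all four.\<close>
  define S00 where "S00 = (\<Sum>n. q0 n * (\<Sum>m. p0 m / (A + real n + real m)))"
  define S01 where "S01 = (\<Sum>n. q0 n * (\<Sum>m. p1 m / (D + real n + real m)))"
  define S10 where "S10 = (\<Sum>n. q1 n * (\<Sum>m. p0 m / (A + 1 - E + real n + real m)))"
  define S11 where "S11 = (\<Sum>n. q1 n * (\<Sum>m. p1 m / (D + 1 - E + real n + real m)))"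
  have D: "D > 0" "A + 1 - E > 0" "D + 1 - E > 0" using pos BCE by auto
  note K00 = kernel_swap[of q0 A p0, OF q0 PF1(2) ps(1), folded S00_def, OF pos(1) pos(1)]
  note K01 = kernel_swap[of q0 D p1, OF q0 PF1(2) ps(2), folded S01_def, OF D(1) D(1)]
  note K10 = kernel_swap[of q1 "A + 1 - E" p0, OF q1 PF1(3) ps(1), folded S10_def, OF pos(1) D(2)]
  note K11 = kernel_swap[of q1 "D + 1 - E" p1, OF q1 PF1(3) ps(2), folded S11_def, OF D(1) D(3)]
  have spi: "sin (pi * E) > 0" "sin (pi * (D - A)) > 0"
    using E BCE pos by (auto intro!: sin_pi_pos)
  have alg: "q * (c * (v * s - w * t)) = c * (v * (q * s) - w * (q * t))" for q c v s w t :: real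
    by (simp add: algebra_simps)
  have L0: "(\<lambda>n. q0 n * P2 (real n)) sums (pi / sin (pi * (D - A)) * (V0 * S00 - V1 * S01))"
  proof -
    have "q0 n * P2 (real n) = pi / sin (pi * (D - A)) * (V0 * (q0 n * (\<Sum>m. p0 m / (A + real n + real m))) - V1 * (q0 n * (\<Sum>m. p1 m / (D + real n + real m))))" for n
    proof -
      have "P2 (real n) = pi / sin (pi * (D - A)) * (P2 (real n) * sin (pi * (D - A)) / pi)" using spi by simp
      also have "P2 (real n) * sin (pi * (D - A)) / pi = V0 * (\<Sum>m. p0 m / (A + real n + real m)) - V1 * (\<Sum>m. p1 m / (D + real n + real m))"
        by (rule PF2) simp
      finally have e: "P2 (real n) = pi / sin (pi * (D - A)) * (V0 * (\<Sum>m. p0 m / (A + real n + real m)) - V1 * (\<Sum>m. p1 m / (D + real n + real m)))" .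
      show ?thesis unfolding e by (rule alg)
    qed
    moreover have "(\<lambda>n. pi / sin (pi * (D - A)) * (V0 * (q0 n * (\<Sum>m. p0 m / (A + real n + real m))) - V1 * (q0 n * (\<Sum>m. p1 m / (D + real n + real m))))) sums
        (pi / sin (pi * (D - A)) * (V0 * S00 - V1 * S01))"
      unfolding S00_def S01_def by (intro sums_mult sums_diff summable_sums K00(2) K01(2))
    ultimately show ?thesis by simp
  qed
  have L1: "(\<lambda>n. q1 n * P2 (1 - E + real n)) sums (pi / sin (pi * (D - A)) * (V0 * S10 - V1 * S11))"
  proof -
    have "q1 n * P2 (1 - E + real n) = pi / sin (pi * (D - A)) * (V0 * (q1 n * (\<Sum>m. p0 m / (A + 1 - E + real n + real m))) - V1 * (q1 n * (\<Sum>m. p1 m / (D + 1 - E + real n + real m))))" for n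
    proof -
      have "P2 (1 - E + real n) = pi / sin (pi * (D - A)) * (P2 (1 - E + real n) * sin (pi * (D - A)) / pi)" using spi by simp
      also have "P2 (1 - E + real n) * sin (pi * (D - A)) / pi = V0 * (\<Sum>m. p0 m / (A + 1 - E + real n + real m)) - V1 * (\<Sum>m. p1 m / (D + 1 - E + real n + real m))"
        using PF2[of "1 - E + real n"] BCE by (simp add: algebra_simps)
      finally have e: "P2 (1 - E + real n) = pi / sin (pi * (D - A)) * (V0 * (\<Sum>m. p0 m / (A + 1 - E + real n + real m)) - V1 * (\<Sum>m. p1 m / (D + 1 - E + real n + real m)))" .
      show ?thesis unfolding e by (rule alg)
    qed
    moreover have "(\<lambda>n. pi / sin (pi * (D - A)) * (V0 * (q1 n * (\<Sum>m. p0 m / (A + 1 - E + real n + real m))) - V1 * (q1 n * (\<Sum>m. p1 m / (D + 1 - E + real n + real m))))) sums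
        (pi / sin (pi * (D - A)) * (V0 * S10 - V1 * S11))"
      unfolding S10_def S11_def by (intro sums_mult sums_diff summable_sums K10(2) K11(2))
    ultimately show ?thesis by simp
  qed
  have R: "(\<lambda>m. p m * P1 (X + real m)) sums (pi / sin (pi * E) * (W0 * (\<Sum>m. p m * (\<Sum>n. q0 n / (X + real m + real n))) - W1 * (\<Sum>m. p m * (\<Sum>n. q1 n / (X + 1 - E + real m + real n)))))"
    if X: "X > 0" and sm: "summable (\<lambda>m. p m * (\<Sum>n. q0 n / (X + real m + real n)))" "summable (\<lambda>m. p m * (\<Sum>n. q1 n / (X + 1 - E + real m + real n)))" for p X
  proof -
    have "p m * P1 (X + real m) = pi / sin (pi * E) * (W0 * (p m * (\<Sum>n. q0 n / (X + real m + real n))) - W1 * (p m * (\<Sum>n. q1 n / (X + 1 - E + real m + real n))))" for m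
    proof -
      have "P1 (X + real m) = pi / sin (pi * E) * (P1 (X + real m) * sin (pi * E) / pi)" using spi by simp
      also have "P1 (X + real m) * sin (pi * E) / pi = W0 * (\<Sum>n. q0 n / (X + real m + real n)) - W1 * (\<Sum>n. q1 n / (X + 1 - E + real m + real n))"
        using PF1(1)[of "X + real m"] X by (simp add: algebra_simps)
      finally have e: "P1 (X + real m) = pi / sin (pi * E) * (W0 * (\<Sum>n. q0 n / (X + real m + real n)) - W1 * (\<Sum>n. q1 n / (X + 1 - E + real m + real n)))" .
      show ?thesis unfolding e by (rule alg)
    qed
    moreover have "(\<lambda>m. pi / sin (pi * E) * (W0 * (p m * (\<Sum>n. q0 n / (X + real m + real n))) - W1 * (p m * (\<Sum>n. q1 n / (X + 1 - E + real m + real n))))) sums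
       (pi / sin (pi * E) * (W0 * (\<Sum>m. p m * (\<Sum>n. q0 n / (X + real m + real n))) - W1 * (\<Sum>m. p m * (\<Sum>n. q1 n / (X + 1 - E + real m + real n)))))"
      by (intro sums_mult sums_diff summable_sums sm)
    ultimately show ?thesis by simp
  qed
  have R0: "(\<lambda>m. p0 m * P1 (A + real m)) sums (pi / sin (pi * E) * (W0 * S00 - W1 * S10))"
    using R[OF pos(1) K00(3) K10(3)] unfolding K00(1) K10(1) .
  have R1: "(\<lambda>m. p1 m * P1 (D + real m)) sums (pi / sin (pi * E) * (W0 * S01 - W1 * S11))"
    using R[OF D(1) K01(3) K11(3)] unfolding K01(1) K11(1) .
  show "summable (\<lambda>n. q0 n * P2 (real n))" "summable (\<lambda>n. q1 n * P2 (1 - E + real n))"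
    "summable (\<lambda>m. p0 m * P1 (A + real m))" "summable (\<lambda>m. p1 m * P1 (D + real m))"
    using L0 L1 R0 R1 by (auto simp: sums_iff)
  have "sin (pi * (D - A)) * (W0 * (\<Sum>n. q0 n * P2 (real n)) - W1 * (\<Sum>n. q1 n * P2 (1 - E + real n))) =
      pi * (W0 * (V0 * S00 - V1 * S01) - W1 * (V0 * S10 - V1 * S11))"
    using L0 L1 spi by (simp add: sums_iff right_diff_distrib)
  also have "\<dots> = pi * (V0 * (W0 * S00 - W1 * S10) - V1 * (W0 * S01 - W1 * S11))"
    by (simp add: algebra_simps)
  also have "\<dots> = sin (pi * E) * (V0 * (\<Sum>m. p0 m * P1 (A + real m)) - V1 * (\<Sum>m. p1 m * P1 (D + real m)))"
    using R0 R1 spi by (simp add: sums_iff right_diff_distrib)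
  finally show "sin (pi * (D - A)) * (rGamma (1-B) * rGamma (1-C) * (\<Sum>n. q0 n * P2 (real n)) - rGamma (E-B) * rGamma (E-C) * (\<Sum>n. q1 n * P2 (1 - E + real n))) =
     sin (pi * E) * (rGamma (F-A) * rGamma (G-A) * (\<Sum>m. p0 m * P1 (A + real m)) - rGamma (F-D) * rGamma (G-D) * (\<Sum>m. p1 m * P1 (D + real m)))"
    by (simp add: W0_def W1_def V0_def V1_def)
qed

section \<open>Analytic continuation\<close>

lemma norm_one_plus_le: "norm (1 + w :: complex) \<le> exp (Re w + (norm w)\<^sup>2 / 2)"
proof -
  have "(norm (1 + w))\<^sup>2 = 1 + (2 * Re w + (norm w)\<^sup>2)"
    unfolding cmod_power2 by (simp add: power2_eq_square algebra_simps)
  also have "\<dots> \<le> exp (2 * Re w + (norm w)\<^sup>2)" by (rule exp_ge_add_one_self)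
  also have "\<dots> = (exp (Re w + (norm w)\<^sup>2 / 2))\<^sup>2" by (simp add: exp_double[symmetric] algebra_simps)
  finally show ?thesis by (rule power2_le_imp_le) simp
qed

lemma norm_inverse_one_plus_le:
  assumes w: "norm (w::complex) \<le> 1 / 2"
  shows "norm (inverse (1 + w)) \<le> exp (- Re w + 4 * (norm w)\<^sup>2)"
proof -
  have "1 - norm w \<le> norm (1 + w)" using norm_triangle_ineq2[of 1 "-w"] by simp
  hence n: "norm (1 + w) \<ge> 1 / 2" using w by linarith
  hence nz: "1 + w \<noteq> 0" by auto
  define v where "v = w\<^sup>2 / (1 + w)"
  have "norm v = (norm w)\<^sup>2 / norm (1 + w)" by (simp add: v_def norm_divide norm_power)
  also have "\<dots> \<le> (norm w)\<^sup>2 / (1 / 2)" using n by (intro divide_left_mono) auto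
  finally have v: "norm v \<le> 2 * (norm w)\<^sup>2" by simp
  have "2 * (norm w)\<^sup>2 \<le> norm w" using w mult_right_mono[of "norm w" "1/2" "norm w"] by (simp add: power2_eq_square)
  hence "norm (- w + v) \<le> 2 * norm w" using norm_triangle_ineq[of "-w" v] v by simp
  hence sq: "(norm (- w + v))\<^sup>2 \<le> 4 * (norm w)\<^sup>2" using power_mono[of "norm (- w + v)" "2 * norm w" 2] by (simp add: power_mult_distrib)
  have "inverse (1 + w) = 1 + (- w + v)" using nz unfolding v_def by (simp add: field_simps power2_eq_square)
  hence "norm (inverse (1 + w)) \<le> exp (Re (- w + v) + (norm (- w + v))\<^sup>2 / 2)" by (metis norm_one_plus_le)
  also have "Re (- w + v) + (norm (- w + v))\<^sup>2 / 2 \<le> - Re w + 4 * (norm w)\<^sup>2"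
    using sq v complex_Re_le_cmod[of v] by simp
  finally show ?thesis by simp
qed

definition F43t :: "complex \<Rightarrow> complex \<Rightarrow> complex \<Rightarrow> complex \<Rightarrow> complex \<Rightarrow> complex \<Rightarrow> complex \<Rightarrow> nat \<Rightarrow> complex" where
  "F43t a1 a2 a3 a4 b1 b2 b3 n = pochhammer a1 n * pochhammer a2 n * pochhammer a3 n * pochhammer a4 n
       * rGamma (b1 + of_nat n) * rGamma (b2 + of_nat n) * rGamma (b3 + of_nat n) / fact n"

text \<open>The term ratio has eight factors, each bounded by an exponential that is exact to first
  order in \<open>1 / n\<close>. By the Saalschuetzian condition the first order parts add up to
  \<open>-2 / n\<close>. The errors total \<open>18 = 4 * (1/2) + 4 * 4\<close> times
  \<open>M\<^sup>2 / n\<^sup>2\<close>, which the lower bound on \<open>n\<close> makes at most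
  \<open>1 / (2 n)\<close>; the exponent \<open>-3/2\<close> still gives convergence.\<close>

lemma F43t_ratio:
  assumes M: "M \<ge> 1" and bd: "norm a1 \<le> M" "norm a2 \<le> M" "norm a3 \<le> M" "norm a4 \<le> M" "norm b1 \<le> M" "norm b2 \<le> M" "norm b3 \<le> M"
    and S: "b1 + b2 + b3 - a1 - a2 - a3 - a4 = 1" and n: "real n \<ge> 36 * M\<^sup>2"
  shows "norm (F43t a1 a2 a3 a4 b1 b2 b3 (Suc n)) \<le> norm (F43t a1 a2 a3 a4 b1 b2 b3 n) * exp (- (3/2) / real n)"
proof -
  have MM: "M \<le> M\<^sup>2" using M by (simp add: power2_eq_square)
  have n0: "real n > 0" "real n \<ge> 2 * M" using n M MM by linarith+
  have small: "norm (z / of_nat n) \<le> 1/2" "norm (z / of_nat n) \<le> M / real n" if "norm z \<le> M" for z :: complex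
    using that n0 by (simp_all add: norm_divide divide_simps)
  have sq: "(norm (z / of_nat n))\<^sup>2 \<le> M\<^sup>2 / (real n)\<^sup>2" if "norm z \<le> M" for z :: complex
    using power_mono[OF small(2)[OF that], of 2] by (simp add: power_divide)
  have up: "norm (z + of_nat n) \<le> real n * exp (Re z / real n + M\<^sup>2 / (real n)\<^sup>2 / 2)" if "norm z \<le> M" for z :: complex
  proof -
    have "z + of_nat n = of_nat n * (1 + z / of_nat n)" using n0 by (simp add: field_simps)
    hence "norm (z + of_nat n) = real n * norm (1 + z / of_nat n)" by (simp add: norm_mult)
    also have "norm (1 + z / of_nat n) \<le> exp (Re (z / of_nat n) + (norm (z / of_nat n))\<^sup>2 / 2)" by (rule norm_one_plus_le)
    also have "\<dots> \<le> exp (Re z / real n + M\<^sup>2 / (real n)\<^sup>2 / 2)" using sq[OF that] by (simp add: Re_divide_of_nat)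
    finally show ?thesis using n0 by simp
  qed
  have dn: "norm (rGamma (z + of_nat (Suc n))) \<le> norm (rGamma (z + of_nat n)) * (exp (- Re z / real n + 4 * (M\<^sup>2 / (real n)\<^sup>2)) / real n)" if "norm z \<le> M" for z :: complex
  proof -
    have e: "z + of_nat n = of_nat n * (1 + z / of_nat n)" using n0 by (simp add: field_simps)
    have nz: "1 + z / of_nat n \<noteq> 0"
    proof
      assume "1 + z / of_nat n = 0"
      hence "z / of_nat n = -1" by (simp add: eq_neg_iff_add_eq_0 add.commute)
      thus False using small(1)[OF that] by simp
    qed
    have "rGamma (z + of_nat n) = (z + of_nat n) * rGamma (z + of_nat (Suc n))"
      using rGamma_plus1[of "z + of_nat n"] by (simp add: add_ac)
    moreover have "(z + of_nat n) * X * (inverse (1 + z / of_nat n) / of_nat n) = X" for X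
      unfolding e using nz n0 by simp
    ultimately have "rGamma (z + of_nat (Suc n)) = rGamma (z + of_nat n) * (inverse (1 + z / of_nat n) / of_nat n)"
      by (simp only:)
    hence "norm (rGamma (z + of_nat (Suc n))) = norm (rGamma (z + of_nat n)) * (norm (inverse (1 + z / of_nat n)) / real n)"
      by (simp add: norm_mult norm_divide norm_inverse)
    also have "\<dots> \<le> norm (rGamma (z + of_nat n)) * (exp (- Re z / real n + 4 * (M\<^sup>2 / (real n)\<^sup>2)) / real n)"
    proof (intro mult_left_mono divide_right_mono)
      have "norm (inverse (1 + z / of_nat n)) \<le> exp (- Re (z / of_nat n) + 4 * (norm (z / of_nat n))\<^sup>2)"
        by (rule norm_inverse_one_plus_le[OF small(1)[OF that]])
      also have "\<dots> \<le> exp (- Re z / real n + 4 * (M\<^sup>2 / (real n)\<^sup>2))" using sq[OF that] by (simp add: Re_divide_of_nat)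
      finally show "norm (inverse (1 + z / of_nat n)) \<le> exp (- Re z / real n + 4 * (M\<^sup>2 / (real n)\<^sup>2))" .
    qed auto
    finally show ?thesis .
  qed
  have one: "1 / (1 + real n) \<le> exp (- 1 / real n + 4 * (M\<^sup>2 / (real n)\<^sup>2)) / real n"
  proof -
    have "norm (inverse (1 + 1 / of_nat n :: complex)) \<le> exp (- Re (1 / of_nat n) + 4 * (norm (1 / of_nat n :: complex))\<^sup>2)"
      using small(1)[of 1] M by (intro norm_inverse_one_plus_le) auto
    also have "\<dots> \<le> exp (- 1 / real n + 4 * (M\<^sup>2 / (real n)\<^sup>2))" using sq[of 1] M by (simp add: Re_divide_of_nat)
    also have "norm (inverse (1 + 1 / of_nat n :: complex)) = real n / (1 + real n)"
    proof -
      have "inverse (1 + 1 / of_nat n :: complex) = of_real (real n / (1 + real n))" using n0 by (simp add: field_simps)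
      thus ?thesis using n0 by (simp only: norm_of_real) simp
    qed
    finally show ?thesis using n0 by (simp add: field_simps)
  qed
  define R where "R = (\<lambda>z. Re z / real n)"
  define Q where "Q = M\<^sup>2 / (real n)\<^sup>2"
  have "F43t a1 a2 a3 a4 b1 b2 b3 (Suc n) = (pochhammer a1 n * pochhammer a2 n * pochhammer a3 n * pochhammer a4 n / fact n) *
      ((a1 + of_nat n) * (a2 + of_nat n) * (a3 + of_nat n) * (a4 + of_nat n)) *
      (rGamma (b1 + of_nat (Suc n)) * rGamma (b2 + of_nat (Suc n)) * rGamma (b3 + of_nat (Suc n))) * (1 / (1 + of_nat n))"
    unfolding F43t_def pochhammer_Suc by (simp add: mult_ac)
  hence "norm (F43t a1 a2 a3 a4 b1 b2 b3 (Suc n)) = norm (pochhammer a1 n * pochhammer a2 n * pochhammer a3 n * pochhammer a4 n / fact n) *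
      (norm (a1 + of_nat n) * norm (a2 + of_nat n) * norm (a3 + of_nat n) * norm (a4 + of_nat n)) *
      (norm (rGamma (b1 + of_nat (Suc n))) * norm (rGamma (b2 + of_nat (Suc n))) * norm (rGamma (b3 + of_nat (Suc n)))) * norm (1 / (1 + of_nat n) :: complex)"
    by (simp only: norm_mult)
  also have "norm (1 / (1 + of_nat n) :: complex) = 1 / (1 + real n)"
    using norm_of_nat[of "Suc n", where ?'a = complex] by (simp add: norm_divide)
  also have "norm (pochhammer a1 n * pochhammer a2 n * pochhammer a3 n * pochhammer a4 n / fact n) *
      (norm (a1 + of_nat n) * norm (a2 + of_nat n) * norm (a3 + of_nat n) * norm (a4 + of_nat n)) *
      (norm (rGamma (b1 + of_nat (Suc n))) * norm (rGamma (b2 + of_nat (Suc n))) * norm (rGamma (b3 + of_nat (Suc n)))) * (1 / (1 + real n)) \<le>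
     norm (pochhammer a1 n * pochhammer a2 n * pochhammer a3 n * pochhammer a4 n / fact n) *
      ((real n * exp (R a1 + Q / 2)) * (real n * exp (R a2 + Q / 2)) * (real n * exp (R a3 + Q / 2)) * (real n * exp (R a4 + Q / 2))) *
      ((norm (rGamma (b1 + of_nat n)) * (exp (- R b1 + 4 * Q) / real n)) * (norm (rGamma (b2 + of_nat n)) * (exp (- R b2 + 4 * Q) / real n)) * (norm (rGamma (b3 + of_nat n)) * (exp (- R b3 + 4 * Q) / real n))) *
      (exp (- 1 / real n + 4 * Q) / real n)"
    using up[OF bd(1)] up[OF bd(2)] up[OF bd(3)] up[OF bd(4)] dn[OF bd(5)] dn[OF bd(6)] dn[OF bd(7)] one n0
    unfolding R_def Q_def by (intro mult_mono) (auto intro!: mult_nonneg_nonneg)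
  also have "\<dots> = norm (F43t a1 a2 a3 a4 b1 b2 b3 n) * (exp (R a1 + Q / 2) * exp (R a2 + Q / 2) * exp (R a3 + Q / 2) * exp (R a4 + Q / 2)
       * exp (- R b1 + 4 * Q) * exp (- R b2 + 4 * Q) * exp (- R b3 + 4 * Q) * exp (- 1 / real n + 4 * Q))"
    unfolding F43t_def using n0 by (simp add: norm_mult norm_divide field_simps)
  also have "exp (R a1 + Q / 2) * exp (R a2 + Q / 2) * exp (R a3 + Q / 2) * exp (R a4 + Q / 2)
       * exp (- R b1 + 4 * Q) * exp (- R b2 + 4 * Q) * exp (- R b3 + 4 * Q) * exp (- 1 / real n + 4 * Q)
     = exp ((R a1 + R a2 + R a3 + R a4 - R b1 - R b2 - R b3) - 1 / real n + 18 * Q)"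
    unfolding exp_add[symmetric] by (simp add: algebra_simps)
  also have "R a1 + R a2 + R a3 + R a4 - R b1 - R b2 - R b3 = - 1 / real n"
  proof -
    have "R a1 + R a2 + R a3 + R a4 - R b1 - R b2 - R b3 = - Re (b1 + b2 + b3 - a1 - a2 - a3 - a4) / real n"
      unfolding R_def by (simp add: diff_divide_distrib add_divide_distrib)
    thus ?thesis unfolding S by simp
  qed
  also have "- 1 / real n - 1 / real n + 18 * Q \<le> - (3/2) / real n"
  proof -
    have "18 * Q = (18 * M\<^sup>2 / real n) / real n" unfolding Q_def by (simp add: power2_eq_square)
    also have "\<dots> \<le> (1/2) / real n" using n n0 by (intro divide_right_mono) (auto simp: divide_simps)
    finally show ?thesis by (simp add: divide_simps split: if_splits)
  qed
  hence "norm (F43t a1 a2 a3 a4 b1 b2 b3 n) * exp (- 1 / real n - 1 / real n + 18 * Q) \<le> norm (F43t a1 a2 a3 a4 b1 b2 b3 n) * exp (- (3/2) / real n)"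
    by (intro mult_left_mono) auto
  finally show ?thesis .
qed

text \<open>The cutoff \<open>N\<close> depends on the parameters only through the bound
  \<open>M\<close>; this uniformity is what the Weierstrass test needs.\<close>

lemma F43t_bound:
  assumes M: "M \<ge> 1" and bd: "norm a1 \<le> M" "norm a2 \<le> M" "norm a3 \<le> M" "norm a4 \<le> M" "norm b1 \<le> M" "norm b2 \<le> M" "norm b3 \<le> M"
    and S: "b1 + b2 + b3 - a1 - a2 - a3 - a4 = 1" and N: "real N \<ge> 36 * M\<^sup>2" and n: "n \<ge> N"
  shows "norm (F43t a1 a2 a3 a4 b1 b2 b3 n) \<le> norm (F43t a1 a2 a3 a4 b1 b2 b3 N) * real N powr (3/2) * real n powr -(3/2)"
  using n
proof (induction n rule: dec_induct)
  case base
  have "M\<^sup>2 \<ge> 1" using M by (simp add: one_le_power)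
  hence "real N > 0" using N by linarith
  hence "real N powr (3/2) * real N powr -(3/2) = 1" by (simp add: powr_minus)
  thus ?case by (simp add: mult.assoc)
next
  case (step n)
  have M2: "M\<^sup>2 \<ge> 1" using M by (simp add: one_le_power)
  have n: "real n \<ge> 36 * M\<^sup>2" using N step by linarith
  hence n0: "real n > 0" using M2 by linarith
  have "norm (F43t a1 a2 a3 a4 b1 b2 b3 (Suc n)) \<le> norm (F43t a1 a2 a3 a4 b1 b2 b3 n) * exp (- (3/2) / real n)"
    by (rule F43t_ratio[OF M bd S n])
  also have "\<dots> \<le> (norm (F43t a1 a2 a3 a4 b1 b2 b3 N) * real N powr (3/2) * real n powr -(3/2)) * exp (- (3/2) / real n)"
    using step by (intro mult_right_mono) auto
  \<comment> \<open>The factor is compared with the growth of \<open>n powr -(3/2)\<close> by means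
    of \<open>ln (1 + 1/n) \<le> 1/n\<close>, so that the bound telescopes.\<close>
  also have "exp (- (3/2) / real n) \<le> (real (Suc n) / real n) powr -(3/2)"
  proof -
    have "ln (real (Suc n) / real n) = ln (1 + 1 / real n)" using n0 by (simp add: field_simps)
    also have "\<dots> \<le> 1 / real n" using n0 by (intro ln_add_one_self_le_self) auto
    finally show ?thesis using n0 by (simp add: powr_def)
  qed
  also have "norm (F43t a1 a2 a3 a4 b1 b2 b3 N) * real N powr (3/2) * real n powr -(3/2) * (real (Suc n) / real n) powr -(3/2) =
     norm (F43t a1 a2 a3 a4 b1 b2 b3 N) * real N powr (3/2) * real (Suc n) powr -(3/2)"
    using n0 by (simp add: powr_divide)
  finally show ?case by (simp add: mult_left_mono)
qed

lemma F43r_eq_suminf: "F43r a1 a2 a3 a4 b1 b2 b3 = suminf (F43t a1 a2 a3 a4 b1 b2 b3)"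
  unfolding F43r_def by (rule arg_cong[where f = suminf]) (simp add: F43t_def fun_eq_iff)

lemma pochhammer_holomorphic [holomorphic_intros]:
  "f holomorphic_on A \<Longrightarrow> (\<lambda>z. pochhammer (f z :: complex) n) holomorphic_on A"
  unfolding pochhammer_prod by (intro holomorphic_intros) auto

text \<open>Reciprocal Gammas leave no poles in the lower parameters, so every term is entire along
  the given curve of parameters, and \<open>F43t_bound\<close> gives locally uniform
  convergence.\<close>

lemma F43r_holomorphic:
  assumes h: "a1 holomorphic_on UNIV" "a2 holomorphic_on UNIV" "a3 holomorphic_on UNIV" "a4 holomorphic_on UNIV"
      "b1 holomorphic_on UNIV" "b2 holomorphic_on UNIV" "b3 holomorphic_on UNIV"
    and S: "\<And>z. b1 z + b2 z + b3 z - a1 z - a2 z - a3 z - a4 z = 1"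
  shows "(\<lambda>z. F43r (a1 z) (a2 z) (a3 z) (a4 z) (b1 z) (b2 z) (b3 z)) holomorphic_on UNIV"
proof -
  define T where "T = (\<lambda>n z. F43t (a1 z) (a2 z) (a3 z) (a4 z) (b1 z) (b2 z) (b3 z) n)"
  have Gamma_quot4: "T n holomorphic_on UNIV" for n
    unfolding T_def F43t_def by (intro holomorphic_intros h) auto
  have "(\<lambda>z. suminf (\<lambda>n. T n z)) holomorphic_on UNIV"
  proof (rule holomorphic_uniform_sequence[where f = "\<lambda>n z. \<Sum>i<n. T i z"])
    show "(\<lambda>z. \<Sum>i<n. T i z) holomorphic_on UNIV" for n by (intro holomorphic_intros Gamma_quot4)
    fix x :: complex
    have cont: "continuous_on (cball x 1) f" if "f holomorphic_on UNIV" for f :: "complex \<Rightarrow> complex"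
      using holomorphic_on_imp_continuous_on[OF that] continuous_on_subset by blast
    have "\<exists>B. \<forall>z\<in>cball x 1. norm (f z) \<le> B" if "f holomorphic_on UNIV" for f :: "complex \<Rightarrow> complex"
      using compact_imp_bounded[OF compact_continuous_image[OF cont[OF that] compact_cball]] by (auto simp: bounded_iff)
    note ex = this
    obtain B1 B2 B3 B4 B5 B6 B7 where B: "\<forall>z\<in>cball x 1. norm (a1 z) \<le> B1" "\<forall>z\<in>cball x 1. norm (a2 z) \<le> B2" "\<forall>z\<in>cball x 1. norm (a3 z) \<le> B3"
      "\<forall>z\<in>cball x 1. norm (a4 z) \<le> B4" "\<forall>z\<in>cball x 1. norm (b1 z) \<le> B5" "\<forall>z\<in>cball x 1. norm (b2 z) \<le> B6" "\<forall>z\<in>cball x 1. norm (b3 z) \<le> B7"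
      using ex[OF h(1)] ex[OF h(2)] ex[OF h(3)] ex[OF h(4)] ex[OF h(5)] ex[OF h(6)] ex[OF h(7)] by (elim exE) (rule that)
    define M where "M = Max {1, B1, B2, B3, B4, B5, B6, B7}"
    have M: "M \<ge> 1" "B1 \<le> M" "B2 \<le> M" "B3 \<le> M" "B4 \<le> M" "B5 \<le> M" "B6 \<le> M" "B7 \<le> M"
      unfolding M_def by (rule Max_ge; simp)+
    define N where "N = nat \<lceil>36 * M\<^sup>2\<rceil>"
    have N: "real N \<ge> 36 * M\<^sup>2" unfolding N_def by linarith
    obtain K where K: "\<forall>z\<in>cball x 1. norm (T N z) \<le> K" using ex[OF Gamma_quot4[of N]] by blast
    have "uniform_limit (cball x 1) (\<lambda>n z. \<Sum>i<n. T i z) (\<lambda>z. suminf (\<lambda>n. T n z)) sequentially"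
    proof (rule Weierstrass_m_test_ev)
      show "summable (\<lambda>n. K * real N powr (3/2) * real n powr -(3/2))"
        by (intro summable_mult) (simp add: summable_real_powr_iff)
      show "\<forall>\<^sub>F n in sequentially. \<forall>z\<in>cball x 1. norm (T n z) \<le> K * real N powr (3/2) * real n powr -(3/2)"
        using eventually_ge_at_top[of N]
      proof eventually_elim
        case (elim n)
        show ?case
        proof
          fix z assume z: "z \<in> cball x 1"
          have "norm (T n z) \<le> norm (T N z) * real N powr (3/2) * real n powr -(3/2)"
            unfolding T_def by (rule F43t_bound[OF M(1) _ _ _ _ _ _ _ S N elim])
              (rule order.trans[OF bspec[OF B(1) z] M(2)] order.trans[OF bspec[OF B(2) z] M(3)] order.trans[OF bspec[OF B(3) z] M(4)]
                order.trans[OF bspec[OF B(4) z] M(5)] order.trans[OF bspec[OF B(5) z] M(6)] order.trans[OF bspec[OF B(6) z] M(7)]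
                order.trans[OF bspec[OF B(7) z] M(8)])+
          also have "\<dots> \<le> K * real N powr (3/2) * real n powr -(3/2)"
            using K z by (intro mult_right_mono) auto
          finally show "norm (T n z) \<le> K * real N powr (3/2) * real n powr -(3/2)" .
        qed
      qed
    qed
    thus "\<exists>d>0. cball x d \<subseteq> UNIV \<and> uniform_limit (cball x d) (\<lambda>n z. \<Sum>i<n. T i z) (\<lambda>z. suminf (\<lambda>n. T n z)) sequentially"
      by (intro exI[of _ 1]) auto
  qed auto
  thus ?thesis by (simp add: T_def F43r_eq_suminf)
qed

text \<open>Continuation is along complex lines only, first with a real direction vector and then with a complex one, so joint
  holomorphy is never needed.\<close>

lemma real_box_identity:
  fixes f :: "(nat \<Rightarrow> complex) \<Rightarrow> complex" and c :: "nat \<Rightarrow> real"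
  assumes hol: "\<And>y d. (\<lambda>t. f (\<lambda>i. y i + t * d i)) holomorphic_on UNIV"
    and zero: "\<And>y. (\<forall>i<k. \<bar>y i - c i\<bar> < e) \<Longrightarrow> f (\<lambda>i. complex_of_real (y i)) = 0" and e: "e > 0"
  shows "f y = 0"
proof -
  have line: "f (\<lambda>i. u i + w * d i) = 0" if r: "r > 0" and z: "\<And>t::real. 0 < t \<Longrightarrow> t < r \<Longrightarrow> f (\<lambda>i. u i + of_real t * d i) = 0" for u d w r
  proof (rule analytic_continuation[OF hol[of u d] open_UNIV connected_UNIV])
    show "0 islimpt (of_real ` {0<..<r} :: complex set)"
      unfolding islimpt_approachable
    proof (intro allI impI)
      fix e' :: real assume e': "e' > 0"
      define t where "t = min (r/2) (e'/2)"
      have "0 < t" "t < r" "t < e'" using r e' by (auto simp: t_def)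
      thus "\<exists>x'\<in>of_real ` {0<..<r}. x' \<noteq> (0::complex) \<and> dist x' 0 < e'"
        by (intro bexI[of _ "of_real t"]) auto
    qed
  qed (use z in auto)
  have real0: "f (\<lambda>i. complex_of_real (y i)) = 0" for y :: "nat \<Rightarrow> real"
  proof -
    define B where "B = 1 + (\<Sum>i<k. \<bar>y i - c i\<bar>)"
    have B: "B > 0" unfolding B_def by (intro add_pos_nonneg sum_nonneg) auto
    have "f (\<lambda>i. complex_of_real (c i) + 1 * complex_of_real (y i - c i)) = 0"
    proof (rule line[of "e / B"])
      fix t :: real assume t: "0 < t" "t < e / B"
      have "\<bar>(c i + t * (y i - c i)) - c i\<bar> < e" if "i < k" for i
      proof -
        have "\<bar>y i - c i\<bar> \<le> (\<Sum>i<k. \<bar>y i - c i\<bar>)" using that by (intro member_le_sum) auto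
        hence "t * \<bar>y i - c i\<bar> \<le> t * B" using t by (intro mult_left_mono) (auto simp: B_def)
        also have "\<dots> < e" using t B by (simp add: field_simps)
        finally show ?thesis using t by (simp add: abs_mult)
      qed
      from zero[of "\<lambda>i. c i + t * (y i - c i)"] this
      show "f (\<lambda>i. complex_of_real (c i) + complex_of_real t * complex_of_real (y i - c i)) = 0" by simp
    qed (use e B in auto)
    thus ?thesis by simp
  qed
  have "f (\<lambda>i. complex_of_real (Re (y i)) + \<i> * complex_of_real (Im (y i))) = 0"
  proof (rule line[of 1])
    fix t :: real
    show "f (\<lambda>i. complex_of_real (Re (y i)) + complex_of_real t * complex_of_real (Im (y i))) = 0"
      using real0[of "\<lambda>i. Re (y i) + t * Im (y i)"] by simp
  qed auto
  thus ?thesis by (simp add: complex_eq[symmetric])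
qed

section \<open>From real parameters to the complex two-term relation\<close>

lemma F43r_of_real:
  assumes "t sums s"
    and "\<And>n. t n = pochhammer a1 n * pochhammer a2 n * pochhammer a3 n * pochhammer a4 n
       * rGamma (b1 + real n) * rGamma (b2 + real n) * rGamma (b3 + real n) / fact n"
  shows "F43r (of_real a1) (of_real a2) (of_real a3) (of_real a4) (of_real b1) (of_real b2) (of_real b3) = of_real s"
proof -
  have "F43t (of_real a1) (of_real a2) (of_real a3) (of_real a4) (of_real b1) (of_real b2) (of_real b3) n = of_real (t n)" for n
  proof -
    have "rGamma (complex_of_real b + of_nat n) = of_real (rGamma (b + real n))" for b
      using rGamma_complex_of_real[of "b + real n"] by simp
    thus ?thesis unfolding F43t_def assms(2) by (simp add: pochhammer_of_real)
  qed
  hence "F43t (of_real a1) (of_real a2) (of_real a3) (of_real a4) (of_real b1) (of_real b2) (of_real b3) = (\<lambda>n. of_real (t n))"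
    by (rule ext)
  thus ?thesis unfolding F43r_eq_suminf using sums_of_real[OF assms(1), where ?'a = complex] by (simp add: sums_iff)
qed

lemma F43r_of_real_pos:
  assumes "a1 > 0" "a2 > 0" "a3 > 0" "a4 > 0" "b1 > 0" "b2 > 0" "b3 > 0" "b1 + b2 + b3 - a1 - a2 - a3 - a4 = 1"
  shows "F43r (of_real a1) (of_real a2) (of_real a3) (of_real a4) (of_real b1) (of_real b2) (of_real b3) =
    of_real ((\<Sum>n. Gamma_quot4 a1 a2 a3 a4 b1 b2 b3 (0 + real n)) * (rGamma a1 * rGamma a2 * rGamma a3 * rGamma a4))"
proof (rule F43r_of_real)
  show "(\<lambda>n. Gamma_quot4 a1 a2 a3 a4 b1 b2 b3 (0 + real n) * (rGamma a1 * rGamma a2 * rGamma a3 * rGamma a4)) sums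
     ((\<Sum>n. Gamma_quot4 a1 a2 a3 a4 b1 b2 b3 (0 + real n)) * (rGamma a1 * rGamma a2 * rGamma a3 * rGamma a4))"
    by (intro sums_mult2 summable_sums Gamma_quot4_summable) (use assms in auto)
  show "Gamma_quot4 a1 a2 a3 a4 b1 b2 b3 (0 + real n) * (rGamma a1 * rGamma a2 * rGamma a3 * rGamma a4) =
    pochhammer a1 n * pochhammer a2 n * pochhammer a3 n * pochhammer a4 n
       * rGamma (b1 + real n) * rGamma (b2 + real n) * rGamma (b3 + real n) / fact n" for n
    using assms Gamma_fact[where ?'a = real, of n] by (simp add: Gamma_quot4_def pochhammer_real_Gamma rGamma_real_eq)
qed

text \<open>The numerator of \<open>L\<close>. Continuing it instead of \<open>L\<close> avoids the
  poles of the sine in the denominator.\<close>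

definition L_entire :: "complex \<Rightarrow> complex \<Rightarrow> complex \<Rightarrow> complex \<Rightarrow> complex \<Rightarrow> complex \<Rightarrow> complex \<Rightarrow> complex" where
  "L_entire A B C D E F G =
     F43r A B C D E F G * rGamma (1-E+A) * rGamma (1-E+B) * rGamma (1-E+C) * rGamma (1-E+D)
      - F43r (1+A-E) (1+B-E) (1+C-E) (1+D-E) (2-E) (1+F-E) (1+G-E) * rGamma A * rGamma B * rGamma C * rGamma D"

lemma Lfun_eq: "Lfun A B C D E F G = L_entire A B C D E F G / sin (of_real pi * E)"
  by (simp add: Lfun_def L_entire_def)

lemma rGamma_of_real': "complex_of_real x = z \<Longrightarrow> rGamma z = of_real (rGamma x)"
  using rGamma_complex_of_real by blast

lemma L_entire_of_real:
  assumes "A > 0" "B > 0" "C > 0" "D > 0" "E > 0" "E < 1" "F > 0" "G > 0" "E + F + G - A - B - C - D = 1"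
  shows "L_entire (of_real A) (of_real B) (of_real C) (of_real D) (of_real E) (of_real F) (of_real G) =
    of_real (((\<Sum>n. Gamma_quot4 A B C D E F G (0 + real n)) - (\<Sum>n. Gamma_quot4 A B C D E F G (1 - E + real n))) *
      (rGamma A * rGamma B * rGamma C * rGamma D * rGamma (1+A-E) * rGamma (1+B-E) * rGamma (1+C-E) * rGamma (1+D-E)))"
proof -
  have r: "rGamma (1 - of_real E + of_real x) = complex_of_real (rGamma (1 + x - E))" for x
    by (rule rGamma_of_real') simp
  have 1: "F43r (of_real A) (of_real B) (of_real C) (of_real D) (of_real E) (of_real F) (of_real G) =
     of_real ((\<Sum>n. Gamma_quot4 A B C D E F G (0 + real n)) * (rGamma A * rGamma B * rGamma C * rGamma D))"
    by (rule F43r_of_real_pos) (use assms in auto)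
  have "F43r (of_real (1+A-E)) (of_real (1+B-E)) (of_real (1+C-E)) (of_real (1+D-E)) (of_real (2-E)) (of_real (1+F-E)) (of_real (1+G-E)) =
     of_real ((\<Sum>n. Gamma_quot4 (1+A-E) (1+B-E) (1+C-E) (1+D-E) (2-E) (1+F-E) (1+G-E) (0 + real n)) * (rGamma (1+A-E) * rGamma (1+B-E) * rGamma (1+C-E) * rGamma (1+D-E)))"
    by (rule F43r_of_real_pos) (use assms in auto)
  moreover have "Gamma_quot4 (1+A-E) (1+B-E) (1+C-E) (1+D-E) (2-E) (1+F-E) (1+G-E) (0 + real n) = Gamma_quot4 A B C D E F G (1 - E + real n)" for n
  proof -
    have "1+Y-E + (0 + real n) = Y + (1 - E + real n)" for Y by simp
    moreover have "2 - E + (0 + real n) = 1 + (1 - E + real n)" "1 + (0 + real n) = E + (1 - E + real n)" by auto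
    ultimately show ?thesis unfolding Gamma_quot4_def by (simp only: mult_ac)
  qed
  ultimately have 2: "F43r (1 + of_real A - of_real E) (1 + of_real B - of_real E) (1 + of_real C - of_real E) (1 + of_real D - of_real E) (2 - of_real E) (1 + of_real F - of_real E) (1 + of_real G - of_real E) =
     complex_of_real ((\<Sum>n. Gamma_quot4 A B C D E F G (1 - E + real n)) * (rGamma (1+A-E) * rGamma (1+B-E) * rGamma (1+C-E) * rGamma (1+D-E)))"
    by simp
  show ?thesis unfolding L_entire_def 1 2 r rGamma_complex_of_real
    by (simp add: algebra_simps)
qed

lemma L_entire_swap_real:
  assumes A: "A > 0" and CDE: "C > 0" "D > 0" "C + D < E" "E < 1" and B: "A < B" "B < A + 1"
    and FG: "F > B" "G > B" and S: "E + F + G - A - B - C - D = (1::real)"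
  shows "L_entire (of_real A) (of_real B) (of_real C) (of_real D) (of_real E) (of_real F) (of_real G) * of_real (sin (pi * (1 + A - B))) =
    L_entire (of_real A) (of_real (1+A-E)) (of_real (F-B)) (of_real (G-B)) (of_real (1+A-B)) (of_real (1+A+C-E)) (of_real (1+A+D-E)) * of_real (sin (pi * E))"
proof -
  have E: "E > 0" using CDE by linarith
  define P where "P = (\<Sum>n. Gamma_quot4 A B C D E F G (0 + real n)) - (\<Sum>n. Gamma_quot4 A B C D E F G (1 - E + real n))"
  define P' where "P' = (\<Sum>n. Gamma_quot4 A (1+A-E) (F-B) (G-B) (1+A-B) (1+A+C-E) (1+A+D-E) (0 + real n)) -
      (\<Sum>n. Gamma_quot4 A (1+A-E) (F-B) (G-B) (1+A-B) (1+A+C-E) (1+A+D-E) (1 - (1+A-B) + real n))"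
  have 1: "L_entire (of_real A) (of_real B) (of_real C) (of_real D) (of_real E) (of_real F) (of_real G) = of_real (P *
     (rGamma A * rGamma B * rGamma C * rGamma D * rGamma (1+A-E) * rGamma (1+B-E) * rGamma (1+C-E) * rGamma (1+D-E)))"
    unfolding P_def by (rule L_entire_of_real) (use assms E in auto)
  have e: "1+A-(1+A-B) = B" "1+(1+A-E)-(1+A-B) = 1+B-E" "1+(F-B)-(1+A-B) = F-A" "1+(G-B)-(1+A-B) = G-A" by auto
  have 2: "L_entire (of_real A) (of_real (1+A-E)) (of_real (F-B)) (of_real (G-B)) (of_real (1+A-B)) (of_real (1+A+C-E)) (of_real (1+A+D-E)) = of_real (P' *
     (rGamma A * rGamma (1+A-E) * rGamma (F-B) * rGamma (G-B) * rGamma B * rGamma (1+B-E) * rGamma (F-A) * rGamma (G-A)))"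
    using L_entire_of_real[of A "1+A-E" "F-B" "G-B" "1+A-B" "1+A+C-E" "1+A+D-E"] unfolding e P'_def[symmetric]
    by (rule meta_mp) (use assms E in auto)
  have sw: "Gamma (F - B) * Gamma (G - B) * Gamma (F - A) * Gamma (G - A) * sin (pi * (1 + A - B)) * P =
    Gamma C * Gamma D * Gamma (1+C-E) * Gamma (1+D-E) * sin (pi * E) * P'"
    unfolding P_def P'_def by (rule Gamma_quot4_swap) (use assms in auto)
  have nz: "Gamma (F-B) \<noteq> 0" "Gamma (G-B) \<noteq> 0" "Gamma (F-A) \<noteq> 0" "Gamma (G-A) \<noteq> 0" "Gamma C \<noteq> 0" "Gamma D \<noteq> 0" "Gamma (1+C-E) \<noteq> 0" "Gamma (1+D-E) \<noteq> 0"
    using assms E by (auto intro!: Gamma_real_nonzero simp del: Gamma_real_pos)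
  have alg: "P * (a * b * rGamma c * rGamma d * r * t * rGamma u * rGamma v) * s' = P' * (a * r * rGamma g1 * rGamma g2 * b * t * rGamma g3 * rGamma g4) * s"
    if "Gamma g1 * Gamma g2 * Gamma g3 * Gamma g4 * s' * P = Gamma c * Gamma d * Gamma u * Gamma v * s * P'"
     "Gamma g1 \<noteq> 0" "Gamma g2 \<noteq> 0" "Gamma g3 \<noteq> 0" "Gamma g4 \<noteq> 0" "Gamma c \<noteq> 0" "Gamma d \<noteq> 0" "Gamma u \<noteq> 0" "Gamma v \<noteq> 0"
    for P P' a b c d r t u v g1 g2 g3 g4 s s' :: real
  proof -
    have "P * (a * b * rGamma c * rGamma d * r * t * rGamma u * rGamma v) * s' =
      (Gamma g1 * Gamma g2 * Gamma g3 * Gamma g4 * s' * P) * (a * b * r * t) / (Gamma g1 * Gamma g2 * Gamma g3 * Gamma g4 * Gamma c * Gamma d * Gamma u * Gamma v)"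
      using that(2-) by (simp add: rGamma_real_eq mult_ac)
    also have "\<dots> = P' * (a * r * rGamma g1 * rGamma g2 * b * t * rGamma g3 * rGamma g4) * s"
      unfolding that(1) using that(2-) by (simp add: rGamma_real_eq mult_ac)
    finally show ?thesis .
  qed
  show ?thesis unfolding 1 2 of_real_mult[symmetric] of_real_eq_iff by (rule alg[OF sw nz])
qed

lemma L_entire_holomorphic:
  assumes h: "A holomorphic_on UNIV" "B holomorphic_on UNIV" "C holomorphic_on UNIV" "D holomorphic_on UNIV"
      "E holomorphic_on UNIV" "F holomorphic_on UNIV" "G holomorphic_on UNIV"
    and S: "\<And>z. E z + F z + G z - A z - B z - C z - D z = 1"
  shows "(\<lambda>z. L_entire (A z) (B z) (C z) (D z) (E z) (F z) (G z)) holomorphic_on UNIV"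
proof -
  have "2 - E z + (1 + F z - E z) + (1 + G z - E z) - (1 + A z - E z) - (1 + B z - E z) - (1 + C z - E z) - (1 + D z - E z) = 1" for z
    using S[of z] by (simp add: algebra_simps)
  thus ?thesis unfolding L_entire_def
    by (intro holomorphic_intros F43r_holomorphic h S) auto
qed

theorem L_entire_swap:
  assumes S: "E + F + G - A - B - C - D = 1"
  shows "L_entire A B C D E F G * sin (of_real pi * (1 + A - B)) =
    L_entire A (1+A-E) (F-B) (G-B) (1+A-B) (1+A+C-E) (1+A+D-E) * sin (of_real pi * E)"
proof -
  \<comment> \<open>Six free coordinates; \<open>G\<close> is eliminated, so that every line in them
    stays in the Saalschuetzian hyperplane.\<close>
  define f where "f = (\<lambda>y::nat \<Rightarrow> complex. let A = y 0; B = y 1; C = y 2; D = y 3; E = y 4; F = y 5; G = 1 + A + B + C + D - E - F in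
     L_entire A B C D E F G * sin (of_real pi * (1 + A - B)) -
    L_entire A (1+A-E) (F-B) (G-B) (1+A-B) (1+A+C-E) (1+A+D-E) * sin (of_real pi * E))"
  \<comment> \<open>A point inside the domain of \<open>L_entire_swap_real\<close>:
    \<open>C + D = 2/5 < E = 1/2\<close>, \<open>A < B < A + 1\<close>, and
    \<open>F = G = 8/5 > B = 13/10\<close>, with room for an error of 1/100 in each of the six
    coordinates.\<close>
  define c :: "nat \<Rightarrow> real" where "c = (\<lambda>i. [1, 13/10, 1/5, 1/5, 1/2, 8/5] ! i)"
  define y where "y = (\<lambda>i. [A, B, C, D, E, F] ! i)"
  have "f y = 0"
  proof (rule real_box_identity[where f = f and y = y and k = 6 and c = c and e = "1/100"])
    show "(\<lambda>t. f (\<lambda>i. y i + t * d i)) holomorphic_on UNIV" for y d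
      unfolding f_def Let_def
      by (intro holomorphic_intros L_entire_holomorphic) (auto simp: algebra_simps)
    fix y :: "nat \<Rightarrow> real" assume y: "\<forall>i<6. \<bar>y i - c i\<bar> < 1/100"
    have b: "\<bar>y 0 - 1\<bar> < 1/100" "\<bar>y 1 - 13/10\<bar> < 1/100" "\<bar>y 2 - 1/5\<bar> < 1/100" "\<bar>y 3 - 1/5\<bar> < 1/100" "\<bar>y 4 - 1/2\<bar> < 1/100" "\<bar>y 5 - 8/5\<bar> < 1/100"
      using y[rule_format, of 0] y[rule_format, of 1] y[rule_format, of 2] y[rule_format, of 3] y[rule_format, of 4] y[rule_format, of 5]
      by (simp_all add: c_def)
    define G where "G = 1 + y 0 + y 1 + y 2 + y 3 - y 4 - y 5"
    have "L_entire (of_real (y 0)) (of_real (y 1)) (of_real (y 2)) (of_real (y 3)) (of_real (y 4)) (of_real (y 5)) (of_real G) * of_real (sin (pi * (1 + y 0 - y 1))) =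
     L_entire (of_real (y 0)) (of_real (1+y 0-y 4)) (of_real (y 5-y 1)) (of_real (G-y 1)) (of_real (1+y 0-y 1)) (of_real (1+y 0+y 2-y 4)) (of_real (1+y 0+y 3-y 4)) * of_real (sin (pi * y 4))"
      by (rule L_entire_swap_real) (use b G_def in linarith)+
    thus "f (\<lambda>i. complex_of_real (y i)) = 0"
      unfolding f_def Let_def G_def by (simp add: sin_of_real[symmetric])
  qed simp
  moreover have "G = 1 + A + B + C + D - E - F" using S by (simp add: algebra_simps)
  ultimately show ?thesis by (simp add: f_def y_def Let_def)
qed


section \<open>Continuation of the four-term relation\<close>

lemma rGamma_mult_Gamma_real: "x > 0 \<Longrightarrow> rGamma x * Gamma (x + real n) = pochhammer (x::real) n"
  by (simp add: pochhammer_real_Gamma rGamma_real_eq)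

text \<open>Each series of \<open>four_term_real\<close> is a 4F3 whose summand has been split: two
  upper parameters and one lower parameter sit in the \<open>Gauss_coeff\<close>, the others in the
  Gamma quotient \<open>P1\<close> or \<open>P2\<close>.\<close>

lemma four_term_of_real:
  fixes A B C D E F G :: real
  assumes pos: "A > 0" "A < D" "D < A + 1" and BCE: "B < E" "C < E" "E < 1" "B + C > E" "B > 0" "C > 0"
    and FG: "F > D" "G > D + 1" "F < A + 1" "G < A + 2" and S: "E + F + G - A - B - C - D = 1"
  defines "K0 \<equiv> F43r (of_real A) (of_real B) (of_real C) (of_real D) (of_real E) (of_real F) (of_real G)"
    and "KE \<equiv> F43r (of_real (1+A-E)) (of_real (1+B-E)) (of_real (1+C-E)) (of_real (1+D-E)) (of_real (2-E)) (of_real (1+F-E)) (of_real (1+G-E))"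
    and "KA \<equiv> F43r (of_real A) (of_real (1+A-E)) (of_real (1+A-F)) (of_real (1+A-G)) (of_real (1+A-B)) (of_real (1+A-C)) (of_real (1+A-D))"
    and "KD \<equiv> F43r (of_real D) (of_real (1+D-E)) (of_real (1+D-F)) (of_real (1+D-G)) (of_real (1+D-B)) (of_real (1+D-C)) (of_real (1+D-A))"
  shows "of_real (sin (pi * (D - A))) * (K0 * of_real (rGamma (1-B) * rGamma (1-C) * rGamma (1+A-E) * rGamma (1+D-E)) -
           KE * of_real (rGamma (E-B) * rGamma (E-C) * rGamma A * rGamma D)) =
         of_real (sin (pi * E)) * (KA * of_real (rGamma (F-A) * rGamma (G-A) * rGamma D * rGamma (1+D-E)) -
           KD * of_real (rGamma (F-D) * rGamma (G-D) * rGamma A * rGamma (1+A-E)))"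
proof -
  define P1 where "P1 = (\<lambda>t. Gamma t * Gamma (t + 1 - E) * rGamma (t + 1 - B) * rGamma (t + 1 - C))"
  define P2 where "P2 = (\<lambda>s. Gamma (A + s) * Gamma (D + s) * rGamma (F + s) * rGamma (G + s))"
  define q0 q1 p0 p1 where "q0 = Gauss_coeff B C E" and "q1 = Gauss_coeff (1+B-E) (1+C-E) (2-E)"
    and "p0 = Gauss_coeff (1+A-F) (1+A-G) (1+A-D)" and "p1 = Gauss_coeff (1+D-F) (1+D-G) (1+D-A)"
  have ft: "summable (\<lambda>n. q0 n * P2 (real n))" "summable (\<lambda>n. q1 n * P2 (1 - E + real n))"
    "summable (\<lambda>m. p0 m * P1 (A + real m))" "summable (\<lambda>m. p1 m * P1 (D + real m))"
    "sin (pi * (D - A)) * (rGamma (1-B) * rGamma (1-C) * (\<Sum>n. q0 n * P2 (real n)) - rGamma (E-B) * rGamma (E-C) * (\<Sum>n. q1 n * P2 (1 - E + real n))) =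
     sin (pi * E) * (rGamma (F-A) * rGamma (G-A) * (\<Sum>m. p0 m * P1 (A + real m)) - rGamma (F-D) * rGamma (G-D) * (\<Sum>m. p1 m * P1 (D + real m)))"
    unfolding P1_def P2_def q0_def q1_def p0_def p1_def by (rule four_term_real[OF pos BCE FG S])+
  have pp: "A > 0" "D > 0" "1+A-E > 0" "1+D-E > 0" using pos BCE by auto
  have K0: "K0 = of_real (rGamma A * rGamma D * (\<Sum>n. q0 n * P2 (real n)))"
  proof -
    have t: "(\<lambda>n. rGamma A * rGamma D * (q0 n * P2 (real n))) sums (rGamma A * rGamma D * (\<Sum>n. q0 n * P2 (real n)))"
      by (intro sums_mult summable_sums ft)
    show ?thesis unfolding K0_def
    proof (rule F43r_of_real[OF t])
    show "rGamma A * rGamma D * (q0 n * P2 (real n)) = pochhammer A n * pochhammer B n * pochhammer C n * pochhammer D n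
       * rGamma (E + real n) * rGamma (F + real n) * rGamma (G + real n) / fact n" for n
      unfolding q0_def Gauss_coeff_def P2_def rGamma_mult_Gamma_real[OF pp(1), symmetric] rGamma_mult_Gamma_real[OF pp(2), symmetric]
      by (simp add: mult_ac)
    qed
  qed
  have KE: "KE = of_real (rGamma (1+A-E) * rGamma (1+D-E) * (\<Sum>n. q1 n * P2 (1 - E + real n)))"
  proof -
    have t: "(\<lambda>n. rGamma (1+A-E) * rGamma (1+D-E) * (q1 n * P2 (1 - E + real n))) sums (rGamma (1+A-E) * rGamma (1+D-E) * (\<Sum>n. q1 n * P2 (1 - E + real n)))"
      by (intro sums_mult summable_sums ft)
    show ?thesis unfolding KE_def
    proof (rule F43r_of_real[OF t])
    fix n
    have e: "1+X-E + real n = X + (1 - E + real n)" for X by simp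
    show "rGamma (1+A-E) * rGamma (1+D-E) * (q1 n * P2 (1 - E + real n)) = pochhammer (1+A-E) n * pochhammer (1+B-E) n * pochhammer (1+C-E) n * pochhammer (1+D-E) n
       * rGamma (2-E + real n) * rGamma (1+F-E + real n) * rGamma (1+G-E + real n) / fact n"
      unfolding q1_def Gauss_coeff_def P2_def rGamma_mult_Gamma_real[OF pp(3), symmetric] rGamma_mult_Gamma_real[OF pp(4), symmetric]
        e[of A] e[of D] e[of F] e[of G]
      by (simp add: mult_ac)
    qed
  qed
  have KA: "KA = of_real (rGamma A * rGamma (1+A-E) * (\<Sum>n. p0 n * P1 (A + real n)))"
  proof -
    have t: "(\<lambda>n. rGamma A * rGamma (1+A-E) * (p0 n * P1 (A + real n))) sums (rGamma A * rGamma (1+A-E) * (\<Sum>n. p0 n * P1 (A + real n)))"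
      by (intro sums_mult summable_sums ft)
    show ?thesis unfolding KA_def
    proof (rule F43r_of_real[OF t])
    fix n
    have e: "1+A-X + real n = A + real n + 1 - X" for X by simp
    show "rGamma A * rGamma (1+A-E) * (p0 n * P1 (A + real n)) = pochhammer A n * pochhammer (1+A-E) n * pochhammer (1+A-F) n * pochhammer (1+A-G) n
       * rGamma (1+A-B + real n) * rGamma (1+A-C + real n) * rGamma (1+A-D + real n) / fact n"
      unfolding p0_def Gauss_coeff_def P1_def rGamma_mult_Gamma_real[OF pp(1), symmetric] rGamma_mult_Gamma_real[OF pp(3), symmetric]
        e[of B] e[of C] e[of E]
      by (simp add: mult_ac)
    qed
  qed
  have KD: "KD = of_real (rGamma D * rGamma (1+D-E) * (\<Sum>n. p1 n * P1 (D + real n)))"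
  proof -
    have t: "(\<lambda>n. rGamma D * rGamma (1+D-E) * (p1 n * P1 (D + real n))) sums (rGamma D * rGamma (1+D-E) * (\<Sum>n. p1 n * P1 (D + real n)))"
      by (intro sums_mult summable_sums ft)
    show ?thesis unfolding KD_def
    proof (rule F43r_of_real[OF t])
    fix n
    have e: "1+D-X + real n = D + real n + 1 - X" for X by simp
    show "rGamma D * rGamma (1+D-E) * (p1 n * P1 (D + real n)) = pochhammer D n * pochhammer (1+D-E) n * pochhammer (1+D-F) n * pochhammer (1+D-G) n
       * rGamma (1+D-B + real n) * rGamma (1+D-C + real n) * rGamma (1+D-A + real n) / fact n"
      unfolding p1_def Gauss_coeff_def P1_def rGamma_mult_Gamma_real[OF pp(2), symmetric] rGamma_mult_Gamma_real[OF pp(4), symmetric]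
        e[of B] e[of C] e[of E]
      by (simp add: mult_ac)
    qed
  qed
  have alg: "s * (a * d * k0 * (w1 * w2 * ae * de) - ae * de * ke * (w3 * w4 * a * d)) = s' * (a * ae * ka * (v1 * v2 * d * de) - d * de * kd * (v3 * v4 * a * ae))"
    if "s * (w1 * w2 * k0 - w3 * w4 * ke) = s' * (v1 * v2 * ka - v3 * v4 * kd)" for s s' a d ae de k0 ke ka kd w1 w2 w3 w4 v1 v2 v3 v4 :: real
  proof -
    have "s * (a * d * k0 * (w1 * w2 * ae * de) - ae * de * ke * (w3 * w4 * a * d)) = a * d * ae * de * (s * (w1 * w2 * k0 - w3 * w4 * ke))"
      by (simp add: algebra_simps)
    also have "\<dots> = s' * (a * ae * ka * (v1 * v2 * d * de) - d * de * kd * (v3 * v4 * a * ae))"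
      unfolding that by (simp add: algebra_simps)
    finally show ?thesis .
  qed
  show ?thesis unfolding K0 KE KA KD of_real_mult[symmetric] of_real_diff[symmetric] of_real_eq_iff
    by (rule alg[OF ft(5)])
qed

theorem four_term:
  assumes S: "E + F + G - A - B - C - D = (1::complex)"
  shows "sin (of_real pi * (D - A)) * (F43r A B C D E F G * (rGamma (1-B) * rGamma (1-C) * rGamma (1+A-E) * rGamma (1+D-E)) -
           F43r (1+A-E) (1+B-E) (1+C-E) (1+D-E) (2-E) (1+F-E) (1+G-E) * (rGamma (E-B) * rGamma (E-C) * rGamma A * rGamma D)) =
         sin (of_real pi * E) * (F43r A (1+A-E) (1+A-F) (1+A-G) (1+A-B) (1+A-C) (1+A-D) * (rGamma (F-A) * rGamma (G-A) * rGamma D * rGamma (1+D-E)) -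
           F43r D (1+D-E) (1+D-F) (1+D-G) (1+D-B) (1+D-C) (1+D-A) * (rGamma (F-D) * rGamma (G-D) * rGamma A * rGamma (1+A-E)))"
proof -
  define f where "f = (\<lambda>y::nat \<Rightarrow> complex. let A = y 0; B = y 1; C = y 2; D = y 3; E = y 4; F = y 5; G = 1 + A + B + C + D - E - F in
     sin (of_real pi * (D - A)) * (F43r A B C D E F G * (rGamma (1-B) * rGamma (1-C) * rGamma (1+A-E) * rGamma (1+D-E)) -
           F43r (1+A-E) (1+B-E) (1+C-E) (1+D-E) (2-E) (1+F-E) (1+G-E) * (rGamma (E-B) * rGamma (E-C) * rGamma A * rGamma D)) -
         sin (of_real pi * E) * (F43r A (1+A-E) (1+A-F) (1+A-G) (1+A-B) (1+A-C) (1+A-D) * (rGamma (F-A) * rGamma (G-A) * rGamma D * rGamma (1+D-E)) -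
           F43r D (1+D-E) (1+D-F) (1+D-G) (1+D-B) (1+D-C) (1+D-A) * (rGamma (F-D) * rGamma (G-D) * rGamma A * rGamma (1+A-E))))"
  \<comment> \<open>Again an interior point. The tightest conditions are \<open>F > D\<close> and
    \<open>G > D + 1\<close>; here \<open>F = 23/20\<close>, \<open>D = 11/10\<close> and
    \<open>G = 43/20\<close>, so both have margin 1/20, large against the box size 1/1000.\<close>
  define c :: "nat \<Rightarrow> real" where "c = (\<lambda>i. [1, 2/5, 2/5, 11/10, 3/5, 23/20] ! i)"
  define y where "y = (\<lambda>i. [A, B, C, D, E, F] ! i)"
  have "f y = 0"
  proof (rule real_box_identity[where f = f and y = y and k = 6 and c = c and e = "1/1000"])
    show "(\<lambda>t. f (\<lambda>i. y i + t * d i)) holomorphic_on UNIV" for y d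
      unfolding f_def Let_def
      by (intro holomorphic_intros F43r_holomorphic) (auto simp: algebra_simps)
    fix y :: "nat \<Rightarrow> real" assume y: "\<forall>i<6. \<bar>y i - c i\<bar> < 1/1000"
    have b: "\<bar>y 0 - 1\<bar> < 1/1000" "\<bar>y 1 - 2/5\<bar> < 1/1000" "\<bar>y 2 - 2/5\<bar> < 1/1000" "\<bar>y 3 - 11/10\<bar> < 1/1000" "\<bar>y 4 - 3/5\<bar> < 1/1000" "\<bar>y 5 - 23/20\<bar> < 1/1000"
      using y[rule_format, of 0] y[rule_format, of 1] y[rule_format, of 2] y[rule_format, of 3] y[rule_format, of 4] y[rule_format, of 5]
      by (simp_all add: c_def)
    define A B C D E F G where "A = y 0" and "B = y 1" and "C = y 2" and "D = y 3" and "E = y 4" and "F = y 5" and "G = 1 + A + B + C + D - E - F"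
    note defs = A_def B_def C_def D_def E_def F_def
    have rg: "rGamma (1 - complex_of_real u) = of_real (rGamma (1 - u))" "rGamma (complex_of_real u - of_real v) = of_real (rGamma (u - v))"
      "rGamma (1 + complex_of_real u - of_real v) = of_real (rGamma (1 + u - v))" for u v
      by (rule rGamma_of_real'; simp)+
    have sn: "sin (of_real pi * complex_of_real u) = of_real (sin (pi * u))" "sin (of_real pi * (complex_of_real u - of_real v)) = of_real (sin (pi * (u - v)))" for u v
      by (simp_all add: sin_of_real[symmetric])
    have "of_real (sin (pi * (D - A))) * (F43r (of_real A) (of_real B) (of_real C) (of_real D) (of_real E) (of_real F) (of_real G) * of_real (rGamma (1-B) * rGamma (1-C) * rGamma (1+A-E) * rGamma (1+D-E)) -
           F43r (of_real (1+A-E)) (of_real (1+B-E)) (of_real (1+C-E)) (of_real (1+D-E)) (of_real (2-E)) (of_real (1+F-E)) (of_real (1+G-E)) * of_real (rGamma (E-B) * rGamma (E-C) * rGamma A * rGamma D)) =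
         of_real (sin (pi * E)) * (F43r (of_real A) (of_real (1+A-E)) (of_real (1+A-F)) (of_real (1+A-G)) (of_real (1+A-B)) (of_real (1+A-C)) (of_real (1+A-D)) * of_real (rGamma (F-A) * rGamma (G-A) * rGamma D * rGamma (1+D-E)) -
           F43r (of_real D) (of_real (1+D-E)) (of_real (1+D-F)) (of_real (1+D-G)) (of_real (1+D-B)) (of_real (1+D-C)) (of_real (1+D-A)) * of_real (rGamma (F-D) * rGamma (G-D) * rGamma A * rGamma (1+A-E)))"
      by (rule four_term_of_real) (use b[folded defs] G_def in linarith)+
    moreover have "1 + complex_of_real A + of_real B + of_real C + of_real D - of_real E - of_real F = of_real G" by (simp add: G_def)
    ultimately show "f (\<lambda>i. complex_of_real (y i)) = 0"
      unfolding f_def Let_def defs[symmetric] by (simp add: rg sn rGamma_complex_of_real)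
  qed simp
  moreover have "G = 1 + A + B + C + D - E - F" using S by (simp add: algebra_simps)
  ultimately show ?thesis by (simp add: f_def y_def Let_def)
qed

section \<open>Symmetries of J and L\<close>

lemma F43r_swap:
  "F43r a1 a2 a3 a4 b1 b2 b3 = F43r a2 a1 a3 a4 b1 b2 b3"
  "F43r a1 a2 a3 a4 b1 b2 b3 = F43r a1 a3 a2 a4 b1 b2 b3"
  "F43r a1 a2 a3 a4 b1 b2 b3 = F43r a1 a2 a4 a3 b1 b2 b3"
  "F43r a1 a2 a3 a4 b1 b2 b3 = F43r a1 a2 a3 a4 b2 b1 b3"
  "F43r a1 a2 a3 a4 b1 b2 b3 = F43r a1 a2 a3 a4 b1 b3 b2"
  unfolding F43r_def by (simp_all add: mult_ac)

lemma L_entire_sym: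
  "L_entire A B C D E F G = L_entire B A C D E F G"
  "L_entire A B C D E F G = L_entire A C B D E F G"
  "L_entire A B C D E F G = L_entire A B D C E F G"
  "L_entire A B C D E F G = L_entire A B C D E G F"
  unfolding L_entire_def F43r_def by (simp_all add: mult_ac)

definition J_entire :: "complex \<Rightarrow> complex \<Rightarrow> complex \<Rightarrow> complex \<Rightarrow> complex \<Rightarrow> complex \<Rightarrow> complex \<Rightarrow> complex" where
  "J_entire A B C D E F G = F43r A B C D E F G * rGamma A * rGamma (1+A-E) * rGamma (1+A-F) * rGamma (1+A-G)
      + F43r A (1+A-E) (1+A-F) (1+A-G) (1+A-B) (1+A-C) (1+A-D) * rGamma A * rGamma B * rGamma C * rGamma D"

lemma Jfun_eq: "Jfun A B C D E F G = J_entire A B C D E F G / sin (of_real pi * A)"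
  by (simp add: Jfun_def J_entire_def)

lemma J_entire_sym:
  "J_entire A B C D E F G = J_entire A C B D E F G"
  "J_entire A B C D E F G = J_entire A B D C E F G"
  "J_entire A B C D E F G = J_entire A B C D F E G"
  "J_entire A B C D E F G = J_entire A B C D E G F"
  unfolding J_entire_def F43r_def by (simp_all add: mult_ac)

lemma J_entire_holomorphic:
  assumes h: "A holomorphic_on UNIV" "B holomorphic_on UNIV" "C holomorphic_on UNIV" "D holomorphic_on UNIV"
      "E holomorphic_on UNIV" "F holomorphic_on UNIV" "G holomorphic_on UNIV"
    and S: "\<And>z. E z + F z + G z - A z - B z - C z - D z = 1"
  shows "(\<lambda>z. J_entire (A z) (B z) (C z) (D z) (E z) (F z) (G z)) holomorphic_on UNIV"
proof -
  have "1 + A z - B z + (1 + A z - C z) + (1 + A z - D z) - A z - (1 + A z - E z) - (1 + A z - F z) - (1 + A z - G z) = 1" for z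
    using S[of z] by (simp add: algebra_simps)
  thus ?thesis unfolding J_entire_def
    by (intro holomorphic_intros F43r_holomorphic h S) auto
qed

lemma sin_sin_diff':
  "sin (f - a) * sin (g - a) - sin (f - d) * sin (g - d) = sin (f + g - a - d) * sin (d - (a::'a::{real_normed_field,banach}))"
proof -
  have "f - a - (g - a) = f - g" "f - d - (g - d) = f - g" "f - a + (g - a) = f + g - a - d + (d - a)" "f - d + (g - d) = f + g - a - d - (d - a)" by auto
  moreover have "f + g - a - d - (d - a) = f + g - 2 * d" "f + g - a - d + (d - a) = f + g - 2 * a" by auto
  ultimately show ?thesis unfolding sin_times_sin by (simp add: field_simps)
qed

text \<open>Elimination among four series: \<open>J\<close> contains \<open>K0\<close> and
  \<open>KA\<close>, one \<open>L\<close> contains \<open>K0\<close> and \<open>KE\<close>, the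
  other \<open>KA\<close> and \<open>KD\<close>. The four-term relation removes \<open>KE\<close>
  and \<open>KD\<close> together, and the remaining coefficients agree by reflection and two sine
  identities.\<close>

lemma J_entire_eq_L_entire:
  assumes S: "E + F + G - A - B - C - D = (1::complex)"
  defines "p \<equiv> complex_of_real pi"
  shows "sin (p * E) * sin (p * (D - A)) * sin (p * (E - B - C)) * rGamma (1+D-E) * J_entire A B C D E F G =
    p\<^sup>2 * rGamma A * (rGamma (1+A-F) * rGamma (1+A-G) * sin (p * (D - A)) * rGamma (E-B) * rGamma (E-C) * L_entire A B C D E F G -
      sin (p * E) * rGamma B * rGamma C * rGamma (F-D) * rGamma (G-D) * L_entire A (1+A-E) (1+A-F) (1+A-G) (1+A-D) (1+A-B) (1+A-C))"
proof -
  define K0 where "K0 = F43r A B C D E F G"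
  define KE where "KE = F43r (1+A-E) (1+B-E) (1+C-E) (1+D-E) (2-E) (1+F-E) (1+G-E)"
  define KA where "KA = F43r A (1+A-E) (1+A-F) (1+A-G) (1+A-B) (1+A-C) (1+A-D)"
  define KD where "KD = F43r D (1+D-E) (1+D-F) (1+D-G) (1+D-B) (1+D-C) (1+D-A)"
  define sE sD sg where "sE = sin (p * E)" and "sD = sin (p * (D - A))" and "sg = sin (p * (E - B - C))"
  have p: "p \<noteq> 0" by (simp add: p_def)
  have ref: "rGamma z * rGamma w = sin (p * z) / p" if "w = 1 - z" for z w
    using rGamma_reflection_complex[of z] that by (simp add: p_def)
  have N: "J_entire A B C D E F G = rGamma A * (K0 * (rGamma (1+A-E) * rGamma (1+A-F) * rGamma (1+A-G)) + KA * (rGamma B * rGamma C * rGamma D))"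
    unfolding J_entire_def K0_def KA_def by (simp add: algebra_simps)
  have L4: "L_entire A B C D E F G = K0 * (rGamma (1+A-E) * rGamma (1+B-E) * rGamma (1+C-E) * rGamma (1+D-E)) - KE * (rGamma A * rGamma B * rGamma C * rGamma D)"
    unfolding L_entire_def K0_def KE_def by (simp add: algebra_simps)
  have "F43r D (1+D-E) (1+D-F) (1+D-G) (1+D-A) (1+D-B) (1+D-C) = KD"
    unfolding KD_def by (metis F43r_swap(4,5))
  moreover have "F43r A (1+A-E) (1+A-F) (1+A-G) (1+A-D) (1+A-B) (1+A-C) = KA"
    unfolding KA_def by (metis F43r_swap(4,5))
  ultimately have L3: "L_entire A (1+A-E) (1+A-F) (1+A-G) (1+A-D) (1+A-B) (1+A-C) = KA * (rGamma D * rGamma (1+D-E) * rGamma (1+D-F) * rGamma (1+D-G)) - KD * (rGamma A * rGamma (1+A-E) * rGamma (1+A-F) * rGamma (1+A-G))"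
    unfolding L_entire_def by (simp add: algebra_simps)
  have R: "sD * (K0 * (rGamma (1-B) * rGamma (1-C) * rGamma (1+A-E) * rGamma (1+D-E)) - KE * (rGamma (E-B) * rGamma (E-C) * rGamma A * rGamma D)) =
         sE * (KA * (rGamma (F-A) * rGamma (G-A) * rGamma D * rGamma (1+D-E)) - KD * (rGamma (F-D) * rGamma (G-D) * rGamma A * rGamma (1+A-E)))"
    using four_term[OF S] unfolding sD_def sE_def p_def K0_def KE_def KA_def KD_def .
  have r: "rGamma B * rGamma (1-B) = sin (p * B) / p" "rGamma C * rGamma (1-C) = sin (p * C) / p"
    "rGamma (E-B) * rGamma (1+B-E) = sin (p * (E - B)) / p" "rGamma (E-C) * rGamma (1+C-E) = sin (p * (E - C)) / p"
    "rGamma (F-A) * rGamma (1+A-F) = sin (p * (F - A)) / p" "rGamma (G-A) * rGamma (1+A-G) = sin (p * (G - A)) / p"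
    "rGamma (F-D) * rGamma (1+D-F) = sin (p * (F - D)) / p" "rGamma (G-D) * rGamma (1+D-G) = sin (p * (G - D)) / p"
    by (rule ref; simp)+
  \<comment> \<open>The identity \<open>s1\<close> matches the coefficients of \<open>K0\<close> and
    \<open>s2\<close> those of \<open>KA\<close>. The Saalschuetzian condition enters through
    \<open>F + G - A - D = 1 - (E - B - C)\<close>.\<close>
  have s1: "sin (p * (E - B)) * sin (p * (E - C)) - sin (p * B) * sin (p * C) = sE * sg"
    using sin_sin_diff[of "p * E" "p * B" "p * C"] by (simp add: sE_def sg_def right_diff_distrib)
  have s2: "sin (p * (F - A)) * sin (p * (G - A)) - sin (p * (F - D)) * sin (p * (G - D)) = sg * sD"
  proof -
    have "F + G - A - D = 1 - (E - B - C)" using S by (simp add: algebra_simps)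
    hence "p * F + p * G - p * A - p * D = p - p * (E - B - C)" by (metis mult.right_neutral ring_class.ring_distribs(1) right_diff_distrib)
    moreover have "sin (p - x) = sin x" for x unfolding p_def by (simp add: sin_diff flip: cos_of_real sin_of_real)
    ultimately show ?thesis
      using sin_sin_diff'[of "p * F" "p * A" "p * G" "p * D"] by (simp add: sg_def sD_def right_diff_distrib)
  qed
  have alg: "sE * sD * sg * de * (a * (K0 * (ae * af * ag) + KA * (b * c * d))) =
      q\<^sup>2 * a * (af * ag * sD * eb * ec * (K0 * (ae * be * ce * de) - KE * (a * b * c * d)) - sE * b * c * fd * gd * (KA * (d * de * df * dg) - KD * (a * ae * af * ag)))"
    if R: "sD * (K0 * (b' * c' * ae * de) - KE * (eb * ec * a * d)) = sE * (KA * (fa * ga * d * de) - KD * (fd * gd * a * ae))"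
      and s1: "t3 * t4 - t1 * t2 = sE * sg" and s2: "t5 * t6 - t7 * t8 = sg * sD"
      and r: "b * b' = t1 / q" "c * c' = t2 / q" "eb * be = t3 / q" "ec * ce = t4 / q" "fa * af = t5 / q" "ga * ag = t6 / q" "fd * df = t7 / q" "gd * dg = t8 / q"
      and q: "q \<noteq> 0"
    for sE sD sg K0 KE KA KD a b c d ae af ag be ce de df dg b' c' eb ec fa ga fd gd q t1 t2 t3 t4 t5 t6 t7 t8 :: complex
  proof -
    have r': "t1 = q * (b * b')" "t2 = q * (c * c')" "t3 = q * (eb * be)" "t4 = q * (ec * ce)" "t5 = q * (fa * af)" "t6 = q * (ga * ag)" "t7 = q * (fd * df)" "t8 = q * (gd * dg)"
      using r q by (simp_all add: field_simps)
    have S1: "sE * sg = q\<^sup>2 * (eb * be * ec * ce - b * b' * c * c')" using s1 unfolding r' by (simp add: power2_eq_square algebra_simps)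
    have S2: "sg * sD = q\<^sup>2 * (fa * af * ga * ag - fd * df * gd * dg)" using s2 unfolding r' by (simp add: power2_eq_square algebra_simps)
    have "sE * sD * sg * de * (a * (K0 * (ae * af * ag) + KA * (b * c * d))) =
       (sE * sg) * (sD * de * a * K0 * ae * af * ag) + (sg * sD) * (sE * de * a * KA * b * c * d)" by (simp add: algebra_simps)
    also have "\<dots> = q\<^sup>2 * (eb * be * ec * ce - b * b' * c * c') * (sD * de * a * K0 * ae * af * ag) + q\<^sup>2 * (fa * af * ga * ag - fd * df * gd * dg) * (sE * de * a * KA * b * c * d)"
      unfolding S1 S2 ..
    \<comment> \<open>The difference of both sides is an explicit multiple of the four-term
      relation.\<close>
    also have "\<dots> - q\<^sup>2 * a * (af * ag * sD * eb * ec * (K0 * (ae * be * ce * de) - KE * (a * b * c * d)) - sE * b * c * fd * gd * (KA * (d * de * df * dg) - KD * (a * ae * af * ag)))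
       = q\<^sup>2 * a * af * ag * b * c * (sE * (KA * (fa * ga * d * de) - KD * (fd * gd * a * ae)) - sD * (K0 * (b' * c' * ae * de) - KE * (eb * ec * a * d)))"
      by (simp add: algebra_simps)
    also have "\<dots> = 0" unfolding R by simp
    finally show ?thesis by simp
  qed
  show ?thesis unfolding N L4 L3 sE_def[symmetric] sD_def[symmetric] sg_def[symmetric]
    by (rule alg[OF R s1 s2 r p])
qed

lemma eventually_sin_nonzero:
  assumes "q \<noteq> 0"
  shows "\<forall>\<^sub>F t in at 0. sin (of_real pi * (r + q * t)) \<noteq> (0::complex)"
proof -
  define f where "f = (\<lambda>t. sin (of_real pi * (r + q * t)) :: complex)"
  have "f ((1/2 - r) / q) = sin (of_real (pi/2))" using assms by (simp add: f_def)
  also have "\<dots> = 1" by (simp only: sin_of_real) simp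
  finally have 1: "f ((1/2 - r) / q) \<noteq> 0" by simp
  have "f holomorphic_on UNIV" unfolding f_def by (intro holomorphic_intros)
  from non_zero_neighbour_alt[OF this open_UNIV connected_UNIV UNIV_I UNIV_I 1, of 0]
  show ?thesis by (simp add: f_def)
qed

text \<open>Removes genericity assumptions: the parameters are perturbed along a line on which the
  excluded sines are nonzero near, though perhaps not at, the point of interest.\<close>

lemma holomorphic_eq_at_0:
  fixes f g :: "complex \<Rightarrow> complex"
  assumes "f holomorphic_on UNIV" "g holomorphic_on UNIV" "\<forall>\<^sub>F t in at 0. f t = g t"
  shows "f 0 = g 0"
proof -
  have c: "(h \<longlongrightarrow> h 0) (at 0)" if "h holomorphic_on UNIV" for h :: "complex \<Rightarrow> complex"
    using holomorphic_on_imp_continuous_on[OF that] by (simp add: continuous_on_def)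
  have "(g \<longlongrightarrow> f 0) (at 0)" by (rule Lim_transform_eventually[OF c[OF assms(1)] assms(3)])
  thus ?thesis using c[OF assms(2)] tendsto_unique[of "at (0::complex)"] by fastforce
qed


text \<open>The two-term relation relates \<open>L_3\<close> to \<open>L_4\<close> composed with \<open>X1\<close>; thus \<open>X1\<close> interchanges the two terms of
  \<open>J_entire_eq_L_entire\<close> up to sign factors.\<close>

lemma L_entire_X1:
  assumes S: "E + F + G - A - B - C - D = (1::complex)"
  shows "L_entire A (E-C) (E-B) D E (E+F-B-C) (E+G-B-C) * sin (of_real pi * (D - A)) =
    L_entire A (1+A-E) (1+A-F) (1+A-G) (1+A-D) (1+A-B) (1+A-C) * sin (of_real pi * E)"
proof -
  have sn: "sin (of_real pi * (1 + A - D)) = sin (of_real pi * (D - A))"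
  proof -
    have "of_real pi * (1 + A - D) = of_real pi - of_real pi * (D - A)" by (simp add: algebra_simps)
    thus ?thesis by (simp add: sin_diff flip: cos_of_real sin_of_real)
  qed
  have e: "E+F-B-C - D = 1+A-G" "E+G-B-C - D = 1+A-F" "1+A+(E-C)-E = 1+A-C" "1+A+(E-B)-E = 1+A-B"
    using S by (simp_all add: algebra_simps)
  have "L_entire A D (E-C) (E-B) E (E+F-B-C) (E+G-B-C) * sin (of_real pi * (1 + A - D)) =
    L_entire A (1+A-E) (1+A-G) (1+A-F) (1+A-D) (1+A-C) (1+A-B) * sin (of_real pi * E)"
    using L_entire_swap[of E "E+F-B-C" "E+G-B-C" A D "E-C" "E-B"] S unfolding e by (simp add: algebra_simps)
  thus ?thesis unfolding sn by (metis L_entire_sym)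
qed

text \<open>Under \<open>X1\<close> the quantity \<open>E - B - C\<close> changes sign, and the
  right side of \<open>J_entire_eq_L_entire\<close> changes sign too, because
  \<open>L_entire_X1\<close> exchanges its two terms. The other factors on the left are the same for
  both points.\<close>

lemma J_entire_X1_generic:
  assumes S: "E + F + G - A - B - C - D = (1::complex)"
    and nz: "sin (of_real pi * E) \<noteq> 0" "sin (of_real pi * (D - A)) \<noteq> 0" "sin (of_real pi * (E - B - C)) \<noteq> 0" "sin (of_real pi * (1 + D - E)) \<noteq> 0"
  shows "J_entire A (E-C) (E-B) D E (E+F-B-C) (E+G-B-C) = J_entire A B C D E F G"
proof -
  define p where "p = complex_of_real pi"
  have rg: "rGamma (1+D-E) \<noteq> 0"
    using nz(4) rGamma_reflection_complex[of "1+D-E"] by auto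
  define L4 L3 L4' L3' where "L4 = L_entire A B C D E F G" and "L3 = L_entire A (1+A-E) (1+A-F) (1+A-G) (1+A-D) (1+A-B) (1+A-C)"
    and "L4' = L_entire A (E-C) (E-B) D E (E+F-B-C) (E+G-B-C)"
    and "L3' = L_entire A (1+A-E) (1+A-(E+F-B-C)) (1+A-(E+G-B-C)) (1+A-D) (1+A-(E-C)) (1+A-(E-B))"
  have S': "E + (E+F-B-C) + (E+G-B-C) - A - (E-C) - (E-B) - D = 1" using S by (simp add: algebra_simps)
  have 1: "L4' * sin (p * (D - A)) = L3 * sin (p * E)"
    unfolding L4'_def L3_def p_def by (rule L_entire_X1[OF S])
  have e: "E - (E - B) = B" "E - (E - C) = C" "E + (E+F-B-C) - (E-C) - (E-B) = F" "E + (E+G-B-C) - (E-C) - (E-B) = G"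
    "1 + A - (E+F-B-C) = G - D" "1 + A - (E+G-B-C) = F - D" "E+F-B-C-D = 1+A-G" "E+G-B-C-D = 1+A-F" "C - (E-B) = -(E-B-C)"
    using S by (simp_all add: algebra_simps)
  have 2: "L4 * sin (p * (D - A)) = L3' * sin (p * E)"
    using L_entire_X1[OF S'] unfolding L4_def L3'_def p_def e .
  have J1: "sin (p * E) * sin (p * (D - A)) * sin (p * (E - B - C)) * rGamma (1+D-E) * J_entire A B C D E F G =
    p\<^sup>2 * rGamma A * (rGamma (1+A-F) * rGamma (1+A-G) * sin (p * (D - A)) * rGamma (E-B) * rGamma (E-C) * L4 -
      sin (p * E) * rGamma B * rGamma C * rGamma (F-D) * rGamma (G-D) * L3)"
    unfolding p_def L4_def L3_def by (rule J_entire_eq_L_entire[OF S])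
  have J2: "sin (p * E) * sin (p * (D - A)) * sin (p * (-(E - B - C))) * rGamma (1+D-E) * J_entire A (E-C) (E-B) D E (E+F-B-C) (E+G-B-C) =
    p\<^sup>2 * rGamma A * (rGamma (G-D) * rGamma (F-D) * sin (p * (D - A)) * rGamma C * rGamma B * L4' -
      sin (p * E) * rGamma (E-C) * rGamma (E-B) * rGamma (1+A-G) * rGamma (1+A-F) * L3')"
    using J_entire_eq_L_entire[OF S'] unfolding L4'_def L3'_def p_def e .
  have alg: "sE * sD * sg * r * J' = sE * sD * sg * r * J"
    if "sE * sD * sg * r * J = q * a * (af * ag * sD * eb * ec * l4 - sE * b * c * fd * gd * l3)"
       "sE * sD * (-sg) * r * J' = q * a * (gd * fd * sD * c * b * l4' - sE * ec * eb * ag * af * l3')"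
       "l4' * sD = l3 * sE" "l4 * sD = l3' * sE"
     for sE sD sg r J J' q a af ag eb ec b c fd gd l4 l3 l4' l3' :: complex
  proof -
    have "sE * sD * (-sg) * r * J' = q * a * (gd * fd * c * b * (l4' * sD) - ec * eb * ag * af * (l3' * sE))"
      unfolding that(2) by (simp add: algebra_simps)
    also have "\<dots> = - (q * a * (af * ag * sD * eb * ec * l4 - sE * b * c * fd * gd * l3))"
      unfolding that(3) that(4)[symmetric] by (simp add: algebra_simps)
    finally show ?thesis unfolding that(1)[symmetric] by simp
  qed
  have "sin (p * E) * sin (p * (D - A)) * sin (p * (E - B - C)) * rGamma (1+D-E) * J_entire A (E-C) (E-B) D E (E+F-B-C) (E+G-B-C) =
     sin (p * E) * sin (p * (D - A)) * sin (p * (E - B - C)) * rGamma (1+D-E) * J_entire A B C D E F G"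
    by (rule alg[OF J1 _ 1 2], use J2 in \<open>simp only: mult_minus_right sin_minus\<close>)
  thus ?thesis using nz rg by (simp add: p_def)
qed

theorem J_entire_X1:
  assumes S: "E + F + G - A - B - C - D = (1::complex)"
  shows "J_entire A (E-C) (E-B) D E (E+F-B-C) (E+G-B-C) = J_entire A B C D E F G"
proof -
  \<comment> \<open>Moving \<open>E\<close> and \<open>F\<close> by \<open>t\<close> and
    \<open>D\<close> by \<open>2 t\<close> keeps the Saalschuetzian condition and makes the
    arguments of all four sines nonconstant.\<close>
  define f where "f = (\<lambda>t. J_entire A (E+t-C) (E+t-B) (D+2*t) (E+t) (E+t+(F+t)-B-C) (E+t+G-B-C))"
  define g where "g = (\<lambda>t. J_entire A B C (D+2*t) (E+t) (F+t) G)"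
  have "f 0 = g 0"
  proof (rule holomorphic_eq_at_0)
    show "f holomorphic_on UNIV" "g holomorphic_on UNIV" unfolding f_def g_def
      by (intro holomorphic_intros J_entire_holomorphic; use S in \<open>simp add: algebra_simps\<close>)+
    have "\<forall>\<^sub>F t in at 0. sin (of_real pi * (E + 1 * t)) \<noteq> 0" "\<forall>\<^sub>F t in at 0. sin (of_real pi * ((D - A) + 2 * t)) \<noteq> 0"
      "\<forall>\<^sub>F t in at 0. sin (of_real pi * ((E - B - C) + 1 * t)) \<noteq> 0" "\<forall>\<^sub>F t in at 0. sin (of_real pi * ((1 + D - E) + 1 * t)) \<noteq> 0"
      by (rule eventually_sin_nonzero; simp)+
    thus "\<forall>\<^sub>F t in at 0. f t = g t"
    proof eventually_elim
      case (elim t)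
      have e: "E + 1 * t = E + t" "D - A + 2 * t = D + 2 * t - A" "E - B - C + 1 * t = E + t - B - C" "1 + D - E + 1 * t = 1 + (D + 2*t) - (E + t)" by simp_all
      have "E + t + (F + t) + G - A - B - C - (D + 2 * t) = 1" using S by (simp add: algebra_simps)
      from J_entire_X1_generic[OF this] show ?case using elim unfolding e f_def g_def by blast
    qed
  qed
  thus ?thesis by (simp add: f_def g_def)
qed

text \<open>Adjacent transpositions generate all permutations. The invariant \<open>P\<close>
  carries side conditions, such as the length or genericity of the list, through the intermediate
  lists.\<close>

lemma adjacent_swaps_mset:
  assumes sw: "\<And>us x y vs. P (us @ x # y # vs) \<Longrightarrow> f (us @ x # y # vs) = f (us @ y # x # vs)"
    and P: "\<And>xs ys. mset xs = mset ys \<Longrightarrow> P xs \<Longrightarrow> P ys"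
    and xs: "mset xs = mset ys" "P xs"
  shows "f xs = f ys"
proof -
  have front: "f (us @ x # ys1 @ ys2) = f (us @ ys1 @ x # ys2)" if "P (us @ x # ys1 @ ys2)" for us x ys1 ys2
    using that
  proof (induction ys1 arbitrary: us)
    case (Cons y ys1)
    have "f (us @ x # y # ys1 @ ys2) = f (us @ y # x # ys1 @ ys2)" using sw Cons.prems by simp
    moreover have "P ((us @ [y]) @ x # ys1 @ ys2)" by (rule P[OF _ Cons.prems]) simp
    ultimately show ?case using Cons.IH[of "us @ [y]"] by simp
  qed simp
  have "f (us @ xs) = f (us @ ys)" if "mset xs = mset ys" "P (us @ xs)" for us
    using that
  proof (induction xs arbitrary: us ys)
    case (Cons x xs)
    have "x \<in> set ys" using Cons.prems(1) by (metis list.set_intros(1) set_mset_mset)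
    then obtain ys1 ys2 where ys: "ys = ys1 @ x # ys2" by (meson split_list)
    have m: "mset xs = mset (ys1 @ ys2)" using Cons.prems(1) ys by simp
    have "f ((us @ [x]) @ xs) = f ((us @ [x]) @ (ys1 @ ys2))"
      by (rule Cons.IH[OF m]) (use Cons.prems in simp)
    also have "\<dots> = f (us @ ys)" unfolding ys
      using front[of us x ys1 ys2] P[OF _ Cons.prems(2), of "us @ x # ys1 @ ys2"] m by simp
    finally show ?case by simp
  qed simp
  from this[of "[]"] xs show ?thesis by simp
qed

text \<open>The 0-based lists below hold the coordinates \<open>y1, \<dots>, y6\<close>.\<close>

definition J_sym :: "complex list \<Rightarrow> complex" where
  "J_sym y = (let A = 1/2 + (y!0 + y!1 + y!2 + y!3 + y!4 + y!5) / 2 in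
     J_entire A (A - y!1 - y!2) (A - y!0 - y!2) (A - y!0 - y!1) (1 + y!4 + y!5) (1 + y!3 + y!5) (1 + y!3 + y!4))"

text \<open>Adjacent swaps inside the first three or the last three coordinates merely permute
  \<open>B, C, D\<close> or \<open>E, F, G\<close>. The one swap across the two halves is
  \<open>J_entire_X1\<close>.\<close>

theorem J_sym_mset:
  assumes "mset xs = mset ys" "length xs = 6"
  shows "J_sym xs = J_sym ys"
proof (rule adjacent_swaps_mset[where P = "\<lambda>xs. length xs = 6", OF _ _ assms])
  have sw: "J_sym [y2,y1,y3,y4,y5,y6] = J_sym [y1,y2,y3,y4,y5,y6]" "J_sym [y1,y3,y2,y4,y5,y6] = J_sym [y1,y2,y3,y4,y5,y6]"
    "J_sym [y1,y2,y4,y3,y5,y6] = J_sym [y1,y2,y3,y4,y5,y6]" "J_sym [y1,y2,y3,y5,y4,y6] = J_sym [y1,y2,y3,y4,y5,y6]" "J_sym [y1,y2,y3,y4,y6,y5] = J_sym [y1,y2,y3,y4,y5,y6]"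
    for y1 y2 y3 y4 y5 y6
  proof -
    define A where "A = 1/2 + (y1 + y2 + y3 + y4 + y5 + y6) / 2"
    have A: "1/2 + (y2 + y1 + y3 + y4 + y5 + y6) / 2 = A" "1/2 + (y1 + y3 + y2 + y4 + y5 + y6) / 2 = A" "1/2 + (y1 + y2 + y4 + y3 + y5 + y6) / 2 = A"
       "1/2 + (y1 + y2 + y3 + y5 + y4 + y6) / 2 = A" "1/2 + (y1 + y2 + y3 + y4 + y6 + y5) / 2 = A"
      by (simp_all add: A_def add_ac)
    have J: "J_sym [y1,y2,y3,y4,y5,y6] = J_entire A (A-y2-y3) (A-y1-y3) (A-y1-y2) (1+y5+y6) (1+y4+y6) (1+y4+y5)"
      unfolding J_sym_def by (simp add: A_def Let_def)
    have "J_sym [y2,y1,y3,y4,y5,y6] = J_entire A (A-y1-y3) (A-y2-y3) (A-y2-y1) (1+y5+y6) (1+y4+y6) (1+y4+y5)"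
      unfolding J_sym_def using A by (simp add: Let_def)
    also have "\<dots> = J_entire A (A-y1-y3) (A-y2-y3) (A-y1-y2) (1+y5+y6) (1+y4+y6) (1+y4+y5)" by (simp add: diff_diff_eq add_ac)
    also have "\<dots> = J_sym [y1,y2,y3,y4,y5,y6]" unfolding J by (rule J_entire_sym(1))
    finally show "J_sym [y2,y1,y3,y4,y5,y6] = J_sym [y1,y2,y3,y4,y5,y6]" .
    have "J_sym [y1,y3,y2,y4,y5,y6] = J_entire A (A-y3-y2) (A-y1-y2) (A-y1-y3) (1+y5+y6) (1+y4+y6) (1+y4+y5)"
      unfolding J_sym_def using A by (simp add: Let_def)
    also have "\<dots> = J_entire A (A-y2-y3) (A-y1-y2) (A-y1-y3) (1+y5+y6) (1+y4+y6) (1+y4+y5)" by (simp add: diff_diff_eq add_ac)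
    also have "\<dots> = J_sym [y1,y2,y3,y4,y5,y6]" unfolding J by (rule J_entire_sym(2))
    finally show "J_sym [y1,y3,y2,y4,y5,y6] = J_sym [y1,y2,y3,y4,y5,y6]" .
    have "J_sym [y1,y2,y3,y5,y4,y6] = J_entire A (A-y2-y3) (A-y1-y3) (A-y1-y2) (1+y4+y6) (1+y5+y6) (1+y5+y4)"
      unfolding J_sym_def using A by (simp add: Let_def)
    also have "\<dots> = J_entire A (A-y2-y3) (A-y1-y3) (A-y1-y2) (1+y4+y6) (1+y5+y6) (1+y4+y5)" by (simp add: diff_diff_eq add_ac)
    also have "\<dots> = J_sym [y1,y2,y3,y4,y5,y6]" unfolding J by (rule J_entire_sym(3))
    finally show "J_sym [y1,y2,y3,y5,y4,y6] = J_sym [y1,y2,y3,y4,y5,y6]" .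
    have "J_sym [y1,y2,y3,y4,y6,y5] = J_entire A (A-y2-y3) (A-y1-y3) (A-y1-y2) (1+y6+y5) (1+y4+y5) (1+y4+y6)"
      unfolding J_sym_def using A by (simp add: Let_def)
    also have "\<dots> = J_entire A (A-y2-y3) (A-y1-y3) (A-y1-y2) (1+y5+y6) (1+y4+y5) (1+y4+y6)" by (simp add: diff_diff_eq add_ac)
    also have "\<dots> = J_sym [y1,y2,y3,y4,y5,y6]" unfolding J by (rule J_entire_sym(4))
    finally show "J_sym [y1,y2,y3,y4,y6,y5] = J_sym [y1,y2,y3,y4,y5,y6]" .
    have e: "1+y5+y6 - (A-y1-y3) = A - y2 - y4" "1+y5+y6 - (A-y2-y3) = A - y1 - y4"
        "1+y5+y6 + (1+y4+y6) - (A-y2-y3) - (A-y1-y3) = 1+y3+y6" "1+y5+y6 + (1+y4+y5) - (A-y2-y3) - (A-y1-y3) = 1+y3+y5"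
        "1+y5+y6 + (1+y4+y6) + (1+y4+y5) - A - (A-y2-y3) - (A-y1-y3) - (A-y1-y2) = 1"
      by (simp_all add: A_def field_simps)
    have "J_sym [y1,y2,y4,y3,y5,y6] = J_entire A (A-y2-y4) (A-y1-y4) (A-y1-y2) (1+y5+y6) (1+y3+y6) (1+y3+y5)"
      unfolding J_sym_def using A by (simp add: Let_def)
    also have "\<dots> = J_sym [y1,y2,y3,y4,y5,y6]"
      unfolding J using J_entire_X1[OF e(5)] unfolding e by simp
    finally show "J_sym [y1,y2,y4,y3,y5,y6] = J_sym [y1,y2,y3,y4,y5,y6]" .
  qed
  fix us vs :: "complex list" and x y assume l: "length (us @ x # y # vs) = 6"
  have "length us = 0 \<or> length us = 1 \<or> length us = 2 \<or> length us = 3 \<or> length us = 4"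
  proof -
    have "length us + length vs = 4" using l by simp
    thus ?thesis by linarith
  qed
  thus "J_sym (us @ x # y # vs) = J_sym (us @ y # x # vs)"
    using l by (elim disjE) (auto simp: length_Suc_conv eval_nat_numeral sw)
qed (metis mset_eq_length)


text \<open>Here \<open>d = y4\<close> and \<open>z = [y3, y2, y1, y6, y5]\<close>; in this order the two-term relation is the reversal of the list, and
  \<open>L_sin z\<close> is the denominator \<open>sin (pi E)\<close> of \<open>L\<close>.\<close>

definition L_sym :: "complex \<Rightarrow> complex list \<Rightarrow> complex" where
  "L_sym d z = (let A = 1/2 + (d + z!0 + z!1 + z!2 + z!3 + z!4) / 2 in
     L_entire A (A - z!0 - z!1) (A - z!0 - z!2) (A - z!1 - z!2) (1 + z!3 + z!4) (1 + d + z!3) (1 + d + z!4))"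

definition L_sin :: "complex list \<Rightarrow> complex" where
  "L_sin z = sin (of_real pi * (1 + z!3 + z!4))"

text \<open>The generic case: no sum or difference of two entries is an integer, so every \<open>L_sin\<close> met on the way is nonzero.\<close>

definition cos_distinct :: "complex list \<Rightarrow> bool" where
  "cos_distinct z \<longleftrightarrow> distinct (map (\<lambda>x. cos (of_real (2 * pi) * x)) z)"

section \<open>Signed permutations of the five coordinates of \<open>L\<close>\<close>

lemma sin_add_sin_diff: "2 * (sin (p * (x + y)) * sin (p * (x - y))) = cos (2 * p * y) - cos (2 * p * (x :: complex))"
proof -
  have "p * (x + y) - p * (x - y) = 2 * p * y" "p * (x + y) + p * (x - y) = 2 * p * x" by (simp_all add: algebra_simps)
  thus ?thesis by (simp add: sin_times_sin)
qed

lemma sin_pi_one_plus: "sin (of_real pi * (1 + x)) = - sin (of_real pi * (x::complex))"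
  by (simp add: distrib_left sin_add flip: cos_of_real sin_of_real)

lemma cos_neq_imp_sin_nonzero:
  assumes "cos (of_real (2 * pi) * x) \<noteq> cos (of_real (2 * pi) * (y::complex))"
  shows "sin (of_real pi * (1 + x + y)) \<noteq> 0"
  using sin_add_sin_diff[of "of_real pi" x y] assms sin_pi_one_plus[of "x + y"] by (auto simp: add.assoc)

lemma cos_distinct_mset: "mset xs = mset ys \<Longrightarrow> cos_distinct xs \<Longrightarrow> cos_distinct ys"
  unfolding cos_distinct_def by (metis mset_eq_imp_distinct_iff mset_map)

text \<open>The first three moves permute parameters of \<open>L\<close>. Negating and exchanging
  \<open>z1\<close> and \<open>z2\<close> lowers \<open>A\<close> by \<open>z1 + z2\<close>, which
  turns \<open>A\<close> into the second parameter and conversely. The last move is the two-term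
  relation.\<close>

lemma L_sym_elem:
  "L_sym d [z2,z1,z3,z4,z5] = L_sym d [z1,z2,z3,z4,z5]" "L_sym d [z1,z3,z2,z4,z5] = L_sym d [z1,z2,z3,z4,z5]"
  "L_sym d [z1,z2,z3,z5,z4] = L_sym d [z1,z2,z3,z4,z5]" "L_sym d [-z2,-z1,z3,z4,z5] = L_sym d [z1,z2,z3,z4,z5]"
  "L_sym d [z1,z2,z3,z4,z5] * sin (of_real pi * (1 + z1 + z2)) = L_sym d [z5,z4,z3,z2,z1] * sin (of_real pi * (1 + z4 + z5))"
proof -
  define A where "A = 1/2 + (d + z1 + z2 + z3 + z4 + z5) / 2"
  have A: "1/2 + (d + z2 + z1 + z3 + z4 + z5) / 2 = A" "1/2 + (d + z1 + z3 + z2 + z4 + z5) / 2 = A" "1/2 + (d + z1 + z2 + z3 + z5 + z4) / 2 = A"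
     "1/2 + (d + z5 + z4 + z3 + z2 + z1) / 2 = A" "1/2 + (d + -z2 + -z1 + z3 + z4 + z5) / 2 = A - z1 - z2"
    by (simp_all add: A_def field_simps)
  have L: "L_sym d [z1,z2,z3,z4,z5] = L_entire A (A-z1-z2) (A-z1-z3) (A-z2-z3) (1+z4+z5) (1+d+z4) (1+d+z5)"
    unfolding L_sym_def by (simp add: A_def Let_def)
  have "L_sym d [z2,z1,z3,z4,z5] = L_entire A (A-z2-z1) (A-z2-z3) (A-z1-z3) (1+z4+z5) (1+d+z4) (1+d+z5)"
    unfolding L_sym_def using A by (simp add: Let_def)
  also have "\<dots> = L_entire A (A-z1-z2) (A-z2-z3) (A-z1-z3) (1+z4+z5) (1+d+z4) (1+d+z5)" by (simp add: diff_diff_eq add_ac)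
  also have "\<dots> = L_sym d [z1,z2,z3,z4,z5]" unfolding L by (rule L_entire_sym(3))
  finally show "L_sym d [z2,z1,z3,z4,z5] = L_sym d [z1,z2,z3,z4,z5]" .
  have "L_sym d [z1,z3,z2,z4,z5] = L_entire A (A-z1-z3) (A-z1-z2) (A-z3-z2) (1+z4+z5) (1+d+z4) (1+d+z5)"
    unfolding L_sym_def using A by (simp add: Let_def)
  also have "\<dots> = L_entire A (A-z1-z3) (A-z1-z2) (A-z2-z3) (1+z4+z5) (1+d+z4) (1+d+z5)" by (simp add: diff_diff_eq add_ac)
  also have "\<dots> = L_sym d [z1,z2,z3,z4,z5]" unfolding L by (rule L_entire_sym(2))
  finally show "L_sym d [z1,z3,z2,z4,z5] = L_sym d [z1,z2,z3,z4,z5]" .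
  have "L_sym d [z1,z2,z3,z5,z4] = L_entire A (A-z1-z2) (A-z1-z3) (A-z2-z3) (1+z5+z4) (1+d+z5) (1+d+z4)"
    unfolding L_sym_def using A by (simp add: Let_def)
  also have "\<dots> = L_entire A (A-z1-z2) (A-z1-z3) (A-z2-z3) (1+z4+z5) (1+d+z5) (1+d+z4)" by (simp add: add_ac)
  also have "\<dots> = L_sym d [z1,z2,z3,z4,z5]" unfolding L by (rule L_entire_sym(4))
  finally show "L_sym d [z1,z2,z3,z5,z4] = L_sym d [z1,z2,z3,z4,z5]" .
  have "L_sym d [-z2,-z1,z3,z4,z5] = L_entire (A-z1-z2) (A-z1-z2 + z2 + z1) (A-z1-z2 + z2 - z3) (A-z1-z2 + z1 - z3) (1+z4+z5) (1+d+z4) (1+d+z5)"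
    unfolding L_sym_def using A(5) by (simp add: Let_def)
  also have "\<dots> = L_entire (A-z1-z2) A (A-z1-z3) (A-z2-z3) (1+z4+z5) (1+d+z4) (1+d+z5)" by simp
  also have "\<dots> = L_sym d [z1,z2,z3,z4,z5]" unfolding L by (rule L_entire_sym(1))
  finally show "L_sym d [-z2,-z1,z3,z4,z5] = L_sym d [z1,z2,z3,z4,z5]" .
  have S: "(1+z4+z5) + (1+d+z4) + (1+d+z5) - A - (A-z1-z2) - (A-z1-z3) - (A-z2-z3) = 1" by (simp add: A_def field_simps)
  have e: "1 + A - (A-z1-z2) = 1 + z1 + z2" "1+d+z4 - (A-z1-z2) = A - z5 - z3" "1+d+z5 - (A-z1-z2) = A - z4 - z3" "1+A+(A-z1-z3)-(1+z4+z5) = 1+d+z2"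
     "1+A+(A-z2-z3)-(1+z4+z5) = 1+d+z1" "1+A-(1+z4+z5) = A-z4-z5"
    by (simp_all add: A_def field_simps)
  have "L_sym d [z5,z4,z3,z2,z1] = L_entire A (A-z5-z4) (A-z5-z3) (A-z4-z3) (1+z2+z1) (1+d+z2) (1+d+z1)"
    unfolding L_sym_def using A by (simp add: Let_def)
  also have "\<dots> = L_entire A (A-z4-z5) (A-z5-z3) (A-z4-z3) (1+z1+z2) (1+d+z2) (1+d+z1)" by (simp add: diff_diff_eq add_ac)
  finally show "L_sym d [z1,z2,z3,z4,z5] * sin (of_real pi * (1 + z1 + z2)) = L_sym d [z5,z4,z3,z2,z1] * sin (of_real pi * (1 + z4 + z5))"
    using L_entire_swap[OF S] unfolding L e by simp
qed

definition L_quot :: "complex \<Rightarrow> complex list \<Rightarrow> complex" where "L_quot d z = L_sym d z / L_sin z"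

lemma L_quot_mset:
  assumes "mset xs = mset ys" "length xs = 5" "cos_distinct xs"
  shows "L_quot d xs = L_quot d ys"
proof (rule adjacent_swaps_mset[where P = "\<lambda>xs. length xs = 5 \<and> cos_distinct xs", OF _ _ assms(1)])
  have rev: "L_quot d [z1,z2,z3,z4,z5] = L_quot d [z5,z4,z3,z2,z1]" if "cos_distinct [z1,z2,z3,z4,z5]" for z1 z2 z3 z4 z5
    using L_sym_elem(5)[of d z1 z2 z3 z4 z5] that cos_neq_imp_sin_nonzero[of z1 z2] cos_neq_imp_sin_nonzero[of z4 z5]
    by (simp add: L_quot_def L_sin_def cos_distinct_def add_ac frac_eq_eq)
  have sw: "L_quot d [z1,z2,z3,z4,z5] = L_quot d [z2,z1,z3,z4,z5]" "L_quot d [z1,z2,z3,z4,z5] = L_quot d [z1,z3,z2,z4,z5]"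
    "L_quot d [z1,z2,z3,z4,z5] = L_quot d [z1,z2,z3,z5,z4]" for z1 z2 z3 z4 z5
    using L_sym_elem(1-3)[of d] by (simp_all add: L_quot_def L_sin_def add_ac)
  \<comment> \<open>The missing adjacent swap is the swap of the second and third entry conjugated
    by the reversal.\<close>
  have sw4: "L_quot d [z1,z2,z3,z4,z5] = L_quot d [z1,z2,z4,z3,z5]" if "cos_distinct [z1,z2,z3,z4,z5]" for z1 z2 z3 z4 z5
  proof -
    have "L_quot d [z1,z2,z3,z4,z5] = L_quot d [z5,z4,z3,z2,z1]" by (rule rev[OF that])
    also have "\<dots> = L_quot d [z5,z3,z4,z2,z1]" by (rule sw(2))
    also have "\<dots> = L_quot d [z1,z2,z4,z3,z5]" by (rule rev, rule cos_distinct_mset[OF _ that]) simp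
    finally show ?thesis .
  qed
  fix us vs :: "complex list" and x y assume l: "length (us @ x # y # vs) = 5 \<and> cos_distinct (us @ x # y # vs)"
  have "length us = 0 \<or> length us = 1 \<or> length us = 2 \<or> length us = 3"
  proof -
    have "length us + length vs = 3" using l by simp
    thus ?thesis by linarith
  qed
  thus "L_quot d (us @ x # y # vs) = L_quot d (us @ y # x # vs)"
    using l by (elim disjE) (auto simp: length_Suc_conv eval_nat_numeral intro: sw sw4)
qed (use assms cos_distinct_mset mset_eq_length in metis)+


lemma L_quot_neg_pair:
  assumes "mset xs = {#x, y#} + M" "mset ys = {#-x, -y#} + M" "length xs = 5" "cos_distinct xs"
  shows "L_quot d xs = L_quot d ys"
proof -
  obtain l where l: "mset l = M" using ex_mset by blast
  have x: "mset xs = mset (x # y # l)" using assms(1) l by simp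
  hence len: "length l = 3" using assms(3) mset_eq_length[OF x] by simp
  then obtain a b c where abc: "l = [a,b,c]" by (auto simp: length_Suc_conv eval_nat_numeral)
  have g: "cos_distinct (x # y # l)" by (rule cos_distinct_mset[OF x assms(4)])
  hence g': "cos_distinct (-y # -x # l)" by (auto simp: cos_distinct_def)
  have "L_quot d xs = L_quot d (x # y # l)" by (rule L_quot_mset[OF x assms(3,4)])
  also have "\<dots> = L_quot d (-y # -x # l)" using L_sym_elem(4)[of d y x a b c] by (simp add: abc L_quot_def L_sin_def)
  also have "\<dots> = L_quot d ys" by (rule L_quot_mset) (use assms(2) l len g' in auto)
  finally show ?thesis .
qed

text \<open>The nontrivial even sign patterns on five entries are ten with two minus signs and five
  with four; the latter are composed of two of the former.\<close>

lemma L_quot_signs: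
  assumes e: "\<And>i. i < 5 \<Longrightarrow> \<eta> i = 1 \<or> \<eta> i = (-1::complex)" "(\<Prod>i<5. \<eta> i) = 1" and g: "cos_distinct (map z [0..<5])"
  shows "L_quot d (map (\<lambda>i. \<eta> i * z i) [0..<5]) = L_quot d (map z [0..<5])"
proof -
  have u: "[0..<5] = [0,1,2,3,4::nat]" by (simp add: upt_rec)
  have g5: "cos_distinct [z 0, z 1, z 2, z 3, z 4]" using g by (simp add: u)
  have gs: "cos_distinct [a * z 0, b * z 1, c * z 2, d' * z 3, e' * z 4]"
    if "a \<in> {1,-1}" "b \<in> {1,-1}" "c \<in> {1,-1}" "d' \<in> {1,-1}" "e' \<in> {1,-1}" for a b c d' e'
    using that g5 by (auto simp: cos_distinct_def)
  have two: "L_quot d xs = L_quot d ys" if "mset ys = {#-x,-y#} + M" "mset xs = {#x,y#} + M" "length xs = 5" "cos_distinct xs" for xs ys x y M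
    using L_quot_neg_pair that by blast
  have p: "\<eta> 0 * \<eta> 1 * \<eta> 2 * \<eta> 3 * \<eta> 4 = 1" using e(2) by (simp add: eval_nat_numeral lessThan_Suc mult_ac)
  define s where "s = (\<lambda>i. \<eta> i = -1)"
  have eta: "\<eta> i = (if s i then -1 else 1)" if "i < 5" for i using e(1)[OF that] by (auto simp: s_def)
  have L2: "L_quot d [-a,-b,c,d',e'] = L_quot d [a,b,c,d',e']" "L_quot d [-a,b,-c,d',e'] = L_quot d [a,b,c,d',e']"
    "L_quot d [-a,b,c,-d',e'] = L_quot d [a,b,c,d',e']" "L_quot d [-a,b,c,d',-e'] = L_quot d [a,b,c,d',e']"
    "L_quot d [a,-b,-c,d',e'] = L_quot d [a,b,c,d',e']" "L_quot d [a,-b,c,-d',e'] = L_quot d [a,b,c,d',e']"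
    "L_quot d [a,-b,c,d',-e'] = L_quot d [a,b,c,d',e']" "L_quot d [a,b,-c,-d',e'] = L_quot d [a,b,c,d',e']"
    "L_quot d [a,b,-c,d',-e'] = L_quot d [a,b,c,d',e']" "L_quot d [a,b,c,-d',-e'] = L_quot d [a,b,c,d',e']"
    if c5: "cos_distinct [a,b,c,d',e']" for a b c d' e'
  proof -
    show "L_quot d [-a,-b,c,d',e'] = L_quot d [a,b,c,d',e']" by (rule two[symmetric, of _ a b "{#c,d',e'#}", OF _ _ _ c5]) auto
    show "L_quot d [-a,b,-c,d',e'] = L_quot d [a,b,c,d',e']" by (rule two[symmetric, of _ a c "{#b,d',e'#}", OF _ _ _ c5]) auto
    show "L_quot d [-a,b,c,-d',e'] = L_quot d [a,b,c,d',e']" by (rule two[symmetric, of _ a d' "{#b,c,e'#}", OF _ _ _ c5]) auto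
    show "L_quot d [-a,b,c,d',-e'] = L_quot d [a,b,c,d',e']" by (rule two[symmetric, of _ a e' "{#b,c,d'#}", OF _ _ _ c5]) auto
    show "L_quot d [a,-b,-c,d',e'] = L_quot d [a,b,c,d',e']" by (rule two[symmetric, of _ b c "{#a,d',e'#}", OF _ _ _ c5]) auto
    show "L_quot d [a,-b,c,-d',e'] = L_quot d [a,b,c,d',e']" by (rule two[symmetric, of _ b d' "{#a,c,e'#}", OF _ _ _ c5]) auto
    show "L_quot d [a,-b,c,d',-e'] = L_quot d [a,b,c,d',e']" by (rule two[symmetric, of _ b e' "{#a,c,d'#}", OF _ _ _ c5]) auto
    show "L_quot d [a,b,-c,-d',e'] = L_quot d [a,b,c,d',e']" by (rule two[symmetric, of _ c d' "{#a,b,e'#}", OF _ _ _ c5]) auto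
    show "L_quot d [a,b,-c,d',-e'] = L_quot d [a,b,c,d',e']" by (rule two[symmetric, of _ c e' "{#a,b,d'#}", OF _ _ _ c5]) auto
    show "L_quot d [a,b,c,-d',-e'] = L_quot d [a,b,c,d',e']" by (rule two[symmetric, of _ d' e' "{#a,b,c#}", OF _ _ _ c5]) auto
  qed
  have L4: "L_quot d [-a,-b,-c,-d',e'] = L_quot d [a,b,c,d',e']" "L_quot d [-a,-b,-c,d',-e'] = L_quot d [a,b,c,d',e']"
    "L_quot d [-a,-b,c,-d',-e'] = L_quot d [a,b,c,d',e']" "L_quot d [-a,b,-c,-d',-e'] = L_quot d [a,b,c,d',e']"
    "L_quot d [a,-b,-c,-d',-e'] = L_quot d [a,b,c,d',e']"
    if c5: "cos_distinct [a,b,c,d',e']" for a b c d' e'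
  proof -
    have c': "cos_distinct [a,b,-c,-d',e']" "cos_distinct [a,b,-c,d',-e']" "cos_distinct [a,b,c,-d',-e']" using c5 by (auto simp: cos_distinct_def)
    show "L_quot d [-a,-b,-c,-d',e'] = L_quot d [a,b,c,d',e']" using L2(1)[OF c'(1)] L2(8)[OF c5] by simp
    show "L_quot d [-a,-b,-c,d',-e'] = L_quot d [a,b,c,d',e']" using L2(1)[OF c'(2)] L2(9)[OF c5] by simp
    show "L_quot d [-a,-b,c,-d',-e'] = L_quot d [a,b,c,d',e']" using L2(1)[OF c'(3)] L2(10)[OF c5] by simp
    show "L_quot d [-a,b,-c,-d',-e'] = L_quot d [a,b,c,d',e']" using L2(2)[OF c'(3)] L2(10)[OF c5] by simp
    show "L_quot d [a,-b,-c,-d',-e'] = L_quot d [a,b,c,d',e']" using L2(5)[OF c'(3)] L2(10)[OF c5] by simp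
  qed
  show ?thesis
    using p eta[of 0] eta[of 1] eta[of 2] eta[of 3] eta[of 4] L2[OF g5] L4[OF g5]
    by (simp add: u split: if_splits)
qed

lemma L_sym_holomorphic:
  assumes "\<And>i. i < 5 \<Longrightarrow> (\<lambda>t. z t i) holomorphic_on UNIV"
  shows "(\<lambda>t. L_sym d (map (z t) [0..<5])) holomorphic_on UNIV" "(\<lambda>t. L_sin (map (z t) [0..<5])) holomorphic_on UNIV"
proof -
  have u: "[0..<5] = [0,1,2,3,4::nat]" by (simp add: upt_rec)
  have "(\<lambda>t. L_sym d [z t 0, z t 1, z t 2, z t 3, z t 4]) holomorphic_on UNIV"
    unfolding L_sym_def Let_def
    by (simp, intro holomorphic_intros L_entire_holomorphic assms) (auto simp: field_simps)
  thus "(\<lambda>t. L_sym d (map (z t) [0..<5])) holomorphic_on UNIV" by (simp add: u)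
  have "(\<lambda>t. L_sin [z t 0, z t 1, z t 2, z t 3, z t 4]) holomorphic_on UNIV"
    unfolding L_sin_def by (simp, intro holomorphic_intros assms) auto
  thus "(\<lambda>t. L_sin (map (z t) [0..<5])) holomorphic_on UNIV" by (simp add: u)
qed

text \<open>Cross multiplied because \<open>L_sin\<close> may vanish for special \<open>z\<close>.
  For generic \<open>z\<close> it is an equality of quotients; the general case is a limit of
  generic ones.\<close>

theorem L_sym_signed_perm:
  assumes p: "\<pi> permutes {..<5}" and e: "\<And>i. i < 5 \<Longrightarrow> \<eta> i = 1 \<or> \<eta> i = (-1::complex)" "(\<Prod>i<5. \<eta> i) = 1"
  shows "L_sym d (map (\<lambda>i. \<eta> i * z (\<pi> i)) [0..<5]) * L_sin (map z [0..<5]) =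
     L_sym d (map z [0..<5]) * L_sin (map (\<lambda>i. \<eta> i * z (\<pi> i)) [0..<5])"
proof -
  have u: "[0..<5] = [0,1,2,3,4::nat]" by (simp add: upt_rec)
  have gen: "L_sym d (map (\<lambda>i. \<eta> i * z (\<pi> i)) [0..<5]) * L_sin (map z [0..<5]) =
     L_sym d (map z [0..<5]) * L_sin (map (\<lambda>i. \<eta> i * z (\<pi> i)) [0..<5])" if g: "cos_distinct (map z [0..<5])" for z
  proof -
    have m: "mset (map (\<lambda>i. z (\<pi> i)) [0..<5]) = mset (map z [0..<5])"
    proof -
      have "image_mset \<pi> (mset [0..<5]) = mset [0..<5]"
      proof -
        have "image_mset \<pi> (mset_set {..<5}) = mset_set {..<5}"
          using permutes_image[OF p] permutes_inj_on[OF p] by (subst image_mset_mset_set) auto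
        thus ?thesis by (metis atLeast0LessThan mset_upt)
      qed
      hence "image_mset z (image_mset \<pi> (mset [0..<5])) = image_mset z (mset [0..<5])" by simp
      thus ?thesis by (simp add: multiset.map_comp o_def)
    qed
    have g': "cos_distinct (map (\<lambda>i. z (\<pi> i)) [0..<5])" by (rule cos_distinct_mset[OF m[symmetric] g])
    have "L_quot d (map (\<lambda>i. \<eta> i * z (\<pi> i)) [0..<5]) = L_quot d (map (\<lambda>i. z (\<pi> i)) [0..<5])"
      by (rule L_quot_signs[OF e g'])
    also have "\<dots> = L_quot d (map z [0..<5])" by (rule L_quot_mset[OF m _ g']) simp
    finally have L: "L_quot d (map (\<lambda>i. \<eta> i * z (\<pi> i)) [0..<5]) = L_quot d (map z [0..<5])" .
    have nz: "L_sin w \<noteq> 0" if "cos_distinct w" "length w = 5" for w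
    proof -
      obtain a b c d' e' where w: "w = [a,b,c,d',e']" using \<open>length w = 5\<close> by (auto simp: length_Suc_conv eval_nat_numeral)
      show ?thesis using cos_neq_imp_sin_nonzero[of d' e'] that(1) by (auto simp: w L_sin_def cos_distinct_def)
    qed
    have "cos_distinct (map (\<lambda>i. \<eta> i * z (\<pi> i)) [0..<5])"
    proof -
      have "map (\<lambda>x. cos (of_real (2 * pi) * x)) (map (\<lambda>i. \<eta> i * z (\<pi> i)) [0..<5]) = map (\<lambda>x. cos (of_real (2 * pi) * x)) (map (\<lambda>i. z (\<pi> i)) [0..<5])"
        using e(1) by (fastforce simp: list_eq_iff_nth_eq)
      thus ?thesis using g' unfolding cos_distinct_def by (simp only:)
    qed
    from nz[OF this] nz[OF g] L show ?thesis by (simp add: L_quot_def frac_eq_eq)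
  qed
  \<comment> \<open>The slopes 1 to 5 are positive and distinct, so every sum and every difference
    of two entries is a nonconstant function of \<open>t\<close>.\<close>
  define zt where "zt = (\<lambda>t i. z i + of_nat (i + 1) * (t::complex))"
  have "L_sym d (map (\<lambda>i. \<eta> i * zt 0 (\<pi> i)) [0..<5]) * L_sin (map (zt 0) [0..<5]) =
     L_sym d (map (zt 0) [0..<5]) * L_sin (map (\<lambda>i. \<eta> i * zt 0 (\<pi> i)) [0..<5])"
  proof (rule holomorphic_eq_at_0[where f = "\<lambda>t. L_sym d (map (\<lambda>i. \<eta> i * zt t (\<pi> i)) [0..<5]) * L_sin (map (zt t) [0..<5])" and
       g = "\<lambda>t. L_sym d (map (zt t) [0..<5]) * L_sin (map (\<lambda>i. \<eta> i * zt t (\<pi> i)) [0..<5])"])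
    show "(\<lambda>t. L_sym d (map (\<lambda>i. \<eta> i * zt t (\<pi> i)) [0..<5]) * L_sin (map (zt t) [0..<5])) holomorphic_on UNIV"
      "(\<lambda>t. L_sym d (map (zt t) [0..<5]) * L_sin (map (\<lambda>i. \<eta> i * zt t (\<pi> i)) [0..<5])) holomorphic_on UNIV"
      unfolding zt_def by (intro holomorphic_intros L_sym_holomorphic)+
    have "\<forall>\<^sub>F t in at 0. \<forall>p\<in>{..<5}\<times>{..<5}. fst p < snd p \<longrightarrow> cos (of_real (2 * pi) * zt t (fst p)) \<noteq> cos (of_real (2 * pi) * zt t (snd p))"
    proof (intro eventually_ball_finite finite_cartesian_product finite_lessThan ballI)
      fix p :: "nat \<times> nat"
      show "\<forall>\<^sub>F t in at 0. fst p < snd p \<longrightarrow> cos (of_real (2 * pi) * zt t (fst p)) \<noteq> cos (of_real (2 * pi) * zt t (snd p))"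
      proof (cases "fst p < snd p")
        case True
        define i j where "i = fst p" and "j = snd p"
        have ij: "i < j" using True by (simp add: i_def j_def)
        have "of_nat (i + 1) + of_nat (j + 1) \<noteq> (0::complex)" unfolding of_nat_add[symmetric] of_nat_eq_0_iff by simp
        moreover have "of_nat (i + 1) - of_nat (j + 1) \<noteq> (0::complex)" using ij by simp
        ultimately have "\<forall>\<^sub>F t in at 0. sin (of_real pi * ((z i + z j) + (of_nat (i + 1) + of_nat (j + 1)) * t)) \<noteq> 0"
            "\<forall>\<^sub>F t in at 0. sin (of_real pi * ((z i - z j) + (of_nat (i + 1) - of_nat (j + 1)) * t)) \<noteq> 0"
          by (auto intro!: eventually_sin_nonzero simp del: of_nat_add of_nat_Suc)
        hence "\<forall>\<^sub>F t in at 0. cos (of_real (2 * pi) * zt t i) \<noteq> cos (of_real (2 * pi) * zt t j)"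
        proof eventually_elim
          case (elim t)
          have s: "z i + z j + (of_nat (i + 1) + of_nat (j + 1)) * t = zt t i + zt t j" "z i - z j + (of_nat (i + 1) - of_nat (j + 1)) * t = zt t i - zt t j"
            by (simp_all add: zt_def algebra_simps)
          show ?case using elim sin_add_sin_diff[of "of_real pi" "zt t i" "zt t j"] unfolding s by auto
        qed
        thus ?thesis by (simp add: i_def j_def)
      qed simp
    qed
    thus "\<forall>\<^sub>F t in at 0. L_sym d (map (\<lambda>i. \<eta> i * zt t (\<pi> i)) [0..<5]) * L_sin (map (zt t) [0..<5]) =
       L_sym d (map (zt t) [0..<5]) * L_sin (map (\<lambda>i. \<eta> i * zt t (\<pi> i)) [0..<5])"
    proof eventually_elim
      case (elim t)
      show ?case
      proof (rule gen)
        have "cos (of_real (2 * pi) * zt t i) \<noteq> cos (of_real (2 * pi) * zt t j)" if "i < j" "j < 5" for i j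
          using elim[rule_format, of "(i,j)"] that by auto
        thus "cos_distinct (map (zt t) [0..<5])"
          unfolding cos_distinct_def distinct_conv_nth by (auto simp: neq_iff) (metis)+
      qed
    qed
  qed
  thus ?thesis by (simp add: zt_def)
qed

section \<open>The action of H on W\<close>

no_notation fps_nth (infixl "$" 75)

lemma exhaust_8: "(x::8) = 1 \<or> x = 2 \<or> x = 3 \<or> x = 4 \<or> x = 5 \<or> x = 6 \<or> x = 7 \<or> x = 8"
proof (induct x)
  case (of_int z)
  then have "0 \<le> z" "z < 8" by simp_all
  then have "z = 0 \<or> z = 1 \<or> z = 2 \<or> z = 3 \<or> z = 4 \<or> z = 5 \<or> z = 6 \<or> z = 7" by arith
  then show ?case by auto
qed

lemma UNIV_8: "(UNIV::8 set) = {1,2,3,4,5,6,7,8}"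
proof (rule set_eqI)
  fix x :: 8
  show "x \<in> UNIV \<longleftrightarrow> x \<in> {1,2,3,4,5,6,7,8}"
    using exhaust_8[of x] by (simp only: insert_iff empty_iff simp_thms UNIV_I)
qed

lemma n8_simps [simp]: "n8 1 = 1" "n8 2 = 2" "n8 3 = 3" "n8 4 = 4" "n8 5 = 5" "n8 6 = 6" "n8 7 = 7" "n8 8 = 8" "n8 0 = 8"
  by (simp_all add: n8_def)

lemma vec8_eqI:
  assumes "(x::'a^8)$1 = y$1" "x$2 = y$2" "x$3 = y$3" "x$4 = y$4" "x$5 = y$5" "x$6 = y$6" "x$7 = y$7" "x$8 = y$8"
  shows "x = y"
  unfolding vec_eq_iff
proof
  fix i :: 8
  show "x$i = y$i" using exhaust_8[of i] by (elim disjE) (simp_all only: assms)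
qed

lemma mk8_mult_vec: "(mk8 f *v w) $ i = f (n8 i) 1 * w$1 + f (n8 i) 2 * w$2 + f (n8 i) 3 * w$3 + f (n8 i) 4 * w$4 +
   f (n8 i) 5 * w$5 + f (n8 i) 6 * w$6 + f (n8 i) 7 * w$7 + f (n8 i) 8 * w$8"
proof -
  have "sum F (UNIV :: 8 set) = F 1 + F 2 + F 3 + F 4 + F 5 + F 6 + F 7 + F 8" for F :: "8 \<Rightarrow> complex"
    unfolding UNIV_8 by (simp add: add.assoc)
  thus ?thesis by (simp add: matrix_vector_mult_def mk8_def)
qed

lemma vec8_nth [simp]: "vec8 f $ i = f (n8 i)" by (simp add: vec8_def)

text \<open>The inverse of \<open>Y\<close>, the only generator of \<open>H\<close> that is not an
  involution.\<close>

definition Yinv :: "complex^8^8" where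
  "Yinv = mk8 (\<lambda>i j. if i = 1 then (if j = 1 then -1 else if j = 3 then 2 else 0)
                    else if i = 2 then (if j = 3 then 1 else 0)
                    else if i = 3 then (if j = 1 then -1 else if j = 2 then 1 else if j = 3 then 1 else 0)
                    else (if j = 1 then -1 else if j = 3 then 1 else if j = i then 1 else 0))"

lemma Ymat_nth:
  "(Ymat *v w)$1 = - w$1 + 2 * w$2" "(Ymat *v w)$2 = - w$1 + w$2 + w$3" "(Ymat *v w)$3 = w$2"
  "(Ymat *v w)$4 = - w$1 + w$2 + w$4" "(Ymat *v w)$5 = - w$1 + w$2 + w$5" "(Ymat *v w)$6 = - w$1 + w$2 + w$6"
  "(Ymat *v w)$7 = - w$1 + w$2 + w$7" "(Ymat *v w)$8 = - w$1 + w$2 + w$8"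
  unfolding Ymat_def mk8_mult_vec by simp_all

lemma Yinv_nth:
  "(Yinv *v w)$1 = - w$1 + 2 * w$3" "(Yinv *v w)$2 = w$3" "(Yinv *v w)$3 = - w$1 + w$2 + w$3"
  "(Yinv *v w)$4 = - w$1 + w$3 + w$4" "(Yinv *v w)$5 = - w$1 + w$3 + w$5" "(Yinv *v w)$6 = - w$1 + w$3 + w$6"
  "(Yinv *v w)$7 = - w$1 + w$3 + w$7" "(Yinv *v w)$8 = - w$1 + w$3 + w$8"
  unfolding Yinv_def mk8_mult_vec by simp_all

text \<open>\<open>X\<close> adds one and the same quantity to the entries 1, 3, 4 and 5. On
  \<open>W\<close> this quantity is \<open>1 + a - c - d - e\<close>.\<close>

definition X_shift :: "complex^8 \<Rightarrow> complex" where
  "X_shift w = (- w$1 + w$2 - w$3 - w$4 - w$5 + w$6 + w$7 + w$8) / 2"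

lemma Xmat_nth:
  "(Xmat *v w)$1 = w$1 + X_shift w" "(Xmat *v w)$2 = w$2" "(Xmat *v w)$3 = w$3 + X_shift w"
  "(Xmat *v w)$4 = w$4 + X_shift w" "(Xmat *v w)$5 = w$5 + X_shift w" "(Xmat *v w)$6 = w$6"
  "(Xmat *v w)$7 = w$7" "(Xmat *v w)$8 = w$8"
  unfolding Xmat_def mk8_mult_vec X_shift_def by (simp_all add: field_simps)

lemma swap8_nth:
  "(swap8 2 3 *v w) = vec8 (\<lambda>k. [w$1, w$3, w$2, w$4, w$5, w$6, w$7, w$8] ! (k-1))"
  "(swap8 3 4 *v w) = vec8 (\<lambda>k. [w$1, w$2, w$4, w$3, w$5, w$6, w$7, w$8] ! (k-1))"
  "(swap8 4 5 *v w) = vec8 (\<lambda>k. [w$1, w$2, w$3, w$5, w$4, w$6, w$7, w$8] ! (k-1))"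
  "(swap8 5 6 *v w) = vec8 (\<lambda>k. [w$1, w$2, w$3, w$4, w$6, w$5, w$7, w$8] ! (k-1))"
  "(swap8 6 7 *v w) = vec8 (\<lambda>k. [w$1, w$2, w$3, w$4, w$5, w$7, w$6, w$8] ! (k-1))"
  "(swap8 7 8 *v w) = vec8 (\<lambda>k. [w$1, w$2, w$3, w$4, w$5, w$6, w$8, w$7] ! (k-1))"
  "(swap8 2 7 *v w) = vec8 (\<lambda>k. [w$1, w$7, w$3, w$4, w$5, w$6, w$2, w$8] ! (k-1))"
  by (rule vec8_eqI; simp add: swap8_def mk8_mult_vec tr_def)+

abbreviation Hgens :: "(complex^8^8) set" where
  "Hgens \<equiv> {swap8 2 3, swap8 3 4, swap8 4 5, swap8 5 6, swap8 6 7, swap8 7 8, Xmat, Ymat}"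
abbreviation Ggens :: "(complex^8^8) set" where
  "Ggens \<equiv> {swap8 3 4, swap8 4 5, swap8 5 6, swap8 6 7, swap8 7 8, Xmat}"

lemma matrix_inv_eqI:
  fixes A B :: "complex^'n^'n"
  assumes "\<And>w. A *v (B *v w) = w" "\<And>w. B *v (A *v w) = w"
  shows "matrix_inv A = B"
proof -
  have AB: "A ** B = mat 1" "B ** A = mat 1"
    by (simp_all add: matrix_eq assms matrix_vector_mul_assoc[symmetric])
  hence "\<exists>B. A ** B = mat 1 \<and> B ** A = mat 1" by blast
  from someI_ex[OF this] have M: "A ** matrix_inv A = mat 1" unfolding matrix_inv_def by blast
  have "matrix_inv A = (B ** A) ** matrix_inv A" by (simp only: AB matrix_mul_lid)
  also have "\<dots> = B" by (simp only: matrix_mul_assoc[symmetric] M matrix_mul_rid)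
  finally show ?thesis .
qed

lemma swap8_involution: "s \<in> Hgens - {Ymat} \<Longrightarrow> s *v (s *v w) = w"
  by (elim DiffE insertE; rule vec8_eqI) (simp_all add: swap8_nth Xmat_nth X_shift_def field_simps)

lemma Ymat_inverse: "Ymat *v (Yinv *v w) = w" "Yinv *v (Ymat *v w) = w"
  by (rule vec8_eqI; simp add: Ymat_nth Yinv_nth)+

lemma matrix_inv_gens: "s \<in> Hgens - {Ymat} \<Longrightarrow> matrix_inv s = s" "matrix_inv Ymat = Yinv"
  by (rule matrix_inv_eqI; rule swap8_involution, assumption) (rule matrix_inv_eqI; rule Ymat_inverse)

lemma gen_group_mult: "g \<in> gen_group S \<Longrightarrow> h \<in> gen_group S \<Longrightarrow> g ** h \<in> gen_group S"
proof (induction rule: gen_group.induct)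
  case gen_one
  thus ?case by simp
next
  case (gen_mul s g)
  thus ?case using gen_group.gen_mul[OF gen_mul.hyps(1) gen_mul.IH[OF gen_mul.prems]] by (simp only: matrix_mul_assoc)
next
  case (gen_inv s g)
  thus ?case using gen_group.gen_inv[OF gen_inv.hyps(1) gen_inv.IH[OF gen_inv.prems]] by (simp only: matrix_mul_assoc)
qed

lemma gen_group_gen: "s \<in> S \<Longrightarrow> s \<in> gen_group S"
  using gen_mul[OF _ gen_one, of s S] by simp

lemma gen_group_mono:
  assumes "S \<subseteq> T" "g \<in> gen_group S"
  shows "g \<in> gen_group T"
  using assms(2)
proof (induction rule: gen_group.induct)
  case gen_one
  show ?case by (rule gen_group.gen_one)
next
  case (gen_mul s g)
  thus ?case using assms(1) by (intro gen_group.gen_mul) auto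
next
  case (gen_inv s g)
  thus ?case using assms(1) by (intro gen_group.gen_inv) auto
qed

lemma Hgrp_induct [consumes 1, case_names one mult]:
  assumes "g \<in> Hgrp" "P (mat 1)" "\<And>s g. s \<in> insert Yinv Hgens \<Longrightarrow> g \<in> Hgrp \<Longrightarrow> P g \<Longrightarrow> P (s ** g)"
  shows "P g"
  using assms(1) unfolding Hgrp_def
proof (induction rule: gen_group.induct)
  case (gen_inv s g)
  have "matrix_inv s \<in> insert Yinv Hgens"
  proof (cases "s = Ymat")
    case True
    show ?thesis unfolding True matrix_inv_gens(2) by simp
  next
    case False
    hence "s \<in> Hgens - {Ymat}" using gen_inv(1) by blast
    from matrix_inv_gens(1)[OF this] show ?thesis using gen_inv(1) by (simp only: insertI2)
  qed
  thus ?case using assms(3) gen_inv unfolding Hgrp_def by blast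
next
  case gen_one
  show ?case by (rule assms(2))
next
  case (gen_mul s g)
  show ?case by (rule assms(3)) (use gen_mul in \<open>auto simp: Hgrp_def\<close>)
qed

definition x_list :: "complex^8 \<Rightarrow> complex list" where
  "x_list w = [w$2, w$8, w$7, w$6, w$5, w$4, w$3, w$1]"

definition in_W :: "complex^8 \<Rightarrow> bool" where
  "in_W w \<longleftrightarrow> 2 + 3 * w$1 = w$2 + w$3 + w$4 + w$5 + w$6 + w$7 + w$8"

lemma in_W_gens: "s \<in> insert Yinv Hgens \<Longrightarrow> in_W w \<Longrightarrow> in_W (s *v w)"
proof -
  define f :: "complex^8 \<Rightarrow> complex" where "f w = w$2 + w$3 + w$4 + w$5 + w$6 + w$7 + w$8 - 3 * w$1" for w
  assume "s \<in> insert Yinv Hgens"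
  hence "f (s *v w) = f w"
    by (elim insertE) (simp_all add: f_def swap8_nth Xmat_nth Ymat_nth Yinv_nth)
  moreover have "in_W w \<longleftrightarrow> f w = 2" for w unfolding in_W_def f_def by (auto simp: algebra_simps)
  moreover assume "in_W w"
  ultimately show ?thesis by simp
qed

lemma in_W_8: "in_W w \<Longrightarrow> w$8 = 2 + 3 * w$1 - w$2 - w$3 - w$4 - w$5 - w$6 - w$7"
  by (simp add: in_W_def algebra_simps)

lemma X_shift_in_W: "in_W w \<Longrightarrow> X_shift w = 1 + w$1 - w$3 - w$4 - w$5"
proof -
  assume "in_W w"
  hence "w$8 = 2 + 3 * w$1 - w$2 - w$3 - w$4 - w$5 - w$6 - w$7" by (simp add: in_W_def algebra_simps)
  thus ?thesis unfolding X_shift_def by (simp add: field_simps)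
qed

text \<open>The Lorentzian form \<open>b^2 + ... + h^2 - a^2\<close>, with a linear term that makes
  it \<open>H\<close>-invariant on the affine space \<open>W\<close>. In the coordinates
  \<open>delta, z\<close> it becomes diagonal, up to a constant, by
  \<open>quad_form_eq\<close>.\<close>

definition quad_form :: "complex^8 \<Rightarrow> complex" where
  "quad_form w = (w$2)^2 + (w$3)^2 + (w$4)^2 + (w$5)^2 + (w$6)^2 + (w$7)^2 + (w$8)^2 - (w$1)^2 - 2 * w$1"

lemma quad_form_gens: "s \<in> insert Yinv Hgens \<Longrightarrow> in_W w \<Longrightarrow> quad_form (s *v w) = quad_form w"
proof -
  assume s: "s \<in> insert Yinv Hgens" and w: "in_W w"
  have h: "w$8 = 2 + 3 * w$1 - w$2 - w$3 - w$4 - w$5 - w$6 - w$7" using w by (simp add: in_W_def algebra_simps)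
  have X: "quad_form (Xmat *v w) = quad_form w"
    unfolding quad_form_def Xmat_nth X_shift_in_W[OF w] by (simp add: power2_eq_square algebra_simps)
  have Y: "quad_form (Ymat *v w) = quad_form w" "quad_form (Yinv *v w) = quad_form w"
    unfolding quad_form_def Ymat_nth Yinv_nth h by (simp_all add: power2_eq_square algebra_simps)
  have sw: "quad_form (s *v w) = quad_form w" if "s \<in> Hgens - {Xmat, Ymat}"
    using that by (elim DiffE insertE emptyE) (simp_all add: quad_form_def swap8_nth add_ac)
  have "s = Xmat \<or> s = Ymat \<or> s = Yinv \<or> s \<in> Hgens - {Xmat, Ymat}" using s by blast
  thus ?thesis by (elim disjE) (simp_all only: X Y sw)
qed

text \<open>The value of \<open>v(i,j)\<close> (\<open>s = True\<close>) or of \<open>-v(i,j)\<close>. Pairs with \<open>i\<close> or \<open>j\<close> equal to 7 are included: \<open>label_value True i 7\<close> is the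
  coordinate \<open>x_i\<close> itself.\<close>

definition label_value :: "bool \<Rightarrow> nat \<Rightarrow> nat \<Rightarrow> complex^8 \<Rightarrow> complex" where
  "label_value s i j w = (if s then x_list w ! i + x_list w ! j - x_list w ! 7 else 1 + x_list w ! 7 - x_list w ! i - x_list w ! j)"

lemma label_value_neg: "label_value (\<not> s) i j w = 1 - label_value s i j w" by (simp add: label_value_def)

lemma all_less_8: "(\<forall>i<8. P i) \<longleftrightarrow> P 0 \<and> P 1 \<and> P 2 \<and> P 3 \<and> P 4 \<and> P 5 \<and> P 6 \<and> P (7::nat)"
proof -
  have "i < 8 \<longleftrightarrow> i \<in> {0,1,2,3,4,5,6,7}" for i :: nat by (simp, linarith)
  hence "(\<forall>i<8. P i) \<longleftrightarrow> (\<forall>i\<in>{0,1,2,3,4,5,6,7}. P i)" by blast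
  thus ?thesis by simp
qed

text \<open>Serves the generator \<open>X\<close>, which sends a pair inside one of the blocks
  \<open>{0,1,2,3}\<close> and \<open>{4,5,6,7}\<close> to the negated label of the complementary
  pair in the same block.\<close>

lemma complementary_pair:
  fixes x :: "nat \<Rightarrow> complex"
  assumes "i \<in> {p,q,r,s}" "j \<in> {p,q,r,s}" "i \<noteq> j" "distinct [p,q,r,s]"
  shows "\<exists>k\<in>{p,q,r,s}. \<exists>l\<in>{p,q,r,s}. k \<noteq> l \<and> (\<forall>x::nat \<Rightarrow> complex. x k + x l = x p + x q + x r + x s - x i - x j)"
proof -
  have "card {p,q,r,s} = 4" using assms(4) by simp
  moreover have "{i,j} \<subseteq> {p,q,r,s}" "card {i,j} = 2" using assms(1-3) by simp_all
  ultimately have "card ({p,q,r,s} - {i,j}) = 2" by (simp only: card_Diff_subset finite.intros)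
  then obtain k l where d: "{p,q,r,s} - {i,j} = {k,l}" "k \<noteq> l" by (metis card_2_iff)
  have kl: "{p,q,r,s} = {i,j,k,l}" using d(1) assms(1,2) by blast
  moreover have "k \<notin> {i,j}" "l \<notin> {i,j}" using d(1) by blast+
  ultimately have kl: "{p,q,r,s} = {i,j,k,l}" "distinct [i,j,k,l]" using d(2) assms(3) by auto
  have "x p + x q + x r + x s = x i + x j + x k + x l" for x :: "nat \<Rightarrow> complex"
  proof -
    have "sum x {p,q,r,s} = sum x {i,j,k,l}" using kl(1) by simp
    thus ?thesis using assms(4) kl(2) by (simp add: add.assoc)
  qed
  hence "x k + x l = x p + x q + x r + x s - x i - x j" for x :: "nat \<Rightarrow> complex" by simp
  moreover have "k \<in> {p,q,r,s}" "l \<in> {p,q,r,s}" by (simp_all only: kl(1) insert_iff simp_thms)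
  moreover have "k \<noteq> l" using kl(2) by simp
  ultimately have "k \<in> {p,q,r,s}" "l \<in> {p,q,r,s}" "k \<noteq> l" "\<forall>x::nat \<Rightarrow> complex. x k + x l = x p + x q + x r + x s - x i - x j"
    by blast+
  thus ?thesis by blast
qed

text \<open>The 56 signed pairs are permuted by each generator, as the minuscule weights of
  \<open>E_7\<close> are. All generators but \<open>X\<close> permute the \<open>x_i\<close> up to a
  common shift; \<open>X\<close> respects a partition of the indices into two blocks of
  four.\<close>

lemma label_value_gens:
  assumes s: "s \<in> insert Yinv Hgens" and ij: "i < 8" "j < 8" "i \<noteq> j"
  shows "\<exists>b k l. k < 8 \<and> l < 8 \<and> k \<noteq> l \<and> (\<forall>w. in_W w \<longrightarrow> label_value True i j (s *v w) = label_value b k l w)"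
proof -
  \<comment> \<open>Every \<open>x_i\<close> acquires the shift \<open>c\<close>, while
    \<open>x_7\<close> itself changes by \<open>2 c\<close> altogether, so the shifts cancel in
    \<open>x_i + x_j - x_7\<close>. Transpositions have \<open>c = 0\<close>; \<open>Y\<close> and
    its inverse have cyclic \<open>\<tau>\<close> and nonzero \<open>c\<close> in general.\<close>
  have perm: ?thesis if t: "\<forall>i<8. \<tau> i < 8" "inj \<tau>" "\<And>w. \<exists>c. (\<forall>i<8. x_list (s *v w) ! i = x_list w ! \<tau> i + c) \<and> x_list w ! \<tau> 7 + c = x_list w ! 7 + 2 * c" for \<tau>
  proof (intro exI conjI allI impI)
    show "\<tau> i < 8" "\<tau> j < 8" "\<tau> i \<noteq> \<tau> j" using t ij by (auto dest: injD)
    fix w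
    obtain c where "\<forall>i<8. x_list (s *v w) ! i = x_list w ! \<tau> i + c" and c: "x_list w ! \<tau> 7 + c = x_list w ! 7 + 2 * c" using t(3) by blast
    hence "x_list (s *v w) ! i = x_list w ! \<tau> i + c" "x_list (s *v w) ! j = x_list w ! \<tau> j + c" "x_list (s *v w) ! 7 = x_list w ! 7 + 2 * c" using ij by simp_all
    thus "label_value True i j (s *v w) = label_value True (\<tau> i) (\<tau> j) w" unfolding label_value_def by simp
  qed
  have tr: "inj (tr p q)" for p q by (rule injI) (auto simp: tr_def split: if_splits)
  have swap: ?thesis if "\<forall>i<8. tr p q i < 8" "tr p q 7 = 7" "\<And>w. \<forall>i<8. x_list (s *v w) ! i = x_list w ! tr p q i" for p q
  proof (rule perm[of "tr p q"])
    show "\<exists>c. (\<forall>i<8. x_list (s *v w) ! i = x_list w ! tr p q i + c) \<and> x_list w ! tr p q 7 + c = x_list w ! 7 + 2 * c" for w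
      using that by (intro exI[of _ 0]) simp
  qed (use that tr in auto)
  have Y: ?thesis if "s = Ymat"
  proof (rule perm[of "\<lambda>i. if i = 0 then 6 else if i = 6 then 7 else if i = 7 then 0 else i"])
    show "\<exists>c. (\<forall>i<8. x_list (s *v w) ! i = x_list w ! (if i = 0 then 6 else if i = 6 then 7 else if i = 7 then 0 else i) + c) \<and>
       x_list w ! (if 7 = (0::nat) then 6 else if 7 = (6::nat) then 7 else if 7 = (7::nat) then 0 else 7) + c = x_list w ! 7 + 2 * c" for w
      by (rule exI[of _ "w$2 - w$1"]) (simp add: that all_less_8 x_list_def Ymat_nth)
    show "inj (\<lambda>i::nat. if i = 0 then 6 else if i = 6 then 7 else if i = 7 then 0 else i)"
      by (rule injI) (simp split: if_splits)
  qed auto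
  have Yi: ?thesis if "s = Yinv"
  proof (rule perm[of "\<lambda>i. if i = 6 then 0 else if i = 7 then 6 else if i = 0 then 7 else i"])
    show "\<exists>c. (\<forall>i<8. x_list (s *v w) ! i = x_list w ! (if i = 6 then 0 else if i = 7 then 6 else if i = 0 then 7 else i) + c) \<and>
       x_list w ! (if 7 = (6::nat) then 0 else if 7 = (7::nat) then 6 else if 7 = (0::nat) then 7 else 7) + c = x_list w ! 7 + 2 * c" for w
      by (rule exI[of _ "w$3 - w$1"]) (simp add: that all_less_8 x_list_def Yinv_nth)
    show "inj (\<lambda>i::nat. if i = 6 then 0 else if i = 7 then 6 else if i = 0 then 7 else i)"
      by (rule injI) (simp split: if_splits)
  qed auto
  \<comment> \<open>A label with one index in each block is fixed, since its shift cancels against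
    that of \<open>x_7\<close>. For two indices in the same block, \<open>p1\<close> and
    \<open>p2\<close> express the shift through the sum over that block, which produces the
    complementary pair.\<close>
  have X: ?thesis if s: "s = Xmat"
  proof -
    have x: "x_list (Xmat *v w) ! i = x_list w ! i + (if i \<in> {4,5,6,7} then X_shift w else 0)" if "i < 8" for i w
      using that by (simp add: less_Suc_eq eval_nat_numeral x_list_def) (elim disjE; simp add: Xmat_nth)
    have p1: "X_shift w = 1 + 2 * x_list w ! 7 - (x_list w ! 4 + x_list w ! 5 + x_list w ! 6 + x_list w ! 7)" if "in_W w" for w
      using X_shift_in_W[OF that] by (simp add: x_list_def)
    have p2: "X_shift w = (x_list w ! 0 + x_list w ! 1 + x_list w ! 2 + x_list w ! 3) - 1 - 2 * x_list w ! 7" if "in_W w" for w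
      using X_shift_in_W[OF that] in_W_8[OF that] by (simp add: x_list_def)
    have m: "i \<in> {4,5,6,7} \<or> i \<in> {0,1,2,3}" "j \<in> {4,5,6,7} \<or> j \<in> {0,1,2,3}" using ij by auto
    consider "i \<in> {4,5,6,7} \<longleftrightarrow> j \<notin> {4,5,6,7}" | "i \<in> {4,5,6,7}" "j \<in> {4,5,6,7}" | "i \<in> {0,1,2,3}" "j \<in> {0,1,2,3}" using m by blast
    thus ?thesis
    proof cases
      case 1
      have "label_value True i j (s *v w) = label_value True i j w" for w
      proof -
        have "x_list (Xmat *v w) ! 7 = x_list w ! 7 + X_shift w" using x[of 7 w] by simp
        moreover have "(i \<in> {4,5,6,7} \<and> j \<notin> {4,5,6,7}) \<or> (i \<notin> {4,5,6,7} \<and> j \<in> {4,5,6,7})" using 1 by blast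
        ultimately show ?thesis unfolding s label_value_def x[OF ij(1)] x[OF ij(2)] by (elim disjE conjE) (simp_all only: if_True if_False, simp_all)
      qed
      thus ?thesis using ij by blast
    next
      case 2
      obtain k l where kl: "k \<in> {4,5,6,7}" "l \<in> {4,5,6,7}" "k \<noteq> l" "\<forall>x::nat \<Rightarrow> complex. x k + x l = x 4 + x 5 + x 6 + x 7 - x i - x j"
      proof -
        have "distinct [4,5,6,7::nat]" by simp
        from complementary_pair[OF 2 ij(3) this] show ?thesis by (elim bexE conjE) (rule that)
      qed
      have "label_value True i j (s *v w) = label_value False k l w" if "in_W w" for w
        using kl(4)[rule_format, of "\<lambda>i. x_list w ! i"] p1[OF that] 2 unfolding s label_value_def x[OF ij(1)] x[OF ij(2)]
        by (simp add: x diff_diff_eq)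
      thus ?thesis using kl by (intro exI[of _ False] exI[of _ k] exI[of _ l]) auto
    next
      case 3
      hence n: "i \<notin> {4,5,6,7}" "j \<notin> {4,5,6,7}" by auto
      obtain k l where kl: "k \<in> {0,1,2,3}" "l \<in> {0,1,2,3}" "k \<noteq> l" "\<forall>x::nat \<Rightarrow> complex. x k + x l = x 0 + x 1 + x 2 + x 3 - x i - x j"
      proof -
        have "distinct [0,1,2,3::nat]" by simp
        from complementary_pair[OF 3 ij(3) this] show ?thesis by (elim bexE conjE) (rule that)
      qed
      have "label_value True i j (s *v w) = label_value False k l w" if "in_W w" for w
        using kl(4)[rule_format, of "\<lambda>i. x_list w ! i"] p2[OF that] n unfolding s label_value_def x[OF ij(1)] x[OF ij(2)]
        by (simp add: x diff_diff_eq)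
      thus ?thesis using kl by (intro exI[of _ False] exI[of _ k] exI[of _ l]) auto
    qed
  qed
  show ?thesis using s
  proof (elim insertE emptyE)
    assume "s = swap8 2 3" thus ?thesis by (intro swap[of 0 6]) (simp_all add: all_less_8 x_list_def swap8_nth tr_def)
  next
    assume "s = swap8 3 4" thus ?thesis by (intro swap[of 6 5]) (simp_all add: all_less_8 x_list_def swap8_nth tr_def)
  next
    assume "s = swap8 4 5" thus ?thesis by (intro swap[of 5 4]) (simp_all add: all_less_8 x_list_def swap8_nth tr_def)
  next
    assume "s = swap8 5 6" thus ?thesis by (intro swap[of 4 3]) (simp_all add: all_less_8 x_list_def swap8_nth tr_def)
  next
    assume "s = swap8 6 7" thus ?thesis by (intro swap[of 3 2]) (simp_all add: all_less_8 x_list_def swap8_nth tr_def)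
  next
    assume "s = swap8 7 8" thus ?thesis by (intro swap[of 2 1]) (simp_all add: all_less_8 x_list_def swap8_nth tr_def)
  qed (rule X Y Yi, assumption)+
qed

lemma Hgrp_action:
  assumes "\<alpha> \<in> Hgrp"
  shows "in_W w \<Longrightarrow> in_W (\<alpha> *v w)" "in_W w \<Longrightarrow> quad_form (\<alpha> *v w) = quad_form w"
    "i < 8 \<Longrightarrow> j < 8 \<Longrightarrow> i \<noteq> j \<Longrightarrow> \<exists>b k l. k < 8 \<and> l < 8 \<and> k \<noteq> l \<and> (\<forall>w. in_W w \<longrightarrow> label_value True i j (\<alpha> *v w) = label_value b k l w)"
proof -
  have "(\<forall>w. in_W w \<longrightarrow> in_W (\<alpha> *v w) \<and> quad_form (\<alpha> *v w) = quad_form w) \<and>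
    (\<forall>i j. i < 8 \<longrightarrow> j < 8 \<longrightarrow> i \<noteq> j \<longrightarrow> (\<exists>b k l. k < 8 \<and> l < 8 \<and> k \<noteq> l \<and> (\<forall>w. in_W w \<longrightarrow> label_value True i j (\<alpha> *v w) = label_value b k l w)))"
    using assms
  proof (induction rule: Hgrp_induct)
    case one
    show ?case by auto
  next
    case (mult s g)
    have 1: "in_W (s ** g *v w) \<and> quad_form (s ** g *v w) = quad_form w" if "in_W w" for w
      using mult that in_W_gens[OF mult(1)] quad_form_gens[OF mult(1)] by (simp add: matrix_vector_mul_assoc[symmetric])
    moreover have "\<exists>b k l. k < 8 \<and> l < 8 \<and> k \<noteq> l \<and> (\<forall>w. in_W w \<longrightarrow> label_value True i j (s ** g *v w) = label_value b k l w)"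
      if "i < 8" "j < 8" "i \<noteq> j" for i j
    proof -
      obtain b k l where kl: "k < 8" "l < 8" "k \<noteq> l" "\<forall>w. in_W w \<longrightarrow> label_value True i j (s *v w) = label_value b k l w"
        using label_value_gens[OF mult(1) \<open>i < 8\<close> \<open>j < 8\<close> \<open>i \<noteq> j\<close>] by metis
      obtain b' k' l' where kl': "k' < 8" "l' < 8" "k' \<noteq> l'" "\<forall>w. in_W w \<longrightarrow> label_value True k l (g *v w) = label_value b' k' l' w"
        using mult(3) kl by metis
      have "label_value True i j (s ** g *v w) = label_value (b = b') k' l' w" if "in_W w" for w
      proof -
        have "label_value True i j (s ** g *v w) = label_value b k l (g *v w)" using kl(4) mult(3) that by (simp add: matrix_vector_mul_assoc[symmetric])
        also have "\<dots> = label_value (b = b') k' l' w"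
          using kl'(4) that label_value_neg[of True k l "g *v w"] label_value_neg[of b' k' l' w] by (cases b; cases b') auto
        finally show ?thesis .
      qed
      thus ?thesis using kl' by blast
    qed
    ultimately show ?case by blast
  qed
  thus "in_W w \<Longrightarrow> in_W (\<alpha> *v w)" "in_W w \<Longrightarrow> quad_form (\<alpha> *v w) = quad_form w"
    "i < 8 \<Longrightarrow> j < 8 \<Longrightarrow> i \<noteq> j \<Longrightarrow> \<exists>b k l. k < 8 \<and> l < 8 \<and> k \<noteq> l \<and> (\<forall>w. in_W w \<longrightarrow> label_value True i j (\<alpha> *v w) = label_value b k l w)"
    by blast+
qed

section \<open>The coordinates \<open>delta\<close> and \<open>z\<close> on \<open>W\<close>\<close>

definition z_coord :: "complex^8 \<Rightarrow> nat \<Rightarrow> complex" where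
  "z_coord w k = (x_list w ! 0 + x_list w ! 1 + 2 * x_list w ! (k + 2) - 2 * x_list w ! 7 - 1) / 2"

definition delta_coord :: "complex^8 \<Rightarrow> complex" where
  "delta_coord w = (x_list w ! 0 - x_list w ! 1) / 2"

text \<open>The point of \<open>W\<close> with \<open>delta_coord = d\<close> and \<open>z_coord = z\<close>; in \<open>wvec\<close> the parameter \<open>b\<close> enters through \<open>d\<close> only.\<close>

definition w_point :: "complex \<Rightarrow> (nat \<Rightarrow> complex) \<Rightarrow> complex^8" where
  "w_point d z = (let S = (\<Sum>k<6. z k); x = (\<lambda>k. 1/2 + z k + z 5 - S / 2) in
     wvec (1/2 + 2 * z 5 - S / 2) (1/2 + z 5 + d) (x 4) (x 3) (x 2) (x 1) (x 0))"

lemma sum_less_6: "(\<Sum>k<6. f k) = f 0 + f 1 + f 2 + f 3 + f 4 + f (5::nat)"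
  by (simp add: eval_nat_numeral)

lemma all_less_6: "(\<forall>i<6. P i) \<longleftrightarrow> P 0 \<and> P 1 \<and> P 2 \<and> P 3 \<and> P 4 \<and> P (5::nat)"
proof -
  have "i < 6 \<longleftrightarrow> i \<in> {0,1,2,3,4,5}" for i :: nat by (simp, linarith)
  hence "(\<forall>i<6. P i) \<longleftrightarrow> (\<forall>i\<in>{0,1,2,3,4,5}. P i)" by blast
  thus ?thesis by simp
qed

lemma wvec_nth:
  "wvec a b c d e f g $ 1 = a" "wvec a b c d e f g $ 2 = b" "wvec a b c d e f g $ 3 = c" "wvec a b c d e f g $ 4 = d"
  "wvec a b c d e f g $ 5 = e" "wvec a b c d e f g $ 6 = f" "wvec a b c d e f g $ 7 = g" "wvec a b c d e f g $ 8 = 2 + 3 * a - b - c - d - e - f - g"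
  by (simp_all add: wvec_def hW_def)

lemma x_list_wvec: "x_list (wvec a b c d e f g) = [b, 2 + 3 * a - b - c - d - e - f - g, g, f, e, d, c, a]"
  unfolding x_list_def wvec_nth ..

lemma in_W_wvec: "in_W (wvec a b c d e f g)"
  unfolding in_W_def wvec_nth by (simp add: algebra_simps)

lemma in_W_w_point: "in_W (w_point d z)"
  unfolding w_point_def Let_def by (rule in_W_wvec)

lemma delta_coord_w_point [simp]: "delta_coord (w_point d z) = d"
  unfolding delta_coord_def w_point_def Let_def x_list_wvec by (simp add: sum_less_6 field_simps)

lemma z_coord_w_point [simp]: "k < 6 \<Longrightarrow> z_coord (w_point d z) k = z k"
proof -
  have "\<forall>k<6. z_coord (w_point d z) k = z k"
    unfolding all_less_6 z_coord_def w_point_def Let_def x_list_wvec by (simp add: sum_less_6 field_simps)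
  thus "k < 6 \<Longrightarrow> z_coord (w_point d z) k = z k" by blast
qed

lemma sum_z_coord: "in_W w \<Longrightarrow> (\<Sum>k<6. z_coord w k) = 2 * (x_list w ! 0 + x_list w ! 1) - 1 - 2 * x_list w ! 7"
  unfolding sum_less_6 z_coord_def by (simp add: x_list_def in_W_8 field_simps)

lemma quad_form_eq: "in_W w \<Longrightarrow> quad_form w = 2 * (delta_coord w)^2 + (\<Sum>k<6. (z_coord w k)^2) + 1/2"
  unfolding sum_less_6 z_coord_def delta_coord_def quad_form_def by (simp add: x_list_def in_W_8 field_simps power2_eq_square)

text \<open>Indices are 0-based here: \<open>z_coord w k\<close> is the coordinate
  \<open>z_(k+1)\<close> of the overview and belongs to \<open>j = k + 2\<close>.\<close>

lemma label_value_0: "label_value True 0 (k + 2) w = 1/2 + delta_coord w + z_coord w k"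
  by (simp add: label_value_def delta_coord_def z_coord_def field_simps)

lemma label_value_1: "label_value True 1 (k + 2) w = 1/2 - delta_coord w + z_coord w k"
  by (simp add: label_value_def delta_coord_def z_coord_def field_simps)

lemma label_value_01: "in_W w \<Longrightarrow> label_value True 0 1 w = 1/2 + (\<Sum>k<6. z_coord w k) / 2"
  unfolding sum_z_coord by (simp add: label_value_def field_simps)

lemma label_value_ij:
  assumes "in_W w" "i < 6" "j < 6" "i \<noteq> j"
  shows "label_value True (i + 2) (j + 2) w = 1/2 + (\<Sum>k<6. (if k = i \<or> k = j then 1 else -1) * z_coord w k) / 2"
proof -
  have "(\<Sum>k<6. (if k = i \<or> k = j then 1 else -1) * z_coord w k) = (\<Sum>k<6. (if k = i then 2 * z_coord w k else 0) + (if k = j then 2 * z_coord w k else 0) - z_coord w k)"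
    using assms(4) by (intro sum.cong) auto
  also have "\<dots> = 2 * z_coord w i + 2 * z_coord w j - (\<Sum>k<6. z_coord w k)"
    using assms(2,3) by (simp add: sum.distrib sum_subtractf)
  finally have s: "(\<Sum>k<6. (if k = i \<or> k = j then 1 else -1) * z_coord w k) = 2 * z_coord w i + 2 * z_coord w j - (\<Sum>k<6. z_coord w k)" .
  show ?thesis unfolding s sum_z_coord[OF assms(1)] by (simp add: label_value_def z_coord_def field_simps)
qed

text \<open>In the coordinates \<open>delta, z\<close> the 56 labels split into 24 of the form
  \<open>1/2 \<plusminus> delta \<plusminus> z_k\<close> and, in \<open>sum_form\<close>, 32 half
  sums of all \<open>z\<close> with an even number of minus signs. The first kind varies with
  \<open>b\<close> and gives \<open>L\<close>, the second does not and gives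
  \<open>J\<close>.\<close>

definition pair_form :: "complex \<Rightarrow> complex \<Rightarrow> nat \<Rightarrow> (complex^8 \<Rightarrow> complex) \<Rightarrow> bool" where
  "pair_form \<epsilon> \<eta> k f \<longleftrightarrow> (\<forall>w. in_W w \<longrightarrow> f w = 1/2 + \<epsilon> * delta_coord w + \<eta> * z_coord w k)"

definition sum_form :: "(nat \<Rightarrow> complex) \<Rightarrow> (complex^8 \<Rightarrow> complex) \<Rightarrow> bool" where
  "sum_form \<theta> f \<longleftrightarrow> (\<forall>w. in_W w \<longrightarrow> f w = 1/2 + (\<Sum>k<6. \<theta> k * z_coord w k) / 2)"

lemma label_value_commute: "label_value b i j = label_value b j i"
  by (rule ext) (simp add: label_value_def algebra_simps)

lemma pair_form_neg: "pair_form \<epsilon> \<eta> k (label_value True i j) \<Longrightarrow> pair_form (-\<epsilon>) (-\<eta>) k (label_value False i j)"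
  using label_value_neg[of True i j] by (auto simp: pair_form_def)

lemma sum_form_neg: "sum_form \<theta> (label_value True i j) \<Longrightarrow> sum_form (\<lambda>k. - \<theta> k) (label_value False i j)"
  using label_value_neg[of True i j] by (auto simp: sum_form_def sum_negf diff_divide_distrib)

lemma pair_form_0: "k < 6 \<Longrightarrow> pair_form 1 1 k (label_value True 0 (k + 2))"
  and pair_form_1: "k < 6 \<Longrightarrow> pair_form (-1) 1 k (label_value True 1 (k + 2))"
  unfolding pair_form_def label_value_0 label_value_1 by simp_all

lemma sum_form_01: "sum_form (\<lambda>k. 1) (label_value True 0 1)"
  unfolding sum_form_def using label_value_01 by simp

lemma sum_form_ij: "i < 6 \<Longrightarrow> j < 6 \<Longrightarrow> i \<noteq> j \<Longrightarrow> sum_form (\<lambda>k. if k = i \<or> k = j then 1 else -1) (label_value True (i + 2) (j + 2))"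
  unfolding sum_form_def using label_value_ij by blast

definition is_sign :: "complex \<Rightarrow> bool" where "is_sign x \<longleftrightarrow> x = 1 \<or> x = -1"

lemma is_sign_simps [simp]: "is_sign 1" "is_sign (-1)" "is_sign (- x) = is_sign x"
  by (auto simp: is_sign_def minus_equation_iff equation_minus_iff)

lemma is_sign_mult: "is_sign x \<Longrightarrow> is_sign y \<Longrightarrow> is_sign (x * y)" by (auto simp: is_sign_def)
lemma is_sign_sq: "is_sign x \<Longrightarrow> x * x = 1" by (auto simp: is_sign_def)

lemma prod_sign_pair: "(i::nat) < 6 \<Longrightarrow> j < 6 \<Longrightarrow> i \<noteq> j \<Longrightarrow> (\<Prod>k<6. if k = i \<or> k = j then 1 else (-1::complex)) = 1"
proof -
  assume ij: "i < 6" "j < 6" "i \<noteq> j"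
  have "(\<Prod>k<6. if k = i \<or> k = j then 1 else (-1::complex)) = (\<Prod>k\<in>{..<6}-{i,j}. -1)"
    using ij by (intro prod.mono_neutral_cong_right) auto
  also have "\<dots> = (-1) ^ card ({..<6}-{i,j})" by simp
  also have "card ({..<6::nat}-{i,j}) = 4" using ij by (subst card_Diff_subset) auto
  finally show ?thesis by simp
qed

lemma label_value_cases:
  assumes "i < 8" "j < 8" "i \<noteq> j"
  shows "(\<exists>\<epsilon> \<eta> k. is_sign \<epsilon> \<and> is_sign \<eta> \<and> k < 6 \<and> pair_form \<epsilon> \<eta> k (label_value b i j)) \<or>
     (\<exists>\<theta>. (\<forall>k<6. is_sign (\<theta> k)) \<and> (\<Prod>k<6. \<theta> k) = 1 \<and> sum_form \<theta> (label_value b i j))"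
proof -
  have T: "(\<exists>\<epsilon> \<eta> k. is_sign \<epsilon> \<and> is_sign \<eta> \<and> k < 6 \<and> pair_form \<epsilon> \<eta> k (label_value True i j)) \<or>
     (\<exists>\<theta>. (\<forall>k<6. is_sign (\<theta> k)) \<and> (\<Prod>k<6. \<theta> k) = 1 \<and> sum_form \<theta> (label_value True i j))"
    if ij: "i < j" "j < 8" for i j
  proof -
    consider "i = 0" "j = 1" | "i = 0" "j \<ge> 2" | "i = 1" "j \<ge> 2" | "i \<ge> 2" using ij by linarith
    thus ?thesis
    proof cases
      case 1
      show ?thesis using sum_form_01 unfolding 1 by (intro disjI2 exI[of _ "\<lambda>k. 1"]) simp
    next
      case 2
      have "pair_form 1 1 (j - 2) (label_value True 0 j)" using pair_form_0[of "j - 2"] 2 ij unfolding le_add_diff_inverse2[OF 2(2)] by simp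
      thus ?thesis using 2 ij by (intro disjI1 exI[of _ 1] exI[of _ "j - 2"]) simp
    next
      case 3
      have "pair_form (-1) 1 (j - 2) (label_value True 1 j)" using pair_form_1[of "j - 2"] 3 ij unfolding le_add_diff_inverse2[OF 3(2)] by simp
      thus ?thesis using 3 ij by (intro disjI1 exI[of _ "-1"] exI[of _ 1] exI[of _ "j - 2"]) simp
    next
      case 4
      have l: "i - 2 < 6" "j - 2 < 6" "i - 2 \<noteq> j - 2" using 4 ij by linarith+
      have "sum_form (\<lambda>k. if k = i - 2 \<or> k = j - 2 then 1 else -1) (label_value True i j)"
        using sum_form_ij[OF l] 4 ij by (simp only: le_add_diff_inverse2)
      thus ?thesis using prod_sign_pair[OF l] by (intro disjI2 exI[of _ "\<lambda>k. if k = i - 2 \<or> k = j - 2 then 1 else -1"]) simp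
    qed
  qed
  have T': "(\<exists>\<epsilon> \<eta> k. is_sign \<epsilon> \<and> is_sign \<eta> \<and> k < 6 \<and> pair_form \<epsilon> \<eta> k (label_value True i j)) \<or>
     (\<exists>\<theta>. (\<forall>k<6. is_sign (\<theta> k)) \<and> (\<Prod>k<6. \<theta> k) = 1 \<and> sum_form \<theta> (label_value True i j))"
  proof (cases "i < j")
    case True
    thus ?thesis using T assms by blast
  next
    case False
    hence "j < i" using assms by simp
    from T[OF this assms(1)] show ?thesis unfolding label_value_commute[of True j i] .
  qed
  show ?thesis
  proof (cases b)
    case True
    thus ?thesis using T' by simp
  next
    case False
    from T' show ?thesis
    proof (elim disjE exE conjE)
      fix \<epsilon> \<eta> k assume "is_sign \<epsilon>" "is_sign \<eta>" "k < 6" "pair_form \<epsilon> \<eta> k (label_value True i j)"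
      thus ?thesis using False pair_form_neg by (intro disjI1 exI[of _ "-\<epsilon>"] exI[of _ "-\<eta>"] exI[of _ k]) simp
    next
      fix \<theta> assume t: "\<forall>k<6. is_sign (\<theta> k)" "(\<Prod>k<6. \<theta> k) = 1" "sum_form \<theta> (label_value True i j)"
      have "(\<Prod>k<6. - \<theta> k) = (\<Prod>k<6. (-1) * \<theta> k)" by simp
      also have "\<dots> = 1" unfolding prod.distrib t(2) by simp
      finally show ?thesis using False t sum_form_neg by (intro disjI2 exI[of _ "\<lambda>k. - \<theta> k"]) simp
    qed
  qed
qed

lemma Hgrp_label_value_cases:
  assumes "\<alpha> \<in> Hgrp" "i < 8" "j < 8" "i \<noteq> j"
  shows "(\<exists>\<epsilon> \<eta> k. is_sign \<epsilon> \<and> is_sign \<eta> \<and> k < 6 \<and> pair_form \<epsilon> \<eta> k (\<lambda>w. label_value True i j (\<alpha> *v w))) \<or>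
     (\<exists>\<theta>. (\<forall>k<6. is_sign (\<theta> k)) \<and> (\<Prod>k<6. \<theta> k) = 1 \<and> sum_form \<theta> (\<lambda>w. label_value True i j (\<alpha> *v w)))"
proof -
  obtain b k l where kl: "k < 8" "l < 8" "k \<noteq> l" "\<forall>w. in_W w \<longrightarrow> label_value True i j (\<alpha> *v w) = label_value b k l w"
    using Hgrp_action(3)[OF assms] by blast
  from label_value_cases[OF kl(1-3), of b] show ?thesis
    using kl(4) unfolding pair_form_def sum_form_def by simp
qed

definition signed_perm :: "complex \<Rightarrow> (nat \<Rightarrow> nat) \<Rightarrow> (nat \<Rightarrow> complex) \<Rightarrow> complex^8^8 \<Rightarrow> bool" where
  "signed_perm \<epsilon> p \<eta> \<alpha> \<longleftrightarrow> is_sign \<epsilon> \<and> p permutes {..<6} \<and> (\<forall>k<6. is_sign (\<eta> k)) \<and> (\<Prod>k<6. \<eta> k) = 1 \<and>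
     (\<forall>w. in_W w \<longrightarrow> delta_coord (\<alpha> *v w) = \<epsilon> * delta_coord w \<and> (\<forall>k<6. z_coord (\<alpha> *v w) k = \<eta> k * z_coord w (p k)))"

lemma w_point_delta_coord_z_coord: "in_W w \<Longrightarrow> w_point (delta_coord w) (z_coord w) = w"
proof -
  assume w: "in_W w"
  have s: "sum (z_coord w) {..<6} = 2 * (w$2 + w$8) - 1 - 2 * w$1" using sum_z_coord[OF w] by (simp add: x_list_def)
  show ?thesis
    unfolding w_point_def Let_def s
    by (rule vec8_eqI) (simp_all add: wvec_nth z_coord_def delta_coord_def x_list_def in_W_8[OF w] field_simps)
qed

text \<open>The differences of label values show that all \<open>z_coord\<close> are signed coordinates; invariance of \<open>quad_form\<close> under a shift
  of \<open>delta_coord\<close> shows that \<open>delta_coord\<close> is only multiplied by a sign and that no coordinate is used twice.\<close>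

theorem Hgrp_signed_perm:
  assumes \<alpha>: "\<alpha> \<in> Hgrp"
    and indep: "\<And>i d d' z. i \<in> {2..7} \<Longrightarrow> x_list (\<alpha> *v w_point d z) ! i = x_list (\<alpha> *v w_point d' z) ! i"
    and dep: "x_list (\<alpha> *v w_point d0 z0) ! 0 \<noteq> x_list (\<alpha> *v w_point d1 z0) ! 0"
  shows "\<exists>\<epsilon> p \<eta>. signed_perm \<epsilon> p \<eta> \<alpha>"
proof -
  define F where "F = (\<lambda>j w. label_value True 0 j (\<alpha> *v w))"
  have F7: "F 7 w = x_list (\<alpha> *v w) ! 0" for w by (simp add: F_def label_value_def)
  have F7ns: "\<not> sum_form \<theta> (F 7)" for \<theta>
  proof
    assume "sum_form \<theta> (F 7)"
    hence "F 7 (w_point d0 z0) = F 7 (w_point d1 z0)" unfolding sum_form_def using in_W_w_point by simp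
    thus False using dep F7 by simp
  qed
  have c: "(\<exists>\<epsilon> \<eta> k. is_sign \<epsilon> \<and> is_sign \<eta> \<and> k < 6 \<and> pair_form \<epsilon> \<eta> k (F j)) \<or>
     (\<exists>\<theta>. (\<forall>k<6. is_sign (\<theta> k)) \<and> (\<Prod>k<6. \<theta> k) = 1 \<and> sum_form \<theta> (F j))" if "j \<in> {1..7}" for j
    unfolding F_def using that by (intro Hgrp_label_value_cases \<alpha>) auto
  from c[of 7] F7ns obtain \<epsilon> \<eta>7 k7 where e: "is_sign \<epsilon>" "pair_form \<epsilon> \<eta>7 k7 (F 7)" "k7 < 6" by auto
  \<comment> \<open>As \<open>x_2, ..., x_7\<close> of the image do not move with
    \<open>delta\<close>, each \<open>v(0,j)\<close> has the same slope in \<open>delta\<close> as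
    \<open>v(0,7) = x_0\<close>.\<close>
  have slope: "F j (w_point d z) - F j (w_point d' z) = \<epsilon> * (d - d')" if "j \<in> {2..7}" for j d d' z
  proof -
    have "F j (w_point d z) - F 7 (w_point d z) = F j (w_point d' z) - F 7 (w_point d' z)"
      using indep[OF that, of d z d'] indep[of 7 d z d'] by (simp add: F_def label_value_def)
    moreover have "F 7 (w_point d z) - F 7 (w_point d' z) = \<epsilon> * (d - d')"
      using e(2,3) unfolding pair_form_def by (simp add: in_W_w_point algebra_simps)
    moreover have "p - q = r" if "p - s = q - t" "s - t = r" for p q r s t :: complex using that by (simp add: algebra_simps)
    ultimately show ?thesis by blast
  qed
  have e0: "\<epsilon> \<noteq> 0" using e by (auto simp: is_sign_def)
  have "\<exists>\<eta> m. is_sign \<eta> \<and> m < 6 \<and> pair_form \<epsilon> \<eta> m (F (k + 2))" if k: "k < 6" for k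
  proof -
    have k2: "k + 2 \<in> {1..7}" "k + 2 \<in> {2..7}" using k by auto
    from c[OF k2(1)] show ?thesis
    proof (elim disjE exE conjE)
      fix \<epsilon>' \<eta> m assume P: "is_sign \<epsilon>'" "is_sign \<eta>" "m < 6" "pair_form \<epsilon>' \<eta> m (F (k + 2))"
      have "\<epsilon>' = \<epsilon>" using slope[OF k2(2), of 1 "\<lambda>_. 0" 0] P unfolding pair_form_def by (simp add: in_W_w_point)
      thus ?thesis using P by blast
    next
      fix \<theta> assume P: "sum_form \<theta> (F (k + 2))"
      have "\<epsilon> = 0" using slope[OF k2(2), of 1 "\<lambda>_. 0" 0] P unfolding sum_form_def by (simp add: in_W_w_point)
      thus ?thesis using e0 by simp
    qed
  qed
  then obtain \<eta> p0 where P: "\<And>k. k < 6 \<Longrightarrow> is_sign (\<eta> k)" "\<And>k. k < 6 \<Longrightarrow> p0 k < 6" "\<And>k. k < 6 \<Longrightarrow> pair_form \<epsilon> (\<eta> k) (p0 k) (F (k + 2))"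
    by metis
  \<comment> \<open>Raising \<open>delta\<close> by 1 shifts \<open>x_0\<close> of the image by
    \<open>\<epsilon>\<close> and hence, by the equation of \<open>W\<close>, \<open>x_1\<close> by
    \<open>-\<epsilon>\<close>. On both sides the change of \<open>quad_form\<close> is then affine
    in \<open>delta_coord\<close>, and invariance compares the two.\<close>
  have dlw: "delta_coord (\<alpha> *v w) = \<epsilon> * delta_coord w" if w: "in_W w" for w
  proof -
    obtain d z where dz: "w = w_point d z" using w_point_delta_coord_z_coord[OF w] by metis
    define w' where "w' = w_point (d + 1) z"
    have w': "in_W w'" unfolding w'_def by (rule in_W_w_point)
    have x: "x_list (\<alpha> *v w') ! i = x_list (\<alpha> *v w) ! i" if "i \<in> {2..7}" for i unfolding w'_def dz by (rule indep[OF that])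
    have x0: "x_list (\<alpha> *v w') ! 0 = x_list (\<alpha> *v w) ! 0 + \<epsilon>"
      using slope[of 7 "d + 1" z d] F7 unfolding w'_def dz by (simp add: algebra_simps)
    have i: "in_W (\<alpha> *v w)" "in_W (\<alpha> *v w')" using Hgrp_action(1)[OF \<alpha>] w w' by auto
    have x1: "x_list (\<alpha> *v w') ! 1 = x_list (\<alpha> *v w) ! 1 - \<epsilon>"
      using in_W_8[OF i(1)] in_W_8[OF i(2)] x[of 2] x[of 3] x[of 4] x[of 5] x[of 6] x[of 7] x0 by (simp add: x_list_def)
    have Q: "quad_form v = (x_list v ! 0)^2 + (x_list v ! 1)^2 + ((x_list v ! 2)^2 + (x_list v ! 3)^2 + (x_list v ! 4)^2 + (x_list v ! 5)^2 + (x_list v ! 6)^2 - (x_list v ! 7)^2 - 2 * x_list v ! 7)" for v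
      by (simp add: quad_form_def x_list_def)
    have "quad_form (\<alpha> *v w') - quad_form (\<alpha> *v w) = 2 * \<epsilon> * (x_list (\<alpha> *v w) ! 0 - x_list (\<alpha> *v w) ! 1) + 2 * (\<epsilon> * \<epsilon>)"
      unfolding Q x0 x1 using x by (simp add: power2_eq_square algebra_simps)
    also have "\<dots> = 4 * \<epsilon> * delta_coord (\<alpha> *v w) + 2" using is_sign_sq[OF e(1)] by (simp add: delta_coord_def field_simps)
    finally have 1: "quad_form (\<alpha> *v w') - quad_form (\<alpha> *v w) = 4 * \<epsilon> * delta_coord (\<alpha> *v w) + 2" .
    have "quad_form w' - quad_form w = 2 * (d + 1)^2 - 2 * d^2"
      using quad_form_eq[OF w'] quad_form_eq[OF w] unfolding w'_def dz by simp
    also have "\<dots> = 4 * delta_coord w + 2" unfolding dz by (simp add: power2_eq_square algebra_simps)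
    finally have "\<epsilon> * delta_coord (\<alpha> *v w) = delta_coord w" using 1 Hgrp_action(2)[OF \<alpha>] w w' by simp
    hence "\<epsilon> * (\<epsilon> * delta_coord (\<alpha> *v w)) = \<epsilon> * delta_coord w" by simp
    thus ?thesis using is_sign_sq[OF e(1)] by (simp add: mult.assoc[symmetric])
  qed
  have zcw: "z_coord (\<alpha> *v w) k = \<eta> k * z_coord w (p0 k)" if w: "in_W w" and k: "k < 6" for w k
  proof -
    have "1/2 + delta_coord (\<alpha> *v w) + z_coord (\<alpha> *v w) k = 1/2 + \<epsilon> * delta_coord w + \<eta> k * z_coord w (p0 k)"
      using P(3)[OF k] w unfolding pair_form_def F_def label_value_0 by simp
    thus ?thesis using dlw[OF w] by simp
  qed
  \<comment> \<open>If \<open>z_m\<close> were missed, the point with \<open>delta = 0\<close> and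
    \<open>z\<close> the \<open>m\<close>-th unit vector would be sent to a point with all
    coordinates 0, lowering \<open>quad_form\<close> by 1.\<close>
  have "\<exists>k<6. p0 k = m" if m: "m < 6" for m
  proof (rule ccontr)
    assume no: "\<not> (\<exists>k<6. p0 k = m)"
    define w where "w = w_point 0 (\<lambda>k. if k = m then 1 else 0)"
    have w: "in_W w" unfolding w_def by (rule in_W_w_point)
    have "quad_form (\<alpha> *v w) = quad_form w" using Hgrp_action(2)[OF \<alpha> w] .
    hence "(\<Sum>k<6. (z_coord (\<alpha> *v w) k)^2) = (\<Sum>k<6. (z_coord w k)^2)"
      using quad_form_eq[OF w] quad_form_eq[OF Hgrp_action(1)[OF \<alpha> w]] dlw[OF w] e(1) by (auto simp: is_sign_def)
    moreover have "z_coord (\<alpha> *v w) k = 0" if "k < 6" for k using zcw[OF w that] P(2)[OF that] no that unfolding w_def by auto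
    moreover have "(\<Sum>k<6. (z_coord w k)^2) = 1"
    proof -
      have "(\<Sum>k<6. (z_coord w k)^2) = (\<Sum>k<6. if k = m then 1 else 0)" unfolding w_def by (intro sum.cong) auto
      thus ?thesis using m by simp
    qed
    ultimately show False by simp
  qed
  hence surj: "p0 ` {..<6} = {..<6}" using P(2) by force
  hence inj: "inj_on p0 {..<6}" by (intro eq_card_imp_inj_on) auto
  define p where "p = (\<lambda>k. if k < 6 then p0 k else k)"
  have pp: "p permutes {..<6}"
  proof (rule bij_imp_permutes)
    show "bij_betw p {..<6} {..<6}" using surj inj unfolding bij_betw_def p_def by (auto simp: inj_on_def)
  qed (auto simp: p_def)
  \<comment> \<open>Two readings of \<open>v(0,1)\<close> after \<open>\<alpha>\<close>: as half the
    sum of the new \<open>z\<close> it has the signs \<open>\<eta>\<close>, and as a label of sum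
    form its signs multiply to 1.\<close>
  have "(\<Prod>k<6. \<eta> k) = 1"
  proof -
    have F1: "F 1 w = 1/2 + (\<Sum>k<6. \<eta> k * z_coord w (p0 k)) / 2" if "in_W w" for w
    proof -
      have "F 1 w = 1/2 + (\<Sum>k<6. z_coord (\<alpha> *v w) k) / 2" unfolding F_def by (rule label_value_01[OF Hgrp_action(1)[OF \<alpha> that]])
      thus ?thesis using zcw[OF that] by simp
    qed
    have "(1::nat) \<in> {1..7}" by simp
    from c[OF this] show ?thesis
    proof (elim disjE exE conjE)
      fix \<epsilon>' \<eta>' k assume "is_sign \<epsilon>'" "pair_form \<epsilon>' \<eta>' k (F 1)" "k < 6"
      hence "F 1 (w_point 1 (\<lambda>_. 0)) - F 1 (w_point 0 (\<lambda>_. 0)) = \<epsilon>'" unfolding pair_form_def by (simp add: in_W_w_point)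
      moreover have "F 1 (w_point 1 (\<lambda>_. 0)) - F 1 (w_point 0 (\<lambda>_. 0)) = 0" unfolding F1[OF in_W_w_point] using P(2) by simp
      ultimately show ?thesis using \<open>is_sign \<epsilon>'\<close> by (auto simp: is_sign_def)
    next
      fix \<theta> assume t: "\<forall>k<6. is_sign (\<theta> k)" "(\<Prod>k<6. \<theta> k) = 1" "sum_form \<theta> (F 1)"
      have "\<theta> (p0 m) = \<eta> m" if m: "m < 6" for m
      proof -
        define w where "w = w_point 0 (\<lambda>k. if k = p0 m then 1 else 0)"
        have w: "in_W w" unfolding w_def by (rule in_W_w_point)
        have "(\<Sum>k<6. \<eta> k * z_coord w (p0 k)) = (\<Sum>k<6. \<theta> k * z_coord w k)"
          using F1[OF w] t(3) w unfolding sum_form_def by simp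
        moreover have "(\<Sum>k<6. \<eta> k * z_coord w (p0 k)) = (\<Sum>k<6. if k = m then \<eta> k else 0)"
          using P(2) inj m unfolding w_def by (intro sum.cong) (auto dest: inj_onD)
        moreover have "(\<Sum>k<6. \<theta> k * z_coord w k) = (\<Sum>k<6. if k = p0 m then \<theta> k else 0)"
          unfolding w_def by (intro sum.cong) auto
        ultimately show ?thesis using m P(2)[OF m] by simp
      qed
      hence "(\<Prod>k<6. \<eta> k) = (\<Prod>k<6. \<theta> (p0 k))" by (intro prod.cong) auto
      also have "\<dots> = prod \<theta> (p0 ` {..<6})" using inj by (simp add: prod.reindex)
      finally show ?thesis using t(2) surj by simp
    qed
  qed
  hence "signed_perm \<epsilon> p \<eta> \<alpha>" unfolding signed_perm_def using e(1) pp P(1) dlw zcw by (auto simp: p_def)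
  thus ?thesis by blast
qed

section \<open>Labels\<close>

lemma w_point_wvec: "\<exists>a c d e f g. \<forall>t. w_point t z = wvec a (s + t) c d e f g" if "s = 1/2 + z 5" for s
  unfolding w_point_def Let_def that by blast

lemma wvec_of_in_W: "in_W w \<Longrightarrow> wvec (w$1) (w$2) (w$3) (w$4) (w$5) (w$6) (w$7) = w"
  by (rule vec8_eqI) (simp_all add: wvec_nth in_W_8)

lemma indep_b_w_point: "indep_b k \<alpha> \<Longrightarrow> (\<alpha> *v w_point t z) $ of_nat k = (\<alpha> *v w_point t' z) $ of_nat k"
  using w_point_wvec[of "1/2 + z 5" z] unfolding indep_b_def comp_def by metis

lemma filtercomap_Im_neq_bot: "filtercomap Im at_top \<noteq> bot"
proof (rule filtercomap_neq_bot_surj)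
  show "surj Im" by (metis complex.sel(2) surjI)
qed simp

text \<open>Extracts the algebraic content of the growth condition: a coordinate independent of
  \<open>b\<close> has constant imaginary part, which cannot diverge along a proper filter.\<close>

lemma Im_to_pm_inf_dep:
  assumes "Im_to_pm_inf k \<alpha>"
  shows "\<exists>t t'. (\<alpha> *v w_point t z) $ of_nat k \<noteq> (\<alpha> *v w_point t' z) $ of_nat k"
proof (rule ccontr)
  assume no: "\<not> ?thesis"
  obtain a c d e f g where w: "\<forall>t. w_point t z = wvec a ((1/2 + z 5) + t) c d e f g" using w_point_wvec by blast
  define C where "C = Im ((\<alpha> *v w_point 0 z) $ of_nat k)"
  have "(\<lambda>b. Im (comp k \<alpha> a b c d e f g)) = (\<lambda>b. C)"
  proof
    fix b
    have "wvec a b c d e f g = w_point (b - (1/2 + z 5)) z" using w by simp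
    thus "Im (comp k \<alpha> a b c d e f g) = C" using no unfolding comp_def C_def by metis
  qed
  with assms have "filterlim (\<lambda>b. C) at_top (filtercomap Im at_top) \<or> filterlim (\<lambda>b. C) at_bot (filtercomap Im at_top)"
    unfolding Im_to_pm_inf_def by metis
  thus False
  proof
    assume "filterlim (\<lambda>b. C) at_top (filtercomap Im at_top)"
    hence "eventually (\<lambda>b. C + 1 \<le> C) (filtercomap Im at_top)" unfolding filterlim_at_top by blast
    thus False using filtercomap_Im_neq_bot by simp
  next
    assume "filterlim (\<lambda>b. C) at_bot (filtercomap Im at_top)"
    hence "eventually (\<lambda>b. C \<le> C - 1) (filtercomap Im at_top)" unfolding filterlim_at_bot by blast
    thus False using filtercomap_Im_neq_bot by simp
  qed
qed

lemma good12_signed_perm: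
  assumes "\<alpha> \<in> Hgrp" "good12 \<alpha>"
  shows "\<exists>\<epsilon> p \<eta>. signed_perm \<epsilon> p \<eta> \<alpha>"
proof -
  obtain t t' where t: "(\<alpha> *v w_point t (\<lambda>_. 0)) $ 2 \<noteq> (\<alpha> *v w_point t' (\<lambda>_. 0)) $ 2"
    using Im_to_pm_inf_dep[of 2 \<alpha> "\<lambda>_. 0"] assms(2) unfolding good12_def by auto
  show ?thesis
  proof (rule Hgrp_signed_perm[OF assms(1)])
    show "x_list (\<alpha> *v w_point t (\<lambda>_. 0)) ! 0 \<noteq> x_list (\<alpha> *v w_point t' (\<lambda>_. 0)) ! 0" using t by (simp add: x_list_def)
    fix i d d' z assume i: "i \<in> {2..(7::nat)}"
    have "i \<in> {2,3,4,5,6,7}" using i by (simp, linarith)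
    moreover have "(\<alpha> *v w_point d z) $ of_nat k = (\<alpha> *v w_point d' z) $ of_nat k" if "k \<in> {1,3,4,5,6,7}" for k
    proof (rule indep_b_w_point)
      show "indep_b k \<alpha>" using that assms(2) unfolding good12_def by (elim insertE emptyE) simp_all
    qed
    from this[of 1] this[of 3] this[of 4] this[of 5] this[of 6] this[of 7]
    have "x_list (\<alpha> *v w_point d z) ! 2 = x_list (\<alpha> *v w_point d' z) ! 2" "x_list (\<alpha> *v w_point d z) ! 3 = x_list (\<alpha> *v w_point d' z) ! 3"
      "x_list (\<alpha> *v w_point d z) ! 4 = x_list (\<alpha> *v w_point d' z) ! 4" "x_list (\<alpha> *v w_point d z) ! 5 = x_list (\<alpha> *v w_point d' z) ! 5"
      "x_list (\<alpha> *v w_point d z) ! 6 = x_list (\<alpha> *v w_point d' z) ! 6" "x_list (\<alpha> *v w_point d z) ! 7 = x_list (\<alpha> *v w_point d' z) ! 7"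
      by (simp_all add: x_list_def)
    ultimately show "x_list (\<alpha> *v w_point d z) ! i = x_list (\<alpha> *v w_point d' z) ! i" by (elim insertE emptyE) simp_all
  qed
qed

definition y_coord :: "complex^7 \<Rightarrow> nat \<Rightarrow> complex" where
  "y_coord v k = [(v$1 + v$2 - v$3 - v$4) / 2, (v$1 + v$3 - v$2 - v$4) / 2, (v$1 + v$4 - v$2 - v$3) / 2,
     (v$6 + v$7 - v$5 - 1) / 2, (v$5 + v$7 - v$6 - 1) / 2, (v$5 + v$6 - v$7 - 1) / 2] ! k"

lemma n7_simps [simp]: "n7 1 = 1" "n7 2 = 2" "n7 3 = 3" "n7 4 = 4" "n7 5 = 5" "n7 6 = 6" "n7 7 = 7" "n7 0 = 7"
  by (simp_all add: n7_def)

lemma vec7_nth [simp]: "vec7 f $ i = f (n7 i)" by (simp add: vec7_def)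

lemma xvec_V7: "xvec a c d e f g \<in> V7"
  unfolding V7_def xvec_def by (simp add: algebra_simps)

lemma z_coord_wvec: "k < 6 \<Longrightarrow> z_coord (wvec a b c d e f g) k = y_coord (xvec a c d e f g) k"
proof -
  have "\<forall>k<6. z_coord (wvec a b c d e f g) k = y_coord (xvec a c d e f g) k"
    unfolding all_less_6 z_coord_def x_list_wvec y_coord_def xvec_def by (simp add: field_simps)
  thus "k < 6 \<Longrightarrow> z_coord (wvec a b c d e f g) k = y_coord (xvec a c d e f g) k" by blast
qed

lemma haslab_iff:
  assumes "i < 8" "j < 8"
  shows "haslab \<tau> s i j \<longleftrightarrow> (\<forall>\<alpha>\<in>\<tau>. \<forall>w. in_W w \<longrightarrow> (\<alpha> *v w) $ 2 = label_value s i j w)"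
proof -
  have x: "xM k a b c d e f g = x_list (wvec a b c d e f g) ! k" for k a b c d e f g
    unfolding xM_def x_list_wvec hW_def ..
  have "haslab \<tau> s i j \<longleftrightarrow> (\<forall>\<alpha>\<in>\<tau>. \<forall>a b c d e f g. (\<alpha> *v wvec a b c d e f g) $ 2 = label_value s i j (wvec a b c d e f g))"
    unfolding haslab_def comp_def x label_value_def by simp
  also have "\<dots> \<longleftrightarrow> (\<forall>\<alpha>\<in>\<tau>. \<forall>w. in_W w \<longrightarrow> (\<alpha> *v w) $ 2 = label_value s i j w)"
    using in_W_wvec wvec_of_in_W by metis
  finally show ?thesis .
qed

definition sign_of :: "bool \<Rightarrow> complex" where "sign_of b = (if b then 1 else -1)"

lemma sign_of_simps [simp]: "sign_of True = 1" "sign_of False = -1" "is_sign (sign_of b)" "sign_of b \<noteq> 0" "sign_of (\<not> b) = - sign_of b" "sign_of b = sign_of c \<longleftrightarrow> b = c"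
  by (auto simp: sign_of_def)

text \<open>The label as a property of the second coordinate viewed as a function on
  \<open>W\<close>. The sign of \<open>delta\<close> is left open because \<open>gamma1\<close>
  gives \<open>v(0,j)\<close> and \<open>v(1,j)\<close> the same label.\<close>

definition label_form :: "label \<Rightarrow> (complex^8 \<Rightarrow> complex) \<Rightarrow> bool" where
  "label_form l F \<longleftrightarrow> (case l of
      LL bar k \<Rightarrow> 0 < k \<and> k \<le> 6 \<and> (\<exists>\<epsilon>. is_sign \<epsilon> \<and> pair_form \<epsilon> (sign_of (\<not> bar)) (k - 1) F)
    | JL s \<Rightarrow> length s = 6 \<and> (\<Prod>k<6. sign_of (s ! k)) = 1 \<and> sum_form (\<lambda>k. sign_of (s ! k)) F)"

lemma pair_form_at:
  assumes "pair_form \<epsilon> \<eta> k F" "k < 6"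
  shows "F (w_point d z) = 1/2 + \<epsilon> * d + \<eta> * z k"
  using assms unfolding pair_form_def by (simp add: in_W_w_point)

lemma sum_form_at:
  assumes "sum_form \<theta> F"
  shows "F (w_point d z) = 1/2 + (\<Sum>k<6. \<theta> k * z k) / 2"
  using assms unfolding sum_form_def by (simp add: in_W_w_point)

lemma sum_form_unique:
  assumes "sum_form \<theta> F" "sum_form \<theta>' F" "k < 6"
  shows "\<theta> k = \<theta>' k"
proof -
  define z where "z = (\<lambda>m. if m = k then 1 else (0::complex))"
  have "(\<Sum>m<6. \<theta> m * z m) = (\<Sum>m<6. if m = k then \<theta> m else 0)" for \<theta>
    unfolding z_def by (intro sum.cong) auto
  thus ?thesis using sum_form_at[OF assms(1), of 0 z] sum_form_at[OF assms(2), of 0 z] assms(3) by simp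
qed

lemma pair_form_unique:
  assumes "pair_form \<epsilon> \<eta> k F" "pair_form \<epsilon>' \<eta>' k' F" "k < 6" "k' < 6" "is_sign \<eta>"
  shows "\<eta> = \<eta>'" "k = k'"
proof -
  define z where "z = (\<lambda>m. if m = k then 1 else (0::complex))"
  have "1/2 + \<eta> = 1/2 + \<eta>' * z k'"
    using pair_form_at[OF assms(1,3), of 0 z] pair_form_at[OF assms(2,4), of 0 z] by (simp add: z_def)
  hence "\<eta> = \<eta>' * z k'" by simp
  moreover have "\<eta> \<noteq> 0" using assms(5) by (auto simp: is_sign_def)
  ultimately show "k = k'" "\<eta> = \<eta>'" by (auto simp: z_def split: if_splits)
qed

lemma pair_form_not_sum_form:
  assumes "pair_form \<epsilon> \<eta> k F" "k < 6" "is_sign \<epsilon>"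
  shows "\<not> sum_form \<theta> F"
proof
  assume S: "sum_form \<theta> F"
  have "1/2 + \<epsilon> = (1/2 :: complex)"
    using pair_form_at[OF assms(1,2), of 1 "\<lambda>_. 0"] sum_form_at[OF S, of 1 "\<lambda>_. 0"] by simp
  thus False using assms(3) by (auto simp: is_sign_def)
qed

lemma label_form_unique:
  assumes "label_form l F" "label_form l' F"
  shows "l = l'"
proof (cases l)
  case (LL bar k)
  hence l: "0 < k" "k \<le> 6" using assms unfolding label_form_def by auto
  obtain \<epsilon> where P: "is_sign \<epsilon>" "pair_form \<epsilon> (sign_of (\<not> bar)) (k - 1) F" using assms LL unfolding label_form_def by auto
  show ?thesis
  proof (cases l')
    case LL': (LL bar' k')
    hence l': "0 < k'" "k' \<le> 6" using assms unfolding label_form_def by auto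
    obtain \<epsilon>' where P': "pair_form \<epsilon>' (sign_of (\<not> bar')) (k' - 1) F" using assms LL' unfolding label_form_def by auto
    have "k - 1 = k' - 1" "sign_of (\<not> bar) = sign_of (\<not> bar')" using pair_form_unique[OF P(2) P'] l l' by auto
    hence "k = k'" "bar = bar'" using l l' by (auto simp: sign_of_def split: if_splits)
    thus ?thesis using LL LL' by simp
  next
    case (JL s)
    hence "sum_form (\<lambda>k. sign_of (s ! k)) F" using assms unfolding label_form_def by auto
    moreover have "k - 1 < 6" using l by linarith
    ultimately show ?thesis using pair_form_not_sum_form P by blast
  qed
next
  case (JL s)
  hence S: "length s = 6" "sum_form (\<lambda>k. sign_of (s ! k)) F" using assms unfolding label_form_def by auto
  show ?thesis
  proof (cases l')
    case (LL bar k)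
    hence l: "k - 1 < 6" using assms unfolding label_form_def by auto
    obtain \<epsilon> where "is_sign \<epsilon>" "pair_form \<epsilon> (sign_of (\<not> bar)) (k - 1) F" using assms LL unfolding label_form_def by auto
    thus ?thesis using pair_form_not_sum_form S(2) l by blast
  next
    case JL': (JL s')
    hence S': "length s' = 6" "sum_form (\<lambda>k. sign_of (s' ! k)) F" using assms unfolding label_form_def by auto
    have "s ! k = s' ! k" if "k < 6" for k using sum_form_unique[OF S(2) S'(2) that] by simp
    hence "s = s'" using S(1) S'(1) by (simp add: list_eq_iff_nth_eq)
    thus ?thesis using JL JL' by simp
  qed
qed

definition has_label :: "(complex^8^8) set \<Rightarrow> label \<Rightarrow> bool" where
  "has_label \<tau> l \<longleftrightarrow>
      (\<exists>j\<in>{2..7}. (haslab \<tau> True 0 j \<or> haslab \<tau> True 1 j) \<and> l = LL False (j - 1))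
    \<or> (\<exists>j\<in>{2..7}. (haslab \<tau> False 1 j \<or> haslab \<tau> False 0 j) \<and> l = LL True (j - 1))
    \<or> (\<exists>s. haslab \<tau> s 0 1 \<and> l = JL (replicate 6 s))
    \<or> (\<exists>s i j. 2 \<le> i \<and> i < j \<and> j \<le> 7 \<and> haslab \<tau> s i j \<and>
          l = JL (map (\<lambda>k. if k = i - 1 \<or> k = j - 1 then s else \<not> s) [1..<7]))"

lemma pair_form_label_value:
  assumes "i < 2" "j \<in> {2..7}"
  shows "\<exists>\<epsilon>. is_sign \<epsilon> \<and> pair_form \<epsilon> (sign_of s) (j - 2) (label_value s i j)"
proof -
  define k where "k = j - 2"
  have k: "j = k + 2" "k < 6" using assms(2) unfolding k_def by auto
  consider "i = 0" | "i = 1" using assms(1) by linarith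
  thus ?thesis
  proof cases
    case 1
    show ?thesis
      using pair_form_0[OF k(2)] pair_form_neg[OF pair_form_0[OF k(2)]] unfolding 1 k(1)
      by (cases s; intro exI[of _ "sign_of s"]) simp_all
  next
    case 2
    show ?thesis
      using pair_form_1[OF k(2)] pair_form_neg[OF pair_form_1[OF k(2)]] unfolding 2 k(1)
      by (cases s; intro exI[of _ "- sign_of s"]) simp_all
  qed
qed

lemma has_label_label_form:
  assumes "has_label \<tau> l" "\<alpha> \<in> \<tau>"
  shows "label_form l (\<lambda>w. (\<alpha> *v w) $ 2)"
proof -
  define F where "F = (\<lambda>w. (\<alpha> *v w) $ 2)"
  have F: "F w = label_value s i j w" if "haslab \<tau> s i j" "i < 8" "j < 8" "in_W w" for s i j w
    using that assms(2) haslab_iff[of i j \<tau> s] unfolding F_def by blast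
  have L: "label_form (LL (\<not> s) (j - 1)) F" if h: "haslab \<tau> s i j" "i < 2" and j: "j \<in> {2..7}" for s i j
  proof -
    obtain \<epsilon> where e: "is_sign \<epsilon>" "pair_form \<epsilon> (sign_of s) (j - 2) (label_value s i j)" using pair_form_label_value[OF h(2) j] by blast
    have "pair_form \<epsilon> (sign_of s) (j - 2) F" using e(2) F[OF h(1)] h(2) j unfolding pair_form_def by simp
    moreover have "j - 1 - 1 = j - 2" by simp
    ultimately show ?thesis using e(1) j unfolding label_form_def by auto
  qed
  have J0: "label_form (JL (replicate 6 s)) F" if h: "haslab \<tau> s 0 1" for s
  proof -
    have "sum_form (\<lambda>k. sign_of s) (label_value s 0 1)" using sum_form_01 sum_form_neg[OF sum_form_01] by (cases s) simp_all
    hence "sum_form (\<lambda>k. sign_of s) F" using F[OF h] unfolding sum_form_def by simp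
    hence "sum_form (\<lambda>k. sign_of (replicate 6 s ! k)) F" unfolding sum_form_def by simp
    moreover have "(\<Prod>k<6. sign_of (replicate 6 s ! k)) = 1" by (cases s) simp_all
    ultimately show ?thesis unfolding label_form_def by simp
  qed
  have J: "label_form (JL (map (\<lambda>k. if k = i - 1 \<or> k = j - 1 then s else \<not> s) [1..<7])) F"
    if h: "haslab \<tau> s i j" and ij: "2 \<le> i" "i < j" "j \<le> 7" for s i j
  proof -
    define i' j' where "i' = i - 2" "j' = j - 2"
    hence ij': "i = i' + 2" "j = j' + 2" using ij by auto
    have l: "i' < 6" "j' < 6" "i' \<noteq> j'" using ij ij' by auto
    define \<theta> where "\<theta> = (\<lambda>k. sign_of (if k = i' \<or> k = j' then s else \<not> s))"
    have S: "sum_form \<theta> (label_value s i j)"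
    proof (cases s)
      case True
      have "\<theta> = (\<lambda>k. if k = i' \<or> k = j' then 1 else -1)" unfolding \<theta>_def using True by (auto simp: fun_eq_iff)
      thus ?thesis using sum_form_ij[OF l] True unfolding ij' by simp
    next
      case False
      have "\<theta> = (\<lambda>k. - (if k = i' \<or> k = j' then 1 else -1))" unfolding \<theta>_def using False by (auto simp: fun_eq_iff)
      thus ?thesis using sum_form_neg[OF sum_form_ij[OF l]] False unfolding ij' by simp
    qed
    have S: "sum_form \<theta> F" using S F[OF h] ij unfolding sum_form_def by simp
    have n: "map (\<lambda>k. if k = i - 1 \<or> k = j - 1 then s else \<not> s) [1..<7] ! k = (if k = i' \<or> k = j' then s else \<not> s)" if "k < 6" for k
      using that ij' by simp
    have "sum_form (\<lambda>k. sign_of (map (\<lambda>k. if k = i - 1 \<or> k = j - 1 then s else \<not> s) [1..<7] ! k)) F"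
      using S n unfolding sum_form_def \<theta>_def by simp
    moreover have "(\<Prod>k<6. sign_of (map (\<lambda>k. if k = i - 1 \<or> k = j - 1 then s else \<not> s) [1..<7] ! k)) = 1"
    proof -
      have "(\<Prod>k<6. sign_of (map (\<lambda>k. if k = i - 1 \<or> k = j - 1 then s else \<not> s) [1..<7] ! k))
         = (\<Prod>k<6. sign_of s * (if k = i' \<or> k = j' then 1 else -1))"
        by (intro prod.cong refl, subst n) auto
      also have "\<dots> = 1" unfolding prod.distrib prod_sign_pair[OF l] by (cases s) simp_all
      finally show ?thesis .
    qed
    ultimately show ?thesis unfolding label_form_def by simp
  qed
  show ?thesis
    using assms(1) L[of True 0] L[of True 1] L[of False 0] L[of False 1] J0 J unfolding has_label_def F_def[symmetric]
    by (elim disjE bexE exE conjE) simp_all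
qed

text \<open>Uniqueness of label forms makes the definite description proper and allows the label to
  be read off from any representative.\<close>

lemma gamma1_eq:
  assumes "has_label \<tau> l" "\<alpha> \<in> \<tau>" "label_form l' (\<lambda>w. (\<alpha> *v w) $ 2)"
  shows "gamma1 \<tau> = l'"
proof -
  have "gamma1 \<tau> = (THE l. has_label \<tau> l)" unfolding gamma1_def has_label_def ..
  also have "\<dots> = l" using has_label_label_form[OF _ assms(2)] assms(1) label_form_unique by (intro the_equality) blast+
  also have "\<dots> = l'" using has_label_label_form[OF assms(1,2)] assms(3) label_form_unique by blast
  finally show ?thesis .
qed

lemma O12_has_label: "\<tau> \<in> O1 \<union> O2 \<Longrightarrow> \<exists>bar k. has_label \<tau> (LL bar k)"
  unfolding O1_def O2_def has_label_def by blast

lemma O3_has_label: "\<tau> \<in> O3 \<Longrightarrow> \<exists>s. has_label \<tau> (JL s)"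
  unfolding O3_def has_label_def by blast

lemma O3_not_O12:
  assumes "\<tau> \<in> O3" "\<alpha> \<in> \<tau>"
  shows "\<tau> \<notin> O1 \<union> O2"
proof
  assume "\<tau> \<in> O1 \<union> O2"
  then obtain bar k s where "has_label \<tau> (LL bar k)" "has_label \<tau> (JL s)" using O12_has_label O3_has_label assms(1) by blast
  from label_form_unique[OF this[THEN has_label_label_form[OF _ assms(2)]]] show False by simp
qed

section \<open>The action of H1 on V\<close>

lemma exhaust_7: "(x::7) = 1 \<or> x = 2 \<or> x = 3 \<or> x = 4 \<or> x = 5 \<or> x = 6 \<or> x = 7"
proof (induct x)
  case (of_int z)
  then have "0 \<le> z" "z < 7" by simp_all
  then have "z = 0 \<or> z = 1 \<or> z = 2 \<or> z = 3 \<or> z = 4 \<or> z = 5 \<or> z = 6" by arith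
  then show ?case by auto
qed

lemma UNIV_7: "(UNIV::7 set) = {1,2,3,4,5,6,7}"
proof (rule set_eqI)
  fix x :: 7
  show "x \<in> UNIV \<longleftrightarrow> x \<in> {1,2,3,4,5,6,7}"
    using exhaust_7[of x] by (simp only: insert_iff empty_iff simp_thms UNIV_I)
qed

lemma vec7_eqI:
  assumes "(x::'a^7)$1 = y$1" "x$2 = y$2" "x$3 = y$3" "x$4 = y$4" "x$5 = y$5" "x$6 = y$6" "x$7 = y$7"
  shows "x = y"
  unfolding vec_eq_iff
proof
  fix i :: 7
  show "x$i = y$i" using exhaust_7[of i] by (elim disjE) (simp_all only: assms)
qed

lemma mk7_mult_vec: "(mk7 f *v w) $ i = f (n7 i) 1 * w$1 + f (n7 i) 2 * w$2 + f (n7 i) 3 * w$3 + f (n7 i) 4 * w$4 +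
   f (n7 i) 5 * w$5 + f (n7 i) 6 * w$6 + f (n7 i) 7 * w$7"
proof -
  have "sum F (UNIV :: 7 set) = F 1 + F 2 + F 3 + F 4 + F 5 + F 6 + F 7" for F :: "7 \<Rightarrow> complex"
    unfolding UNIV_7 by (simp add: add.assoc)
  thus ?thesis by (simp add: matrix_vector_mult_def mk7_def)
qed

lemma H1gens_mult_vec:
  "swap7 1 2 *v w = vec7 (\<lambda>k. [w$2, w$1, w$3, w$4, w$5, w$6, w$7] ! (k-1))"
  "swap7 2 3 *v w = vec7 (\<lambda>k. [w$1, w$3, w$2, w$4, w$5, w$6, w$7] ! (k-1))"
  "swap7 3 4 *v w = vec7 (\<lambda>k. [w$1, w$2, w$4, w$3, w$5, w$6, w$7] ! (k-1))"
  "swap7 5 6 *v w = vec7 (\<lambda>k. [w$1, w$2, w$3, w$4, w$6, w$5, w$7] ! (k-1))"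
  "swap7 6 7 *v w = vec7 (\<lambda>k. [w$1, w$2, w$3, w$4, w$5, w$7, w$6] ! (k-1))"
  "X1mat *v w = vec7 (\<lambda>k. [w$1, w$5 - w$3, w$5 - w$2, w$4, w$5, w$5 + w$6 - w$2 - w$3, w$5 + w$7 - w$2 - w$3] ! (k-1))"
  by (rule vec7_eqI; simp add: swap7_def X1mat_def mk7_mult_vec tr_def)+

abbreviation H1gens :: "(complex^7^7) set" where
  "H1gens \<equiv> {swap7 1 2, swap7 2 3, swap7 3 4, swap7 5 6, swap7 6 7, X1mat}"

lemma H1gens_involution: "s \<in> H1gens \<Longrightarrow> s *v (s *v w) = w"
  by (elim insertE emptyE; rule vec7_eqI; simp add: H1gens_mult_vec del: One_nat_def)

lemma H1grp_induct [consumes 1, case_names one mult]: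
  assumes "g \<in> H1grp" "P (mat 1)" "\<And>s g. s \<in> H1gens \<Longrightarrow> g \<in> H1grp \<Longrightarrow> P g \<Longrightarrow> P (s ** g)"
  shows "P g"
  using assms(1) unfolding H1grp_def
proof (induction rule: gen_group.induct)
  case (gen_inv s g)
  have "matrix_inv s = s" by (rule matrix_inv_eqI; rule H1gens_involution[OF gen_inv(1)])
  thus ?case using assms(3) gen_inv unfolding H1grp_def by metis
next
  case gen_one
  show ?case by (rule assms(2))
next
  case (gen_mul s g)
  thus ?case using assms(3) unfolding H1grp_def by blast
qed

definition signed_perm7 :: "(nat \<Rightarrow> nat) \<Rightarrow> (nat \<Rightarrow> complex) \<Rightarrow> complex^7^7 \<Rightarrow> bool" where
  "signed_perm7 p \<eta> \<beta> \<longleftrightarrow> p permutes {..<6} \<and> (\<forall>k<6. is_sign (\<eta> k)) \<and>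
     (\<forall>v\<in>V7. \<beta> *v v \<in> V7 \<and> (\<forall>k<6. y_coord (\<beta> *v v) k = \<eta> k * y_coord v (p k)))"

lemma V7_sum: "v \<in> V7 \<Longrightarrow> v$7 = 1 + v$1 + v$2 + v$3 + v$4 - v$5 - v$6"
  unfolding V7_def by (simp add: algebra_simps)

lemma V7_coords:
  assumes "v \<in> V7"
  shows "v$1 = 1/2 + (\<Sum>k<6. y_coord v k) / 2" "v$2 = v$1 - y_coord v 1 - y_coord v 2" "v$3 = v$1 - y_coord v 0 - y_coord v 2"
    "v$4 = v$1 - y_coord v 0 - y_coord v 1" "v$5 = 1 + y_coord v 4 + y_coord v 5" "v$6 = 1 + y_coord v 3 + y_coord v 5" "v$7 = 1 + y_coord v 3 + y_coord v 4"
  unfolding sum_less_6 y_coord_def by (simp_all add: V7_sum[OF assms] field_simps)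

lemma map_upt_6: "map f [0..<6] = [f 0, f 1, f 2, f 3, f 4, f 5]"
  by (simp add: upt_rec eval_nat_numeral)
text \<open>Five generators act as the five adjacent transpositions of the six coordinates,
  \<open>X1\<close> being the one across the two halves. The transposition \<open>(12)\<close>
  exchanges two coordinates and negates both, so the action is that of the Weyl group of type
  \<open>D_6\<close>.\<close>

lemma y_coord_H1gens:
  "v \<in> V7 \<Longrightarrow> map (y_coord (swap7 1 2 *v v)) [0..<6] = [y_coord v 0, - y_coord v 2, - y_coord v 1, y_coord v 3, y_coord v 4, y_coord v 5]"
  "v \<in> V7 \<Longrightarrow> map (y_coord (swap7 2 3 *v v)) [0..<6] = [y_coord v 1, y_coord v 0, y_coord v 2, y_coord v 3, y_coord v 4, y_coord v 5]"
  "v \<in> V7 \<Longrightarrow> map (y_coord (swap7 3 4 *v v)) [0..<6] = [y_coord v 0, y_coord v 2, y_coord v 1, y_coord v 3, y_coord v 4, y_coord v 5]"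
  "v \<in> V7 \<Longrightarrow> map (y_coord (swap7 5 6 *v v)) [0..<6] = [y_coord v 0, y_coord v 1, y_coord v 2, y_coord v 4, y_coord v 3, y_coord v 5]"
  "v \<in> V7 \<Longrightarrow> map (y_coord (swap7 6 7 *v v)) [0..<6] = [y_coord v 0, y_coord v 1, y_coord v 2, y_coord v 3, y_coord v 5, y_coord v 4]"
  "v \<in> V7 \<Longrightarrow> map (y_coord (X1mat *v v)) [0..<6] = [y_coord v 0, y_coord v 1, y_coord v 3, y_coord v 2, y_coord v 4, y_coord v 5]"
  by (simp_all only: map_upt_6 H1gens_mult_vec) (simp_all add: y_coord_def V7_sum field_simps)


lemma V7_gens: "s \<in> H1gens \<Longrightarrow> v \<in> V7 \<Longrightarrow> s *v v \<in> V7"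
  by (elim insertE emptyE) (simp_all add: V7_def H1gens_mult_vec algebra_simps del: One_nat_def)

lemma transpose_permutes_6: "a < 6 \<Longrightarrow> b < 6 \<Longrightarrow> Transposition.transpose a b permutes {..<6::nat}"
  by (rule permutes_swap_id) simp_all

lemma H1gens_signed_perm7:
  assumes "s \<in> H1gens"
  shows "\<exists>p \<eta>. signed_perm7 p \<eta> s"
proof -
  have I: ?thesis if l: "a < 6" "b < 6" "\<forall>k<6. is_sign (\<eta> k)"
    "\<And>v. v \<in> V7 \<Longrightarrow> map (y_coord (s *v v)) [0..<6] = map (\<lambda>k. \<eta> k * y_coord v (Transposition.transpose a b k)) [0..<6]" for a b \<eta>
  proof -
    have "signed_perm7 (Transposition.transpose a b) \<eta> s"
      unfolding signed_perm7_def using l transpose_permutes_6[OF l(1,2)] V7_gens[OF assms] by simp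
    thus ?thesis by blast
  qed
  show ?thesis using assms
  proof (elim insertE emptyE)
    assume s: "s = swap7 1 2"
    show ?thesis
      by (rule I[of 1 2 "\<lambda>k. if k = 1 \<or> k = 2 then -1 else 1"], unfold s)
        (simp_all only: y_coord_H1gens, simp_all add: map_upt_6 Transposition.transpose_def)
  next
    assume s: "s = swap7 2 3"
    show ?thesis by (rule I[of 0 1 "\<lambda>_. 1"], unfold s)
      (simp_all only: y_coord_H1gens, simp_all add: map_upt_6 Transposition.transpose_def)
  next
    assume s: "s = swap7 3 4"
    show ?thesis by (rule I[of 1 2 "\<lambda>_. 1"], unfold s)
      (simp_all only: y_coord_H1gens, simp_all add: map_upt_6 Transposition.transpose_def)
  next
    assume s: "s = swap7 5 6"
    show ?thesis by (rule I[of 3 4 "\<lambda>_. 1"], unfold s)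
      (simp_all only: y_coord_H1gens, simp_all add: map_upt_6 Transposition.transpose_def)
  next
    assume s: "s = swap7 6 7"
    show ?thesis by (rule I[of 4 5 "\<lambda>_. 1"], unfold s)
      (simp_all only: y_coord_H1gens, simp_all add: map_upt_6 Transposition.transpose_def)
  next
    assume s: "s = X1mat"
    show ?thesis by (rule I[of 2 3 "\<lambda>_. 1"], unfold s)
      (simp_all only: y_coord_H1gens, simp_all add: map_upt_6 Transposition.transpose_def)
  qed
qed

lemma H1grp_signed_perm7:
  assumes "\<beta> \<in> H1grp"
  shows "\<exists>p \<eta>. signed_perm7 p \<eta> \<beta>"
  using assms
proof (induction rule: H1grp_induct)
  case one
  have "signed_perm7 id (\<lambda>_. 1) (mat 1)" unfolding signed_perm7_def by (simp add: permutes_id)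
  thus ?case by blast
next
  case (mult s g)
  obtain p \<eta> where g: "signed_perm7 p \<eta> g" using mult by blast
  obtain q \<theta> where s: "signed_perm7 q \<theta> s" using H1gens_signed_perm7[OF mult(1)] by blast
  have q: "q k < 6" if "k < 6" for k using s that permutes_in_image[of q "{..<6}" k] unfolding signed_perm7_def by simp
  have "signed_perm7 (p \<circ> q) (\<lambda>k. \<theta> k * \<eta> (q k)) (s ** g)"
    using g s q permutes_compose[of q "{..<6}" p] unfolding signed_perm7_def
    by (simp add: matrix_vector_mul_assoc[symmetric] is_sign_mult)
  thus ?case by blast
qed

section \<open>Sign strings and \<open>J\<close>-cosets\<close>

definition string_value :: "bool list \<Rightarrow> complex^7 \<Rightarrow> complex" where
  "string_value s v = 1/2 + (\<Sum>k<6. sign_of (s ! k) * y_coord v k) / 2"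

definition v_point :: "(nat \<Rightarrow> complex) \<Rightarrow> complex^7" where
  "v_point y = (let A = 1/2 + (\<Sum>k<6. y k) / 2 in
     vec7 (\<lambda>m. [A, A - y 1 - y 2, A - y 0 - y 2, A - y 0 - y 1, 1 + y 4 + y 5, 1 + y 3 + y 5, 1 + y 3 + y 4] ! (m - 1)))"

lemma v_point_V7: "v_point y \<in> V7"
  unfolding v_point_def V7_def Let_def by (simp add: sum_less_6 field_simps)

lemma y_coord_v_point: "k < 6 \<Longrightarrow> y_coord (v_point y) k = y k"
proof -
  have "\<forall>k<6. y_coord (v_point y) k = y k"
    unfolding all_less_6 y_coord_def v_point_def Let_def by (simp add: field_simps)
  thus "k < 6 \<Longrightarrow> y_coord (v_point y) k = y k" by blast
qed

text \<open>The meaning of the label strings: \<open>b_r\<close> gives the signs of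
  \<open>y1, y2, y3\<close> and \<open>b_q\<close> those of \<open>y4, y5, y6\<close> in
  \<open>1 + A_r - E_q\<close>; complementing to 1 negates all six.\<close>

lemma string_value_jlab:
  assumes "v \<in> V7" "r < 4" "q < 4"
  shows "1 + Aco r v - Eco q v = string_value (bstr r @ bstr q) v" "Eco q v - Aco r v = string_value (map Not (bstr r @ bstr q)) v"
proof -
  have 4: "k \<in> {0,1,2,3}" if "k < 4" for k :: nat using that by (simp, linarith)
  have A: "Aco r v = 1/2 + (\<Sum>k<3. sign_of (bstr r ! k) * y_coord v k) / 2 + (y_coord v 3 + y_coord v 4 + y_coord v 5) / 2"
    using 4[OF assms(2)] by (elim insertE emptyE) (simp_all add: Aco_def bstr_def V7_coords[OF assms(1)] sum_less_6 eval_nat_numeral field_simps)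
  have E: "Eco q v = 1 + (y_coord v 3 + y_coord v 4 + y_coord v 5) / 2 - (\<Sum>k<3. sign_of (bstr q ! k) * y_coord v (k + 3)) / 2"
    using 4[OF assms(3)] by (elim insertE emptyE) (simp_all add: Eco_def bstr_def V7_coords[OF assms(1)] eval_nat_numeral field_simps)
  have l: "length (bstr k) = 3" if "k < 4" for k using 4[OF that] by (auto simp: bstr_def)
  have S: "(\<Sum>k<6. sign_of ((bstr r @ bstr q) ! k) * y_coord v k) = (\<Sum>k<3. sign_of (bstr r ! k) * y_coord v k) + (\<Sum>k<3. sign_of (bstr q ! k) * y_coord v (k + 3))"
    unfolding sum_less_6 using l[OF assms(2)] by (simp add: eval_nat_numeral nth_append)
  show 1: "1 + Aco r v - Eco q v = string_value (bstr r @ bstr q) v"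
    unfolding string_value_def A E S by (simp add: add_divide_distrib)
  have "(\<Sum>k<6. sign_of (map Not (bstr r @ bstr q) ! k) * y_coord v k) = - (\<Sum>k<6. sign_of ((bstr r @ bstr q) ! k) * y_coord v k)"
    unfolding sum_negf[symmetric] using l[OF assms(2)] l[OF assms(3)] by (intro sum.cong) (auto simp del: map_append simp: nth_map)
  hence "string_value (map Not (bstr r @ bstr q)) v = 1 - string_value (bstr r @ bstr q) v"
    unfolding string_value_def by (simp add: field_simps)
  moreover have "Eco q v - Aco r v = 1 - (1 + Aco r v - Eco q v)" by simp
  ultimately show "Eco q v - Aco r v = string_value (map Not (bstr r @ bstr q)) v" unfolding 1 by simp
qed

lemma length_6_conv: "length s = 6 \<Longrightarrow> \<exists>a b c d e f. s = [a,b,c,d,e,f]"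
  by (auto simp: length_Suc_conv eval_nat_numeral)

text \<open>In a string with an even number of minus signs both halves are even or both are odd;
  this gives the 16 concatenations and their 16 negations.\<close>

lemma bstr_cover:
  assumes "length s = 6" "(\<Prod>k<6. sign_of (s ! k)) = 1"
  shows "\<exists>r<4. \<exists>q<4. s = bstr r @ bstr q \<or> s = map Not (bstr r @ bstr q)"
proof -
  obtain a b c d e f where s: "s = [a,b,c,d,e,f]" using length_6_conv[OF assms(1)] by blast
  have ex: "(\<exists>r<4. P r) \<longleftrightarrow> P 0 \<or> P 1 \<or> P 2 \<or> P (3::nat)" for P
    by (auto simp: eval_nat_numeral less_Suc_eq)
  have "(\<Prod>k<6. sign_of (s ! k)) = sign_of a * sign_of b * sign_of c * sign_of d * sign_of e * sign_of f"
    unfolding s by (simp add: eval_nat_numeral)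
  thus ?thesis using assms(2) unfolding s ex bstr_def
    by (cases a; cases b; cases c; cases d; cases e; cases f; simp)
qed

text \<open>Strings \<open>s\<close> attained as first coordinates; right multiplication by the generators permutes them and negates a pair.\<close>

definition reached :: "bool list \<Rightarrow> bool" where
  "reached s \<longleftrightarrow> (\<exists>\<beta>\<in>H1grp. \<forall>v\<in>V7. (\<beta> *v v) $ 1 = string_value s v)"

lemma reached_right:
  assumes "reached s" "g \<in> H1gens" "\<And>v. v \<in> V7 \<Longrightarrow> string_value s (g *v v) = string_value t v"
  shows "reached t"
proof -
  obtain \<beta> where b: "\<beta> \<in> H1grp" "\<forall>v\<in>V7. (\<beta> *v v) $ 1 = string_value s v" using assms(1) unfolding reached_def by blast
  have "\<beta> ** g \<in> H1grp" using b(1) gen_group_mult gen_group_gen[OF assms(2)] unfolding H1grp_def by blast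
  moreover have "(\<beta> ** g *v v) $ 1 = string_value t v" if "v \<in> V7" for v
    using b(2) V7_gens[OF assms(2) that] assms(3)[OF that] by (simp add: matrix_vector_mul_assoc[symmetric])
  ultimately show ?thesis unfolding reached_def by blast
qed

lemma reached_steps:
  assumes "reached [a,b,c,d,e,f]"
  shows "reached [b,a,c,d,e,f]" "reached [a,c,b,d,e,f]" "reached [a,b,d,c,e,f]" "reached [a,b,c,e,d,f]" "reached [a,b,c,d,f,e]"
    "reached [a,\<not>c,\<not>b,d,e,f]"
proof -
  have s: "string_value [a,b,c,d,e,f] v = 1/2 + (sign_of a * y_coord v 0 + sign_of b * y_coord v 1 + sign_of c * y_coord v 2 + sign_of d * y_coord v 3 + sign_of e * y_coord v 4 + sign_of f * y_coord v 5) / 2"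
    for a b c d e f v unfolding string_value_def sum_less_6 by (simp add: eval_nat_numeral)
  note Y = y_coord_H1gens[unfolded map_upt_6 list.inject]
  show "reached [b,a,c,d,e,f]" by (rule reached_right[OF assms, of "swap7 2 3"]) (simp_all add: s Y del: One_nat_def)
  show "reached [a,c,b,d,e,f]" by (rule reached_right[OF assms, of "swap7 3 4"]) (simp_all add: s Y del: One_nat_def)
  show "reached [a,b,d,c,e,f]" by (rule reached_right[OF assms, of "X1mat"]) (simp_all add: s Y del: One_nat_def)
  show "reached [a,b,c,e,d,f]" by (rule reached_right[OF assms, of "swap7 5 6"]) (simp_all add: s Y del: One_nat_def)
  show "reached [a,b,c,d,f,e]" by (rule reached_right[OF assms, of "swap7 6 7"]) (simp_all add: s Y del: One_nat_def)
  show "reached [a,\<not>c,\<not>b,d,e,f]" by (rule reached_right[OF assms, of "swap7 1 2"]) (simp_all add: s Y del: One_nat_def)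
qed

lemma reached_mset:
  assumes "mset xs = mset ys" "length xs = 6"
  shows "reached xs = reached ys"
proof (rule adjacent_swaps_mset[where P = "\<lambda>xs. length xs = 6", OF _ _ assms])
  show "mset xs = mset ys \<Longrightarrow> length xs = 6 \<Longrightarrow> length ys = 6" for xs ys :: "bool list" by (metis size_mset)
  have imp: "reached (us @ y # x # vs)" if r: "reached (us @ x # y # vs)" and l: "length (us @ x # y # vs) = 6" for us x y vs
  proof -
    obtain a b c d e f where abc: "us @ x # y # vs = [a,b,c,d,e,f]"
      using length_6_conv[OF l] by blast
    hence "reached [a,b,c,d,e,f]" using r by simp
    note R = reached_steps[OF this]
    have "length us < 5" using l by simp
    hence "length us \<in> {0,1,2,3,4}" unfolding insert_iff empty_iff by linarith
    thus ?thesis using abc R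
      by (elim insertE emptyE) (auto simp: length_Suc_conv eval_nat_numeral)
  qed
  show "reached (us @ x # y # vs) = reached (us @ y # x # vs)" if "length (us @ x # y # vs) = 6" for us x y vs
    using imp[of us x y vs] imp[of us y x vs] that by auto
qed

text \<open>Up to permutation an even string is determined by its number of minus signs, 0, 2, 4 or
  6. Each representative arises from the preceding one by moving two plus signs to the second and
  third place, where \<open>(12)\<close> negates them.\<close>

lemma reached_all:
  assumes "length s = 6" "(\<Prod>k<6. sign_of (s ! k)) = 1"
  shows "reached s"
proof -
  have "reached [True,True,True,True,True,True]"
  proof -
    have "mat 1 \<in> H1grp" unfolding H1grp_def by (rule gen_group.gen_one)
    moreover have "(mat 1 *v v) $ 1 = string_value [True,True,True,True,True,True] v" if "v \<in> V7" for v
      using V7_coords(1)[OF that] by (simp add: string_value_def sum_less_6 eval_nat_numeral)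
    ultimately show ?thesis unfolding reached_def by blast
  qed
  hence 1: "reached [True,True,True,True,True,True]" "reached [True,False,False,True,True,True]" using reached_steps(6) by fastforce+
  have "reached [False,True,True,False,True,True]" by (rule reached_mset[THEN iffD1, OF _ _ 1(2)]) simp_all
  hence 2: "reached [False,False,False,False,True,True]" using reached_steps(6) by fastforce
  have "reached [False,True,True,False,False,False]" by (rule reached_mset[THEN iffD1, OF _ _ 2]) simp_all
  hence 3: "reached [False,False,False,False,False,False]" using reached_steps(6) by fastforce
  obtain a b c d e f where s: "s = [a,b,c,d,e,f]" using length_6_conv[OF assms(1)] by blast
  have "(\<Prod>k<6. sign_of (s ! k)) = sign_of a * sign_of b * sign_of c * sign_of d * sign_of e * sign_of f"
    unfolding s by (simp add: eval_nat_numeral)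
  hence "\<exists>t\<in>{[True,True,True,True,True,True], [True,False,False,True,True,True], [False,False,False,False,True,True], [False,False,False,False,False,False]}. mset s = mset t"
    using assms(2) unfolding s by (cases a; cases b; cases c; cases d; cases e; cases f; simp)
  thus ?thesis using 1 2 3 reached_mset[OF _ assms(1)] by blast
qed

lemma jlab_exists:
  assumes "length s = 6" "(\<Prod>k<6. sign_of (s ! k)) = 1"
  shows "\<exists>\<beta>. \<beta> \<in> H1grp \<and> jlab \<beta> s"
proof -
  obtain \<beta> where b: "\<beta> \<in> H1grp" "\<forall>v\<in>V7. (\<beta> *v v) $ 1 = string_value s v" using reached_all[OF assms] unfolding reached_def by blast
  obtain r q where "r < 4" "q < 4" "s = bstr r @ bstr q \<or> s = map Not (bstr r @ bstr q)" using bstr_cover[OF assms] by blast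
  hence "jlab \<beta> s" using b(2) string_value_jlab unfolding jlab_def by metis
  thus ?thesis using b(1) by blast
qed

lemma jlab_string_value: "jlab \<beta> s \<Longrightarrow> v \<in> V7 \<Longrightarrow> (\<beta> *v v) $ 1 = string_value s v"
  unfolding jlab_def using string_value_jlab by metis

text \<open>The first coordinate is \<open>1/2\<close> plus half the sum of all \<open>y\<close>, so
  evaluating it at unit vectors determines the signs of the signed permutation
  \<open>\<beta>\<close>. The permutation itself stays undetermined; the multiset suffices because
  \<open>J_sym\<close> is symmetric.\<close>

lemma jlab_mset:
  assumes "\<beta> \<in> H1grp" "jlab \<beta> s" "v \<in> V7"
  shows "mset (map (y_coord (\<beta> *v v)) [0..<6]) = mset (map (\<lambda>k. sign_of (s ! k) * y_coord v k) [0..<6])"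
proof -
  obtain p \<eta> where p: "signed_perm7 p \<eta> \<beta>" using H1grp_signed_perm7[OF assms(1)] by blast
  have pp: "p permutes {..<6}" and Y: "y_coord (\<beta> *v v) k = \<eta> k * y_coord v (p k)" "\<beta> *v v \<in> V7" if "v \<in> V7" "k < 6" for v k
    using p that unfolding signed_perm7_def by auto
  have pl: "p k < 6" if "k < 6" for k using pp[OF v_point_V7 that] that permutes_in_image[of p "{..<6}" k] by simp
  have inj: "p k = p m \<longleftrightarrow> k = m" for k m using permutes_inj[OF pp[OF v_point_V7, of 0]] by (auto dest: injD)
  have e: "\<eta> k = sign_of (s ! p k)" if k: "k < 6" for k
  proof -
    define u where "u = v_point (\<lambda>m. if m = p k then 1 else 0)"
    have u: "u \<in> V7" unfolding u_def by (rule v_point_V7)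
    have "1/2 + (\<Sum>m<6. y_coord (\<beta> *v u) m) / 2 = string_value s u"
      using jlab_string_value[OF assms(2) u] V7_coords(1)[OF Y(2)[OF u k]] by simp
    moreover have "(\<Sum>m<6. y_coord (\<beta> *v u) m) = (\<Sum>m<6. if m = k then \<eta> m else 0)"
      using Y(1)[OF u] pl inj unfolding u_def by (intro sum.cong) (auto simp: y_coord_v_point)
    moreover have "(\<Sum>m<6. sign_of (s ! m) * y_coord u m) = (\<Sum>m<6. if m = p k then sign_of (s ! m) else 0)"
      unfolding u_def by (intro sum.cong) (auto simp: y_coord_v_point)
    ultimately show ?thesis using k pl[OF k] unfolding string_value_def by simp
  qed
  have "mset (map (y_coord (\<beta> *v v)) [0..<6]) = image_mset (\<lambda>k. sign_of (s ! p k) * y_coord v (p k)) (mset [0..<6])"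
    using Y(1)[OF assms(3)] e by (auto intro!: image_mset_cong)
  also have "\<dots> = image_mset (\<lambda>k. sign_of (s ! k) * y_coord v k) (image_mset p (mset_set {..<6}))"
    by (simp add: lessThan_atLeast0 image_mset.compositionality o_def)
  also have "image_mset p (mset_set {..<6}) = mset_set {..<6}"
    using permutes_image[OF pp[OF v_point_V7, of 0]] permutes_inj_on[OF pp[OF v_point_V7, of 0]] by (simp add: image_mset_mset_set)
  finally show ?thesis by (simp add: lessThan_atLeast0)
qed

section \<open>Existence of admissible coset representatives\<close>

text \<open>The direction \<open>e_2 - e_8\<close> in which \<open>b\<close> varies is a root of the \<open>E_7\<close> lattice \<open>3 l_0 = l_1 + \<dots> + l_7\<close>, and \<open>H\<close> permutes the 126
  roots, listed here by their first two coordinates. The group \<open>G\<close> fixes the second coordinate, and on each of its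
  three values it is transitive, because every root can be moved up in \<open>root_rank\<close> until the highest one is reached.\<close>

definition root_block :: "int \<Rightarrow> int \<Rightarrow> int list list" where
  "root_block a b = map (\<lambda>l. a # b # l)
     (if a = -2 \<and> b = -1 then
        [[0,-1,-1,-1,-1,-1], [-1,0,-1,-1,-1,-1], [-1,-1,0,-1,-1,-1], [-1,-1,-1,0,-1,-1], [-1,-1,-1,-1,0,-1], [-1,-1,-1,-1,-1,0]]
      else if a = -2 \<and> b = 0 then
        [[-1,-1,-1,-1,-1,-1]]
      else if a = -1 \<and> b = -1 then
        [[-1,-1,0,0,0,0], [-1,0,-1,0,0,0], [-1,0,0,-1,0,0], [-1,0,0,0,-1,0], [-1,0,0,0,0,-1], [0,-1,-1,0,0,0],
         [0,-1,0,-1,0,0], [0,-1,0,0,-1,0], [0,-1,0,0,0,-1], [0,0,-1,-1,0,0], [0,0,-1,0,-1,0], [0,0,-1,0,0,-1],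
         [0,0,0,-1,-1,0], [0,0,0,-1,0,-1], [0,0,0,0,-1,-1]]
      else if a = -1 \<and> b = 0 then
        [[-1,-1,-1,0,0,0], [-1,-1,0,-1,0,0], [-1,-1,0,0,-1,0], [-1,-1,0,0,0,-1], [-1,0,-1,-1,0,0], [-1,0,-1,0,-1,0],
         [-1,0,-1,0,0,-1], [-1,0,0,-1,-1,0], [-1,0,0,-1,0,-1], [-1,0,0,0,-1,-1], [0,-1,-1,-1,0,0], [0,-1,-1,0,-1,0],
         [0,-1,-1,0,0,-1], [0,-1,0,-1,-1,0], [0,-1,0,-1,0,-1], [0,-1,0,0,-1,-1], [0,0,-1,-1,-1,0], [0,0,-1,-1,0,-1],
         [0,0,-1,0,-1,-1], [0,0,0,-1,-1,-1]]
      else if a = 0 \<and> b = -1 then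
        [[1,0,0,0,0,0], [0,1,0,0,0,0], [0,0,1,0,0,0], [0,0,0,1,0,0], [0,0,0,0,1,0], [0,0,0,0,0,1]]
      else if a = 0 \<and> b = 0 then
        [[1,-1,0,0,0,0], [1,0,-1,0,0,0], [1,0,0,-1,0,0], [1,0,0,0,-1,0], [1,0,0,0,0,-1], [-1,1,0,0,0,0],
         [0,1,-1,0,0,0], [0,1,0,-1,0,0], [0,1,0,0,-1,0], [0,1,0,0,0,-1], [-1,0,1,0,0,0], [0,-1,1,0,0,0],
         [0,0,1,-1,0,0], [0,0,1,0,-1,0], [0,0,1,0,0,-1], [-1,0,0,1,0,0], [0,-1,0,1,0,0], [0,0,-1,1,0,0],
         [0,0,0,1,-1,0], [0,0,0,1,0,-1], [-1,0,0,0,1,0], [0,-1,0,0,1,0], [0,0,-1,0,1,0], [0,0,0,-1,1,0],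
         [0,0,0,0,1,-1], [-1,0,0,0,0,1], [0,-1,0,0,0,1], [0,0,-1,0,0,1], [0,0,0,-1,0,1], [0,0,0,0,-1,1]]
      else if a = 0 \<and> b = 1 then
        [[-1,0,0,0,0,0], [0,-1,0,0,0,0], [0,0,-1,0,0,0], [0,0,0,-1,0,0], [0,0,0,0,-1,0], [0,0,0,0,0,-1]]
      else if a = 1 \<and> b = 0 then
        [[1,1,1,0,0,0], [1,1,0,1,0,0], [1,1,0,0,1,0], [1,1,0,0,0,1], [1,0,1,1,0,0], [1,0,1,0,1,0],
         [1,0,1,0,0,1], [1,0,0,1,1,0], [1,0,0,1,0,1], [1,0,0,0,1,1], [0,1,1,1,0,0], [0,1,1,0,1,0],
         [0,1,1,0,0,1], [0,1,0,1,1,0], [0,1,0,1,0,1], [0,1,0,0,1,1], [0,0,1,1,1,0], [0,0,1,1,0,1],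
         [0,0,1,0,1,1], [0,0,0,1,1,1]]
      else if a = 1 \<and> b = 1 then
        [[1,1,0,0,0,0], [1,0,1,0,0,0], [1,0,0,1,0,0], [1,0,0,0,1,0], [1,0,0,0,0,1], [0,1,1,0,0,0],
         [0,1,0,1,0,0], [0,1,0,0,1,0], [0,1,0,0,0,1], [0,0,1,1,0,0], [0,0,1,0,1,0], [0,0,1,0,0,1],
         [0,0,0,1,1,0], [0,0,0,1,0,1], [0,0,0,0,1,1]]
      else if a = 2 \<and> b = 0 then
        [[1,1,1,1,1,1]]
      else if a = 2 \<and> b = 1 then
        [[0,1,1,1,1,1], [1,0,1,1,1,1], [1,1,0,1,1,1], [1,1,1,0,1,1], [1,1,1,1,0,1], [1,1,1,1,1,0]]
      else [])"

definition roots :: "int list list" where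
  "roots = concat (map (\<lambda>(a, b). root_block a b)
     [(-2,-1), (-2,0), (-1,-1), (-1,0), (0,-1), (0,0), (0,1), (1,0), (1,1), (2,0), (2,1)])"

text \<open>The order is that of \<open>gen_mat\<close>: the first six entries belong to the
  generators of \<open>G\<close>, which explains the bound 6 in \<open>roots_check\<close> and
  later. On the root lattice the shift of \<open>X\<close> is the integer
  \<open>a - c - d - e\<close>.\<close>

definition gen_images :: "int list \<Rightarrow> int list list" where
  "gen_images l = (case l of [a,b,c,d,e,f,g,h] \<Rightarrow>
     [[a,b,d,c,e,f,g,h], [a,b,c,e,d,f,g,h], [a,b,c,d,f,e,g,h], [a,b,c,d,e,g,f,h], [a,b,c,d,e,f,h,g],
      (let t = a-c-d-e in [a+t,b,c+t,d+t,e+t,f,g,h]), [a,c,b,d,e,f,g,h],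
      (let t = b-a in [b+t,c+t,b,d+t,e+t,f+t,g+t,h+t]), (let t = c-a in [c+t,c,b+t,d+t,e+t,f+t,g+t,h+t])])"

definition gen_mat :: "nat \<Rightarrow> complex^8^8" where
  "gen_mat n = [swap8 3 4, swap8 4 5, swap8 5 6, swap8 6 7, swap8 7 8, Xmat, swap8 2 3, Ymat, Yinv] ! n"

definition root_vec :: "int list \<Rightarrow> complex^8" where
  "root_vec l = vec8 (\<lambda>k. of_int (l ! (k - 1)))"

text \<open>A linear height. Its weights grow along the entries 3 to 8, so moving larger entries to
  the right raises it, as does \<open>X\<close> when its shift is positive. The second entry, fixed
  by \<open>G\<close>, has weight 0. The bound 41 is the value at
  \<open>[2,0,1,1,1,1,1,1]\<close>.\<close>

definition root_rank :: "int list \<Rightarrow> int" where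
  "root_rank l = 10 * l!0 + l!2 + 2 * l!3 + 3 * l!4 + 4 * l!5 + 5 * l!6 + 6 * l!7"

definition is_root_vec :: "int list \<Rightarrow> bool" where
  "is_root_vec l \<longleftrightarrow> length l = 8 \<and> 3 * l!0 = l!1 + l!2 + l!3 + l!4 + l!5 + l!6 + l!7"

definition highest_roots :: "int list list" where
  "highest_roots = [[2, 1, 0, 1, 1, 1, 1, 1], [0, -1, 0, 0, 0, 0, 0, 1], [2, 0, 1, 1, 1, 1, 1, 1]]"

text \<open>Allows membership in \<open>roots\<close> to be tested in the single block determined by
  the first two entries, which keeps the evaluation in \<open>roots_check\<close> small.\<close>

lemma root_block_subset: "set (root_block a b) \<subseteq> set roots"
proof (cases "root_block a b = []")
  case False
  hence "(a, b) \<in> set [(-2,-1), (-2,0), (-1,-1), (-1,0), (0,-1), (0,0), (0,1), (1,0), (1,1), (2,0), (2,1)]"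
    unfolding root_block_def by (simp split: if_splits)
  thus ?thesis unfolding roots_def set_concat set_map by (intro UN_upper image_eqI[where x = "(a, b)"]) simp_all
qed simp

lemma roots_check:
  "list_all (\<lambda>l. is_root_vec l \<and> list_all (\<lambda>m. List.member (root_block (m ! 0) (m ! 1)) m) (gen_images l) \<and> root_rank l \<le> 41 \<and>
     (List.member highest_roots l \<or> list_ex (\<lambda>m. root_rank m > root_rank l) (take 6 (gen_images l)))) roots"
  by code_simp

lemma root_vec_nth:
  "root_vec [a,b,c,d,e,f,g,h] $ 1 = of_int a" "root_vec [a,b,c,d,e,f,g,h] $ 2 = of_int b" "root_vec [a,b,c,d,e,f,g,h] $ 3 = of_int c"
  "root_vec [a,b,c,d,e,f,g,h] $ 4 = of_int d" "root_vec [a,b,c,d,e,f,g,h] $ 5 = of_int e" "root_vec [a,b,c,d,e,f,g,h] $ 6 = of_int f"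
  "root_vec [a,b,c,d,e,f,g,h] $ 7 = of_int g" "root_vec [a,b,c,d,e,f,g,h] $ 8 = of_int h"
  by (simp_all add: root_vec_def)

lemma gens_root_vec:
  "swap8 3 4 *v root_vec [a,b,c,d,e,f,g,h] = root_vec [a,b,d,c,e,f,g,h]"
  "swap8 4 5 *v root_vec [a,b,c,d,e,f,g,h] = root_vec [a,b,c,e,d,f,g,h]"
  "swap8 5 6 *v root_vec [a,b,c,d,e,f,g,h] = root_vec [a,b,c,d,f,e,g,h]"
  "swap8 6 7 *v root_vec [a,b,c,d,e,f,g,h] = root_vec [a,b,c,d,e,g,f,h]"
  "swap8 7 8 *v root_vec [a,b,c,d,e,f,g,h] = root_vec [a,b,c,d,e,f,h,g]"
  "swap8 2 3 *v root_vec [a,b,c,d,e,f,g,h] = root_vec [a,c,b,d,e,f,g,h]"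
  "Ymat *v root_vec [a,b,c,d,e,f,g,h] = root_vec [b+(b-a),c+(b-a),b,d+(b-a),e+(b-a),f+(b-a),g+(b-a),h+(b-a)]"
  "Yinv *v root_vec [a,b,c,d,e,f,g,h] = root_vec [c+(c-a),c,b+(c-a),d+(c-a),e+(c-a),f+(c-a),g+(c-a),h+(c-a)]"
  by (rule vec8_eqI; simp add: root_vec_nth swap8_nth Ymat_nth Yinv_nth)+

lemma Xmat_root_vec:
  assumes "3 * a = b + c + d + e + f + g + h"
  shows "Xmat *v root_vec [a,b,c,d,e,f,g,h] = root_vec [a+(a-c-d-e),b,c+(a-c-d-e),d+(a-c-d-e),e+(a-c-d-e),f,g,h]"
proof -
  have "h = 3 * a - b - c - d - e - f - g" using assms by simp
  hence h: "of_int h = 3 * of_int a - of_int b - of_int c - of_int d - of_int e - of_int f - (of_int g :: complex)" by simp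
  have "X_shift (root_vec [a,b,c,d,e,f,g,h]) = of_int (a-c-d-e)"
    unfolding X_shift_def root_vec_nth h by (simp add: field_simps)
  thus ?thesis by (intro vec8_eqI) (simp_all add: root_vec_nth Xmat_nth)
qed

lemma length_8_conv:
  assumes "length l = 8"
  shows "\<exists>a b c d e f g h. l = [a,b,c,d,e,f,g,h]"
proof -
  have "l = [l!0, l!1, l!2, l!3, l!4, l!5, l!6, l!7]"
    unfolding list_eq_iff_nth_eq assms all_less_8 by simp
  thus ?thesis by blast
qed

lemma gen_images_nth:
  "gen_images [a,b,c,d,e,f,g,h] ! 0 = [a,b,d,c,e,f,g,h]"
  "gen_images [a,b,c,d,e,f,g,h] ! 1 = [a,b,c,e,d,f,g,h]"
  "gen_images [a,b,c,d,e,f,g,h] ! 2 = [a,b,c,d,f,e,g,h]"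
  "gen_images [a,b,c,d,e,f,g,h] ! 3 = [a,b,c,d,e,g,f,h]"
  "gen_images [a,b,c,d,e,f,g,h] ! 4 = [a,b,c,d,e,f,h,g]"
  "gen_images [a,b,c,d,e,f,g,h] ! 5 = [a+(a-c-d-e),b,c+(a-c-d-e),d+(a-c-d-e),e+(a-c-d-e),f,g,h]"
  "gen_images [a,b,c,d,e,f,g,h] ! 6 = [a,c,b,d,e,f,g,h]"
  "gen_images [a,b,c,d,e,f,g,h] ! 7 = [b+(b-a),c+(b-a),b,d+(b-a),e+(b-a),f+(b-a),g+(b-a),h+(b-a)]"
  "gen_images [a,b,c,d,e,f,g,h] ! 8 = [c+(c-a),c,b+(c-a),d+(c-a),e+(c-a),f+(c-a),g+(c-a),h+(c-a)]"
  by (simp_all add: gen_images_def Let_def)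

lemma gen_mat_nth:
  "gen_mat 0 = swap8 3 4" "gen_mat 1 = swap8 4 5" "gen_mat 2 = swap8 5 6" "gen_mat 3 = swap8 6 7" "gen_mat 4 = swap8 7 8"
  "gen_mat 5 = Xmat" "gen_mat 6 = swap8 2 3" "gen_mat 7 = Ymat" "gen_mat 8 = Yinv"
  by (simp_all add: gen_mat_def)

lemma gen_image_root_vec:
  assumes "is_root_vec l" "n < 9"
  shows "gen_mat n *v root_vec l = root_vec (gen_images l ! n)" "n < 6 \<Longrightarrow> gen_images l ! n ! 1 = l ! 1"
proof -
  obtain a b c d e f g h where l: "l = [a,b,c,d,e,f,g,h]"
    using length_8_conv assms(1) unfolding is_root_vec_def by blast
  have s: "3 * a = b + c + d + e + f + g + h" using assms(1) unfolding is_root_vec_def l by simp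
  have n: "n \<in> {0,1,2,3,4,5,6,7,8}" using assms(2) unfolding insert_iff empty_iff by linarith
  show "gen_mat n *v root_vec l = root_vec (gen_images l ! n)"
    unfolding l by (insert n, elim insertE emptyE) (simp_all only: gen_mat_nth gen_images_nth gens_root_vec Xmat_root_vec[OF s])
  show "gen_images l ! n ! 1 = l ! 1" if "n < 6"
  proof -
    have "n \<in> {0,1,2,3,4,5}" using that unfolding insert_iff empty_iff by linarith
    thus ?thesis unfolding l by (elim insertE emptyE) (simp_all add: gen_images_nth del: One_nat_def)
  qed
qed

lemma length_gen_images: "is_root_vec l \<Longrightarrow> length (gen_images l) = 9"
  unfolding is_root_vec_def gen_images_def Let_def using length_8_conv by fastforce

lemma rootsD:
  assumes "l \<in> set roots"
  shows "is_root_vec l" "n < 9 \<Longrightarrow> gen_images l ! n \<in> set roots" "root_rank l \<le> 41"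
    "l \<in> set highest_roots \<or> (\<exists>n<6. root_rank (gen_images l ! n) > root_rank l)"
proof -
  have c: "is_root_vec l \<and> list_all (\<lambda>m. List.member (root_block (m ! 0) (m ! 1)) m) (gen_images l) \<and> root_rank l \<le> 41 \<and>
     (List.member highest_roots l \<or> list_ex (\<lambda>m. root_rank m > root_rank l) (take 6 (gen_images l)))"
    using roots_check assms unfolding list_all_iff[of _ roots] by blast
  thus "is_root_vec l" "root_rank l \<le> 41" by auto
  have len: "length (gen_images l) = 9" using c length_gen_images by blast
  show "n < 9 \<Longrightarrow> gen_images l ! n \<in> set roots"
    using c len root_block_subset unfolding list_all_length List.member_iff by auto
  show "l \<in> set highest_roots \<or> (\<exists>n<6. root_rank (gen_images l ! n) > root_rank l)"
    using c len unfolding list_ex_length List.member_iff by auto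
qed

lemma gen_mat_Hgens: "s \<in> insert Yinv Hgens \<Longrightarrow> \<exists>n<9. s = gen_mat n"
  by (elim insertE emptyE)
    (rule exI[of _ 8], simp add: gen_mat_def, rule exI[of _ 6], simp add: gen_mat_def, rule exI[of _ 0], simp add: gen_mat_def,
     rule exI[of _ 1], simp add: gen_mat_def, rule exI[of _ 2], simp add: gen_mat_def, rule exI[of _ 3], simp add: gen_mat_def,
     rule exI[of _ 4], simp add: gen_mat_def, rule exI[of _ 5], simp add: gen_mat_def, rule exI[of _ 7], simp add: gen_mat_def)

lemma gen_mat_Ggens: "n < 6 \<Longrightarrow> gen_mat n \<in> Ggens"
proof -
  assume "n < 6"
  hence "n \<in> {0,1,2,3,4,5}" unfolding insert_iff empty_iff by linarith
  thus ?thesis by (elim insertE emptyE) (simp_all add: gen_mat_def)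
qed

lemma Hgrp_roots:
  assumes "\<alpha> \<in> Hgrp" "l \<in> set roots"
  shows "\<exists>m\<in>set roots. \<alpha> *v root_vec l = root_vec m"
  using assms(1)
proof (induction rule: Hgrp_induct)
  case one
  show ?case by (rule bexI[OF _ assms(2)]) simp
next
  case (mult s g)
  obtain m where m: "m \<in> set roots" "g *v root_vec l = root_vec m" using mult by blast
  obtain n where n: "n < 9" "s = gen_mat n" using gen_mat_Hgens[OF mult(1)] by blast
  have "s ** g *v root_vec l = root_vec (gen_images m ! n)"
    using gen_image_root_vec(1)[OF rootsD(1)[OF m(1)] n(1)] m(2) n(2) by (simp add: matrix_vector_mul_assoc[symmetric])
  thus ?case using rootsD(2)[OF m(1) n(1)] by blast
qed

definition G_reach :: "complex^8 \<Rightarrow> complex^8 \<Rightarrow> bool" where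
  "G_reach u v \<longleftrightarrow> (\<exists>g\<in>Ggrp. g *v u = v)"

lemma G_reach_refl: "G_reach u u"
  unfolding G_reach_def Ggrp_def by (rule bexI[OF _ gen_one]) simp

lemma G_reach_trans: "G_reach u v \<Longrightarrow> G_reach v w \<Longrightarrow> G_reach u w"
proof -
  assume "G_reach u v" "G_reach v w"
  then obtain g h where "g \<in> Ggrp" "g *v u = v" "h \<in> Ggrp" "h *v v = w" unfolding G_reach_def by blast
  hence "h ** g \<in> Ggrp" "(h ** g) *v u = w" unfolding Ggrp_def
    by (simp_all only: gen_group_mult matrix_vector_mul_assoc[symmetric])
  thus "G_reach u w" unfolding G_reach_def by blast
qed

lemma G_reach_gen: "s \<in> Ggens \<Longrightarrow> G_reach u (s *v u)"
  unfolding G_reach_def Ggrp_def by (rule bexI[OF refl gen_group_gen])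

lemma Ggens_involution: "s \<in> Ggens \<Longrightarrow> s *v (s *v w) = w"
  by (elim insertE emptyE; rule vec8_eqI) (simp_all add: swap8_nth Xmat_nth X_shift_def field_simps)

lemma G_reach_sym:
  assumes "G_reach u v"
  shows "G_reach v u"
proof -
  obtain g where "g \<in> Ggrp" "g *v u = v" using assms unfolding G_reach_def by blast
  thus ?thesis unfolding Ggrp_def
  proof (induction arbitrary: v rule: gen_group.induct)
    case gen_one
    thus ?case by (simp add: G_reach_refl)
  next
    case (gen_mul s g)
    have "v = s *v (g *v u)" using gen_mul(4) by (simp add: matrix_vector_mul_assoc)
    hence "s *v v = g *v u" using Ggens_involution[OF gen_mul(1)] by simp
    hence "G_reach v (g *v u)" using G_reach_gen[OF gen_mul(1), of v] by simp
    thus ?case using gen_mul.IH G_reach_trans by blast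
  next
    case (gen_inv s g)
    have "matrix_inv s = s" by (rule matrix_inv_eqI; rule Ggens_involution[OF gen_inv(1)])
    hence "v = s *v (g *v u)" using gen_inv(4) by (simp add: matrix_vector_mul_assoc)
    hence "s *v v = g *v u" using Ggens_involution[OF gen_inv(1)] by simp
    hence "G_reach v (g *v u)" using G_reach_gen[OF gen_inv(1), of v] by simp
    thus ?case using gen_inv.IH G_reach_trans by blast
  qed
qed

lemma root_climb:
  assumes "l \<in> set roots"
  shows "\<exists>t\<in>set highest_roots. t ! 1 = l ! 1 \<and> G_reach (root_vec l) (root_vec t)"
  using assms
proof (induction "nat (41 - root_rank l)" arbitrary: l rule: less_induct)
  case less
  from rootsD(4)[OF less.prems] show ?case
  proof
    assume "l \<in> set highest_roots"
    thus ?thesis using G_reach_refl by blast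
  next
    assume "\<exists>n<6. root_rank (gen_images l ! n) > root_rank l"
    then obtain n where n: "n < 6" "root_rank (gen_images l ! n) > root_rank l" by blast
    hence n9: "n < 9" by simp
    have r: "gen_images l ! n \<in> set roots" by (rule rootsD(2)[OF less.prems n9])
    have "nat (41 - root_rank (gen_images l ! n)) < nat (41 - root_rank l)" using n(2) rootsD(3)[OF r] by linarith
    from less.hyps[OF this r] obtain t where t: "t \<in> set highest_roots" "t ! 1 = gen_images l ! n ! 1" "G_reach (root_vec (gen_images l ! n)) (root_vec t)" by blast
    have "G_reach (root_vec l) (root_vec (gen_images l ! n))"
      using G_reach_gen[OF gen_mat_Ggens[OF n(1)], of "root_vec l"] gen_image_root_vec(1)[OF rootsD(1)[OF less.prems] n9] by simp
    thus ?thesis using t gen_image_root_vec(2)[OF rootsD(1)[OF less.prems] n9 n(1)] G_reach_trans by metis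
  qed
qed

lemma G_reach_roots:
  assumes "l \<in> set roots" "m \<in> set roots" "l ! 1 = m ! 1"
  shows "G_reach (root_vec l) (root_vec m)"
proof -
  obtain t where t: "t \<in> set highest_roots" "t ! 1 = l ! 1" "G_reach (root_vec l) (root_vec t)" using root_climb[OF assms(1)] by blast
  obtain u where u: "u \<in> set highest_roots" "u ! 1 = m ! 1" "G_reach (root_vec m) (root_vec u)" using root_climb[OF assms(2)] by blast
  have "x = y" if "x \<in> set highest_roots" "y \<in> set highest_roots" "x ! 1 = y ! 1" for x y
    using that unfolding highest_roots_def list.set by (elim insertE emptyE) simp_all
  hence "t = u" using t u assms(3) by metis
  thus ?thesis using t(3) u(3) G_reach_sym G_reach_trans by blast
qed

text \<open>The directions in which \<open>b\<close> may move an admissible image: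
  \<open>e_2 - e_8\<close> and its negative for \<open>good12\<close>, and \<open>e_7 - e_8\<close>
  for \<open>good3\<close>.\<close>

lemma distinguished_roots:
  "[0,1,0,0,0,0,0,-1] \<in> set roots" "[0,-1,0,0,0,0,0,1] \<in> set roots" "[0,0,0,0,0,0,1,-1] \<in> set roots"
  using root_block_subset[of 0 1] root_block_subset[of 0 "-1"] root_block_subset[of 0 0] by (auto simp: root_block_def)

section \<open>Comparison of the two sides\<close>

lemma Lv_eq:
  assumes "v \<in> V7"
  shows "Lv v = L_sym (y_coord v 3) [y_coord v 2, y_coord v 1, y_coord v 0, y_coord v 5, y_coord v 4] / L_sin [y_coord v 2, y_coord v 1, y_coord v 0, y_coord v 5, y_coord v 4]"
    and "Lreg v \<longleftrightarrow> L_sin [y_coord v 2, y_coord v 1, y_coord v 0, y_coord v 5, y_coord v 4] \<noteq> 0"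
proof -
  note c = V7_coords[OF assms]
  have A: "1/2 + (y_coord v 3 + y_coord v 2 + y_coord v 1 + y_coord v 0 + y_coord v 5 + y_coord v 4) / 2 = v$1" unfolding c(1) sum_less_6 by (simp add: add_ac)
  have E: "1 + y_coord v 5 + y_coord v 4 = v$5" unfolding c(5) by (simp add: add_ac)
  have args: "v$1 - y_coord v 2 - y_coord v 1 = v$2" "v$1 - y_coord v 2 - y_coord v 0 = v$3" "v$1 - y_coord v 1 - y_coord v 0 = v$4"
    unfolding c(2-4) by simp_all
  have "L_sym d [z0,z1,z2,z3,z4] = L_entire A (A - z0 - z1) (A - z0 - z2) (A - z1 - z2) (1 + z3 + z4) (1 + d + z3) (1 + d + z4)"
    if "1/2 + (d + z0 + z1 + z2 + z3 + z4) / 2 = A" for d z0 z1 z2 z3 z4 A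
    unfolding L_sym_def Let_def that[symmetric] by simp
  from this[OF A] have "L_sym (y_coord v 3) [y_coord v 2, y_coord v 1, y_coord v 0, y_coord v 5, y_coord v 4] = L_entire (v$1) (v$2) (v$3) (v$4) (v$5) (v$6) (v$7)"
    unfolding args E c(6,7)[symmetric] .
  moreover have "L_sin [y_coord v 2, y_coord v 1, y_coord v 0, y_coord v 5, y_coord v 4] = sin (of_real pi * v$5)"
    unfolding L_sin_def using E by simp
  ultimately show "Lv v = L_sym (y_coord v 3) [y_coord v 2, y_coord v 1, y_coord v 0, y_coord v 5, y_coord v 4] / L_sin [y_coord v 2, y_coord v 1, y_coord v 0, y_coord v 5, y_coord v 4]"
    "Lreg v \<longleftrightarrow> L_sin [y_coord v 2, y_coord v 1, y_coord v 0, y_coord v 5, y_coord v 4] \<noteq> 0"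
    unfolding Lv_def Lreg_def Lfun_eq by simp_all
qed

lemma Jv_eq:
  assumes "v \<in> V7"
  shows "Jv v = J_sym (map (y_coord v) [0..<6]) / sin (of_real pi * v$1)"
proof -
  note c = V7_coords[OF assms]
  have A: "1/2 + (y_coord v 0 + y_coord v 1 + y_coord v 2 + y_coord v 3 + y_coord v 4 + y_coord v 5) / 2 = v$1" unfolding c(1) sum_less_6 ..
  have "J_sym [y0,y1,y2,y3,y4,y5] = J_entire A (A - y1 - y2) (A - y0 - y2) (A - y0 - y1) (1 + y4 + y5) (1 + y3 + y5) (1 + y3 + y4)"
    if "1/2 + (y0 + y1 + y2 + y3 + y4 + y5) / 2 = A" for y0 y1 y2 y3 y4 y5 A
    unfolding J_sym_def Let_def that[symmetric] by simp
  from this[OF A] have "J_sym (map (y_coord v) [0..<6]) = J_entire (v$1) (v$2) (v$3) (v$4) (v$5) (v$6) (v$7)"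
    unfolding map_upt_6 c(2-7)[symmetric] .
  thus ?thesis unfolding Jv_def Jfun_eq by simp
qed

text \<open>The form in which the symmetry of \<open>L\<close> is applied: two signed arrangements
  of the same five coordinates with equal sign products differ by a permutation and an even sign
  change.\<close>

lemma L_sym_signed_lists:
  assumes f: "inj_on f {..<5}" "inj_on f' {..<5::nat}" "f ` {..<5} = f' ` {..<5}"
    and s: "\<And>i. i < 5 \<Longrightarrow> is_sign (\<sigma> i)" "\<And>i. i < 5 \<Longrightarrow> is_sign (\<sigma>' i)" "(\<Prod>i<5. \<sigma> i) = (\<Prod>i<5. \<sigma>' i)"
  shows "L_sym d (map (\<lambda>i. \<sigma>' i * y (f' i)) [0..<5]) * L_sin (map (\<lambda>i. \<sigma> i * y (f i)) [0..<5]) =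
     L_sym d (map (\<lambda>i. \<sigma> i * y (f i)) [0..<5]) * L_sin (map (\<lambda>i. \<sigma>' i * y (f' i)) [0..<5])"
proof -
  define \<pi> where "\<pi> = (\<lambda>i. if i < 5 then inv_into {..<5} f (f' i) else i)"
  have fp: "f (\<pi> i) = f' i" "\<pi> i < 5" if "i < 5" for i
  proof -
    have "f' i \<in> f ` {..<5}" using that f(3) by blast
    thus "f (\<pi> i) = f' i" "\<pi> i < 5" using that f_inv_into_f[of "f' i" f "{..<5}"] inv_into_into[of "f' i" f "{..<5}"] by (simp_all add: \<pi>_def)
  qed
  have inj: "inj_on \<pi> {..<5}"
  proof (rule inj_onI)
    fix i j assume ij: "i \<in> {..<5}" "j \<in> {..<5}" "\<pi> i = \<pi> j"
    hence "f' i = f' j" using fp(1)[of i] fp(1)[of j] by simp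
    thus "i = j" using f(2) ij by (auto dest: inj_onD)
  qed
  have perm: "\<pi> permutes {..<5}"
  proof (rule bij_imp_permutes)
    have "\<pi> ` {..<5} = {..<5}" using inj fp(2) by (intro card_subset_eq) (auto simp: card_image)
    thus "bij_betw \<pi> {..<5} {..<5}" using inj unfolding bij_betw_def by simp
  qed (simp add: \<pi>_def)
  define \<eta> where "\<eta> = (\<lambda>i. \<sigma>' i * \<sigma> (\<pi> i))"
  define z where "z = (\<lambda>i. \<sigma> i * y (f i))"
  have e: "\<eta> i = 1 \<or> \<eta> i = -1" if "i < 5" for i
    using s(1)[OF fp(2)[OF that]] s(2)[OF that] is_sign_mult unfolding \<eta>_def is_sign_def[symmetric] by blast
  have "(\<Prod>i<5. \<eta> i) = (\<Prod>i<5. \<sigma>' i) * (\<Prod>i<5. \<sigma> (\<pi> i))" unfolding \<eta>_def by (rule prod.distrib)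
  also have "(\<Prod>i<5. \<sigma> (\<pi> i)) = (\<Prod>i<5. \<sigma> i)" using prod.permute[OF perm, of \<sigma>] by (simp add: o_def)
  also have "(\<Prod>i<5. \<sigma>' i) * (\<Prod>i<5. \<sigma> i) = (\<Prod>i<5. \<sigma> i * \<sigma> i)" unfolding s(3)[symmetric] prod.distrib ..
  also have "\<dots> = 1" using s(1) is_sign_sq by (intro prod.neutral) auto
  finally have ep: "(\<Prod>i<5. \<eta> i) = 1" .
  have m: "map (\<lambda>i. \<eta> i * z (\<pi> i)) [0..<5] = map (\<lambda>i. \<sigma>' i * y (f' i)) [0..<5]"
  proof (rule map_cong[OF refl])
    fix i assume "i \<in> set [0..<5]"
    hence i: "i < 5" by simp
    have "\<eta> i * z (\<pi> i) = (\<sigma> (\<pi> i) * \<sigma> (\<pi> i)) * (\<sigma>' i * y (f (\<pi> i)))" unfolding \<eta>_def z_def by (simp add: mult_ac)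
    thus "\<eta> i * z (\<pi> i) = \<sigma>' i * y (f' i)" using is_sign_sq[OF s(1)[OF fp(2)[OF i]]] fp(1)[OF i] by simp
  qed
  from L_sym_signed_perm[OF perm e ep, of d z] show ?thesis unfolding m unfolding z_def .
qed

lemma quotient_eqI:
  fixes p q r s :: complex
  assumes "p * s = r * q" "q \<noteq> 0" "s \<noteq> 0"
  shows "p / q = r / s"
  using assms by (simp add: frac_eq_eq)

section \<open>Admissible elements of a coset\<close>

lemma McosetsE:
  assumes "\<tau> \<in> Mcosets"
  obtains \<alpha> where "\<alpha> \<in> Hgrp" "\<alpha> \<in> \<tau>" "\<And>g. g \<in> Ggrp \<Longrightarrow> g ** \<alpha> \<in> \<tau>" "\<And>\<beta>. \<beta> \<in> \<tau> \<Longrightarrow> \<beta> \<in> Hgrp"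
proof -
  obtain \<alpha> where a: "\<alpha> \<in> Hgrp" "\<tau> = (\<lambda>k. k ** \<alpha>) ` Ggrp" using assms unfolding Mcosets_def right_cosets_def by blast
  have sub: "g \<in> Hgrp" if "g \<in> Ggrp" for g
    using gen_group_mono[of Ggens Hgens g] that unfolding Ggrp_def Hgrp_def by blast
  show ?thesis
  proof (rule that[OF a(1)])
    have "mat 1 \<in> Ggrp" unfolding Ggrp_def by (rule gen_one)
    hence "mat 1 ** \<alpha> \<in> \<tau>" unfolding a(2) by (rule imageI)
    thus "\<alpha> \<in> \<tau>" by simp
    show "g ** \<alpha> \<in> \<tau>" if "g \<in> Ggrp" for g using that unfolding a(2) by (rule imageI)
    show "\<beta> \<in> Hgrp" if b: "\<beta> \<in> \<tau>" for \<beta>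
    proof -
      obtain g where g: "g \<in> Ggrp" "\<beta> = g ** \<alpha>" using b unfolding a(2) by blast
      have "g \<in> gen_group Hgens" using sub[OF g(1)] unfolding Hgrp_def .
      thus ?thesis unfolding g(2) using a(1) gen_group_mult unfolding Hgrp_def by blast
    qed
  qed
qed

abbreviation root_b :: "int list" where "root_b \<equiv> [0,1,0,0,0,0,0,-1]"

lemma wvec_shift: "wvec a b c d e f g = wvec a 0 c d e f g + b *s root_vec root_b"
  by (rule vec8_eqI) (simp_all add: wvec_nth root_vec_nth)

lemma w_point_shift: "w_point t z = w_point 0 z + t *s root_vec root_b"
  unfolding w_point_def Let_def by (rule vec8_eqI) (simp_all add: wvec_nth root_vec_nth)

lemma comp_root:
  assumes "\<alpha> *v root_vec root_b = root_vec r"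
  shows "comp k \<alpha> a b c d e f g = comp k \<alpha> a 0 c d e f g + b * root_vec r $ of_nat k"
  unfolding comp_def
  by (subst wvec_shift) (simp add: matrix_vector_right_distrib vector_scalar_commute assms)

lemma w_point_root:
  assumes "\<alpha> *v root_vec root_b = root_vec r"
  shows "(\<alpha> *v w_point t z) $ k = (\<alpha> *v w_point 0 z) $ k + t * root_vec r $ k"
  by (subst w_point_shift) (simp add: matrix_vector_right_distrib vector_scalar_commute assms)

lemma filterlim_Im_shift:
  "filterlim (\<lambda>b. Im (C + b)) at_top (filtercomap Im at_top)"
  "filterlim (\<lambda>b. Im (C - b)) at_bot (filtercomap Im at_top)"
proof -
  have "filterlim (\<lambda>x. Im C + x) at_top at_top" "filterlim (\<lambda>x. Im C - x) at_bot at_top" by real_asymp+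
  from this[THEN filterlim_compose, OF filterlim_filtercomap[of Im at_top]]
  show "filterlim (\<lambda>b. Im (C + b)) at_top (filtercomap Im at_top)"
    "filterlim (\<lambda>b. Im (C - b)) at_bot (filtercomap Im at_top)" by simp_all
qed

lemma indep_b_root:
  assumes "\<alpha> *v root_vec root_b = root_vec r" "root_vec r $ of_nat k = 0"
  shows "indep_b k \<alpha>"
proof -
  have "comp k \<alpha> a b c d e f g = comp k \<alpha> a 0 c d e f g" for a b c d e f g
    using comp_root[OF assms(1), of k a b c d e f g] unfolding assms(2) by simp
  thus ?thesis unfolding indep_b_def by metis
qed

lemma good12_root:
  assumes "\<alpha> *v root_vec root_b = root_vec r" "r = root_b \<or> r = [0,-1,0,0,0,0,0,1]"
  shows "good12 \<alpha>"
proof -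
  have "root_vec r $ of_nat k = 0" if "k \<in> {1,3,4,5,6,7}" for k
    using that assms(2) by (elim insertE emptyE disjE) (simp_all add: root_vec_nth)
  hence "indep_b k \<alpha>" if "k \<in> {1,3,4,5,6,7}" for k using that indep_b_root[OF assms(1)] by blast
  hence "indep_b 1 \<alpha>" "indep_b 3 \<alpha>" "indep_b 4 \<alpha>" "indep_b 5 \<alpha>" "indep_b 6 \<alpha>" "indep_b 7 \<alpha>" by simp_all
  moreover have "Im_to_pm_inf 2 \<alpha>"
    unfolding Im_to_pm_inf_def
  proof (intro allI)
    fix a c d e f g
    define C where "C = comp 2 \<alpha> a 0 c d e f g"
    have "(\<forall>b. comp 2 \<alpha> a b c d e f g = C + b) \<or> (\<forall>b. comp 2 \<alpha> a b c d e f g = C - b)"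
      using assms(2)
    proof
      assume r: "r = root_b"
      have "comp 2 \<alpha> a b c d e f g = C + b" for b
        using comp_root[OF assms(1), of 2 a b c d e f g] by (simp add: r root_vec_nth C_def)
      thus ?thesis by blast
    next
      assume r: "r = [0,-1,0,0,0,0,0,1]"
      have "comp 2 \<alpha> a b c d e f g = C - b" for b
        using comp_root[OF assms(1), of 2 a b c d e f g] by (simp add: r root_vec_nth C_def)
      thus ?thesis by blast
    qed
    thus "filterlim (\<lambda>b. Im (comp 2 \<alpha> a b c d e f g)) at_top (filtercomap Im at_top) \<or>
        filterlim (\<lambda>b. Im (comp 2 \<alpha> a b c d e f g)) at_bot (filtercomap Im at_top)"
      using filterlim_Im_shift[of C] by (elim disjE) (simp_all only: simp_thms)
  qed
  ultimately show ?thesis unfolding good12_def by blast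
qed

lemma good3_root:
  assumes "\<alpha> *v root_vec root_b = root_vec [0,0,0,0,0,0,1,-1]"
  shows "good3 \<alpha>"
proof -
  have "root_vec [0,0,0,0,0,0,1,-1] $ of_nat k = 0" if "k \<in> {1,2,3,4,5,6}" for k
    using that by (elim insertE emptyE) (simp_all add: root_vec_nth)
  hence "indep_b k \<alpha>" if "k \<in> {1,2,3,4,5,6}" for k using that indep_b_root[OF assms] by blast
  hence "indep_b 1 \<alpha>" "indep_b 2 \<alpha>" "indep_b 3 \<alpha>" "indep_b 4 \<alpha>" "indep_b 5 \<alpha>" "indep_b 6 \<alpha>" by simp_all
  moreover have "Im_to_inf 7 \<alpha>"
    unfolding Im_to_inf_def
  proof (intro allI)
    fix a c d e f g
    define C where "C = comp 7 \<alpha> a 0 c d e f g"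
    have "comp 7 \<alpha> a b c d e f g = C + b" for b
      using comp_root[OF assms, of 7 a b c d e f g] by (simp add: root_vec_nth C_def)
    thus "filterlim (\<lambda>b. Im (comp 7 \<alpha> a b c d e f g)) at_top (filtercomap Im at_top)"
      using filterlim_Im_shift(1)[of C] by (simp only:)
  qed
  ultimately show ?thesis unfolding good3_def by blast
qed

text \<open>By transitivity of \<open>G\<close>, the second entry of the image of
  \<open>e_2 - e_8\<close> is the only restriction on where a member of the coset can send this
  root.\<close>

lemma coset_root:
  assumes "\<alpha> \<in> Hgrp" "l \<in> set roots" "(\<alpha> *v root_vec root_b) $ 2 = of_int (l ! 1)"
  shows "\<exists>g\<in>Ggrp. (g ** \<alpha>) *v root_vec root_b = root_vec l"
proof -
  obtain m where m: "m \<in> set roots" "\<alpha> *v root_vec root_b = root_vec m"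
    using Hgrp_roots[OF assms(1) distinguished_roots(1)] by blast
  have "root_vec m $ 2 = of_int (m ! 1)" by (simp add: root_vec_def)
  hence "m ! 1 = l ! 1" using assms(3) m(2) by simp
  then obtain g where "g \<in> Ggrp" "g *v root_vec m = root_vec l" using G_reach_roots[OF m(1) assms(2)] unfolding G_reach_def by blast
  thus ?thesis using m(2) by (metis matrix_vector_mul_assoc)
qed

lemma good12_exists:
  assumes "\<tau> \<in> Mcosets" "has_label \<tau> (LL bar k)"
  shows "\<exists>\<alpha>. \<alpha> \<in> \<tau> \<and> good12 \<alpha>"
proof -
  obtain \<alpha> where a: "\<alpha> \<in> Hgrp" "\<alpha> \<in> \<tau>" "\<And>g. g \<in> Ggrp \<Longrightarrow> g ** \<alpha> \<in> \<tau>" using McosetsE[OF assms(1)] by metis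
  obtain m where m: "m \<in> set roots" "\<alpha> *v root_vec root_b = root_vec m"
    using Hgrp_roots[OF a(1) distinguished_roots(1)] by blast
  from has_label_label_form[OF assms(2) a(2)] obtain \<epsilon> where e: "is_sign \<epsilon>" "k - 1 < 6" "pair_form \<epsilon> (sign_of (\<not> bar)) (k - 1) (\<lambda>w. (\<alpha> *v w) $ 2)"
    unfolding label_form_def by auto
  \<comment> \<open>The slope of the second coordinate in \<open>delta\<close> is the second entry
    of the image root. It is 1 or -1, which selects one of the two distinguished roots for
    \<open>good12\<close>.\<close>
  have "\<epsilon> = (\<alpha> *v root_vec root_b) $ 2"
    using pair_form_at[OF e(3,2), of 1 "\<lambda>_. 0"] pair_form_at[OF e(3,2), of 0 "\<lambda>_. 0"] w_point_root[OF m(2), of 1 "\<lambda>_. 0" 2] m(2) by simp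
  hence "(\<alpha> *v root_vec root_b) $ 2 = of_int (root_b ! 1) \<or> (\<alpha> *v root_vec root_b) $ 2 = of_int ([0,-1,0,0,0,0,0,1] ! 1)"
    using e(1) unfolding is_sign_def by auto
  hence "\<exists>g\<in>Ggrp. (g ** \<alpha>) *v root_vec root_b = root_vec root_b \<or> (g ** \<alpha>) *v root_vec root_b = root_vec [0,-1,0,0,0,0,0,1]"
    using coset_root[OF a(1) distinguished_roots(1)] coset_root[OF a(1) distinguished_roots(2)] by blast
  thus ?thesis using good12_root a(3) by blast
qed

lemma good3_exists:
  assumes "\<tau> \<in> Mcosets" "has_label \<tau> (JL s)"
  shows "\<exists>\<alpha>. \<alpha> \<in> \<tau> \<and> good3 \<alpha>"
proof -
  obtain \<alpha> where a: "\<alpha> \<in> Hgrp" "\<alpha> \<in> \<tau>" "\<And>g. g \<in> Ggrp \<Longrightarrow> g ** \<alpha> \<in> \<tau>" using McosetsE[OF assms(1)] by metis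
  obtain m where m: "m \<in> set roots" "\<alpha> *v root_vec root_b = root_vec m"
    using Hgrp_roots[OF a(1) distinguished_roots(1)] by blast
  have e: "sum_form (\<lambda>k. sign_of (s ! k)) (\<lambda>w. (\<alpha> *v w) $ 2)"
    using has_label_label_form[OF assms(2) a(2)] unfolding label_form_def by auto
  \<comment> \<open>A half sum of the \<open>z\<close> does not involve \<open>delta\<close>; the
    second entry 0 is that of \<open>e_7 - e_8\<close>.\<close>
  have "(\<alpha> *v root_vec root_b) $ 2 = 0"
    using sum_form_at[OF e, of 1 "\<lambda>_. 0"] sum_form_at[OF e, of 0 "\<lambda>_. 0"] w_point_root[OF m(2), of 1 "\<lambda>_. 0" 2] m(2) by simp
  hence "(\<alpha> *v root_vec root_b) $ 2 = of_int ([0,0,0,0,0,0,1,-1] ! 1)" by simp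
  from coset_root[OF a(1) distinguished_roots(3) this] show ?thesis using good3_root a(3) by blast
qed

text \<open>Row \<open>m\<close> lists the coordinates of \<open>x\<close> that occur as \<open>[y3, y2, y1, y6, y5]\<close> of the argument of \<open>L_{m+1}\<close>; the omitted one,
  \<open>m\<close>, occurs as \<open>y4\<close>.\<close>

definition L_index_table :: "nat \<Rightarrow> nat list" where
  "L_index_table m = [[5,4,3,2,1], [5,4,3,2,0], [5,4,3,1,0], [2,1,0,5,4], [2,1,0,5,3], [2,1,0,3,4]] ! m"

section \<open>Coordinates of the arguments on both sides\<close>

lemma map_upt_5: "map f [0..<5] = [f 0, f 1, f 2, f 3, f 4]"
  by (simp add: upt_rec eval_nat_numeral)

lemma lessThan_5: "{..<5::nat} = {0,1,2,3,4}" and lessThan_6: "{..<6::nat} = {0,1,2,3,4,5}"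
  by auto

lemma L_index_table_inj:
  assumes "m < 6"
  shows "inj_on (\<lambda>i. L_index_table m ! i) {..<5}" "(\<lambda>i. L_index_table m ! i) ` {..<5} = {..<6} - {m}"
proof -
  have "\<forall>m<6. inj_on (\<lambda>i. L_index_table m ! i) {..<5} \<and> (\<lambda>i. L_index_table m ! i) ` {..<5} = {..<6} - {m}"
    unfolding all_less_6 lessThan_5 lessThan_6 by (auto simp: L_index_table_def)
  thus "inj_on (\<lambda>i. L_index_table m ! i) {..<5}" "(\<lambda>i. L_index_table m ! i) ` {..<5} = {..<6} - {m}" using assms by blast+
qed

lemma Lk_args_V7: "v \<in> V7 \<Longrightarrow> Lk_args k v \<in> V7"
  unfolding V7_def Lk_args_def Let_def by (simp add: algebra_simps)

lemma Lk_args_y_coord: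
  assumes "v \<in> V7" "m < 6"
  shows "y_coord (Lk_args (m + 1) v) 3 = y_coord v m"
    "[y_coord (Lk_args (m + 1) v) 2, y_coord (Lk_args (m + 1) v) 1, y_coord (Lk_args (m + 1) v) 0, y_coord (Lk_args (m + 1) v) 5, y_coord (Lk_args (m + 1) v) 4]
     = map (\<lambda>i. y_coord v (L_index_table m ! i)) [0..<5]"
proof -
  have m: "m \<in> {0,1,2,3,4,5}" using assms(2) unfolding insert_iff empty_iff by linarith
  note s = V7_sum[OF assms(1)]
  have "y_coord (Lk_args (m + 1) v) 3 = y_coord v m \<and> y_coord (Lk_args (m + 1) v) 2 = y_coord v (L_index_table m ! 0) \<and> y_coord (Lk_args (m + 1) v) 1 = y_coord v (L_index_table m ! 1) \<and>
     y_coord (Lk_args (m + 1) v) 0 = y_coord v (L_index_table m ! 2) \<and> y_coord (Lk_args (m + 1) v) 5 = y_coord v (L_index_table m ! 3) \<and> y_coord (Lk_args (m + 1) v) 4 = y_coord v (L_index_table m ! 4)"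
    using m by (elim insertE emptyE) (simp_all add: Lk_args_def Let_def L_index_table_def y_coord_def s field_simps)
  thus "y_coord (Lk_args (m + 1) v) 3 = y_coord v m"
    "[y_coord (Lk_args (m + 1) v) 2, y_coord (Lk_args (m + 1) v) 1, y_coord (Lk_args (m + 1) v) 0, y_coord (Lk_args (m + 1) v) 5, y_coord (Lk_args (m + 1) v) 4]
     = map (\<lambda>i. y_coord v (L_index_table m ! i)) [0..<5]"
    unfolding map_upt_5 by blast+
qed

lemma Lbar_pt_V7: "v \<in> V7 \<Longrightarrow> Lbar_pt v \<in> V7"
  unfolding V7_def Lbar_pt_def by (simp add: algebra_simps)

lemma y_coord_Lbar_pt: "k < 6 \<Longrightarrow> y_coord (Lbar_pt v) k = - y_coord v k"
proof -
  have "\<forall>k<6. y_coord (Lbar_pt v) k = - y_coord v k"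
    unfolding all_less_6 y_coord_def Lbar_pt_def by (simp add: field_simps)
  thus "k < 6 \<Longrightarrow> y_coord (Lbar_pt v) k = - y_coord v k" by blast
qed

lemma Llab_args_y_coord:
  fixes bar :: bool
  assumes "x \<in> V7" "m < 6"
  defines "v \<equiv> Llab_args bar (m + 1) x"
  shows "v \<in> V7" "y_coord v 3 = sign_of (\<not> bar) * y_coord x m"
    "[y_coord v 2, y_coord v 1, y_coord v 0, y_coord v 5, y_coord v 4] = map (\<lambda>i. sign_of (\<not> bar) * y_coord x (L_index_table m ! i)) [0..<5]"
proof -
  have l: "L_index_table m ! i < 6" if "i < 5" for i using L_index_table_inj(2)[OF assms(2)] that by blast
  show "v \<in> V7" unfolding v_def Llab_args_def using Lk_args_V7 Lbar_pt_V7 assms(1) by simp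
  show "y_coord v 3 = sign_of (\<not> bar) * y_coord x m"
    unfolding v_def Llab_args_def using Lk_args_y_coord(1)[OF _ assms(2)] Lbar_pt_V7 assms(1) y_coord_Lbar_pt[OF assms(2)]
    by (cases bar) simp_all
  show "[y_coord v 2, y_coord v 1, y_coord v 0, y_coord v 5, y_coord v 4] = map (\<lambda>i. sign_of (\<not> bar) * y_coord x (L_index_table m ! i)) [0..<5]"
  proof (cases bar)
    case True
    have "[y_coord v 2, y_coord v 1, y_coord v 0, y_coord v 5, y_coord v 4] = map (\<lambda>i. y_coord (Lbar_pt x) (L_index_table m ! i)) [0..<5]"
      unfolding v_def Llab_args_def if_P[OF True] by (rule Lk_args_y_coord(2)[OF Lbar_pt_V7[OF assms(1)] assms(2)])
    also have "\<dots> = map (\<lambda>i. sign_of (\<not> bar) * y_coord x (L_index_table m ! i)) [0..<5]"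
      using l True by (intro map_cong) (auto simp: y_coord_Lbar_pt)
    finally show ?thesis .
  next
    case False
    show ?thesis unfolding v_def Llab_args_def if_not_P[OF False] Lk_args_y_coord(2)[OF assms(1,2)] using False by simp
  qed
qed

text \<open>Among the five coordinates other than \<open>y4\<close>, four carry a minus sign; their
  even number is what makes the parities agree later.\<close>

lemma good12_args:
  assumes "in_W w"
  defines "u \<equiv> vec7 (\<lambda>m. [w$5, w$6, w$7, 1 + w$1 - w$3 - w$4, w$5 + w$6 + w$7 - w$1, 1 + w$1 - w$3, 1 + w$1 - w$4] ! (m - 1))"
  shows "u \<in> V7" "y_coord u 3 = z_coord w 5" "[y_coord u 2, y_coord u 1, y_coord u 0, y_coord u 5, y_coord u 4] = [z_coord w 2, - z_coord w 1, - z_coord w 0, - z_coord w 4, - z_coord w 3]"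
proof -
  note h = in_W_8[OF assms(1)]
  show "u \<in> V7" unfolding V7_def u_def by (simp add: algebra_simps)
  show "y_coord u 3 = z_coord w 5" "[y_coord u 2, y_coord u 1, y_coord u 0, y_coord u 5, y_coord u 4] = [z_coord w 2, - z_coord w 1, - z_coord w 0, - z_coord w 4, - z_coord w 3]"
    unfolding y_coord_def z_coord_def u_def by (simp_all add: x_list_def h field_simps)
qed

text \<open>The point \<open>w\<close> is taken after the transposition of entries 2 and 7, so that
  \<open>w$7\<close> stands for \<open>b\<close> of the chosen representative.\<close>

lemma good3_args:
  assumes "in_W w"
  defines "u \<equiv> vec7 (\<lambda>m. [w$7, w$3, w$4, 1 + w$1 - w$5 - w$6, w$7 + w$3 + w$4 - w$1, 1 + w$1 - w$5, 1 + w$1 - w$6] ! (m - 1))"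
  shows "u \<in> V7" "map (y_coord u) [0..<6] = [- z_coord w 3, - z_coord w 4, z_coord w 0, z_coord w 5, - z_coord w 1, - z_coord w 2]"
proof -
  note h = in_W_8[OF assms(1)]
  show "u \<in> V7" unfolding V7_def u_def by (simp add: algebra_simps)
  show "map (y_coord u) [0..<6] = [- z_coord w 3, - z_coord w 4, z_coord w 0, z_coord w 5, - z_coord w 1, - z_coord w 2]"
    unfolding map_upt_6 y_coord_def z_coord_def u_def by (simp add: x_list_def h field_simps)
qed

lemma gamma2_eq_L:
  assumes "\<tau> \<in> Mcosets" "\<tau> \<in> O1 \<union> O2"
    and reg: "Lreg (gamma2_args \<tau> a c d e f g)" "Lreg (lab_args (gamma1 \<tau>) (xvec a c d e f g))"
  shows "gamma2 \<tau> a c d e f g = Lv (lab_args (gamma1 \<tau>) (xvec a c d e f g))"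
proof -
  define x where "x = xvec a c d e f g"
  have x: "x \<in> V7" unfolding x_def by (rule xvec_V7)
  obtain bar k where lab: "has_label \<tau> (LL bar k)" using O12_has_label[OF assms(2)] by blast
  define \<alpha> where "\<alpha> = (SOME \<alpha>. \<alpha> \<in> \<tau> \<and> good12 \<alpha>)"
  have a: "\<alpha> \<in> \<tau>" "good12 \<alpha>" using someI_ex[OF good12_exists[OF assms(1) lab]] unfolding \<alpha>_def by blast+
  have aH: "\<alpha> \<in> Hgrp" using McosetsE[OF assms(1)] a(1) by metis
  obtain \<epsilon> p \<eta> where sp: "signed_perm \<epsilon> p \<eta> \<alpha>" using good12_signed_perm[OF aH a(2)] by blast
  have p: "p permutes {..<6}" and eps: "is_sign \<epsilon>" and eta: "\<And>k. k < 6 \<Longrightarrow> is_sign (\<eta> k)" "(\<Prod>k<6. \<eta> k) = 1"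
    using sp unfolding signed_perm_def by blast+
  have act: "delta_coord (\<alpha> *v w) = \<epsilon> * delta_coord w" "k < 6 \<Longrightarrow> z_coord (\<alpha> *v w) k = \<eta> k * z_coord w (p k)" if "in_W w" for w k
    using sp that unfolding signed_perm_def by blast+
  have pl: "p k < 6" if "k < 6" for k using permutes_in_image[OF p, of k] that by simp
  define bar' where "bar' \<longleftrightarrow> \<eta> 5 = -1"
  have bar': "sign_of (\<not> bar') = \<eta> 5" using eta(1)[of 5] unfolding bar'_def is_sign_def by auto
  have "label_form (LL bar' (p 5 + 1)) (\<lambda>w. (\<alpha> *v w) $ 2)"
  proof -
    have "(\<alpha> *v w) $ 2 = 1/2 + \<epsilon> * delta_coord w + \<eta> 5 * z_coord w (p 5)" if w: "in_W w" for w
    proof -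
      \<comment> \<open>The second entry is \<open>x_0 = v(0,7)\<close>, so the label is decided by
        the last \<open>z\<close>: its index by \<open>p 5\<close> and its bar by the sign
        \<open>\<eta> 5\<close>.\<close>
      have "(\<alpha> *v w) $ 2 = label_value True 0 (5 + 2) (\<alpha> *v w)" by (simp add: label_value_def x_list_def)
      also have "\<dots> = 1/2 + \<epsilon> * delta_coord w + \<eta> 5 * z_coord w (p 5)" unfolding label_value_0 using act[OF w] by simp
      finally show ?thesis .
    qed
    hence "pair_form \<epsilon> (sign_of (\<not> bar')) (p 5) (\<lambda>w. (\<alpha> *v w) $ 2)" unfolding pair_form_def bar' by blast
    thus ?thesis using eps pl[of 5] unfolding label_form_def by auto
  qed
  hence g1: "gamma1 \<tau> = LL bar' (p 5 + 1)" by (rule gamma1_eq[OF lab a(1)])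
  define v where "v = lab_args (gamma1 \<tau>) x"
  have v: "v = Llab_args bar' (p 5 + 1) x" unfolding v_def g1 by simp
  define w where "w = \<alpha> *v wvec a 0 c d e f g"
  have w: "in_W w" unfolding w_def by (rule Hgrp_action(1)[OF aH in_W_wvec])
  have zw: "z_coord w k = \<eta> k * y_coord x (p k)" if "k < 6" for k
    unfolding w_def act(2)[OF in_W_wvec that] z_coord_wvec[OF pl[OF that]] x_def ..
  define u where "u = gamma2_args \<tau> a c d e f g"
  have u: "u = vec7 (\<lambda>m. [w$5, w$6, w$7, 1 + w$1 - w$3 - w$4, w$5 + w$6 + w$7 - w$1, 1 + w$1 - w$3, 1 + w$1 - w$4] ! (m - 1))"
    unfolding u_def gamma2_args_def if_P[OF assms(2)] Let_def \<alpha>_def[symmetric] comp_def w_def by simp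
  have Y3: "y_coord u 3 = y_coord v 3"
    unfolding u good12_args(2)[OF w] v Llab_args_y_coord(2)[OF x pl[of 5, simplified]] bar' using zw[of 5] by simp
  define q :: "nat \<Rightarrow> nat" where "q = (\<lambda>i. [2,1,0,4,3] ! i)"
  define \<sigma> where "\<sigma> = (\<lambda>i. (if i = 0 then 1 else -1) * \<eta> (q i))"
  have yu: "[y_coord u 2, y_coord u 1, y_coord u 0, y_coord u 5, y_coord u 4] = map (\<lambda>i. \<sigma> i * y_coord x (p (q i))) [0..<5]"
    unfolding u good12_args(3)[OF w] map_upt_5 \<sigma>_def q_def by (simp add: zw)
  have yv: "[y_coord v 2, y_coord v 1, y_coord v 0, y_coord v 5, y_coord v 4] = map (\<lambda>i. \<eta> 5 * y_coord x (L_index_table (p 5) ! i)) [0..<5]"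
    unfolding v Llab_args_y_coord(3)[OF x pl[of 5, simplified]] bar' ..
  have q: "q ` {..<5} = {..<6} - {5}" "inj_on q {..<5}"
    unfolding lessThan_5 lessThan_6 by (auto simp: q_def)
  have key: "L_sym (y_coord u 3) (map (\<lambda>i. \<eta> 5 * y_coord x (L_index_table (p 5) ! i)) [0..<5]) * L_sin (map (\<lambda>i. \<sigma> i * y_coord x (p (q i))) [0..<5]) =
    L_sym (y_coord u 3) (map (\<lambda>i. \<sigma> i * y_coord x (p (q i))) [0..<5]) * L_sin (map (\<lambda>i. \<eta> 5 * y_coord x (L_index_table (p 5) ! i)) [0..<5])"
  proof (rule L_sym_signed_lists[where y = "y_coord x" and f = "\<lambda>i. p (q i)" and f' = "\<lambda>i. L_index_table (p 5) ! i" and \<sigma> = \<sigma> and \<sigma>' = "\<lambda>_. \<eta> 5"])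
    show "inj_on (\<lambda>i. p (q i)) {..<5}" using q(2) permutes_inj[OF p] by (auto simp: inj_on_def)
    show "inj_on (\<lambda>i. L_index_table (p 5) ! i) {..<5}" by (rule L_index_table_inj(1)) (simp add: pl)
    have "(\<lambda>i. p (q i)) ` {..<5} = p ` ({..<6} - {5})" unfolding q(1)[symmetric] by (simp add: image_image)
    also have "\<dots> = {..<6} - {p 5}" using permutes_inj[OF p] permutes_image[OF p] by (simp add: image_set_diff)
    also have "\<dots> = (\<lambda>i. L_index_table (p 5) ! i) ` {..<5}" by (rule L_index_table_inj(2)[symmetric]) (simp add: pl)
    finally show "(\<lambda>i. p (q i)) ` {..<5} = (\<lambda>i. L_index_table (p 5) ! i) ` {..<5}" .
    show "is_sign (\<sigma> i)" if "i < 5" for i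
    proof -
      have "q i < 6" using q(1) that by blast
      thus ?thesis unfolding \<sigma>_def using eta(1) by (cases "i = 0") simp_all
    qed
    show "is_sign (\<eta> 5)" by (rule eta) simp
    \<comment> \<open>Parity: the four minus signs of \<open>good12_args\<close> cancel, so the
      product on one side is that of the first five \<open>\<eta>\<close>. As all six multiply to 1,
      it equals \<open>\<eta> 5\<close>, which is also its own fifth power.\<close>
    have "\<eta> 5 * \<eta> 5 = 1" using is_sign_sq[OF eta(1)[of 5]] by simp
    moreover have "(\<Prod>i<5. \<sigma> i) = \<eta> 0 * \<eta> 1 * \<eta> 2 * \<eta> 3 * \<eta> 4"
      unfolding \<sigma>_def q_def lessThan_5 by simp
    moreover have "\<eta> 0 * \<eta> 1 * \<eta> 2 * \<eta> 3 * \<eta> 4 * \<eta> 5 = 1" using eta(2) unfolding lessThan_6 by (simp add: mult_ac)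
    moreover have "(\<Prod>i<5::nat. \<eta> 5) = \<eta> 5 * \<eta> 5 * (\<eta> 5 * \<eta> 5) * \<eta> 5" by (simp add: eval_nat_numeral)
    ultimately show "(\<Prod>i<5. \<sigma> i) = (\<Prod>i<5::nat. \<eta> 5)"
      by (metis mult.assoc mult.left_neutral mult.right_neutral)
  qed
  have uV: "u \<in> V7" unfolding u by (rule good12_args(1)[OF w])
  have vV: "v \<in> V7" unfolding v by (rule Llab_args_y_coord(1)[OF x]) (simp add: pl)
  have r: "Lreg u" "Lreg v" using reg unfolding u_def v_def x_def by blast+
  have "Lv u = Lv v"
    unfolding Lv_eq(1)[OF uV] Lv_eq(1)[OF vV] Y3[symmetric]
  proof (rule quotient_eqI)
    show "L_sin [y_coord u 2, y_coord u 1, y_coord u 0, y_coord u 5, y_coord u 4] \<noteq> 0" using r(1) unfolding Lv_eq(2)[OF uV] .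
    show "L_sin [y_coord v 2, y_coord v 1, y_coord v 0, y_coord v 5, y_coord v 4] \<noteq> 0" using r(2) unfolding Lv_eq(2)[OF vV] .
    show "L_sym (y_coord u 3) [y_coord u 2, y_coord u 1, y_coord u 0, y_coord u 5, y_coord u 4] * L_sin [y_coord v 2, y_coord v 1, y_coord v 0, y_coord v 5, y_coord v 4] =
      L_sym (y_coord u 3) [y_coord v 2, y_coord v 1, y_coord v 0, y_coord v 5, y_coord v 4] * L_sin [y_coord u 2, y_coord u 1, y_coord u 0, y_coord u 5, y_coord u 4]"
      unfolding yu yv by (rule key[symmetric])
  qed
  moreover have "gamma2 \<tau> a c d e f g = Lv u" unfolding gamma2_def if_P[OF assms(2)] u_def ..
  ultimately show ?thesis unfolding v_def x_def by simp
qed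

lemma swap8_2_7_Hgrp: "swap8 2 7 \<in> Hgrp"
proof -
  have "swap8 2 7 *v w = (swap8 2 3 ** (swap8 3 4 ** (swap8 4 5 ** (swap8 5 6 ** (swap8 6 7 ** (swap8 5 6 ** (swap8 4 5 ** (swap8 3 4 ** swap8 2 3)))))))) *v w" for w
    by (rule vec8_eqI) (simp_all add: matrix_vector_mul_assoc[symmetric] swap8_nth)
  hence e: "swap8 2 7 = swap8 2 3 ** (swap8 3 4 ** (swap8 4 5 ** (swap8 5 6 ** (swap8 6 7 ** (swap8 5 6 ** (swap8 4 5 ** (swap8 3 4 ** swap8 2 3)))))))"
    unfolding matrix_eq by blast
  have "s \<in> gen_group Hgens" if "s \<in> {swap8 2 3, swap8 3 4, swap8 4 5, swap8 5 6, swap8 6 7}" for s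
    using gen_group_gen[of s Hgens] that by blast
  hence "swap8 2 3 \<in> gen_group Hgens" "swap8 3 4 \<in> gen_group Hgens" "swap8 4 5 \<in> gen_group Hgens" "swap8 5 6 \<in> gen_group Hgens" "swap8 6 7 \<in> gen_group Hgens"
    by blast+
  thus ?thesis unfolding e Hgrp_def by (intro gen_group_mult)
qed

text \<open>Reduces the representatives for \<open>O3\<close>, where \<open>b\<close> moves the entry \<open>g\<close>, to those for \<open>O1 \<union> O2\<close>.\<close>

lemma good3_swap:
  assumes "good3 \<alpha>"
  shows "good12 (swap8 2 7 ** \<alpha>)"
proof -
  have c: "comp k (swap8 2 7 ** \<alpha>) a b c d e f g = comp k \<alpha> a b c d e f g" if "k \<in> {1,3,4,5,6}" for k a b c d e f g
    using that unfolding comp_def by (elim insertE emptyE) (simp_all add: matrix_vector_mul_assoc[symmetric] swap8_nth)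
  have c2: "comp 2 (swap8 2 7 ** \<alpha>) a b c d e f g = comp 7 \<alpha> a b c d e f g"
    "comp 7 (swap8 2 7 ** \<alpha>) a b c d e f g = comp 2 \<alpha> a b c d e f g" for a b c d e f g
    unfolding comp_def by (simp_all add: matrix_vector_mul_assoc[symmetric] swap8_nth)
  have "indep_b k (swap8 2 7 ** \<alpha>) \<longleftrightarrow> indep_b k \<alpha>" if "k \<in> {1,3,4,5,6}" for k
    unfolding indep_b_def c[OF that] ..
  moreover have "indep_b 7 (swap8 2 7 ** \<alpha>) \<longleftrightarrow> indep_b 2 \<alpha>" unfolding indep_b_def c2 ..
  moreover have "Im_to_inf 7 \<alpha> \<Longrightarrow> Im_to_pm_inf 2 (swap8 2 7 ** \<alpha>)"
    unfolding Im_to_pm_inf_def Im_to_inf_def c2 by blast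
  ultimately show ?thesis using assms unfolding good12_def good3_def by blast
qed

lemma gamma2_eq_J:
  assumes "\<tau> \<in> Mcosets" "\<tau> \<in> O3"
  shows "gamma2 \<tau> a c d e f g = Jv (lab_args (gamma1 \<tau>) (xvec a c d e f g))"
proof -
  define x where "x = xvec a c d e f g"
  have x: "x \<in> V7" unfolding x_def by (rule xvec_V7)
  obtain t where lab: "has_label \<tau> (JL t)" using O3_has_label[OF assms(2)] by blast
  define \<alpha> where "\<alpha> = (SOME \<alpha>. \<alpha> \<in> \<tau> \<and> good3 \<alpha>)"
  have a: "\<alpha> \<in> \<tau>" "good3 \<alpha>" using someI_ex[OF good3_exists[OF assms(1) lab]] unfolding \<alpha>_def by blast+
  have aH: "\<alpha> \<in> Hgrp" using McosetsE[OF assms(1)] a(1) by metis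
  have not12: "\<tau> \<notin> O1 \<union> O2" by (rule O3_not_O12[OF assms(2) a(1)])
  define \<beta> where "\<beta> = swap8 2 7 ** \<alpha>"
  have bH: "\<beta> \<in> Hgrp" unfolding \<beta>_def using aH swap8_2_7_Hgrp gen_group_mult unfolding Hgrp_def by blast
  have bnth: "\<beta> *v w = vec8 (\<lambda>k. [(\<alpha> *v w)$1, (\<alpha> *v w)$7, (\<alpha> *v w)$3, (\<alpha> *v w)$4, (\<alpha> *v w)$5, (\<alpha> *v w)$6, (\<alpha> *v w)$2, (\<alpha> *v w)$8] ! (k - 1))" for w
    unfolding \<beta>_def matrix_vector_mul_assoc[symmetric] swap8_nth ..
  obtain \<epsilon> p \<eta> where sp: "signed_perm \<epsilon> p \<eta> \<beta>"
    using good12_signed_perm[OF bH] good3_swap[OF a(2)] unfolding \<beta>_def by blast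
  have p: "p permutes {..<6}" using sp unfolding signed_perm_def by blast
  have act: "k < 6 \<Longrightarrow> z_coord (\<beta> *v w) k = \<eta> k * z_coord w (p k)" if "in_W w" for w k
    using sp that unfolding signed_perm_def by blast
  have pl: "p k < 6" if "k < 6" for k using permutes_in_image[OF p, of k] that by simp
  have lf: "length t = 6" "(\<Prod>k<6. sign_of (t ! k)) = 1" "sum_form (\<lambda>k. sign_of (t ! k)) (\<lambda>w. (\<alpha> *v w) $ 2)"
    using has_label_label_form[OF lab a(1)] unfolding label_form_def by auto
  \<comment> \<open>After the transposition the label of the coset is \<open>x_2 = v(2,7)\<close> of
    the new point, whose plus signs are at 0 and 5. The same signs occur in
    \<open>good3_args\<close>, which is why the two sides fit.\<close>
  define \<theta> :: "nat \<Rightarrow> complex" where "\<theta> = (\<lambda>k. if k = 0 \<or> k = 5 then 1 else -1)"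
  have F: "(\<alpha> *v w) $ 2 = 1/2 + (\<Sum>k<6. \<theta> k * (\<eta> k * z_coord w (p k))) / 2" if w: "in_W w" for w
  proof -
    have "(\<alpha> *v w) $ 2 = label_value True (0 + 2) (5 + 2) (\<beta> *v w)" unfolding bnth by (simp add: label_value_def x_list_def)
    also have "\<dots> = 1/2 + (\<Sum>k<6. \<theta> k * z_coord (\<beta> *v w) k) / 2"
      unfolding \<theta>_def by (rule label_value_ij[OF Hgrp_action(1)[OF bH w]]) simp_all
    finally show ?thesis using act[OF w] by simp
  qed
  \<comment> \<open>Comparing the two expressions for the second coordinate at unit vectors
    determines the signs through the label string.\<close>
  have sg: "\<theta> m * \<eta> m = sign_of (t ! p m)" if m: "m < 6" for m
  proof -
    define z where "z = (\<lambda>k. if k = p m then 1 else (0::complex))"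
    have "(\<Sum>k<6. \<theta> k * (\<eta> k * z_coord (w_point 0 z) (p k))) = (\<Sum>k<6. if k = m then \<theta> k * \<eta> k else 0)"
      using pl permutes_inj[OF p] unfolding z_def by (intro sum.cong) (auto dest: injD)
    moreover have "(\<Sum>k<6. sign_of (t ! k) * z k) = (\<Sum>k<6. if k = p m then sign_of (t ! k) else 0)"
      unfolding z_def by (intro sum.cong) auto
    ultimately show ?thesis using F[OF in_W_w_point, of 0 z] sum_form_at[OF lf(3), of 0 z] m pl[OF m] by simp
  qed
  have g1: "gamma1 \<tau> = JL t" by (rule gamma1_eq[OF lab a(1) has_label_label_form[OF lab a(1)]])
  define \<rho> where "\<rho> = (SOME \<beta>. \<beta> \<in> H1grp \<and> jlab \<beta> t)"
  have r: "\<rho> \<in> H1grp" "jlab \<rho> t" using someI_ex[OF jlab_exists[OF lf(1,2)]] unfolding \<rho>_def by blast+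
  define v where "v = \<rho> *v x"
  have v: "lab_args (gamma1 \<tau>) x = v" unfolding g1 v_def \<rho>_def by (simp add: Jlab_args_def)
  have vV: "v \<in> V7" using H1grp_signed_perm7[OF r(1)] x unfolding v_def signed_perm7_def by blast
  define w where "w = \<beta> *v wvec a 0 c d e f g"
  have w: "in_W w" unfolding w_def by (rule Hgrp_action(1)[OF bH in_W_wvec])
  have zw: "z_coord w k = \<eta> k * y_coord x (p k)" if "k < 6" for k
    unfolding w_def act[OF in_W_wvec that] z_coord_wvec[OF pl[OF that]] x_def ..
  define u where "u = gamma2_args \<tau> a c d e f g"
  have u: "u = vec7 (\<lambda>m. [w$7, w$3, w$4, 1 + w$1 - w$5 - w$6, w$7 + w$3 + w$4 - w$1, 1 + w$1 - w$5, 1 + w$1 - w$6] ! (m - 1))"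
    unfolding u_def gamma2_args_def if_not_P[OF not12] Let_def \<alpha>_def[symmetric] comp_def w_def bnth by simp
  have uV: "u \<in> V7" unfolding u by (rule good3_args(1)[OF w])
  have yu: "map (y_coord u) [0..<6] = [- z_coord w 3, - z_coord w 4, z_coord w 0, z_coord w 5, - z_coord w 1, - z_coord w 2]"
    unfolding u by (rule good3_args(2)[OF w])
  have "mset (map (y_coord u) [0..<6]) = mset (map (\<lambda>k. \<theta> k * z_coord w k) [0..<6])"
    unfolding yu unfolding map_upt_6 \<theta>_def by simp
  also have "map (\<lambda>k. \<theta> k * z_coord w k) [0..<6] = map (\<lambda>k. sign_of (t ! p k) * y_coord x (p k)) [0..<6]"
    using zw by (intro map_cong refl) (simp add: sg[symmetric])
  also have "mset \<dots> = image_mset (\<lambda>k. sign_of (t ! k) * y_coord x k) (image_mset p (mset_set {..<6}))"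
    by (simp add: lessThan_atLeast0 image_mset.compositionality o_def)
  also have "image_mset p (mset_set {..<6}) = mset_set {..<6}"
    using permutes_image[OF p] permutes_inj_on[OF p] by (simp add: image_mset_mset_set)
  also have "image_mset (\<lambda>k. sign_of (t ! k) * y_coord x k) (mset_set {..<6}) = mset (map (\<lambda>k. sign_of (t ! k) * y_coord x k) [0..<6])"
    by (simp add: lessThan_atLeast0)
  also have "\<dots> = mset (map (y_coord v) [0..<6])" unfolding v_def by (rule jlab_mset[OF r x, symmetric])
  finally have m: "mset (map (y_coord u) [0..<6]) = mset (map (y_coord v) [0..<6])" .
  \<comment> \<open>The first coordinate is \<open>1/2\<close> plus half the sum of the
    \<open>y\<close>, so equal multisets give equal sines in the denominators of
    \<open>J\<close>.\<close>
  have "sum_list (map (y_coord u) [0..<6]) = sum_list (map (y_coord v) [0..<6])"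
    using arg_cong[OF m, of sum_mset] unfolding sum_mset_sum_list .
  hence "(\<Sum>k<6. y_coord u k) = (\<Sum>k<6. y_coord v k)"
    unfolding interv_sum_list_conv_sum_set_nat lessThan_atLeast0 by simp
  hence "u$1 = v$1" unfolding V7_coords(1)[OF uV] V7_coords(1)[OF vV] by simp
  moreover have "J_sym (map (y_coord u) [0..<6]) = J_sym (map (y_coord v) [0..<6])" by (rule J_sym_mset[OF m]) simp
  ultimately have "Jv u = Jv v" unfolding Jv_eq[OF uV] Jv_eq[OF vV] by simp
  moreover have "gamma2 \<tau> a c d e f g = Jv u" unfolding gamma2_def if_not_P[OF not12] u_def ..
  ultimately show ?thesis using v unfolding x_def by simp
qed

theorem theorem7p5:
  fixes a c d e f g :: complex and \<tau> :: "(complex^8^8) set"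
  assumes "\<tau> \<in> Mcosets"
  shows "(\<tau> \<in> O1 \<union> O2 \<longrightarrow> Lreg (gamma2_args \<tau> a c d e f g) \<longrightarrow> Lreg (lab_args (gamma1 \<tau>) (xvec a c d e f g)) \<longrightarrow>
            gamma2 \<tau> a c d e f g = Lv (lab_args (gamma1 \<tau>) (xvec a c d e f g)))
       \<and> (\<tau> \<in> O3 \<longrightarrow> Jreg (gamma2_args \<tau> a c d e f g) \<longrightarrow> Jreg (lab_args (gamma1 \<tau>) (xvec a c d e f g)) \<longrightarrow>
            gamma2 \<tau> a c d e f g = Jv (lab_args (gamma1 \<tau>) (xvec a c d e f g)))"
  using gamma2_eq_L[OF assms] gamma2_eq_J[OF assms] by blast

end
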